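(* Let $X$ be a second countable locally compact Abelian group. Let $n\ge 2$ and let $\alpha_j,\beta_j$, $j=1,2,\dots,n$, be topological automorphisms of $X$ such that both $\beta_i\alpha_i^{-1}+\beta_j\alpha_j^{-1}\in\mathrm{Aut}(X)$ and $\beta_i\alpha_i^{-1}-\beta_j\alpha_j^{-1}\in\mathrm{Aut}(X)$ for all $i\ne j$. Then the following two conditions are equivalent. (i) For all $Q$-independent random variables $\xi_1,\dots,\xi_n$ with values in $X$ and distributions $\mu_1,\dots,\mu_n$ with non-vanishing characteristic functions: if the conditional distribution of the linear form $L_2=\beta_1\xi_1+\dots+\beta_n\xi_n$ given $L_1=\alpha_1\xi_1+\dots+\alpha_n\xi_n$ is symmetric, then $\mu_j\in\Gamma(X)$ for all $j=1,\dots,n$. (ii) $X$ contains no elements of order $2$.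
   Context: The group $X$ is written additively, and $\mathrm{Aut}(X)$ is the group of topological automorphisms of $X$; sums and differences of automorphisms are taken pointwise. Let $Y$ be the character group (Pontryagin dual) of $X$, and let $(x,y)$ denote the value of the character $y\in Y$ at $x\in X$. Random variables have values in $X$ with its Borel $\sigma$-algebra, and random variables considered jointly are defined on a common probability space. The characteristic function of a distribution $\mu$ on $X$ is $\widehat\mu(y)=\int_X (x,y)\,d\mu(x)$, $y\in Y$; $\mu_\xi$ denotes the distribution of a random variable $\xi$. The symmetry of the conditional distribution of $L_2$ given $L_1$ means that the random vectors $(L_1,L_2)$ and $(L_1,-L_2)$ are identically distributed. Polynomials: for a function $f$ on an Abelian group $G$ and $h\in G$ put $\Delta_hf(y)=f(y+h)-f(y)$. A (complex-valued) function $f$ on $G$ is called a polynomial if for some non-negative integer $m$ one has $\Delta_h^{m+1}f(y)=0$ for all $y,h\in G$. $Q$-independence: random variables $\xi_1,\dots,\xi_n$ with values in $X$ are $Q$-independent if there is a continuous polynomial $q$ on the group $Y^n$ with $q(0,\dots,0)=0$ such that $$\mathbf{E}[(\xi_1,y_1)\cdots(\xi_n,y_n)]=\Big(\prod_{j=1}^n\widehat\mu_{\xi_j}(y_j)\Big)\exp\{q(y_1,\dots,y_n)\}\quad\text{for all } y_1,\dots,y_n\in Y.$$ Gaussian distributions: $\Gamma(X)$ is the set of probability distributions $\gamma$ on $X$ whose characteristic function has the form $\widehat\gamma(y)=(x,y)\exp\{-\varphi(y)\}$, $y\in Y$, where $x\in X$ and $\varphi$ is a continuous non-negative function on $Y$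 satisfying $\varphi(u+v)+\varphi(u-v)=2[\varphi(u)+\varphi(v)]$ for all $u,v\in Y$. Degenerate distributions belong to $\Gamma(X)$. *)

theory Defs
  imports "HOL-Probability.Probability"
begin

definition topological_automorphism :: "('a::topological_ab_group_add \<Rightarrow> 'a) \<Rightarrow> bool" where
  "topological_automorphism f \<longleftrightarrow> Modules.additive f \<and> homeomorphism UNIV UNIV f (inv f)"


section \<open>The character group\<close>

text \<open>The Pontryagin dual: continuous homomorphisms into the unit circle, written additively
  (so addition of characters is pointwise multiplication), with the compact-open topology.\<close>

typedef (overloaded) ('a::topological_ab_group_add) dual =
  "{c :: 'a \<Rightarrow> complex. continuous_on UNIV c \<and> (\<forall>x. cmod (c x) = 1) \<and>
      (\<forall>x y. c (x + y) = c x * c y)}"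
  morphisms ev Dual
  by (rule exI[of _ "\<lambda>_. 1"]) simp

setup_lifting type_definition_dual

instantiation dual :: (topological_ab_group_add) ab_group_add
begin

lift_definition zero_dual :: "'a dual" is "\<lambda>_. 1"
  by simp

lift_definition plus_dual :: "'a dual \<Rightarrow> 'a dual \<Rightarrow> 'a dual" is "\<lambda>c d x. c x * d x"
  by (auto intro: continuous_intros simp: norm_mult algebra_simps)

lift_definition uminus_dual :: "'a dual \<Rightarrow> 'a dual" is "\<lambda>c x. cnj (c x)"
  by (auto intro: continuous_intros)

definition minus_dual :: "'a dual \<Rightarrow> 'a dual \<Rightarrow> 'a dual" where
  "minus_dual c d = c + (- d)"

instance
proof
  fix a b c :: "'a dual"
  show "a + b + c = a + (b + c)" by transfer (simp add: mult.assoc)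
  show "a + b = b + a" by transfer (simp add: mult.commute)
  show "0 + a = a" by transfer simp
  show "- a + a = 0"
    by transfer (auto simp: fun_eq_iff mult.commute[of "cnj _"] complex_norm_square[symmetric])
  show "a - b = a + - b" by (rule minus_dual_def)
qed

end

instantiation dual :: (topological_ab_group_add) topological_space
begin

definition open_dual :: "'a dual set \<Rightarrow> bool" where
  "open_dual = generate_topology {{y. ev y ` K \<subseteq> U} | K U. compact K \<and> open U}"

instance
  by standard (auto simp: open_dual_def intro: generate_topology.intros)

end


section \<open>Polynomials on Abelian groups\<close>

definition difference :: "'g::ab_group_add \<Rightarrow> ('g \<Rightarrow> complex) \<Rightarrow> 'g \<Rightarrow> complex" where
  "difference h f y = f (y + h) - f y"

definition group_polynomial :: "('g::ab_group_add \<Rightarrow> complex) \<Rightarrow> bool" where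
  "group_polynomial f \<longleftrightarrow> (\<exists>m::nat. \<forall>y h. (difference h ^^ (m + 1)) f y = 0)"


section \<open>Distributions\<close>

definition char_fn :: "'a::topological_ab_group_add measure \<Rightarrow> 'a dual \<Rightarrow> complex" where
  "char_fn \<mu> y = (LINT x|\<mu>. ev y x)"

definition Q_independent ::
  "'w measure \<Rightarrow> ('n::finite \<Rightarrow> 'w \<Rightarrow> 'a::topological_ab_group_add) \<Rightarrow> bool" where
  "Q_independent M \<xi> \<longleftrightarrow>
     (\<exists>q :: 'a dual ^ 'n \<Rightarrow> complex.
        group_polynomial q \<and> continuous_on UNIV q \<and> q 0 = 0 \<and>
        (\<forall>y. (LINT \<omega>|M. (\<Prod>j\<in>UNIV. ev (y $ j) (\<xi> j \<omega>))) =
              (\<Prod>j\<in>UNIV. char_fn (distr M borel (\<xi> j)) (y $ j)) * exp (q y)))"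

definition Gaussian :: "'a::topological_ab_group_add measure set" where
  "Gaussian = {\<gamma>. prob_space \<gamma> \<and> sets \<gamma> = sets borel \<and>
     (\<exists>x (\<phi> :: 'a dual \<Rightarrow> real).
        continuous_on UNIV \<phi> \<and> (\<forall>y. 0 \<le> \<phi> y) \<and>
        (\<forall>u v. \<phi> (u + v) + \<phi> (u - v) = 2 * (\<phi> u + \<phi> v)) \<and>
        (\<forall>y. char_fn \<gamma> y = ev y x * complex_of_real (exp (- \<phi> y))))}"

definition conditionally_symmetric ::
  "'w measure \<Rightarrow> ('w \<Rightarrow> 'a::topological_ab_group_add) \<Rightarrow> ('w \<Rightarrow> 'a) \<Rightarrow> bool" where
  "conditionally_symmetric M L1 L2 \<longleftrightarrow>
     distr M borel (\<lambda>\<omega>. (L1 \<omega>, L2 \<omega>)) = distr M borel (\<lambda>\<omega>. (L1 \<omega>, - L2 \<omega>))"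

text \<open>HOL cannot quantify over types inside a formula, so the type of the sample space is a
  parameter. For \<^typ>\<open>'a ^ 'n\<close> the property says the same as for all sample spaces
  together: every hypothesis and the conclusion depend only on the joint distribution of the
  random variables, which is realised by the coordinates on \<^typ>\<open>'a ^ 'n\<close>.\<close>

definition Heyde_property ::
  "'w itself \<Rightarrow> ('n::finite \<Rightarrow> 'a::topological_ab_group_add \<Rightarrow> 'a) \<Rightarrow> ('n \<Rightarrow> 'a \<Rightarrow> 'a) \<Rightarrow> bool"
where
  "Heyde_property _ \<alpha> \<beta> \<longleftrightarrow>
     (\<forall>(M :: 'w measure) (\<xi> :: 'n \<Rightarrow> 'w \<Rightarrow> 'a).
        prob_space M \<longrightarrow>
        (\<forall>j. \<xi> j \<in> borel_measurable M) \<longrightarrow>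
        Q_independent M \<xi> \<longrightarrow>
        (\<forall>j y. char_fn (distr M borel (\<xi> j)) y \<noteq> 0) \<longrightarrow>
        conditionally_symmetric M (\<lambda>\<omega>. \<Sum>j\<in>UNIV. \<alpha> j (\<xi> j \<omega>)) (\<lambda>\<omega>. \<Sum>j\<in>UNIV. \<beta> j (\<xi> j \<omega>)) \<longrightarrow>
        (\<forall>j. distr M borel (\<xi> j) \<in> Gaussian))"

end

theory Submission
  imports Defs "HOL-Complex_Analysis.Complex_Analysis" "HOL-Real_Asymp.Real_Asymp"
begin

text \<open>
Write \<open>Y\<close> for the character group, \<open>f\<^sub>j\<close> for the characteristic function of \<open>\<xi>\<^sub>j\<close> and
\<open>\<psi>\<^sub>j = - ln |f\<^sub>j|\<^sup>2\<close>. The proof has four parts.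

\<^emph>\<open>The functional equation.\<close> For Q-independent variables, equality of the laws of \<open>(L\<^sub>1, L\<^sub>2)\<close> and
\<open>(L\<^sub>1, - L\<^sub>2)\<close> implies, after taking moduli and logarithms, that
\<open>\<Sum>\<^sub>j \<psi>\<^sub>j (a\<^sub>j u + b\<^sub>j v) - \<psi>\<^sub>j (a\<^sub>j u - b\<^sub>j v)\<close> is a polynomial in \<open>(u, v)\<close>, where \<open>a\<^sub>j\<close> and \<open>b\<^sub>j\<close> are
the adjoints of \<open>\<alpha>\<^sub>j\<close> and \<open>\<beta>\<^sub>j\<close> (Heyde_functional_equation). A difference operator along the kernel
of one of the maps \<open>(u, v) \<mapsto> a\<^sub>j u \<plusminus> b\<^sub>j v\<close> removes the corresponding term (elimination). The hypothesis
on sums and differences makes every term with another index removable with an arbitrary prescribed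
effect \<open>w\<close> on the remaining argument; the term with the same index and the opposite sign allows only
\<open>w \<in> 2Y\<close>. If \<open>X\<close> has no element of order two, then \<open>x \<mapsto> 2x\<close> is injective, \<open>2Y\<close> is dense in \<open>Y\<close>,
and \<open>\<psi>\<^sub>j\<close> is a continuous polynomial on \<open>Y\<close>.

\<^emph>\<open>A Marcinkiewicz theorem.\<close> A law on \<open>X\<close> with nowhere vanishing characteristic function \<open>f\<close> and
polynomial \<open>\<psi>\<close> is Gaussian. On the line this is char_modulus_exp_polynomial: the law has all
exponential moments, its Laplace transform is zero-free and of order at most two, so it is the
exponential of a quadratic. On \<open>X\<close> one cannot divide characters, but \<open>y \<in> Y\<close> is a limit of elements
\<open>2\<^sup>k h\<^sub>k\<close>, and polynomiality forces \<open>\<psi> (h\<^sub>k) = O(4\<^sup>-\<^sup>k)\<close>. Hence the centred and rescaled variables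
\<open>2\<^sup>k arg (\<xi>, h\<^sub>k)\<close> are bounded in mean square, and a limit of their laws is a law on the line whose
characteristic function has the squared modulus \<open>exp (- p)\<close>, where \<open>p\<close> interpolates \<open>n \<mapsto> \<psi> (n y)\<close>.
The theorem on the line gives \<open>\<psi> (n y) = n\<^sup>2 \<psi> (y)\<close> and \<open>f (2y) = f (y)\<^sup>2 exp (- \<psi> (y))\<close>; the
parallelogram law for \<open>\<psi>\<close> (psi_parallelogram) and multiplicativity of the phase \<open>l = f / |f|\<close>
(phase_add) follow by further passages to the limit along \<open>2\<^sup>k\<close>. It remains to realise \<open>l\<close> by a point
of \<open>X\<close>. Instead of Pontryagin duality, a probabilistic argument is used: from four independent copies
of \<open>\<xi>\<close> one builds three families \<open>(V\<^sub>1(y))\<close>, \<open>(V\<^sub>2(y))\<close>, \<open>(V\<^sub>3(y))\<close> of circle valued variables with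
\<open>V\<^sub>1 V\<^sub>2 cnj V\<^sub>3 = l\<close>, each having in the limit the same joint law as \<open>((\<xi>, y))\<^sub>y\<close>. Some outcome puts
all three near \<open>((x\<^sub>i, y))\<^sub>y\<close> with \<open>x\<^sub>1, x\<^sub>2, x\<^sub>3\<close> in a fixed compact set, so \<open>l(y)\<close> is close to
\<open>(x\<^sub>1 + x\<^sub>2 - x\<^sub>3, y)\<close>, and compactness finishes (phase_is_evaluation).

\<^emph>\<open>Enough characters.\<close> Density of \<open>2Y\<close> and the separation of points of \<open>X\<close> by characters are the
parts of duality theory that the proof needs. Both follow from one principle (character_extraction):
an additive functional with an upper bound \<open>B Re (P 0)\<close> on the cone of continuous positive definite
functions \<open>P\<close>, positive at one of them, is positive at normalised functions that are arbitrarily close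
to a single character on finite sets. The functionals used are built with an invariant integral, which exists
    by averaging over boxes in finitely generated
subgroups, because those boxes grow only polynomially.

\<^emph>\<open>The converse.\<close> If \<open>x\<^sub>0\<close> has order two, let one of the variables take the values \<open>x\<^sub>0\<close> and \<open>0\<close> with
probabilities \<open>1/4\<close> and \<open>3/4\<close> and the others vanish. Then \<open>L\<^sub>2 = - L\<^sub>2\<close>, but the law is not Gaussian,
as its characteristic function equals \<open>1\<close> on \<open>2Y\<close> but not on \<open>Y\<close>.
\<close>

section \<open>An invariant integral\<close>

text \<open>Tychonoff's theorem in the form of a limit along a finer filter: one filter serves all indices \<open>f\<close>,
so that every relation between finitely many of the \<open>\<Phi> i f\<close> survives in the limit.\<close>
lemma bounded_family_convergent_subfilter:
  fixes \<Phi> :: "'i \<Rightarrow> 'f \<Rightarrow> 'b::euclidean_space"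
  assumes "F \<noteq> bot" and bd: "\<And>f. \<forall>\<^sub>F i in F. norm (\<Phi> i f) \<le> C f"
  obtains H I where "H \<le> F" "H \<noteq> bot" "\<And>f. ((\<lambda>i. \<Phi> i f) \<longlongrightarrow> I f) H"
proof -
  define \<Psi> where "\<Psi> i f = (if norm (\<Phi> i f) \<le> \<bar>C f\<bar> then \<Phi> i f else 0)" for i f
  define S where "S = (PiE UNIV (\<lambda>f. cball (0::'b) \<bar>C f\<bar>))"
  have "compactin (product_topology (\<lambda>f::'f. euclidean) UNIV) S"
    unfolding S_def compactin_PiE by (simp add: compactin_euclidean_iff)
  hence cS: "compact S"
    by (simp add: euclidean_product_topology compactin_euclidean_iff)
  have "\<Psi> i \<in> S" for i by (auto simp: S_def \<Psi>_def)
  hence ev: "eventually (\<lambda>x. x \<in> S) (filtermap \<Psi> F)"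
    by (simp add: eventually_filtermap)
  moreover have "filtermap \<Psi> F \<noteq> bot" using assms(1) by (simp add: filtermap_bot_iff)
  ultimately obtain I where I: "inf (nhds I) (filtermap \<Psi> F) \<noteq> bot"
    using cS unfolding compact_filter by blast
  define H where "H = inf F (filtercomap \<Psi> (nhds I))"
  have 1: "H \<le> F" by (simp add: H_def)
  have 2: "H \<noteq> bot"
  proof
    assume "H = bot"
    then obtain P Q where PQ: "eventually P F" "eventually Q (nhds I)"
      "\<And>i. P i \<Longrightarrow> Q (\<Psi> i) \<Longrightarrow> False"
      unfolding H_def trivial_limit_def eventually_inf eventually_filtercomap by metis
    have "eventually (\<lambda>z. \<not> Q z) (filtermap \<Psi> F)"
      unfolding eventually_filtermap using PQ(1) by eventually_elim (use PQ(3) in blast)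
    with PQ(2) have "eventually (\<lambda>z. False) (inf (nhds I) (filtermap \<Psi> F))"
      unfolding eventually_inf by blast
    with I show False by (simp add: trivial_limit_def)
  qed
  have 3: "((\<lambda>i. \<Phi> i f) \<longlongrightarrow> I f) H" for f
  proof -
    have "filterlim \<Psi> (nhds I) H"
      unfolding H_def by (rule filterlim_mono[OF filterlim_filtercomap]) auto
    moreover have "filterlim (\<lambda>g. g f) (nhds (I f)) (nhds I)"
      using continuous_on_product_coordinates[of f]
      unfolding continuous_on_def by (metis UNIV_I tendsto_at_iff_tendsto_nhds)
    ultimately have "((\<lambda>i. \<Psi> i f) \<longlongrightarrow> I f) H"
      by (rule filterlim_compose[rotated])
    moreover have "\<forall>\<^sub>F i in H. \<Psi> i f = \<Phi> i f"
      using filter_leD[OF 1 bd[of f]]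
      by eventually_elim (auto simp: \<Psi>_def)
    ultimately show ?thesis using tendsto_cong by fastforce
  qed
  from 1 2 3 show ?thesis by (rule that)
qed

definition Cc :: "('a::topological_space \<Rightarrow> real) set" where
  "Cc = {f. continuous_on UNIV f \<and> (\<exists>K. compact K \<and> (\<forall>x. x \<notin> K \<longrightarrow> f x = 0))}"

lemma CcI: "continuous_on UNIV f \<Longrightarrow> compact K \<Longrightarrow> (\<And>x. x \<notin> K \<Longrightarrow> f x = 0) \<Longrightarrow> f \<in> Cc"
  by (auto simp: Cc_def)

lemma Cc_continuous: "f \<in> Cc \<Longrightarrow> continuous_on UNIV f"
  by (auto simp: Cc_def)

lemma CcE:
  assumes "f \<in> Cc"
  obtains K where "compact K" "\<And>x. x \<notin> K \<Longrightarrow> f x = 0"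
  using assms by (auto simp: Cc_def)

lemma Cc_bounded:
  assumes "f \<in> Cc"
  obtains M where "0 \<le> M" "\<And>x. \<bar>f x\<bar> \<le> M"
proof -
  obtain K where K: "compact K" "\<And>x. x \<notin> K \<Longrightarrow> f x = 0" using assms by (rule CcE) blast
  have "compact (f ` K)"
    using K(1) Cc_continuous[OF assms] by (meson compact_continuous_image continuous_on_subset top_greatest)
  from compact_imp_bounded[OF this] obtain M where "\<And>x. x \<in> K \<Longrightarrow> \<bar>f x\<bar> \<le> M"
    unfolding bounded_iff by auto
  then have "\<bar>f x\<bar> \<le> max 0 M" for x using K(2)[of x] by (cases "x \<in> K") fastforce+
  then show ?thesis by (intro that[of "max 0 M"]) auto
qed

lemma Cc_mult_continuous:
  assumes "f \<in> Cc" "continuous_on UNIV g"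
  shows "(\<lambda>x. f x * g x) \<in> Cc" and "(\<lambda>x. g x * f x) \<in> Cc"
proof -
  obtain K where K: "compact K" "\<And>x. x \<notin> K \<Longrightarrow> f x = 0" using assms(1) by (rule CcE) blast
  show "(\<lambda>x. f x * g x) \<in> Cc" "(\<lambda>x. g x * f x) \<in> Cc"
    by (rule CcI[OF _ K(1)]; use K in \<open>simp add: continuous_on_mult assms Cc_continuous\<close>)+
qed

lemma Cc_add:
  assumes "f \<in> Cc" "g \<in> Cc"
  shows "(\<lambda>x. f x + g x) \<in> Cc"
proof -
  obtain K L where "compact K" "\<And>x. x \<notin> K \<Longrightarrow> f x = 0" "compact L" "\<And>x. x \<notin> L \<Longrightarrow> g x = 0"
    using assms by (metis CcE)
  then show ?thesis using assms
    by (intro CcI[of _ "K \<union> L"]) (auto intro: continuous_on_add Cc_continuous)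
qed

lemma Cc_zero: "(\<lambda>x. 0) \<in> Cc"
  by (rule CcI[of _ "{}"]) auto

lemma Cc_cmult: "f \<in> Cc \<Longrightarrow> (\<lambda>x. c * f x) \<in> Cc"
  by (rule Cc_mult_continuous) auto

lemma Cc_uminus: "f \<in> Cc \<Longrightarrow> (\<lambda>x. - f x) \<in> Cc"
  using Cc_cmult[of f "-1"] by simp

lemma Cc_diff: "f \<in> Cc \<Longrightarrow> g \<in> Cc \<Longrightarrow> (\<lambda>x. f x - g x) \<in> Cc"
  using Cc_add[of f "\<lambda>x. - g x"] Cc_uminus[of g] by simp

lemma Cc_abs:
  assumes f: "f \<in> Cc"
  shows "(\<lambda>x. \<bar>f x\<bar>) \<in> Cc"
proof -
  obtain K where K: "compact K" "\<And>x. x \<notin> K \<Longrightarrow> f x = 0" using f by (rule CcE) blast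
  show ?thesis
    by (rule CcI[OF _ K(1)]) (simp_all add: continuous_on_rabs Cc_continuous f K(2))
qed

lemma Cc_sum: "(\<And>i. i \<in> A \<Longrightarrow> f i \<in> Cc) \<Longrightarrow> (\<lambda>x. \<Sum>i\<in>A. f i x) \<in> Cc"
  by (induction A rule: infinite_finite_induct) (auto simp: Cc_zero Cc_add)

lemma continuous_on_UNIV_compose:
  assumes "continuous_on UNIV f" "continuous_on UNIV g"
  shows "continuous_on UNIV (\<lambda>x. f (g x))"
  using assms by (metis continuous_on_compose2 top_greatest)

lemma Cc_shift:
  fixes f :: "'a::{topological_ab_group_add} \<Rightarrow> real"
  assumes "f \<in> Cc"
  shows "(\<lambda>x. f (x + a)) \<in> Cc"
proof -
  obtain K where K: "compact K" "\<And>x. x \<notin> K \<Longrightarrow> f x = 0" using assms by (rule CcE) blast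
  have c: "continuous_on UNIV (\<lambda>x. f (x + a))"
    by (rule continuous_on_UNIV_compose[OF Cc_continuous[OF assms]]) (auto intro!: continuous_intros)
  have "compact ((\<lambda>x. x + (- a)) ` K)"
    by (intro compact_continuous_image continuous_intros K)
  moreover have "f (x + a) = 0" if "x \<notin> (\<lambda>x. x + (- a)) ` K" for x
  proof (rule K(2), rule notI)
    assume "x + a \<in> K"
    moreover have "x = (x + a) + (- a)" by simp
    ultimately show False using that by blast
  qed
  ultimately show ?thesis by (rule CcI[OF c])
qed

lemma Cc_reflect:
  fixes f :: "'a::{topological_ab_group_add} \<Rightarrow> real"
  assumes "f \<in> Cc"
  shows "(\<lambda>x. f (a - x)) \<in> Cc"
proof -
  obtain K where K: "compact K" "\<And>x. x \<notin> K \<Longrightarrow> f x = 0" using assms by (rule CcE) blast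
  have c: "continuous_on UNIV (\<lambda>x. f (a + - x))"
    by (rule continuous_on_UNIV_compose[OF Cc_continuous[OF assms]]) (intro continuous_intros)
  have "compact ((\<lambda>x. a + - x) ` K)"
    by (intro compact_continuous_image continuous_intros K)
  moreover have "f (a + - x) = 0" if "x \<notin> (\<lambda>x. a + - x) ` K" for x
  proof (rule K(2), rule notI)
    assume "a + - x \<in> K"
    moreover have "x = a + - (a + - x)" by simp
    ultimately show False using that by blast
  qed
  ultimately show ?thesis using CcI[OF c, of "(\<lambda>x. a + - x) ` K"] by simp
qed

lemma Hausdorff_euclidean_t2: "Hausdorff_space (euclidean :: 'a::t2_space topology)"
  unfolding Hausdorff_space_def disjnt_def open_openin[symmetric] using hausdorff by metis

lemma bump_function:
  fixes U :: "'a::{topological_ab_group_add, t2_space} set"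
  assumes lc: "locally_compact_space (euclidean :: 'a topology)" and U: "open U" "0 \<in> U"
  obtains b where "b \<in> Cc" "\<And>x. 0 \<le> b x" "\<And>x. b x \<le> 1" "b 0 = 1" "\<And>x. x \<notin> U \<Longrightarrow> b x = 0"
    "\<And>x. b (- x) = b x"
proof -
  obtain W K :: "'a set" where WK: "open W" "compact K" "0 \<in> W" "W \<subseteq> K"
    using bspec[OF lc[unfolded locally_compact_space_def], of 0]
    unfolding compactin_euclidean_iff open_openin[symmetric] by auto
  have "completely_regular_space (euclidean :: 'a topology)"
    by (rule locally_compact_regular_imp_completely_regular_space[OF lc]) (use Hausdorff_euclidean_t2 in
        blast)
  moreover have "closedin euclidean (- (U \<inter> W))" using U WK by auto
  moreover have "(0::'a) \<in> topspace euclidean - (- (U \<inter> W))" using U WK by auto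
  ultimately obtain f where f: "continuous_map euclidean (top_of_set {0..1}) f" "f (0::'a) = (0::real)"
     "f ` (- (U \<inter> W)) \<subseteq> {1}"
    unfolding completely_regular_space_def by blast
  have fc: "continuous_on UNIV f" and f01: "\<And>x. f x \<in> {0..1}"
    using f(1) by (auto simp: continuous_map_in_subtopology)
  define b where "b x = (1 - f x) * (1 - f (- x))" for x
  have cb: "continuous_on UNIV b" unfolding b_def
    by (intro continuous_intros fc continuous_on_UNIV_compose[OF fc])
  have z: "b x = 0" if "x \<notin> U \<inter> W" for x using that f(3) unfolding b_def by force
  show ?thesis
  proof (rule that[of b])
    show "b \<in> Cc" using cb WK(2) by (rule CcI) (use z WK in auto)
    show "0 \<le> b x" for x using f01[of x] f01[of "-x"] by (auto simp: b_def)
    show "b x \<le> 1" for x using f01[of x] f01[of "-x"] by (auto simp: b_def intro!: mult_le_one)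
    show "b 0 = 1" by (simp add: b_def f(2))
    show "x \<notin> U \<Longrightarrow> b x = 0" for x using z by auto
    show "b (- x) = b x" for x by (simp add: b_def mult.commute)
  qed
qed

lemma open_translate:
  fixes W :: "'a::topological_ab_group_add set"
  assumes "open W"
  shows "open {x. x + e \<in> W}"
proof -
  have "continuous_on UNIV (\<lambda>x::'a. x + e)" by (intro continuous_intros)
  from open_vimage[OF assms this] show ?thesis by (simp add: vimage_def)
qed

lemma compact_cover_translates:
  fixes K :: "'a::topological_ab_group_add set"
  assumes "compact K" "open W" "0 \<in> W"
  obtains F where "finite F" "\<And>x. x \<in> K \<Longrightarrow> \<exists>e\<in>F. x + e \<in> W"
proof -
  have "K \<subseteq> (\<Union>e\<in>UNIV. {x. x + e \<in> W})"
  proof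
    fix x assume "x \<in> K"
    have "x + (- x) \<in> W" using assms by simp
    then show "x \<in> (\<Union>e\<in>UNIV. {x. x + e \<in> W})" by blast
  qed
  then obtain F where "finite F" "K \<subseteq> (\<Union>e\<in>F. {x. x + e \<in> W})"
    by (rule compactE_image[OF assms(1) open_translate[OF assms(2)]]) blast
  then show ?thesis by (intro that[of F]) auto
qed

text \<open>Finitely many translates of a neighbourhood on which \<open>f0\<close> exceeds half of \<open>f0 x0\<close> cover the support of
\<open>f\<close>. This bounds all approximate integrals of \<open>f\<close> in terms of that of \<open>f0\<close>.\<close>
lemma Cc_dominated_by_translates:
  fixes f0 :: "'a::topological_ab_group_add \<Rightarrow> real"
  assumes f0: "continuous_on UNIV f0" "\<And>x. 0 \<le> f0 x" "0 < f0 x0" and f: "f \<in> Cc"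
  obtains c F where "finite F" "0 \<le> c" "\<And>x. \<bar>f x\<bar> \<le> c * (\<Sum>e\<in>F. f0 (x + e))"
proof -
  obtain K where K: "compact K" "\<And>x. x \<notin> K \<Longrightarrow> f x = 0" using f by (rule CcE) blast
  obtain M where M: "0 \<le> M" "\<And>x. \<bar>f x\<bar> \<le> M" using f by (rule Cc_bounded) blast
  define W where "W = {x. x + x0 \<in> {x. f0 x > f0 x0 / 2}}"
  have "open {x. f0 x > f0 x0 / 2}"
    using open_vimage[OF open_greaterThan[of "f0 x0 / 2"] f0(1)] by (simp add: vimage_def)
  hence oW: "open W" unfolding W_def by (rule open_translate)
  have "0 \<in> W" using f0(3) by (simp add: W_def)
  then obtain F where F: "finite F" "\<And>x. x \<in> K \<Longrightarrow> \<exists>e\<in>F. x + e \<in> W"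
    using compact_cover_translates[OF K(1) oW] by metis
  have pos: "0 \<le> (\<Sum>e\<in>(\<lambda>e. e + x0) ` F. f0 (x + e))" for x by (intro sum_nonneg f0)
  show ?thesis
  proof (rule that[of "(\<lambda>e. e + x0) ` F" "2 * M / f0 x0"])
    fix x
    show "\<bar>f x\<bar> \<le> 2 * M / f0 x0 * (\<Sum>e\<in>(\<lambda>e. e + x0) ` F. f0 (x + e))"
    proof (cases "x \<in> K")
      case True
      then obtain e where e: "e \<in> F" "x + e \<in> W" using F by blast
      have "f0 x0 / 2 \<le> f0 (x + (e + x0))" using e by (simp add: W_def add.assoc)
      also have "\<dots> \<le> (\<Sum>e\<in>(\<lambda>e. e + x0) ` F. f0 (x + e))"
        by (rule member_le_sum) (use e F f0 in auto)
      finally have "2 * M / f0 x0 * (f0 x0 / 2) \<le> 2 * M / f0 x0 * (\<Sum>e\<in>(\<lambda>e. e + x0) ` F. f0 (x + e))"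
        by (rule mult_left_mono) (use M f0 in auto)
      moreover have "2 * M / f0 x0 * (f0 x0 / 2) = M" using f0(3) by simp
      ultimately show ?thesis using M(2)[of x] by linarith
    next
      case False
      then show ?thesis using K(2) M(1) f0(3) pos by (simp add: zero_le_mult_iff zero_le_divide_iff)
    qed
  qed (use F M f0 in auto)
qed

primrec nmul :: "nat \<Rightarrow> 'a::ab_group_add \<Rightarrow> 'a" where
  "nmul 0 x = 0"
| "nmul (Suc n) x = nmul n x + x"

text \<open>Combinations of the elements of a finite set \<open>E\<close> with coefficients at most \<open>N\<close>, counted with
multiplicity: summing over coefficient vectors rather than over points makes translation by an
element of \<open>E\<close> an injection of the box of size \<open>N\<close> into the box of size \<open>N + 1\<close>, whatever relations hold
between the elements of \<open>E\<close>.\<close>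
definition index_box :: "'a set \<Rightarrow> nat \<Rightarrow> ('a \<Rightarrow> nat) set" where
  "index_box E N = E \<rightarrow>\<^sub>E {..N}"

definition box_point :: "'a set \<Rightarrow> ('a::ab_group_add \<Rightarrow> nat) \<Rightarrow> 'a" where
  "box_point E w = (\<Sum>e\<in>E. nmul (w e) e)"

definition box_sum :: "'a::ab_group_add set \<Rightarrow> nat \<Rightarrow> ('a \<Rightarrow> real) \<Rightarrow> real" where
  "box_sum E N f = (\<Sum>w\<in>index_box E N. f (box_point E w))"

lemma finite_index_box: "finite E \<Longrightarrow> finite (index_box E N)"
  by (simp add: index_box_def finite_PiE)

lemma card_index_box: "finite E \<Longrightarrow> card (index_box E N) = Suc N ^ card E"
  by (simp add: index_box_def card_PiE)

lemma index_box_mono: "M \<le> N \<Longrightarrow> index_box E M \<subseteq> index_box E N"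
  by (force simp: index_box_def PiE_iff)

lemma box_point_step:
  assumes "finite E" "e \<in> E"
  shows "box_point E (w(e := Suc (w e))) = box_point E w + e"
proof -
  have "(\<Sum>x\<in>E - {e}. nmul ((w(e := Suc (w e))) x) x) = (\<Sum>x\<in>E - {e}. nmul (w x) x)"
    by (rule sum.cong) auto
  then show ?thesis
    unfolding box_point_def using assms by (subst (1 2) sum.remove[of E e]) (simp_all add: add_ac)
qed

lemma index_box_step:
  assumes "e \<in> E" "w \<in> index_box E N"
  shows "w(e := Suc (w e)) \<in> index_box E (Suc N)"
  using assms by (force simp: index_box_def PiE_iff extensional_def Pi_iff le_SucI)

lemma inj_on_step: "inj_on (\<lambda>w. w(e := Suc (w e))) A"
  by (rule inj_onI) (metis Suc_inject fun_upd_same fun_upd_triv fun_upd_upd)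

lemma box_sum_shift_diff:
  assumes E: "finite E" "e \<in> E" and f: "\<And>x. 0 \<le> f x" and T: "T \<subseteq> index_box E N" and
    T': "\<And>w. w \<in> T \<Longrightarrow> w(e := Suc (w e)) \<notin> R" and R: "R \<subseteq> index_box E (Suc N)"
  shows "(\<Sum>w\<in>T. f (box_point E w + e)) \<le> box_sum E (Suc N) f - (\<Sum>w\<in>R. f (box_point E w))"
proof -
  have fin: "finite (index_box E M)" for M by (rule finite_index_box[OF E(1)])
  have "(\<Sum>w\<in>T. f (box_point E w + e)) = (\<Sum>w\<in>T. f (box_point E (w(e := Suc (w e)))))"
    by (simp add: box_point_step[OF E] del: fun_upd_apply)
  also have "\<dots> = (\<Sum>w\<in>(\<lambda>w. w(e := Suc (w e))) ` T. f (box_point E w))"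
    by (subst sum.reindex[OF inj_on_step]) simp
  also have "\<dots> \<le> (\<Sum>w\<in>index_box E (Suc N) - R. f (box_point E w))"
    using T T' index_box_step[OF E(2)] by (intro sum_mono2 f) (auto simp: fin)
  also have "\<dots> = box_sum E (Suc N) f - (\<Sum>w\<in>R. f (box_point E w))"
    unfolding box_sum_def by (rule sum_diff[OF fin R])
  finally show ?thesis .
qed

lemma box_sum_shift_le:
  assumes E: "finite E" "e \<in> E" and f: "\<And>x. 0 \<le> f x"
  shows "box_sum E N (\<lambda>x. f (x + e)) \<le> box_sum E (Suc N) f"
  using box_sum_shift_diff[OF E f, of "index_box E N" N "{}"] by (simp add: box_sum_def)

text \<open>Translation by \<open>e\<close> moves the layer between sizes \<open>N\<close> and \<open>N + 1\<close> into the layers between \<open>N\<close> and \<open>N + 2\<close>.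
The error of translation invariance lives on such layers.\<close>
lemma box_sum_annulus_shift_le:
  assumes E: "finite E" "e \<in> E" and f: "\<And>x. 0 \<le> f x"
  shows "box_sum E (Suc N) (\<lambda>x. f (x + e)) - box_sum E N (\<lambda>x. f (x + e)) \<le> box_sum E (Suc (Suc N)) f - box_sum
      E N f"
proof -
  have fin: "finite (index_box E M)" for M by (rule finite_index_box[OF E(1)])
  have step: "w(e := Suc (w e)) \<notin> index_box E N" if "w \<in> index_box E (Suc N) - index_box E N" for w
  proof
    assume up: "w(e := Suc (w e)) \<in> index_box E N"
    have "w x \<le> N" if "x \<in> E" for x
      using PiE_mem[OF up[unfolded index_box_def] that] by (cases "x = e") auto
    moreover have "w \<in> extensional E" using that by (auto simp: index_box_def PiE_iff)
    ultimately have "w \<in> index_box E N" by (simp add: index_box_def PiE_iff)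
    with that show False by simp
  qed
  have "(\<Sum>w\<in>index_box E (Suc N) - index_box E N. f (box_point E w + e))
      \<le> box_sum E (Suc (Suc N)) f - (\<Sum>w\<in>index_box E N. f (box_point E w))"
    by (rule box_sum_shift_diff[OF E f]) (use step index_box_mono[of N "Suc (Suc N)" E] in auto)
  hence "(\<Sum>w\<in>index_box E (Suc N) - index_box E N. f (box_point E w + e)) \<le> box_sum E (Suc (Suc N)) f - box_sum
      E N f"
    unfolding box_sum_def .
  moreover have "(\<Sum>w\<in>index_box E (Suc N) - index_box E N. f (box_point E w + e)) = box_sum E (Suc N) (\<lambda>x. f (x
      + e)) - box_sum E N (\<lambda>x. f (x + e))"
    unfolding box_sum_def by (rule sum_diff) (auto simp: fin index_box_mono)
  ultimately show ?thesis by simp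
qed

text \<open>A growth factor \<open>1 + \<epsilon>\<close> at every second step would make \<open>a\<close> grow exponentially.\<close>
lemma slow_growth_step:
  fixes a :: "nat \<Rightarrow> real"
  assumes a0: "0 < a 0" and mono: "\<And>M N. M \<le> N \<Longrightarrow> a M \<le> a N"
    and bd: "\<And>N. a N \<le> C * real (Suc N) ^ d" and e: "0 < \<epsilon>"
  obtains N where "a (N + 2) \<le> (1 + \<epsilon>) * a N"
proof (rule ccontr)
  assume "\<not> thesis"
  with that have *: "(1 + \<epsilon>) * a N < a (N + 2)" for N using not_le by blast
  have "(1 + \<epsilon>) ^ k * a 0 \<le> a (2 * k)" for k
  proof (induction k)
    case (Suc k)
    have "(1 + \<epsilon>) ^ Suc k * a 0 \<le> (1 + \<epsilon>) * a (2 * k)" using Suc e by simp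
    also have "\<dots> \<le> a (2 * Suc k)" using *[of "2 * k"] by (simp add: less_imp_le)
    finally show ?case .
  qed simp
  hence le: "(1 + \<epsilon>) ^ k * a 0 \<le> C * real (Suc (2 * k)) ^ d" for k using bd order.trans by blast
  have C: "0 < C" using le[of 0] a0 by simp
  have "(\<lambda>k. (1 + 2 * real k) ^ d / (1 + \<epsilon>) ^ k) \<longlonglongrightarrow> 0"
    using e by real_asymp
  hence "(\<lambda>k. real (Suc (2 * k)) ^ d / (1 + \<epsilon>) ^ k) \<longlonglongrightarrow> 0"
    by simp
  moreover have "0 < a 0 / C" using a0 C by simp
  ultimately have "eventually (\<lambda>k. real (Suc (2 * k)) ^ d / (1 + \<epsilon>) ^ k < a 0 / C) sequentially"
    by (rule order_tendstoD)
  then obtain k where "real (Suc (2 * k)) ^ d / (1 + \<epsilon>) ^ k < a 0 / C"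
    unfolding eventually_sequentially by blast
  hence "C * real (Suc (2 * k)) ^ d < a 0 * (1 + \<epsilon>) ^ k" using C e by (simp add: field_simps)
  with le[of k] show False by (simp add: mult.commute)
qed

locale invariant_integral =
  fixes I :: "('a::{topological_ab_group_add, t2_space} \<Rightarrow> real) \<Rightarrow> real"
  assumes locally_compact: "locally_compact_space (euclidean :: 'a topology)"
    and I_add: "f \<in> Cc \<Longrightarrow> g \<in> Cc \<Longrightarrow> I (\<lambda>x. f x + g x) = I f + I g"
    and I_cmult: "f \<in> Cc \<Longrightarrow> I (\<lambda>x. c * f x) = c * I f"
    and I_nonneg: "f \<in> Cc \<Longrightarrow> (\<And>x. 0 \<le> f x) \<Longrightarrow> 0 \<le> I f"
    and I_shift: "f \<in> Cc \<Longrightarrow> I (\<lambda>x. f (x + a)) = I f"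
    and I_nontrivial: "\<exists>f\<in>Cc. I f \<noteq> 0"

lemma box_sum_linear:
  shows "box_sum E N (\<lambda>x. f x + g x) = box_sum E N f + box_sum E N g"
    and "box_sum E N (\<lambda>x. c * f x) = c * box_sum E N f"
    and "box_sum E N (\<lambda>x. \<Sum>i\<in>A. h i x) = (\<Sum>i\<in>A. box_sum E N (h i))"
  unfolding box_sum_def by (auto simp: sum.distrib sum_distrib_left intro: sum.swap)

lemma box_sum_mono: "(\<And>x. f x \<le> g x) \<Longrightarrow> box_sum E N f \<le> box_sum E N g"
  unfolding box_sum_def by (rule sum_mono) auto

lemma box_sum_range_mono:
  assumes "finite E" "\<And>x. 0 \<le> f x" "M \<le> N"
  shows "box_sum E M f \<le> box_sum E N f"
  unfolding box_sum_def by (intro sum_mono2) (use assms finite_index_box index_box_mono[OF assms(3)] in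
      blast)+

lemma index_box_0: "index_box E 0 = {\<lambda>x. if x \<in> E then 0 else undefined}"
  by (force simp: index_box_def PiE_iff extensional_def fun_eq_iff)

text \<open>A positive linear functional normalised at \<open>f0\<close> that translation by elements of \<open>E\<close> increases by at
most \<open>\<epsilon>\<close>, relative to the mass of a sum of translates of \<open>f0\<close> dominating the argument. In the limit
the one-sided estimates become equalities, because they apply to the opposite translations as
well.\<close>
definition nearly_invariant ::
  "(('a::ab_group_add \<Rightarrow> real) \<Rightarrow> real) \<Rightarrow> ('a \<Rightarrow> real) \<Rightarrow> 'a set \<Rightarrow> real \<Rightarrow> bool" where
  "nearly_invariant S f0 E \<epsilon> \<longleftrightarrow>
      (\<forall>f g. S (\<lambda>x. f x + g x) = S f + S g) \<and> (\<forall>c f. S (\<lambda>x. c * f x) = c * S f) \<and>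
      (\<forall>f g. (\<forall>x. f x \<le> g x) \<longrightarrow> S f \<le> S g) \<and> S f0 = 1 \<and>
      (\<forall>f F c. (\<forall>x. 0 \<le> f x) \<longrightarrow> (\<forall>x. f x \<le> c * (\<Sum>e\<in>F. f0 (x + e))) \<longrightarrow> 0 \<le> c \<longrightarrow> F \<subseteq> E \<longrightarrow>
        S f \<le> 2 * c * real (card F) \<and> (\<forall>e\<in>E. S (\<lambda>x. f (x + e)) \<le> S f + c * real (card F) * \<epsilon>))"

lemma nearly_invariantD:
  assumes "nearly_invariant S f0 E \<epsilon>"
  shows "S (\<lambda>x. f x + g x) = S f + S g" and "S (\<lambda>x. c * f x) = c * S f"
    and "(\<And>x. f x \<le> g x) \<Longrightarrow> S f \<le> S g" and "S f0 = 1"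
  using assms unfolding nearly_invariant_def by (elim conjE, simp)+

lemma nearly_invariant_shift:
  assumes "nearly_invariant S f0 E \<epsilon>" "\<And>x. 0 \<le> f x" "\<And>x. f x \<le> c * (\<Sum>e\<in>F. f0 (x + e))" "0 \<le> c" "F \<subseteq> E"
  shows "S f \<le> 2 * c * real (card F)" and "e \<in> E \<Longrightarrow> S (\<lambda>x. f (x + e)) \<le> S f + c * real (card F) * \<epsilon>"
proof -
  have "S f \<le> 2 * c * real (card F) \<and> (\<forall>e\<in>E. S (\<lambda>x. f (x + e)) \<le> S f + c * real (card F) * \<epsilon>)"
    using assms(1) unfolding nearly_invariant_def
    by (elim conjE allE[where x = f] allE[where x = F] allE[where x = c]) (use assms in simp)
  then show "S f \<le> 2 * c * real (card F)"
    and "e \<in> E \<Longrightarrow> S (\<lambda>x. f (x + e)) \<le> S f + c * real (card F) * \<epsilon>" by blast+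
qed

text \<open>Normalised box sums over a size \<open>N\<close> after which the box sums of \<open>f0\<close> grow by a factor of at most
\<open>1 + \<epsilon>\<close>. Such sizes exist because the box sums of \<open>f0\<close> are bounded by a power of \<open>N\<close>.\<close>
lemma nearly_invariant_functional:
  fixes f0 :: "'a::ab_group_add \<Rightarrow> real"
  assumes E: "finite E" and f0: "\<And>x. 0 \<le> f0 x" "f0 0 = 1" "\<And>x. f0 x \<le> 1" and e: "0 < \<epsilon>" "\<epsilon> \<le> 1"
  shows "\<exists>S. nearly_invariant S f0 E \<epsilon>"
proof -
  define a where "a N = box_sum E N f0" for N
  have a0: "a 0 = 1" unfolding a_def box_sum_def index_box_0
    by (simp add: box_point_def f0(2))
  have amono: "a M \<le> a N" if "M \<le> N" for M N
    unfolding a_def by (rule box_sum_range_mono[OF E f0(1) that])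
  have abd: "a N \<le> 1 * real (Suc N) ^ card E" for N
  proof -
    have "a N \<le> (\<Sum>w\<in>index_box E N. 1)" unfolding a_def box_sum_def by (intro sum_mono f0)
    also have "\<dots> = real (Suc N) ^ card E" by (simp add: card_index_box[OF E])
    finally show ?thesis by simp
  qed
  obtain N where N: "a (N + 2) \<le> (1 + \<epsilon>) * a N"
    using slow_growth_step[of a 1 "card E" \<epsilon>] a0 amono abd e by auto
  have aN: "1 \<le> a N" using amono[of 0 N] a0 by simp
  define S where "S f = box_sum E N f / a N" for f
  show ?thesis
    unfolding nearly_invariant_def
  proof (intro exI[of _ S] conjI allI impI)
    show "S (\<lambda>x. f x + g x) = S f + S g" for f g by (simp add: S_def box_sum_linear add_divide_distrib)
    show "S (\<lambda>x. c * f x) = c * S f" for c f by (simp add: S_def box_sum_linear)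
    show "S f \<le> S g" if "\<forall>x. f x \<le> g x" for f g
      unfolding S_def using aN that by (intro divide_right_mono box_sum_mono) auto
    show "S f0 = 1" using aN by (simp add: S_def a_def[symmetric])
    fix f F c
    assume "\<forall>x. 0 \<le> f x" "\<forall>x. f x \<le> c * (\<Sum>e\<in>F. f0 (x + e))" and c: "0 \<le> c" and F: "F \<subseteq> E"
    then have f: "\<And>x. 0 \<le> f x" "\<And>x. f x \<le> c * (\<Sum>e\<in>F. f0 (x + e))" by auto
    have finF: "finite F" using E F finite_subset by blast
    have *: "f (x + 0) \<le> c * (\<Sum>e\<in>F. f0 (x + e))" for x using f(2)[of x] by simp
    have "box_sum E N f \<le> c * (\<Sum>e\<in>F. box_sum E N (\<lambda>x. f0 (x + e)))"
      using box_sum_mono[of f "\<lambda>x. c * (\<Sum>e\<in>F. f0 (x + e))"] f(2) by (simp add: box_sum_linear)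
    also have "\<dots> \<le> c * (\<Sum>e\<in>F. a (Suc N))"
      unfolding a_def by (intro mult_left_mono sum_mono box_sum_shift_le E f0 c) (use F in auto)
    also have "\<dots> = c * card F * a (Suc N)" by simp
    also have "\<dots> \<le> c * card F * (2 * a N)"
    proof (rule mult_left_mono)
      have "\<epsilon> * a N \<le> 1 * a N" by (rule mult_right_mono) (use e aN in auto)
      then show "a (Suc N) \<le> 2 * a N" using amono[of "Suc N" "N + 2"] N by (simp add: algebra_simps)
    qed (use c in auto)
    finally show "S f \<le> 2 * c * card F"
      unfolding S_def using aN by (simp add: field_simps)
    show "\<forall>e\<in>E. S (\<lambda>x. f (x + e)) \<le> S f + c * real (card F) * \<epsilon>"
    proof
      fix e assume e: "e \<in> E"
      have "box_sum E N (\<lambda>x. f (x + e)) - box_sum E N f \<le> box_sum E (Suc N) f - box_sum E N f"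
        using box_sum_shift_le[OF E e f(1), of N] by simp
      also have "\<dots> = (\<Sum>w\<in>index_box E (Suc N) - index_box E N. f (box_point E w))"
        unfolding box_sum_def by (rule sum_diff[symmetric]) (auto simp: finite_index_box E index_box_mono)
      also have "\<dots> \<le> (\<Sum>w\<in>index_box E (Suc N) - index_box E N. c * (\<Sum>e\<in>F. f0 (box_point E w + e)))"
        by (intro sum_mono f)
      also have "\<dots> = c * (\<Sum>e\<in>F. \<Sum>w\<in>index_box E (Suc N) - index_box E N. f0 (box_point E w + e))"
        by (subst sum.swap) (simp add: sum_distrib_left)
      also have "\<dots> = c * (\<Sum>e\<in>F. box_sum E (Suc N) (\<lambda>x. f0 (x + e)) - box_sum E N (\<lambda>x. f0 (x + e)))"
        unfolding box_sum_def by (subst sum_diff) (auto simp: finite_index_box E index_box_mono)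
      also have "\<dots> \<le> c * (\<Sum>e\<in>F. a (N + 2) - a N)"
        unfolding a_def using F by (intro mult_left_mono sum_mono c) (use box_sum_annulus_shift_le[OF E, where
            f = f0] f0(1) in auto)
      also have "\<dots> \<le> c * (\<Sum>e\<in>F. \<epsilon> * a N)"
        using N by (intro mult_left_mono sum_mono c) (simp add: algebra_simps)
      also have "\<dots> = c * card F * \<epsilon> * a N" by simp
      finally have "box_sum E N (\<lambda>x. f (x + e)) \<le> box_sum E N f + c * card F * \<epsilon> * a N" by simp
      from divide_right_mono[OF this, of "a N"] aN show "S (\<lambda>x. f (x + e)) \<le> S f + c * real (card F) * \<epsilon>"
        unfolding S_def by (simp add: add_divide_distrib)
    qed
  qed
qed

text \<open>The limit of nearly invariant functionals, with \<open>E\<close> increasing to the whole group and \<open>\<epsilon>\<close> tending to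
zero, along a filter that makes all values converge. For an Abelian group this replaces the
construction of Haar measure.\<close>
theorem invariant_integral_exists:
  assumes lc: "locally_compact_space (euclidean :: 'a::{topological_ab_group_add, t2_space} topology)"
  obtains I :: "('a::{topological_ab_group_add, t2_space} \<Rightarrow> real) \<Rightarrow> real" where "invariant_integral I"
proof -
  obtain f0 :: "'a \<Rightarrow> real" where f0: "f0 \<in> Cc" "\<And>x. 0 \<le> f0 x" "\<And>x. f0 x \<le> 1" "f0 0 = 1"
    using bump_function[OF lc, of UNIV] by (metis open_UNIV UNIV_I)
  have "\<exists>c F. finite F \<and> 0 \<le> c \<and> (\<forall>x. \<bar>f x\<bar> \<le> c * (\<Sum>e\<in>F. f0 (x + e)))" if "f \<in> Cc" for f
    using Cc_dominated_by_translates[OF Cc_continuous[OF f0(1)] f0(2) _ that, of 0] f0(4)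
    by (metis zero_less_one)
  then obtain c F where cF: "\<And>f. f \<in> Cc \<Longrightarrow> finite (F f)" "\<And>f. f \<in> Cc \<Longrightarrow> 0 \<le> (c f :: real)"
    "\<And>f x. f \<in> Cc \<Longrightarrow> \<bar>f x\<bar> \<le> c f * (\<Sum>e\<in>F f. f0 (x + e))" by metis
  have "\<exists>S. nearly_invariant S f0 (fst i) (1 / real (Suc (snd i)))" if "finite (fst i)" for i
    by (rule nearly_invariant_functional[of "fst i" f0, OF that f0(2) f0(4) f0(3)]) auto
  then obtain \<Phi> where \<Phi>: "\<And>i. finite (fst i) \<Longrightarrow> nearly_invariant (\<Phi> i) f0 (fst i) (1 / real (Suc (snd i)))"
    by metis
  define G where "G = (finite_subsets_at_top (UNIV :: 'a set) \<times>\<^sub>F sequentially)"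
  have Gev: "\<forall>\<^sub>F i in G. finite (fst i) \<and> E \<subseteq> fst i" if "finite E" for E
  proof -
    have "\<forall>\<^sub>F E' in finite_subsets_at_top UNIV. finite E' \<and> E \<subseteq> E'"
      unfolding eventually_finite_subsets_at_top using that by auto
    then show ?thesis unfolding G_def
      using eventually_prod1 [of sequentially "\<lambda>E'. finite E' \<and> E \<subseteq> E'"] by (simp add: split_def)
  qed
  have G0: "G \<noteq> bot" by (simp add: G_def prod_filter_eq_bot)
  have good: "\<forall>\<^sub>F i in G. nearly_invariant (\<Phi> i) f0 (fst i) (1 / real (Suc (snd i))) \<and> E \<subseteq> fst i" if "finite E"
      for E
    using Gev[OF that] by eventually_elim (use \<Phi> in blast)
  let ?C = "\<lambda>f. 4 * c (\<lambda>x. \<bar>f x\<bar>) * real (card (F (\<lambda>x. \<bar>f x\<bar>)))"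
  define \<Psi> where "\<Psi> i f = (if f \<in> Cc then \<Phi> i f else 0)" for i f
  have bd: "\<forall>\<^sub>F i in G. norm (\<Psi> i f) \<le> (if f \<in> Cc then ?C f else 0)" for f
  proof (cases "f \<in> Cc")
    case True
    let ?h = "\<lambda>x. \<bar>f x\<bar>"
    note h = cF[OF Cc_abs[OF True]]
    show ?thesis using good[OF h(1)]
    proof eventually_elim
      case (elim i)
      then have S: "nearly_invariant (\<Phi> i) f0 (fst i) (1 / real (Suc (snd i)))" by blast
      have "\<Phi> i ?h \<le> 2 * c ?h * card (F ?h)"
        by (rule nearly_invariant_shift(1)[OF S, of ?h]) (use h elim in auto)
      moreover have "\<Phi> i f \<le> \<Phi> i ?h" "\<Phi> i (\<lambda>x. (-1) * f x) \<le> \<Phi> i ?h"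
        by (rule nearly_invariantD(3)[OF S], simp)+
      moreover have "\<Phi> i (\<lambda>x. (-1) * f x) = (-1) * \<Phi> i f" by (rule nearly_invariantD(2)[OF S])
      moreover have "0 \<le> c ?h * card (F ?h)" using h by simp
      ultimately show ?case using True by (simp add: abs_le_iff \<Psi>_def)
    qed
  qed (simp add: \<Psi>_def)
  obtain H I where H: "H \<le> G" "H \<noteq> bot" and
    lim': "\<And>f. ((\<lambda>i. \<Psi> i f) \<longlongrightarrow> I f) H"
    by (rule bounded_family_convergent_subfilter[of G \<Psi>, OF G0 bd]) blast
  have lim: "((\<lambda>i. \<Phi> i f) \<longlongrightarrow> I f) H" if "f \<in> Cc" for f using lim'[of f] that by (simp add: \<Psi>_def)
  have goodH: "\<forall>\<^sub>F i in H. nearly_invariant (\<Phi> i) f0 (fst i) (1 / real (Suc (snd i))) \<and> E \<subseteq> fst i" if "finite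
      E" for E
    by (rule filter_leD[OF H(1) good[OF that]])
  have add: "I (\<lambda>x. f x + g x) = I f + I g" if "f \<in> Cc" "g \<in> Cc" for f g
  proof (rule tendsto_unique[OF H(2) lim[OF Cc_add[OF that]]])
    have "((\<lambda>i. \<Phi> i f + \<Phi> i g) \<longlongrightarrow> I f + I g) H" by (intro tendsto_add lim that)
    moreover have "\<forall>\<^sub>F i in H. \<Phi> i f + \<Phi> i g = \<Phi> i (\<lambda>x. f x + g x)"
      using goodH[of "{}", simplified] by eventually_elim (rule nearly_invariantD(1)[symmetric])
    ultimately show "((\<lambda>i. \<Phi> i (\<lambda>x. f x + g x)) \<longlongrightarrow> I f + I g) H" by (rule Lim_transform_eventually)
  qed
  have cmult: "I (\<lambda>x. k * f x) = k * I f" if "f \<in> Cc" for f k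
  proof (rule tendsto_unique[OF H(2) lim[OF Cc_cmult[OF that]]])
    have "((\<lambda>i. k * \<Phi> i f) \<longlongrightarrow> k * I f) H" by (intro tendsto_intros lim that)
    moreover have "\<forall>\<^sub>F i in H. k * \<Phi> i f = \<Phi> i (\<lambda>x. k * f x)"
      using goodH[of "{}", simplified] by eventually_elim (rule nearly_invariantD(2)[symmetric])
    ultimately show "((\<lambda>i. \<Phi> i (\<lambda>x. k * f x)) \<longlongrightarrow> k * I f) H" by (rule Lim_transform_eventually)
  qed
  have nonneg: "0 \<le> I f" if "f \<in> Cc" "\<And>x. 0 \<le> f x" for f
  proof (rule tendsto_lowerbound[OF lim[OF that(1)] _ H(2)])
    show "\<forall>\<^sub>F i in H. 0 \<le> \<Phi> i f"
      using goodH[of "{}", simplified]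
    proof eventually_elim
      case (elim i)
      have "\<Phi> i (\<lambda>x. 0 * f x) \<le> \<Phi> i f" by (rule nearly_invariantD(3)[OF elim]) (simp add: that)
      moreover have "\<Phi> i (\<lambda>x. 0 * f x) = 0 * \<Phi> i f" by (rule nearly_invariantD(2)[OF elim])
      ultimately show ?case by simp
    qed
  qed
  have shift_le: "I (\<lambda>x. f (x + a)) \<le> I f" if f: "f \<in> Cc" "\<And>x. 0 \<le> f x" for f a
  proof (rule tendsto_le[OF H(2) _ lim[OF Cc_shift[OF f(1)]]])
    note h = cF[OF f(1)]
    have "filterlim snd sequentially G" unfolding G_def by (rule filterlim_snd)
    hence "filterlim snd sequentially H" by (rule filterlim_mono[OF _ order_refl H(1)])
    hence "((\<lambda>i. 1 / real (Suc (snd i))) \<longlongrightarrow> 0) H"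
      using filterlim_compose[OF LIMSEQ_inverse_real_of_nat] by (simp add: inverse_eq_divide)
    hence "((\<lambda>i. \<Phi> i f + c f * card (F f) * (1 / real (Suc (snd i)))) \<longlongrightarrow> I f + c f * card (F f) * 0) H"
      by (intro tendsto_intros lim f)
    then show "((\<lambda>i. \<Phi> i f + c f * card (F f) * (1 / real (Suc (snd i)))) \<longlongrightarrow> I f) H" by simp
    show "\<forall>\<^sub>F i in H. \<Phi> i (\<lambda>x. f (x + a)) \<le> \<Phi> i f + c f * card (F f) * (1 / real (Suc (snd i)))"
      using goodH[OF finite.insertI[OF h(1), of a]]
    proof eventually_elim
      case (elim i)
      then have S: "nearly_invariant (\<Phi> i) f0 (fst i) (1 / real (Suc (snd i)))" by blast
      show ?case
        by (rule nearly_invariant_shift(2)[OF S, of f]) (use h elim f(2) in \<open>auto intro: order_trans[OF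
            abs_ge_self]\<close>)
    qed
  qed
  have shift_nonneg: "I (\<lambda>x. f (x + a)) = I f" if f: "f \<in> Cc" "\<And>x. 0 \<le> f x" for f a
  proof (rule antisym[OF shift_le[OF f]])
    have "I (\<lambda>x. f (x + - a + a)) \<le> I (\<lambda>x. f (x + a))"
      using shift_le[OF Cc_shift[OF f(1)], of a "- a"] f(2) by simp
    then show "I f \<le> I (\<lambda>x. f (x + a))" by simp
  qed
  \<comment> \<open>The invariance is known for non-negative functions; \<open>f\<close> is half the difference of \<open>|f| + f\<close>
    and \<open>|f| - f\<close>.\<close>
  have shift: "I (\<lambda>x. f (x + a)) = I f" if f: "f \<in> Cc" for f a
  proof -
    define p q where "p x = (\<bar>f x\<bar> + f x)" and "q x = (\<bar>f x\<bar> + (- 1) * f x)" for x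
    have pq: "p \<in> Cc" "q \<in> Cc" unfolding p_def q_def by (intro Cc_add Cc_abs Cc_cmult f)+
    have "I (\<lambda>x. p (x + a)) = I p" "I (\<lambda>x. q (x + a)) = I q"
      by (intro shift_nonneg pq; simp add: p_def q_def)+
    moreover have "I (\<lambda>x. f (x + b)) = (1/2) * I (\<lambda>x. p (x + b)) + (-1/2) * I (\<lambda>x. q (x + b))" for b
    proof -
      have "(\<lambda>x. f (x + b)) = (\<lambda>x. (1/2) * p (x + b) + (-1/2) * q (x + b))"
        by (rule ext) (simp add: p_def q_def field_simps)
      then show ?thesis
        by (simp only: add[OF Cc_cmult[OF Cc_shift[OF pq(1)]] Cc_cmult[OF Cc_shift[OF pq(2)]]]
            cmult[OF Cc_shift[OF pq(1)]] cmult[OF Cc_shift[OF pq(2)]])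
    qed
    from this[of a] this[of 0] calculation show ?thesis by simp
  qed
  have "I f0 = 1"
  proof (rule tendsto_unique[OF H(2) lim[OF f0(1)]])
    show "((\<lambda>i. \<Phi> i f0) \<longlongrightarrow> 1) H"
      by (rule tendsto_eventually) (use goodH[of "{}", simplified] in eventually_elim, rule
          nearly_invariantD(4))
  qed
  hence "\<exists>f\<in>Cc. I f \<noteq> 0" using f0(1) by (metis zero_neq_one)
  then have "invariant_integral I"
    by unfold_locales (use lc add cmult nonneg shift in auto)
  then show ?thesis by (rule that)
qed

section \<open>Almost invariant functions\<close>

lemma compact_tube:
  fixes U :: "('a::topological_space \<times> 'b::topological_space) set"
  assumes K: "compact K" and U: "open U" "\<And>x. x \<in> K \<Longrightarrow> (x, b) \<in> U"
  obtains V where "open V" "b \<in> V" "\<And>x y. x \<in> K \<Longrightarrow> y \<in> V \<Longrightarrow> (x, y) \<in> U"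
proof -
  have "\<exists>A B. open A \<and> open B \<and> x \<in> A \<and> b \<in> B \<and> A \<times> B \<subseteq> U" if "x \<in> K" for x
    using open_prod_elim[OF U(1) U(2)[OF that]] by (metis mem_Sigma_iff)
  then obtain A B where AB: "\<And>x. x \<in> K \<Longrightarrow> open (A x)" "\<And>x. x \<in> K \<Longrightarrow> open (B x)"
    "\<And>x. x \<in> K \<Longrightarrow> x \<in> A x" "\<And>x. x \<in> K \<Longrightarrow> b \<in> B x" "\<And>x. x \<in> K \<Longrightarrow> A x \<times> B x \<subseteq> U" by metis
  have "K \<subseteq> (\<Union>x\<in>K. A x)" using AB(3) by blast
  then obtain F where F: "F \<subseteq> K" "finite F" "K \<subseteq> (\<Union>x\<in>F. A x)"
    using compactE_image[OF K, of K A] AB(1) by metis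
  show ?thesis
  proof (rule that[of "\<Inter>x\<in>F. B x"])
    show "open (\<Inter>x\<in>F. B x)" by (rule open_INT) (use F AB in auto)
    show "b \<in> (\<Inter>x\<in>F. B x)" using F AB by blast
    fix x y assume "x \<in> K" "y \<in> (\<Inter>x\<in>F. B x)"
    then obtain z where "z \<in> F" "x \<in> A z" "y \<in> B z" using F by blast
    then show "(x, y) \<in> U" using AB(5)[of z] F by blast
  qed
qed

lemma uniformly_small_near:
  fixes f :: "'a::topological_space \<Rightarrow> 'b::topological_space \<Rightarrow> real"
  assumes K: "compact K" and f: "continuous_on UNIV (\<lambda>p. f (fst p) (snd p))" and small: "\<And>x. x \<in> K \<Longrightarrow> f x b <
      \<epsilon>"
  obtains V where "open V" "b \<in> V" "\<And>x y. x \<in> K \<Longrightarrow> y \<in> V \<Longrightarrow> f x y < \<epsilon>"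
proof -
  have "open ((\<lambda>p. f (fst p) (snd p)) -` {..<\<epsilon>})"
    by (rule open_vimage[OF open_lessThan f])
  from compact_tube[OF K this, of b] small obtain V where
    "open V" "b \<in> V" "\<And>x y. x \<in> K \<Longrightarrow> y \<in> V \<Longrightarrow> (x, y) \<in> (\<lambda>p. f (fst p) (snd p)) -` {..<\<epsilon>}" by auto
  then show ?thesis by (intro that[of V]) auto
qed

lemma symmetric_neighbourhood:
  fixes U :: "'a::topological_ab_group_add set"
  assumes "open U" "0 \<in> U"
  obtains V where "open V" "0 \<in> V" "V \<subseteq> U" "\<And>x. x \<in> V \<Longrightarrow> - x \<in> V"
proof -
  have "open (uminus -` U)" by (intro open_vimage assms continuous_intros)
  then show ?thesis using assms by (intro that[of "U \<inter> uminus -` U"]) auto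
qed

lemma Cc_uniformly_continuous:
  fixes f :: "'a::topological_ab_group_add \<Rightarrow> real"
  assumes f: "f \<in> Cc" and e: "0 < \<epsilon>"
  obtains V where "open V" "0 \<in> V" "\<And>x v. v \<in> V \<Longrightarrow> \<bar>f (x + v) - f x\<bar> < \<epsilon>"
proof -
  obtain K where K: "compact K" "\<And>x. x \<notin> K \<Longrightarrow> f x = 0" using f by (rule CcE) blast
  have "continuous_on UNIV (\<lambda>p::'a \<times> 'a. \<bar>f (fst p + snd p) - f (fst p)\<bar>)"
    by (intro continuous_intros continuous_on_UNIV_compose[OF Cc_continuous[OF f]])
  then obtain U where U: "open U" "0 \<in> U" "\<And>x v. x \<in> K \<Longrightarrow> v \<in> U \<Longrightarrow> \<bar>f (x + v) - f x\<bar> < \<epsilon>"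
    by (rule uniformly_small_near[OF K(1), where f = "\<lambda>x v. \<bar>f (x + v) - f x\<bar>" and b = 0 and \<epsilon> = \<epsilon>])
       (use e in auto)
  obtain V where V: "open V" "0 \<in> V" "V \<subseteq> U" "\<And>x. x \<in> V \<Longrightarrow> - x \<in> V"
    using symmetric_neighbourhood[OF U(1,2)] by blast
  show ?thesis
  proof (rule that[OF V(1,2)])
    fix x v assume v: "v \<in> V"
    consider "x \<in> K" | "x + v \<in> K" | "x \<notin> K" "x + v \<notin> K" by blast
    then show "\<bar>f (x + v) - f x\<bar> < \<epsilon>"
    proof cases
      case 1 then show ?thesis using U V v by blast
    next
      case 2
      have "\<bar>f (x + v + - v) - f (x + v)\<bar> < \<epsilon>" using U V v 2 by blast
      then show ?thesis by (simp add: abs_minus_commute)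
    next
      case 3 then show ?thesis using K(2) e by simp
    qed
  qed
qed

lemma cutoff_function:
  fixes C :: "'a::{topological_ab_group_add, t2_space} set"
  assumes lc: "locally_compact_space (euclidean :: 'a topology)" and C: "compact C"
  obtains \<zeta> :: "'a \<Rightarrow> real" where "\<zeta> \<in> Cc" "\<And>x. 0 \<le> \<zeta> x" "\<And>x. \<zeta> x \<le> 1" "\<And>x. x \<in> C \<Longrightarrow> \<zeta> x = 1"
proof -
  obtain b :: "'a \<Rightarrow> real" where b: "b \<in> Cc" "\<And>x. 0 \<le> b x" "b 0 = 1"
    using bump_function[OF lc, of UNIV] by (metis open_UNIV UNIV_I)
  have "open (b -` {1/2<..})" by (rule open_vimage[OF open_greaterThan Cc_continuous[OF b(1)]])
  moreover have "0 \<in> b -` {1/2<..}" using b(3) by simp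
  ultimately obtain F where F: "finite F" "\<And>x. x \<in> C \<Longrightarrow> \<exists>e\<in>F. x + e \<in> b -` {1/2<..}"
    using compact_cover_translates[OF C] by metis
  define s where "s x = (\<Sum>e\<in>F. b (x + e))" for x
  have s: "s \<in> Cc" unfolding s_def by (rule Cc_sum) (rule Cc_shift[OF b(1)])
  have s0: "0 \<le> s x" for x unfolding s_def by (intro sum_nonneg b)
  have s1: "1/2 < s x" if "x \<in> C" for x
  proof -
    obtain e where e: "e \<in> F" "1/2 < b (x + e)" using F(2)[OF \<open>x \<in> C\<close>] by auto
    have "b (x + e) \<le> s x" unfolding s_def by (rule member_le_sum) (use e F b in auto)
    then show ?thesis using e by simp
  qed
  obtain K where K: "compact K" "\<And>x. x \<notin> K \<Longrightarrow> s x = 0" using s by (rule CcE) blast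
  show ?thesis
  proof (rule that[of "\<lambda>x. min 1 (2 * s x)"])
    show "(\<lambda>x. min 1 (2 * s x)) \<in> Cc"
      by (rule CcI[OF _ K(1)]) (use K(2) in \<open>auto intro!: continuous_on_min continuous_on_const
          continuous_on_mult Cc_continuous[OF s]\<close>)
    show "min 1 (2 * s x) = 1" if "x \<in> C" for x using s1[OF that] by simp
  qed (use s0 in auto)
qed

context invariant_integral
begin

lemma I_zero: "I (\<lambda>x. 0) = 0"
  using I_cmult[OF Cc_zero, of 0] by simp

lemma I_uminus: "f \<in> Cc \<Longrightarrow> I (\<lambda>x. - f x) = - I f"
  using I_cmult[of f "-1"] by simp

lemma I_diff: "f \<in> Cc \<Longrightarrow> g \<in> Cc \<Longrightarrow> I (\<lambda>x. f x - g x) = I f - I g"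
  using I_add[of f "\<lambda>x. - g x"] I_uminus[of g] Cc_uminus[of g] by simp

lemma I_mono:
  assumes "f \<in> Cc" "g \<in> Cc" "\<And>x. f x \<le> g x"
  shows "I f \<le> I g"
  using I_nonneg[OF Cc_diff[OF assms(2,1)]] I_diff[OF assms(2,1)] assms(3) by simp

lemma I_abs_le:
  assumes "f \<in> Cc" "g \<in> Cc" "\<And>x. \<bar>f x\<bar> \<le> g x"
  shows "\<bar>I f\<bar> \<le> I g"
proof -
  have "I f \<le> I g" by (rule I_mono[OF assms(1,2)]) (use assms(3) abs_le_D1 in blast)
  moreover have "I (\<lambda>x. - f x) \<le> I g"
    by (rule I_mono[OF Cc_uminus[OF assms(1)] assms(2)]) (use assms(3) abs_le_D2 in blast)
  ultimately show ?thesis using I_uminus[OF assms(1)] by (simp add: abs_le_iff)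
qed

lemma I_sum:
  assumes "\<And>i. i \<in> A \<Longrightarrow> f i \<in> Cc"
  shows "I (\<lambda>x. \<Sum>i\<in>A. f i x) = (\<Sum>i\<in>A. I (f i))"
  using assms
proof (induction A rule: infinite_finite_induct)
  case (insert a A)
  then show ?case using I_add[of "f a" "\<lambda>x. \<Sum>i\<in>A. f i x"] Cc_sum[of A f] by simp
qed (simp_all add: I_zero)

lemma I_pos:
  assumes f: "f \<in> Cc" "\<And>x. 0 \<le> f x" "0 < f x0"
  shows "0 < I f"
proof (rule ccontr)
  assume "\<not> 0 < I f"
  hence I0: "I f = 0" using I_nonneg[OF f(1,2)] by simp
  have "I g = 0" if g: "g \<in> Cc" for g
  proof -
    obtain F c where F: "finite F" "0 \<le> c" "\<And>x. \<bar>g x\<bar> \<le> c * (\<Sum>e\<in>F. f (x + e))"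
        by (rule Cc_dominated_by_translates[OF Cc_continuous[OF f(1)] f(2) f(3) g]) blast
    have "\<bar>I g\<bar> \<le> I (\<lambda>x. c * (\<Sum>e\<in>F. f (x + e)))"
      by (rule I_abs_le[OF g _ F(3)]) (intro Cc_cmult Cc_sum Cc_shift f)
    also have "\<dots> = c * (\<Sum>e\<in>F. I (\<lambda>x. f (x + e)))"
      by (subst I_cmult) (auto intro!: Cc_sum Cc_shift f simp: I_sum[OF Cc_shift[OF f(1)]])
    also have "\<dots> = 0" by (simp add: I_shift[OF f(1)] I0)
    finally show ?thesis by simp
  qed
  then show False using I_nontrivial by blast
qed

lemma I_translation_continuous:
  assumes f: "f \<in> Cc" and e: "0 < \<epsilon>"
  obtains V where "open V" "0 \<in> V" "\<And>v. v \<in> V \<Longrightarrow> I (\<lambda>x. \<bar>f (x + v) - f x\<bar>) \<le> \<epsilon>"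
proof -
  obtain K where K: "compact K" "\<And>x. x \<notin> K \<Longrightarrow> f x = 0" using f by (rule CcE) blast
  obtain b :: "'a \<Rightarrow> real" where b: "b \<in> Cc" "b 0 = 1"
    using bump_function[OF locally_compact, of UNIV] by (metis open_UNIV UNIV_I)
  obtain C where C: "compact C" "\<And>x. x \<notin> C \<Longrightarrow> b x = 0" using b(1) by (rule CcE) blast
  define U where "U = b -` {1/2<..}"
  have U: "open U" "0 \<in> U" "U \<subseteq> C"
    unfolding U_def using b C by (auto intro!: open_vimage[OF open_greaterThan Cc_continuous[OF b(1)]])
        fastforce
  have "compact ((\<lambda>p. fst p + - snd p) ` (K \<times> C))"
    by (intro compact_continuous_image compact_Times K C continuous_intros)
  from compact_Un[OF K(1) this] obtain \<zeta> :: "'a \<Rightarrow> real" where \<zeta>: "\<zeta> \<in> Cc" "\<And>x. 0 \<le> \<zeta> x"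
    "\<And>x. x \<in> K \<union> (\<lambda>p. fst p + - snd p) ` (K \<times> C) \<Longrightarrow> \<zeta> x = 1"
    by (rule cutoff_function[OF locally_compact]) blast
  have Iz: "0 \<le> I \<zeta>" by (rule I_nonneg[OF \<zeta>(1,2)])
  define \<delta> where "\<delta> = \<epsilon> / (I \<zeta> + 1)"
  have \<delta>: "0 < \<delta>" using e Iz by (simp add: \<delta>_def)
  obtain W where W: "open W" "0 \<in> W" "\<And>x v. v \<in> W \<Longrightarrow> \<bar>f (x + v) - f x\<bar> < \<delta>"
    by (rule Cc_uniformly_continuous[OF f \<delta>]) blast
  show ?thesis
  proof (rule that[of "U \<inter> W"])
    show "open (U \<inter> W)" "0 \<in> U \<inter> W" using U W by auto
    fix v assume v: "v \<in> U \<inter> W"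
    have le: "\<bar>f (x + v) - f x\<bar> \<le> \<delta> * \<zeta> x" for x
    proof (cases "x \<in> K \<or> x + v \<in> K")
      case True
      have "x \<in> (\<lambda>p. fst p + - snd p) ` (K \<times> C)" if "x + v \<in> K"
        by (rule image_eqI[where x = "(x + v, v)"]) (use v U(3) that in auto)
      hence "\<zeta> x = 1" using \<zeta>(3)[of x] True by blast
      then show ?thesis using W(3)[of v x] v by simp
    next
      case False
      then show ?thesis using K(2) \<delta> \<zeta>(2)[of x] by simp
    qed
    have "I (\<lambda>x. \<bar>f (x + v) - f x\<bar>) \<le> I (\<lambda>x. \<delta> * \<zeta> x)"
      by (rule I_mono[OF _ _ le]) (intro Cc_abs Cc_diff Cc_shift Cc_cmult f \<zeta>)+
    also have "\<dots> = \<delta> * I \<zeta>" by (rule I_cmult[OF \<zeta>(1)])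
    also have "\<dots> \<le> \<epsilon>" using e Iz by (simp add: \<delta>_def field_simps)
    finally show "I (\<lambda>x. \<bar>f (x + v) - f x\<bar>) \<le> \<epsilon>" .
  qed
qed

lemma normalized_bump:
  assumes "open U" "0 \<in> U"
  obtains b where "b \<in> Cc" "\<And>x. 0 \<le> b x" "I b = 1" "\<And>x. x \<notin> U \<Longrightarrow> b x = 0" "\<And>x. b (- x) = b x"
proof -
  obtain b where b: "b \<in> Cc" "\<And>x. 0 \<le> b x" "b 0 = 1" "\<And>x. x \<notin> U \<Longrightarrow> b x = 0" "\<And>x. b (- x) = b x"
    by (rule bump_function[OF locally_compact assms]) blast
  have p: "0 < I b" by (rule I_pos[OF b(1,2), of 0]) (simp add: b)
  show ?thesis
    by (rule that[of "\<lambda>x. (1 / I b) * b x"]) (use b p I_cmult[OF b(1), of "1 / I b"] Cc_cmult[OF b(1), of "1 /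
        I b"] in auto)
qed

text \<open>Averages of translates of a bump over a box of combinations of a finite set \<open>E\<close>. Translation by an
element of \<open>E\<close> changes the average by the relative size of the boundary of the box, which is small
for a suitable size, and translation by an element of a small neighbourhood \<open>V\<close> hardly changes the
bump. The set \<open>E\<close> is chosen so that each \<open>x \<in> K\<close> is a difference of an element of \<open>V\<close> and one of \<open>E\<close>.\<close>
lemma Reiter_function:
  assumes K: "compact K" and e: "0 < \<epsilon>"
  obtains k where "k \<in> Cc" "\<And>x. 0 \<le> k x" "I k = 1" "\<And>x. x \<in> K \<Longrightarrow> I (\<lambda>t. \<bar>k (t + x) - k t\<bar>) \<le> \<epsilon>"
proof -
  obtain b where b: "b \<in> Cc" "\<And>x. 0 \<le> b x" "I b = 1"
    using normalized_bump[of UNIV] by (metis open_UNIV UNIV_I)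
  obtain V where V: "open V" "0 \<in> V" "\<And>v. v \<in> V \<Longrightarrow> I (\<lambda>x. \<bar>b (x + v) - b x\<bar>) \<le> \<epsilon> / 2"
    by (rule I_translation_continuous[OF b(1), of "\<epsilon> / 2"]) (use e in simp, blast)
  obtain E where F: "finite E" "\<And>x. x \<in> K \<Longrightarrow> \<exists>e\<in>E. x + e \<in> V"
    by (rule compact_cover_translates[OF K V(1,2)]) blast
  define a where "a N = real (Suc N) ^ card E" for N
  have apos: "0 < a N" for N by (simp add: a_def)
  obtain N where N: "a (N + 2) \<le> (1 + \<epsilon> / 4) * a N"
  proof (rule slow_growth_step[of a 1 "card E" "\<epsilon> / 4"])
    show "a M \<le> a N" if "M \<le> N" for M N unfolding a_def by (rule power_mono) (use that in auto)
  qed (use e in \<open>simp_all add: a_def\<close>)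
  define h where "h x = (\<Sum>w\<in>index_box E N. b (x + box_point E w))" for x
  have finE: "finite E" using F by simp
  have fin: "finite (index_box E N)" for N by (rule finite_index_box[OF finE])
  have hC: "h \<in> Cc" unfolding h_def by (intro Cc_sum Cc_shift b)
  have Ih: "I h = a N" unfolding h_def
    by (subst I_sum) (auto intro!: Cc_shift b simp: I_shift[OF b(1)] b(3) a_def card_index_box[OF finE])
  have step: "I (\<lambda>t. \<bar>h (t + e) - h t\<bar>) \<le> (\<epsilon> / 2) * a N" if e: "e \<in> E" for e
  proof -
    define h' where "h' x = (\<Sum>w\<in>index_box E (Suc N). b (x + box_point E w))" for x
    have h'C: "h' \<in> Cc" unfolding h'_def by (intro Cc_sum Cc_shift b)
    have Ih': "I h' = a (Suc N)" unfolding h'_def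
      by (subst I_sum) (auto intro!: Cc_shift b simp: I_shift[OF b(1)] b(3) a_def card_index_box[OF finE]
          algebra_simps)
    have "h (t + e) \<le> h' t" for t
    proof -
      have "box_sum E N (\<lambda>x. b (t + (x + e))) \<le> box_sum E (Suc N) (\<lambda>x. b (t + x))"
        using box_sum_shift_le[OF finE e, of "\<lambda>x. b (t + x)"] b(2) by simp
      then show ?thesis by (simp add: box_sum_def h_def h'_def add_ac)
    qed
    moreover have "h t \<le> h' t" for t unfolding h_def h'_def
      by (rule sum_mono2) (use fin b(2) index_box_mono[of N "Suc N" E] in auto)
    \<comment> \<open>Both \<open>h\<close> and its translate lie below the average \<open>h'\<close> over the next box, and the integrals of the
      gaps are known.\<close>
    ultimately have "\<bar>h (t + e) - h t\<bar> \<le> (h' t - h (t + e)) + (h' t - h t)" for t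
      by (smt (verit))
    hence "I (\<lambda>t. \<bar>h (t + e) - h t\<bar>) \<le> I (\<lambda>t. (h' t - h (t + e)) + (h' t - h t))"
      by (intro I_mono Cc_abs Cc_diff Cc_add Cc_shift h'C hC)
    also have "\<dots> = 2 * (a (Suc N) - a N)"
      by (subst I_add) (auto intro!: Cc_diff Cc_shift h'C hC simp: I_diff[OF h'C hC] I_diff[OF h'C Cc_shift[OF
          hC]] I_shift[OF hC] Ih Ih')
    also have "\<dots> \<le> 2 * (a (N + 2) - a N)" by (simp add: a_def power_mono)
    also have "\<dots> \<le> (\<epsilon> / 2) * a N" using N by (simp add: algebra_simps)
    finally show ?thesis .
  qed
  have small: "I (\<lambda>t. \<bar>h (t + v) - h t\<bar>) \<le> (\<epsilon> / 2) * a N" if v: "v \<in> V" for v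
  proof -
    have "\<bar>h (t + v) - h t\<bar> \<le> (\<Sum>w\<in>index_box E N. \<bar>b (t + box_point E w + v) - b (t + box_point E w)\<bar>)" for t
      unfolding h_def sum_subtractf[symmetric] using sum_abs by (simp add: add_ac)
    hence "I (\<lambda>t. \<bar>h (t + v) - h t\<bar>) \<le> I (\<lambda>t. \<Sum>w\<in>index_box E N. \<bar>b (t + box_point E w + v) - b (t + box_point
        E w)\<bar>)"
      by (intro I_mono Cc_abs Cc_diff Cc_shift hC Cc_sum Cc_shift[of "\<lambda>x. \<bar>b (x + v) - b x\<bar>"] b)
    also have "\<dots> = (\<Sum>w\<in>index_box E N. I (\<lambda>t. \<bar>b (t + box_point E w + v) - b (t + box_point E w)\<bar>))"
      by (intro I_sum Cc_shift[of "\<lambda>x. \<bar>b (x + v) - b x\<bar>"] Cc_abs Cc_diff Cc_shift b)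
    also have "\<dots> = (\<Sum>w\<in>index_box E N. I (\<lambda>t. \<bar>b (t + v) - b t\<bar>))"
      by (intro sum.cong refl I_shift[of "\<lambda>x. \<bar>b (x + v) - b x\<bar>"] Cc_abs Cc_diff Cc_shift b)
    also have "\<dots> \<le> (\<Sum>w\<in>index_box E N. \<epsilon> / 2)" by (intro sum_mono V v)
    also have "\<dots> = (\<epsilon> / 2) * a N" by (simp add: card_index_box[OF finE] a_def)
    finally show ?thesis .
  qed
  show ?thesis
  proof (rule that[of "\<lambda>x. (1 / a N) * h x"])
    show "(\<lambda>x. 1 / a N * h x) \<in> Cc" by (rule Cc_cmult[OF hC])
    show "0 \<le> 1 / a N * h x" for x 
      unfolding h_def by (intro mult_nonneg_nonneg sum_nonneg b) (use apos[of N] in simp)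
    show "I (\<lambda>x. 1 / a N * h x) = 1" using apos[of N] by (subst I_cmult[OF hC]) (simp add: Ih)
    fix x assume "x \<in> K"
    then obtain e where e: "e \<in> E" "x + e \<in> V" using F by auto
    have *: "I (\<lambda>t. \<bar>h (t + x) - h t\<bar>) \<le> \<epsilon> * a N"
    proof -
      have "\<bar>h (t + x) - h t\<bar> \<le> \<bar>h (t + x + e) - h (t + x)\<bar> + \<bar>h (t + (x + e)) - h t\<bar>" for t
        by (simp add: add.assoc)
      hence "I (\<lambda>t. \<bar>h (t + x) - h t\<bar>) \<le> I (\<lambda>t. \<bar>h (t + x + e) - h (t + x)\<bar> + \<bar>h (t + (x + e)) - h t\<bar>)"
        by (intro I_mono Cc_abs Cc_diff Cc_shift hC Cc_add Cc_shift[of "\<lambda>x. \<bar>h (x + e) - h x\<bar>"])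
      also have "\<dots> = I (\<lambda>t. \<bar>h (t + x + e) - h (t + x)\<bar>) + I (\<lambda>t. \<bar>h (t + (x + e)) - h t\<bar>)"
        by (intro I_add Cc_abs Cc_diff Cc_shift hC Cc_shift[of "\<lambda>x. \<bar>h (x + e) - h x\<bar>"])
      also have "I (\<lambda>t. \<bar>h (t + x + e) - h (t + x)\<bar>) = I (\<lambda>t. \<bar>h (t + e) - h t\<bar>)"
        by (intro I_shift[of "\<lambda>x. \<bar>h (x + e) - h x\<bar>"] Cc_abs Cc_diff Cc_shift hC)
      finally show ?thesis using step[OF e(1)] small[OF e(2)] by simp
    qed
    have "(\<lambda>t. \<bar>1 / a N * h (t + x) - 1 / a N * h t\<bar>) = (\<lambda>t. (1 / a N) * \<bar>h (t + x) - h t\<bar>)"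
      unfolding right_diff_distrib[symmetric] abs_mult using apos[of N] by simp
    hence "I (\<lambda>t. \<bar>1 / a N * h (t + x) - 1 / a N * h t\<bar>) = (1 / a N) * I (\<lambda>t. \<bar>h (t + x) - h t\<bar>)"
      using I_cmult[OF Cc_abs[OF Cc_diff[OF Cc_shift[OF hC] hC]]] by metis
    also have "\<dots> \<le> \<epsilon>" using * apos[of N] by (simp add: field_simps)
    finally show "I (\<lambda>t. \<bar>1 / a N * h (t + x) - 1 / a N * h t\<bar>) \<le> \<epsilon>" .
  qed
qed

end

section \<open>Positive definite functions and extraction of characters\<close>

definition pos_def :: "('a::ab_group_add \<Rightarrow> complex) \<Rightarrow> bool" where
  "pos_def P \<longleftrightarrow> (\<forall>(A :: nat set) p c. finite A \<longrightarrow>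
     (\<exists>r\<ge>0. (\<Sum>i\<in>A. \<Sum>j\<in>A. c i * cnj (c j) * P (p i - p j)) = complex_of_real r))"

lemma pos_def_sum:
  assumes P: "pos_def P" and A: "finite (A :: 'i set)"
  shows "\<exists>r\<ge>0. (\<Sum>i\<in>A. \<Sum>j\<in>A. c i * cnj (c j) * P (p i - p j)) = complex_of_real r"
proof -
  obtain h where h: "bij_betw h {0..<card A} A" using ex_bij_betw_nat_finite[OF A] by blast
  have "\<exists>r\<ge>0. (\<Sum>i\<in>{0..<card A}. \<Sum>j\<in>{0..<card A}. c (h i) * cnj (c (h j)) * P (p (h i) - p (h j))) =
      complex_of_real r"
    using P[unfolded pos_def_def, rule_format, of "{0..<card A}" "\<lambda>i. c (h i)" "\<lambda>i. p (h i)"] by simp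
  moreover have "(\<Sum>i\<in>{0..<card A}. \<Sum>j\<in>{0..<card A}. c (h i) * cnj (c (h j)) * P (p (h i) - p (h j)))
      = (\<Sum>i\<in>A. \<Sum>j\<in>A. c i * cnj (c j) * P (p i - p j))"
    by (subst sum.reindex_bij_betw[OF h, symmetric], rule sum.cong[OF refl])
       (subst sum.reindex_bij_betw[OF h, symmetric], rule refl)
  ultimately show ?thesis by simp
qed

lemma pos_def_twist:
  fixes P :: "'a::ab_group_add \<Rightarrow> complex"
  assumes P: "pos_def P" and J: "finite J"
  shows "pos_def (\<lambda>t. \<Sum>j\<in>J. \<Sum>k\<in>J. a j * cnj (a k) * P (t + x j - x k))"
  unfolding pos_def_def
proof (intro allI impI)
  fix A :: "nat set" and p :: "nat \<Rightarrow> 'a" and c :: "nat \<Rightarrow> complex" assume A: "finite A"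
  let ?c = "\<lambda>(i, j). c i * a j" and ?p = "\<lambda>(i, j). p i + x j"
  have "(\<Sum>i\<in>A. \<Sum>i'\<in>A. c i * cnj (c i') * (\<Sum>j\<in>J. \<Sum>k\<in>J. a j * cnj (a k) * P (p i - p i' + x j - x k)))
     = (\<Sum>i\<in>A. \<Sum>i'\<in>A. \<Sum>j\<in>J. \<Sum>k\<in>J. (c i * a j) * cnj (c i' * a k) * P ((p i + x j) - (p i' + x k)))"
    by (simp add: sum_distrib_left algebra_simps)
  also have "\<dots> = (\<Sum>i\<in>A. \<Sum>j\<in>J. \<Sum>i'\<in>A. \<Sum>k\<in>J. (c i * a j) * cnj (c i' * a k) * P ((p i + x j) - (p i' + x k)))"
    by (intro sum.cong refl sum.swap)
  also have "\<dots> = (\<Sum>u\<in>A \<times> J. \<Sum>v\<in>A \<times> J. ?c u * cnj (?c v) * P (?p u - ?p v))"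
    by (simp add: sum.cartesian_product')
  finally show "\<exists>r\<ge>0. (\<Sum>i\<in>A. \<Sum>i'\<in>A. c i * cnj (c i') * (\<Sum>j\<in>J. \<Sum>k\<in>J. a j * cnj (a k) * P (p i - p i' + x j - x
      k)))
      = complex_of_real r"
    using pos_def_sum[OF P finite_cartesian_product[OF A J], of ?c ?p] by simp
qed

lemma pos_def_add:
  fixes P :: "'a::ab_group_add \<Rightarrow> complex"
  assumes "pos_def P" "pos_def Q"
  shows "pos_def (\<lambda>t. P t + Q t)"
  unfolding pos_def_def
proof (intro allI impI)
  fix A :: "nat set" and p :: "nat \<Rightarrow> 'a" and c :: "nat \<Rightarrow> complex" assume A: "finite A"
  from pos_def_sum[OF assms(1) A, of c p] obtain r where r: "0 \<le> r"
    "(\<Sum>i\<in>A. \<Sum>j\<in>A. c i * cnj (c j) * P (p i - p j)) = complex_of_real r" by blast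
  from pos_def_sum[OF assms(2) A, of c p] obtain s where s: "0 \<le> s"
    "(\<Sum>i\<in>A. \<Sum>j\<in>A. c i * cnj (c j) * Q (p i - p j)) = complex_of_real s" by blast
  show "\<exists>r\<ge>0. (\<Sum>i\<in>A. \<Sum>j\<in>A. c i * cnj (c j) * (P (p i - p j) + Q (p i - p j))) = complex_of_real r"
    using r s by (intro exI[of _ "r + s"]) (simp add: distrib_left sum.distrib)
qed

lemma pos_def_cmult:
  fixes P :: "'a::ab_group_add \<Rightarrow> complex"
  assumes "pos_def P" "0 \<le> r"
  shows "pos_def (\<lambda>t. complex_of_real r * P t)"
  unfolding pos_def_def
proof (intro allI impI)
  fix A :: "nat set" and p :: "nat \<Rightarrow> 'a" and c :: "nat \<Rightarrow> complex" assume A: "finite A"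
  from pos_def_sum[OF assms(1) A, of c p] obtain s where s: "0 \<le> s"
    "(\<Sum>i\<in>A. \<Sum>j\<in>A. c i * cnj (c j) * P (p i - p j)) = complex_of_real s" by blast
  have "(\<Sum>i\<in>A. \<Sum>j\<in>A. c i * cnj (c j) * (complex_of_real r * P (p i - p j)))
     = complex_of_real r * (\<Sum>i\<in>A. \<Sum>j\<in>A. c i * cnj (c j) * P (p i - p j))"
    by (simp add: sum_distrib_left algebra_simps)
  then show "\<exists>r'\<ge>0. (\<Sum>i\<in>A. \<Sum>j\<in>A. c i * cnj (c j) * (complex_of_real r * P (p i - p j))) = complex_of_real r'"
    using s assms(2) by (intro exI[of _ "r * s"]) simp
qed

lemma pos_def_two_points:
  assumes "pos_def P"
  shows "\<exists>r\<ge>0. P 0 + c * P t + cnj c * P (- t) + (c * cnj c) * P 0 = complex_of_real r"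
proof -
  have "(\<Sum>i\<in>{0, 1::nat}. \<Sum>j\<in>{0, 1::nat}. (if i = 0 then 1 else c) * cnj (if j = 0 then 1 else c) *
      P ((if i = 0 then 0 else t) - (if j = (0::nat) then 0 else t))) = P 0 + c * P t + cnj c * P (- t) + (c *
          cnj c) * P 0"
    by simp
  moreover have "\<exists>r\<ge>0. (\<Sum>i\<in>{0, 1::nat}. \<Sum>j\<in>{0, 1::nat}. (if i = 0 then 1 else c) * cnj (if j = 0 then 1 else
      c) *
      P ((if i = 0 then 0 else t) - (if j = (0::nat) then 0 else t))) = complex_of_real r"
    by (rule pos_def_sum[OF assms]) simp
  ultimately show ?thesis by (simp only:)
qed

lemma pos_def_zero:
  assumes "pos_def P"
  shows "Im (P 0) = 0" and "0 \<le> Re (P 0)"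
  using pos_def_two_points[OF assms, of 0] by auto

lemma pos_def_minus:
  assumes "pos_def P"
  shows "P (- t) = cnj (P t)"
proof -
  from pos_def_two_points[OF assms, of 1 t] obtain r where "P 0 + P t + P (- t) + P 0 = complex_of_real r" by
      auto
  hence "Im (P t) + Im (P (- t)) = 0" using pos_def_zero[OF assms] by (simp add: complex_eq_iff)
  moreover from pos_def_two_points[OF assms, of \<i> t] obtain r' where "P 0 + \<i> * P t + cnj \<i> * P (- t) + (\<i> *
      cnj \<i>) * P 0 = complex_of_real r'" by blast
  hence "Re (P t) - Re (P (- t)) = 0" using pos_def_zero[OF assms] by (simp add: complex_eq_iff)
  ultimately show ?thesis by (simp add: complex_eq_iff)
qed

lemma pos_def_norm_le:
  assumes "pos_def P"
  shows "norm (P t) \<le> Re (P 0)"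
proof (cases "P t = 0")
  case True then show ?thesis using pos_def_zero[OF assms] by simp
next
  case False
  define c where "c = - cnj (P t) / norm (P t)"
  have sq: "cnj (P t) * P t = complex_of_real (norm (P t)) * complex_of_real (norm (P t))"
    using complex_norm_square[of "P t"] by (simp add: mult.commute power2_eq_square)
  have "c * P t = - (cnj (P t) * P t / norm (P t))" by (simp add: c_def)
  hence "c * P t = - complex_of_real (norm (P t))" unfolding sq using False by simp
  hence "Re (c * P t) = - norm (P t)" by simp
  moreover have "c * cnj c = cnj (P t) * P t / (complex_of_real (norm (P t)) * complex_of_real (norm (P t)))"
    by (simp add: c_def)
  hence "c * cnj c = 1" unfolding sq using False by simp
  moreover obtain r where "0 \<le> r" "P 0 + c * P t + cnj c * P (- t) + (c * cnj c) * P 0 = complex_of_real r"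
    using pos_def_two_points[OF assms, of c t] by blast
  moreover have "cnj c * P (- t) = cnj (c * P t)" using pos_def_minus[OF assms] by simp
  ultimately have "0 \<le> Re (P 0 + c * P t + cnj (c * P t) + P 0)" by (metis Re_complex_of_real mult_1)
  then show ?thesis using \<open>Re (c * P t) = - norm (P t)\<close> by simp
qed

text \<open>Positivity of the form at the points \<open>s\<close>, \<open>0\<close>, \<open>- t\<close> with coefficients \<open>1\<close>, \<open>- Q s\<close>, \<open>- w\<close>, where \<open>w\<close> is the
defect of multiplicativity; in these coordinates the form is the difference of the two sides.
Where \<open>|Q|\<close> is near \<open>1\<close>, the function is nearly a character.\<close>
lemma pos_def_almost_multiplicative:
  assumes Q: "pos_def Q" and Q0: "Q 0 = 1"
  shows "(norm (Q (s + t) - Q s * Q t))\<^sup>2 \<le> 1 - (norm (Q s))\<^sup>2"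
proof -
  define w where "w = Q (s + t) - Q s * Q t"
  let ?c = "\<lambda>i::nat. if i = 0 then 1 else if i = 1 then - Q s else - w"
  let ?p = "\<lambda>i::nat. if i = 0 then s else if i = 1 then 0 else - t"
  obtain r where r: "0 \<le> r" "(\<Sum>i\<in>{0, 1, 2}. \<Sum>j\<in>{0, 1, 2}. ?c i * cnj (?c j) * Q (?p i - ?p j)) =
      complex_of_real r"
    using pos_def_sum[OF Q, of "{0, 1, 2::nat}" ?c ?p] by blast
  have m: "Q (- t - s) = cnj (Q (s + t))" 
  proof -
    have "- t - s = - (s + t)" by (simp add: algebra_simps)
    then show ?thesis using pos_def_minus[OF Q, of "s + t"] by (simp only:)
  qed
  have "(\<Sum>i\<in>{0, 1, 2::nat}. \<Sum>j\<in>{0, 1, 2::nat}. ?c i * cnj (?c j) * Q (?p i - ?p j))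
     = 1 - Q s * cnj (Q s) + w * cnj w - (w * cnj (Q (s + t) - Q s * Q t) + cnj w * (Q (s + t) - Q s * Q t))"
    by (simp add: Q0 m pos_def_minus[OF Q] algebra_simps)
  also have "\<dots> = 1 - Q s * cnj (Q s) - w * cnj w" by (simp add: w_def[symmetric])
  also have "\<dots> = complex_of_real (1 - (norm (Q s))\<^sup>2 - (norm w)\<^sup>2)"
    by (simp add: complex_norm_square flip: of_real_power)
  finally have "1 - (norm (Q s))\<^sup>2 - (norm w)\<^sup>2 = r" using r(2) of_real_eq_iff by metis
  then show ?thesis using r(1) by (simp add: w_def)
qed

definition pos_def_cts :: "('a::topological_ab_group_add \<Rightarrow> complex) set" where
  "pos_def_cts = {P. continuous_on UNIV P \<and> pos_def P}"

text \<open>Functionals that are additive and positively homogeneous on the cone of continuous positive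
definite functions. The bound is one-sided, so that subtracting a multiple of a non-negative
defect such as \<open>Re (P 0) - Re (cnj \<zeta> * P x)\<close> stays within the class with the same \<open>B\<close>.\<close>
definition cone_functional :: "(('a::topological_ab_group_add \<Rightarrow> complex) \<Rightarrow> real) \<Rightarrow> real \<Rightarrow> bool" where
  "cone_functional G B \<longleftrightarrow>
     (\<forall>P\<in>pos_def_cts. \<forall>Q\<in>pos_def_cts. G (\<lambda>t. P t + Q t) = G P + G Q) \<and>
     (\<forall>P\<in>pos_def_cts. \<forall>r\<ge>0. G (\<lambda>t. complex_of_real r * P t) = r * G P) \<and>
     (\<forall>P\<in>pos_def_cts. G P \<le> B * Re (P 0))"

lemma cone_functionalD:
  assumes "cone_functional G B" "P \<in> pos_def_cts"
  shows "Q \<in> pos_def_cts \<Longrightarrow> G (\<lambda>t. P t + Q t) = G P + G Q"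
    and "0 \<le> r \<Longrightarrow> G (\<lambda>t. complex_of_real r * P t) = r * G P"
    and "G P \<le> B * Re (P 0)"
  using assms unfolding cone_functional_def by blast+

lemma pos_def_cts_add: "P \<in> pos_def_cts \<Longrightarrow> Q \<in> pos_def_cts \<Longrightarrow> (\<lambda>t. P t + Q t) \<in> pos_def_cts"
  by (simp add: pos_def_cts_def pos_def_add continuous_on_add)

lemma pos_def_cts_cmult: "P \<in> pos_def_cts \<Longrightarrow> 0 \<le> r \<Longrightarrow> (\<lambda>t. complex_of_real r * P t) \<in> pos_def_cts"
  by (simp add: pos_def_cts_def pos_def_cmult continuous_on_mult_left)

lemma pos_def_cts_twist:
  assumes "P \<in> pos_def_cts" "finite J"
  shows "(\<lambda>t. \<Sum>j\<in>J. \<Sum>k\<in>J. a j * cnj (a k) * P (t + x j - x k)) \<in> pos_def_cts"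
proof -
  have P: "continuous_on UNIV P" "pos_def P" using assms by (auto simp: pos_def_cts_def)
  have "continuous_on UNIV (\<lambda>t. P (t + x j - x k))" for j k
    by (rule continuous_on_UNIV_compose[OF P(1)]) (intro continuous_intros)
  then have "continuous_on UNIV (\<lambda>t. \<Sum>j\<in>J. \<Sum>k\<in>J. a j * cnj (a k) * P (t + x j - x k))"
    by (intro continuous_on_sum continuous_on_mult_left)
  then show ?thesis using pos_def_twist[OF P(2) assms(2)] by (simp add: pos_def_cts_def)
qed

lemma cone_functional_sum:
  assumes G: "cone_functional G B" and "finite A" "A \<noteq> {}" "\<And>i. i \<in> A \<Longrightarrow> P i \<in> pos_def_cts"
  shows "(\<lambda>t. \<Sum>i\<in>A. P i t) \<in> pos_def_cts \<and> G (\<lambda>t. \<Sum>i\<in>A. P i t) = (\<Sum>i\<in>A. G (P i))"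
  using assms(2-)
proof (induction A rule: finite_ne_induct)
  case (insert a A)
  have "G (\<lambda>t. P a t + (\<Sum>i\<in>A. P i t)) = G (P a) + G (\<lambda>t. \<Sum>i\<in>A. P i t)"
    by (rule cone_functionalD(1)[OF G]) (use insert in auto)
  then show ?case using insert pos_def_cts_add[of "P a" "\<lambda>t. \<Sum>i\<in>A. P i t"] by simp
qed simp

lemma roots_of_unity_orthogonal:
  fixes N :: nat
  defines "w \<equiv> \<lambda>j. exp (2 * of_real pi * \<i> * of_nat j / of_nat N)"
  assumes "1 \<le> N"
  shows "(\<Sum>m<N. cnj (w j) ^ m * w k ^ m) = (if j mod N = k mod N then of_nat N else 0)"
proof -
  have eq: "w j = w k \<longleftrightarrow> j mod N = k mod N" unfolding w_def by (rule complex_root_unity_eq[OF assms(2)])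
  have n1: "norm (w j) = 1" for j unfolding w_def by (simp add: norm_exp_eq_Re)
  have wN: "w j ^ N = 1" for j unfolding w_def using assms(2) by (intro complex_root_unity) simp
  have inv: "cnj (w j) * w j = 1" for j using complex_norm_square[of "w j"] n1[of j] by (simp add:
      mult.commute)
  have one: "cnj (w j) * w k = 1 \<longleftrightarrow> w j = w k"
  proof
    assume "cnj (w j) * w k = 1"
    hence "w j * (cnj (w j) * w k) = w j" by simp
    then show "w j = w k" using inv[of j] by (metis mult.assoc mult.commute mult_1)
  qed (use inv in auto)
  show ?thesis
  proof (cases "w j = w k")
    case True
    then show ?thesis using eq one by (simp flip: power_mult_distrib)
  next
    case False
    have "(\<Sum>m<N. (cnj (w j) * w k) ^ m) = ((cnj (w j) * w k) ^ N - 1) / (cnj (w j) * w k - 1)"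
      by (rule geometric_sum) (use False one in simp)
    also have "(cnj (w j) * w k) ^ N = cnj (w j ^ N) * w k ^ N" by (simp add: power_mult_distrib)
    finally show ?thesis using False eq wN by (simp add: power_mult_distrib)
  qed
qed

text \<open>Twisting \<open>P\<close> with the roots of unity of order \<open>N\<close> along the multiples of \<open>x\<close> gives positive definite
functions \<open>Q m\<close> whose sum is \<open>N\<^sup>2 P\<close>. Summed over \<open>m\<close>, the defects \<open>Q m 0 - Re (cnj \<zeta>\<^sub>m * Q m x)\<close> telescope
to \<open>N (P 0 - Re (P (N x)))\<close>, which is only of order \<open>N\<close>. So one of the \<open>Q m\<close> keeps \<open>G\<close> positive although \<open>M\<close>
times its defect is subtracted.\<close>
lemma character_extraction_step:
  fixes G :: "('a::topological_ab_group_add \<Rightarrow> complex) \<Rightarrow> real"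
  assumes G: "cone_functional G B" and P: "P \<in> pos_def_cts" "0 < G P" and M: "0 < M"
  shows "\<exists>\<zeta> Q. norm \<zeta> = 1 \<and> Q \<in> pos_def_cts \<and> 0 < G Q - M * (Re (Q 0) - Re (cnj \<zeta> * Q x))"
proof -
  have pd: "pos_def P" using P(1) by (simp add: pos_def_cts_def)
  obtain N0 :: nat where N0: "2 * M * Re (P 0) / G P < real N0" using reals_Archimedean2 by blast
  define N where "N = Suc N0"
  have N1: "1 \<le> N" by (simp add: N_def)
  have N: "2 * M * Re (P 0) < real N * G P" using N0 P(2) by (simp add: N_def field_simps)
  define w where "w j = exp (2 * of_real pi * \<i> * of_nat j / of_nat N)" for j :: nat
  have orth: "(\<Sum>m<N. cnj (w j) ^ m * w k ^ m) = (if j mod N = k mod N then of_nat N else 0)" for j k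
    unfolding w_def by (rule roots_of_unity_orthogonal[OF N1])
  have wSuc: "w (Suc j) = w 1 * w j" for j
    unfolding w_def exp_add[symmetric] by (rule arg_cong[of _ _ exp]) (simp add: algebra_simps
        add_divide_distrib)
  define X where "X j = nmul j x" for j
  define Q where "Q m t = (\<Sum>j<N. \<Sum>k<N. cnj (w j) ^ m * cnj (cnj (w k) ^ m) * P (t + X j - X k))" for m t
  have Qc: "Q m \<in> pos_def_cts" for m
    unfolding Q_def by (rule pos_def_cts_twist[OF P(1)]) simp
  have sumQ: "(\<Sum>m<N. Q m t) = complex_of_real ((real N)\<^sup>2) * P t" for t
  proof -
    have "(\<Sum>m<N. Q m t) = (\<Sum>j<N. \<Sum>k<N. \<Sum>m<N. cnj (w j) ^ m * w k ^ m * P (t + X j - X k))"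
      unfolding Q_def by (subst sum.swap, rule sum.cong[OF refl], subst sum.swap) simp
    also have "\<dots> = (\<Sum>j<N. \<Sum>k<N. (if j mod N = k mod N then of_nat N else 0) * P (t + X j - X k))"
      by (simp only: sum_distrib_right[symmetric] orth)
    also have "\<dots> = (\<Sum>j<N. \<Sum>k<N. if j = k then of_nat N * P t else 0)"
      by (intro sum.cong refl) auto
    also have "\<dots> = of_nat N * (of_nat N * P t)" by (simp add: sum.delta)
    finally show ?thesis by (simp add: power2_eq_square)
  qed
  have "G (\<lambda>t. \<Sum>m<N. Q m t) = (\<Sum>m<N. G (Q m))"
    using cone_functional_sum[OF G, of "{..<N}" Q] Qc by (simp add: N_def lessThan_empty_iff)
  moreover have "G (\<lambda>t. \<Sum>m<N. Q m t) = (real N)\<^sup>2 * G P"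
    unfolding sumQ by (rule cone_functionalD(2)[OF G P(1)]) simp
  ultimately have sumG: "(\<Sum>m<N. G (Q m)) = (real N)\<^sup>2 * G P" by simp
  have "(\<Sum>m<N. cnj (w 1 ^ m) * Q m x)
      = (\<Sum>j<N. \<Sum>k<N. \<Sum>m<N. cnj (w (Suc j)) ^ m * w k ^ m * P (x + X j - X k))"
  proof -
    have "(\<Sum>m<N. cnj (w 1 ^ m) * Q m x) = (\<Sum>m<N. \<Sum>j<N. \<Sum>k<N. cnj (w (Suc j)) ^ m * w k ^ m * P (x + X j - X
        k))"
      unfolding Q_def wSuc by (simp add: sum_distrib_left power_mult_distrib mult.assoc)
    also have "\<dots> = (\<Sum>j<N. \<Sum>k<N. \<Sum>m<N. cnj (w (Suc j)) ^ m * w k ^ m * P (x + X j - X k))"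
      by (subst sum.swap, rule sum.cong[OF refl], subst sum.swap) simp
    finally show ?thesis .
  qed
  also have "\<dots> = (\<Sum>j<N. \<Sum>k<N. (if Suc j mod N = k mod N then of_nat N else 0) * P (x + X j - X k))"
    by (simp only: sum_distrib_right[symmetric] orth)
  also have "\<dots> = (\<Sum>j<N. of_nat N * P (X (Suc j) - X (Suc j mod N)))"
  proof (rule sum.cong[OF refl])
    fix j assume "j \<in> {..<N}"
    have "(\<Sum>k<N. (if Suc j mod N = k mod N then of_nat N else 0) * P (x + X j - X k))
        = (\<Sum>k<N. if k = Suc j mod N then of_nat N * P (x + X j - X k) else 0)"
      by (intro sum.cong refl) auto
    also have "\<dots> = of_nat N * P (x + X j - X (Suc j mod N))" using N1 by (simp add: sum.delta)
    finally show "(\<Sum>k<N. (if Suc j mod N = k mod N then of_nat N else 0) * P (x + X j - X k)) = of_nat N * P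
        (X (Suc j) - X (Suc j mod N))"
      by (simp add: X_def add.commute)
  qed
  also have "\<dots> = (\<Sum>j<N0. of_nat N * P 0) + of_nat N * P (X N)"
    by (simp add: N_def X_def)
  finally have sumQx: "(\<Sum>m<N. cnj (w 1 ^ m) * Q m x) = of_nat N * (of_nat N0 * P 0 + P (X N))"
    by (simp add: algebra_simps)
  have "(\<Sum>m<N. Re (Q m 0) - Re (cnj (w 1 ^ m) * Q m x)) = Re ((\<Sum>m<N. Q m 0) - (\<Sum>m<N. cnj (w 1 ^ m) * Q m x))"
    by (simp only: sum_subtractf minus_complex.simps Re_sum)
  also have "(\<Sum>m<N. Q m 0) - (\<Sum>m<N. cnj (w 1 ^ m) * Q m x) = of_nat N * (P 0 - P (X N))"
    unfolding sumQ sumQx by (simp add: N_def algebra_simps power2_eq_square)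
  also have "Re (of_nat N * (P 0 - P (X N))) = real N * (Re (P 0) - Re (P (X N)))" by simp
  also have "\<dots> \<le> real N * (2 * Re (P 0))"
    using pos_def_norm_le[OF pd, of "X N"] abs_Re_le_cmod[of "P (X N)"] by (intro mult_left_mono) auto
  finally have "M * (\<Sum>m<N. Re (Q m 0) - Re (cnj (w 1 ^ m) * Q m x)) \<le> M * (real N * (2 * Re (P 0)))"
    by (rule mult_left_mono) (use M in simp)
  also have "\<dots> < (real N)\<^sup>2 * G P"
    using mult_strict_left_mono[OF N, of "real N"] N1 by (simp add: power2_eq_square algebra_simps)
  finally have "0 < (\<Sum>m<N. G (Q m) - M * (Re (Q m 0) - Re (cnj (w 1 ^ m) * Q m x)))"
    by (simp only: sum_subtractf[of "\<lambda>m. G (Q m)"] sumG sum_distrib_left[symmetric] diff_gt_0_iff_gt)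
  then obtain m where "0 < G (Q m) - M * (Re (Q m 0) - Re (cnj (w 1 ^ m) * Q m x))"
    by (metis (no_types, lifting) sum_nonpos not_le)
  moreover have "norm (w 1 ^ m) = 1" unfolding w_def by (simp add: norm_power norm_exp_eq_Re)
  ultimately show ?thesis using Qc by blast
qed

text \<open>The functional minus \<open>M\<close> times the defect at \<open>x\<close> is again a functional of the same kind, positive at
some function, so the step can be repeated at the next point.\<close>
lemma character_extraction_finite:
  fixes G :: "('a::topological_ab_group_add \<Rightarrow> complex) \<Rightarrow> real"
  assumes "finite E" "cone_functional G B" "\<exists>P\<in>pos_def_cts. 0 < G P" and M: "0 < M"
  shows "\<exists>Q\<in>pos_def_cts. 0 < G Q - (\<Sum>x\<in>E. M * (Re (Q 0) - norm (Q x)))"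
  using assms(1-3)
proof (induction E arbitrary: G rule: finite_induct)
  case (insert x E)
  from insert.prems obtain P where P: "P \<in> pos_def_cts" "0 < G P" by blast
  obtain \<zeta> Q where Q: "norm \<zeta> = 1" "Q \<in> pos_def_cts" "0 < G Q - M * (Re (Q 0) - Re (cnj \<zeta> * Q x))"
    using character_extraction_step[OF insert.prems(1) P M] by blast
  define G' where "G' P = G P - M * (Re (P 0) - Re (cnj \<zeta> * P x))" for P
  have le: "Re (cnj \<zeta> * P x) \<le> norm (P x)" for P
    using complex_Re_le_cmod[of "cnj \<zeta> * P x"] Q(1) by (simp add: norm_mult)
  have "cone_functional G' B"
    unfolding cone_functional_def
  proof (intro conjI ballI allI impI)
    fix P Q :: "'a \<Rightarrow> complex" and r :: real assume PQ: "P \<in> pos_def_cts"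
    { assume Q: "Q \<in> pos_def_cts"
      then show "G' (\<lambda>t. P t + Q t) = G' P + G' Q"
        unfolding G'_def cone_functionalD(1)[OF insert.prems(1) PQ Q] by (simp add: algebra_simps) }
    { assume r: "0 \<le> r"
      then show "G' (\<lambda>t. complex_of_real r * P t) = r * G' P"
        unfolding G'_def cone_functionalD(2)[OF insert.prems(1) PQ r] by (simp add: algebra_simps) }
    have "norm (P x) \<le> Re (P 0)" using PQ pos_def_norm_le by (auto simp: pos_def_cts_def)
    hence "0 \<le> M * (Re (P 0) - Re (cnj \<zeta> * P x))" using le[of P] M by simp
    moreover have "G P \<le> B * Re (P 0)" by (rule cone_functionalD(3)[OF insert.prems(1) PQ])
    ultimately show "G' P \<le> B * Re (P 0)" by (simp add: G'_def)
  qed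
  from insert.IH[OF this] Q obtain R where R: "R \<in> pos_def_cts" "0 < G' R - (\<Sum>x\<in>E. M * (Re (R 0) - norm (R
      x)))"
    unfolding G'_def by blast
  have "M * (Re (R 0) - norm (R x)) \<le> M * (Re (R 0) - Re (cnj \<zeta> * R x))"
    using le[of R] M by (intro mult_left_mono) auto
  then have "0 < G R - (\<Sum>x\<in>insert x E. M * (Re (R 0) - norm (R x)))"
    using R(2) insert.hyps by (simp add: G'_def)
  then show ?case using R(1) by blast
qed simp

lemma character_extraction_normalized:
  fixes G :: "('a::topological_ab_group_add \<Rightarrow> complex) \<Rightarrow> real"
  assumes E: "finite E" and G: "cone_functional G B" and ex: "\<exists>P\<in>pos_def_cts. 0 < G P" and e: "0 < \<epsilon>"
  shows "\<exists>Q\<in>pos_def_cts. Q 0 = 1 \<and> 0 < G Q \<and> (\<forall>x\<in>E. 1 - \<epsilon> \<le> norm (Q x))"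
proof -
  define M where "M = (\<bar>B\<bar> + 1) / \<epsilon>"
  have M: "0 < M" using e by (simp add: M_def add_nonneg_pos)
  obtain R where R: "R \<in> pos_def_cts" "0 < G R - (\<Sum>x\<in>E. M * (Re (R 0) - norm (R x)))"
    using character_extraction_finite[OF E G ex M] by blast
  have pd: "pos_def R" using R(1) by (simp add: pos_def_cts_def)
  have le: "norm (R x) \<le> Re (R 0)" for x using pos_def_norm_le[OF pd] .
  have nn: "0 \<le> M * (Re (R 0) - norm (R x))" for x using le M by simp
  have GB: "G R \<le> B * Re (R 0)" by (rule cone_functionalD(3)[OF G R(1)])
  have GR: "0 < G R" using R(2) sum_nonneg[of E "\<lambda>x. M * (Re (R 0) - norm (R x))"] nn by force
  have R0: "0 < Re (R 0)"
  proof (rule ccontr)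
    assume "\<not> 0 < Re (R 0)"
    hence "Re (R 0) = 0" using pos_def_zero[OF pd] by simp
    then show False using GB GR by simp
  qed
  define r where "r = 1 / Re (R 0)"
  have r: "0 < r" using R0 by (simp add: r_def)
  define Q where "Q t = complex_of_real r * R t" for t
  have "R 0 = complex_of_real (Re (R 0))" using pos_def_zero[OF pd] by (simp add: complex_eq_iff)
  hence "Q 0 = 1" unfolding Q_def r_def using R0
    by (metis divide_self_if less_irrefl of_real_1 of_real_mult times_divide_eq_left mult_1)
  moreover have "G Q = r * G R" unfolding Q_def by (rule cone_functionalD(2)[OF G R(1)]) (use r in simp)
  hence "0 < G Q" using r GR by simp
  moreover have "1 - \<epsilon> \<le> norm (Q x)" if x: "x \<in> E" for x
  proof -
    have "M * (Re (R 0) - norm (R x)) \<le> (\<Sum>x\<in>E. M * (Re (R 0) - norm (R x)))"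
      by (rule member_le_sum) (use x nn E in auto)
    also have "\<dots> \<le> B * Re (R 0)" using R(2) GB by simp
    also have "\<dots> \<le> (\<bar>B\<bar> + 1) * Re (R 0)" using R0 by (intro mult_right_mono) auto
    also have "\<dots> = M * (\<epsilon> * Re (R 0))" using e by (simp add: M_def)
    finally have "Re (R 0) - norm (R x) \<le> \<epsilon> * Re (R 0)" using M by simp
    hence "(1 - \<epsilon>) * Re (R 0) \<le> norm (R x)" by (simp add: algebra_simps)
    hence "(1 - \<epsilon>) \<le> norm (R x) / Re (R 0)" using R0 by (simp add: field_simps)
    then show ?thesis using R0 by (simp add: Q_def r_def norm_mult norm_divide)
  qed
  moreover have "Q \<in> pos_def_cts" unfolding Q_def using R(1) r by (intro pos_def_cts_cmult) auto
  ultimately show ?thesis by blast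
qed

text \<open>Functions with \<open>|Q|\<close> near \<open>1\<close> on larger and larger finite sets converge along a filter to a function
of modulus \<open>1\<close>, which is multiplicative by the three point inequality. It need not be continuous.\<close>
theorem character_extraction:
  fixes G :: "('a::topological_ab_group_add \<Rightarrow> complex) \<Rightarrow> real"
  assumes G: "cone_functional G B" and ex: "\<exists>P\<in>pos_def_cts. 0 < G P"
  obtains \<kappa> where "\<And>x. norm (\<kappa> x) = 1" "\<And>x y. \<kappa> (x + y) = \<kappa> x * \<kappa> y"
    "\<And>E \<epsilon>. finite E \<Longrightarrow> 0 < \<epsilon> \<Longrightarrow>
       \<exists>Q\<in>pos_def_cts. Q 0 = 1 \<and> 0 < G Q \<and> (\<forall>x\<in>E. norm (Q x - \<kappa> x) < \<epsilon>)"
proof -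
  have "\<exists>Q\<in>pos_def_cts. Q 0 = 1 \<and> 0 < G Q \<and> (finite (fst i) \<longrightarrow> (\<forall>x\<in>fst i. 1 - 1 / real (Suc (snd i)) \<le> norm (Q
      x)))"
    for i :: "'a set \<times> nat"
  proof (cases "finite (fst i)")
    case True
    then show ?thesis using character_extraction_normalized[OF True G ex, of "1 / real (Suc (snd i))"] by auto
  next
    case False
    then show ?thesis using character_extraction_normalized[OF finite.emptyI G ex, of 1] by auto
  qed
  then obtain \<Phi> where \<Phi>: "\<And>i. \<Phi> i \<in> pos_def_cts" "\<And>i. \<Phi> i 0 = 1" "\<And>i. 0 < G (\<Phi> i)"
    "\<And>i x. finite (fst i) \<Longrightarrow> x \<in> fst i \<Longrightarrow> 1 - 1 / real (Suc (snd i)) \<le> norm (\<Phi> i x)" by metis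
  have pd: "pos_def (\<Phi> i)" for i using \<Phi>(1) by (simp add: pos_def_cts_def)
  have le1: "norm (\<Phi> i x) \<le> 1" for i x using pos_def_norm_le[OF pd[of i], of x] \<Phi>(2)[of i] by simp
  define F where "F = (finite_subsets_at_top (UNIV :: 'a set) \<times>\<^sub>F sequentially)"
  have F0: "F \<noteq> bot" by (simp add: F_def prod_filter_eq_bot)
  have bd: "\<forall>\<^sub>F i in F. norm (\<Phi> i x) \<le> 1" for x using le1 by simp
  obtain H \<kappa> where H: "H \<le> F" "H \<noteq> bot" and lim: "\<And>x. ((\<lambda>i. \<Phi> i x) \<longlongrightarrow> \<kappa> x) H"
    by (rule bounded_family_convergent_subfilter[of F \<Phi>, OF F0 bd]) blast
  have norm1: "norm (\<kappa> x) = 1" for x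
  proof (rule antisym)
    show "norm (\<kappa> x) \<le> 1"
      by (rule tendsto_upperbound[OF tendsto_norm[OF lim] _ H(2)]) (simp add: le1)
    have "filterlim snd sequentially F" unfolding F_def by (rule filterlim_snd)
    hence "filterlim snd sequentially H" by (rule filterlim_mono[OF _ order_refl H(1)])
    hence "((\<lambda>i. 1 / real (Suc (snd i))) \<longlongrightarrow> 0) H"
      using filterlim_compose[OF LIMSEQ_inverse_real_of_nat] by (simp add: inverse_eq_divide)
    hence l: "((\<lambda>i. 1 - 1 / real (Suc (snd i))) \<longlongrightarrow> 1 - 0) H" by (intro tendsto_intros)
    have "\<forall>\<^sub>F E' in finite_subsets_at_top UNIV. finite E' \<and> x \<in> E'"
      unfolding eventually_finite_subsets_at_top by (rule exI[of _ "{x}"]) auto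
    hence "\<forall>\<^sub>F i in F. finite (fst i) \<and> x \<in> fst i" unfolding F_def
      using eventually_prod1[of sequentially "\<lambda>E'. finite E' \<and> x \<in> E'"] by (simp add: split_def)
    hence "\<forall>\<^sub>F i in H. finite (fst i) \<and> x \<in> fst i" by (rule filter_leD[OF H(1)])
    hence "\<forall>\<^sub>F i in H. 1 - 1 / real (Suc (snd i)) \<le> norm (\<Phi> i x)"
      by eventually_elim (use \<Phi>(4) in blast)
    from tendsto_le[OF H(2) tendsto_norm[OF lim] l this] show "1 \<le> norm (\<kappa> x)" by simp
  qed
  have mult: "\<kappa> (x + y) = \<kappa> x * \<kappa> y" for x y
  proof -
    have "((\<lambda>i. (norm (\<Phi> i (x + y) - \<Phi> i x * \<Phi> i y))\<^sup>2) \<longlongrightarrow> (norm (\<kappa> (x + y) - \<kappa> x * \<kappa> y))\<^sup>2) H"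
      by (intro tendsto_intros lim)
    moreover have "((\<lambda>i. 1 - (norm (\<Phi> i x))\<^sup>2) \<longlongrightarrow> 1 - (norm (\<kappa> x))\<^sup>2) H"
      by (intro tendsto_intros lim)
    moreover have "\<forall>\<^sub>F i in H. (norm (\<Phi> i (x + y) - \<Phi> i x * \<Phi> i y))\<^sup>2 \<le> 1 - (norm (\<Phi> i x))\<^sup>2"
      using pos_def_almost_multiplicative[OF pd \<Phi>(2)] by simp
    ultimately have "(norm (\<kappa> (x + y) - \<kappa> x * \<kappa> y))\<^sup>2 \<le> 1 - (norm (\<kappa> x))\<^sup>2"
      using tendsto_le[OF H(2)] by blast
    then show ?thesis by (simp add: norm1)
  qed
  show ?thesis
  proof (rule that[OF norm1 mult])
    fix E and \<epsilon> :: real assume E: "finite (E :: 'a set)" and e: "0 < \<epsilon>"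
    have "\<forall>\<^sub>F i in H. \<forall>x\<in>E. norm (\<Phi> i x - \<kappa> x) < \<epsilon>"
    proof (rule eventually_ball_finite[OF E], rule ballI)
      fix x
      show "\<forall>\<^sub>F i in H. norm (\<Phi> i x - \<kappa> x) < \<epsilon>"
        using tendstoD[OF lim[of x] e] by (simp add: dist_norm)
    qed
    then obtain i where "\<forall>x\<in>E. norm (\<Phi> i x - \<kappa> x) < \<epsilon>" using eventually_happens'[OF H(2)] by blast
    then show "\<exists>Q\<in>pos_def_cts. Q 0 = 1 \<and> 0 < G Q \<and> (\<forall>x\<in>E. norm (Q x - \<kappa> x) < \<epsilon>)"
      using \<Phi> by blast
  qed
qed

section \<open>Enough continuous characters\<close>

text \<open>The limit \<open>\<eta> \<rightarrow> 0\<close> in the estimates that compare a character with a positive definite function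
\<open>\<eta>\<close>-close to it at a point.\<close>
lemma tendsto_sqrt_bound:
  fixes A B C D :: real
  assumes "\<And>\<eta>. 0 < \<eta> \<Longrightarrow> A \<le> B + sqrt (2 * \<eta>) * C + \<eta> * D"
  shows "A \<le> B"
proof (rule tendsto_lowerbound)
  have "((\<lambda>\<eta>. B + sqrt (2 * \<eta>) * C + \<eta> * D) \<longlongrightarrow> B + sqrt (2 * 0) * C + 0 * D) (at_right 0)"
    by (intro tendsto_intros)
  then show "((\<lambda>\<eta>. B + sqrt (2 * \<eta>) * C + \<eta> * D) \<longlongrightarrow> B) (at_right 0)" by simp
  show "\<forall>\<^sub>F \<eta> in at_right 0. A \<le> B + sqrt (2 * \<eta>) * C + \<eta> * D"
    using eventually_at_right_less[of 0] by eventually_elim (use assms in blast)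
qed simp

lemma continuous_homomorphism_circle:
  fixes \<kappa> :: "'a::topological_ab_group_add \<Rightarrow> complex"
  assumes n: "\<And>x. norm (\<kappa> x) = 1" and m: "\<And>x y. \<kappa> (x + y) = \<kappa> x * \<kappa> y"
    and c: "\<And>\<epsilon>. 0 < \<epsilon> \<Longrightarrow> \<exists>V. open V \<and> 0 \<in> V \<and> (\<forall>v\<in>V. norm (\<kappa> v - 1) \<le> \<epsilon>)"
  shows "continuous_on UNIV \<kappa>"
  unfolding continuous_on_def
proof (intro ballI)
  fix a
  show "(\<kappa> \<longlongrightarrow> \<kappa> a) (at a within UNIV)"
  proof (rule tendstoI)
    fix e :: real assume e: "0 < e"
    obtain V where V: "open V" "0 \<in> V" "\<And>v. v \<in> V \<Longrightarrow> norm (\<kappa> v - 1) \<le> e / 2"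
      using c[of "e / 2"] e by auto
    have "eventually (\<lambda>x. x \<in> {x. x + (- a) \<in> V}) (nhds a)"
      by (rule eventually_nhds_in_open[OF open_translate[OF V(1)]]) (use V in simp)
    hence "eventually (\<lambda>x. dist (\<kappa> x) (\<kappa> a) < e) (nhds a)"
    proof eventually_elim
      case (elim x)
      have "\<kappa> x = \<kappa> a * \<kappa> (x + - a)" using m[of a "x + - a"] by simp
      hence "norm (\<kappa> x - \<kappa> a) = norm (\<kappa> a * (\<kappa> (x + - a) - 1))" by (simp add: algebra_simps)
      also have "\<dots> \<le> e / 2" using V(3) elim by (simp add: norm_mult n)
      finally show ?case using e by (simp add: dist_norm)
    qed
    then show "\<forall>\<^sub>F x in at a within UNIV. dist (\<kappa> x) (\<kappa> a) < e"
      by (rule filter_leD[rotated]) (simp add: at_within_def)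
  qed
qed

lemma norm_one_almost_multiplicative:
  assumes Q: "pos_def Q" "Q 0 = 1" and z: "norm (Q x - z) < \<eta>" "norm z = 1"
  shows "norm (Q (t + x) - Q t * Q x) \<le> sqrt (2 * \<eta>)"
proof -
  have le1: "norm (Q x) \<le> 1" using pos_def_norm_le[OF Q(1), of x] Q(2) by simp
  have "1 - \<eta> < norm (Q x)" using norm_triangle_ineq2[of z "Q x"] z by (simp add: norm_minus_commute)
  moreover have "1 - (norm (Q x))\<^sup>2 = (1 - norm (Q x)) * (1 + norm (Q x))" by (simp add: power2_eq_square
      algebra_simps)
  moreover have "(1 - norm (Q x)) * (1 + norm (Q x)) \<le> (1 - norm (Q x)) * 2" using le1 by (intro
      mult_left_mono) auto
  ultimately have "1 - (norm (Q x))\<^sup>2 \<le> (1 - norm (Q x)) * 2" and lt: "1 - \<eta> < norm (Q x)" by (simp_all only:)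
  note this(1)
  also have "(1 - norm (Q x)) * 2 \<le> 2 * \<eta>" using lt by argo
  finally have "1 - (norm (Q x))\<^sup>2 \<le> 2 * \<eta>" .
  with pos_def_almost_multiplicative[OF Q, of x t] have "(norm (Q (x + t) - Q x * Q t))\<^sup>2 \<le> 2 * \<eta>" by linarith
  then have "norm (Q (x + t) - Q x * Q t) \<le> sqrt (2 * \<eta>)" by (rule real_le_rsqrt)
  then show ?thesis by (simp add: add.commute mult.commute)
qed

context invariant_integral
begin

lemma I_Re_linear:
  assumes b: "\<beta> \<in> Cc" and th: "continuous_on UNIV \<theta>"
  shows "I (\<lambda>t. \<beta> t * Re (w * \<theta> t)) = Re (w * Complex (I (\<lambda>t. \<beta> t * Re (\<theta> t))) (I (\<lambda>t. \<beta> t * Im (\<theta> t))))"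
proof -
  have c: "(\<lambda>t. \<beta> t * Re (\<theta> t)) \<in> Cc" "(\<lambda>t. \<beta> t * Im (\<theta> t)) \<in> Cc"
    by (rule Cc_mult_continuous(1)[OF b]; intro continuous_intros th)+
  have "(\<lambda>t. \<beta> t * Re (w * \<theta> t)) = (\<lambda>t. Re w * (\<beta> t * Re (\<theta> t)) - Im w * (\<beta> t * Im (\<theta> t)))"
    by (simp add: algebra_simps)
  then show ?thesis by (simp add: I_diff[OF Cc_cmult[OF c(1)] Cc_cmult[OF c(2)]] I_cmult[OF c(1)] I_cmult[OF
      c(2)])
qed

text \<open>Let \<open>J\<close> be the integral of \<open>\<beta> \<theta>\<close>, so \<open>|J| \<ge> c\<close>. Up to \<open>\<delta>\<close>, the number \<open>(\<theta> x - 1) J\<close> is the integral of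
\<open>\<beta> t (\<theta> (t + x) - \<theta> t)\<close>, and translation invariance moves the difference from \<open>\<theta>\<close> to \<open>\<beta>\<close>.\<close>
lemma near_character_bound:
  fixes \<theta> :: "'a \<Rightarrow> complex"
  assumes th: "continuous_on UNIV \<theta>" "\<And>t. norm (\<theta> t) \<le> 1" and b: "\<beta> \<in> Cc"
    and c: "c \<le> I (\<lambda>t. \<beta> t * Re (\<theta> t))" and d: "\<And>t. norm (\<theta> (t + x) - \<theta> t * \<theta> x) \<le> \<delta>"
  shows "norm (\<theta> x - 1) * c \<le> I (\<lambda>t. \<bar>\<beta> (t + - x) - \<beta> t\<bar>) + \<delta> * I (\<lambda>t. \<bar>\<beta> t\<bar>)"
proof -
  define J where "J = Complex (I (\<lambda>t. \<beta> t * Re (\<theta> t))) (I (\<lambda>t. \<beta> t * Im (\<theta> t)))"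
  define z where "z = \<theta> x - 1"
  \<comment> \<open>A rotation that makes \<open>v * z * J\<close> real, so that only real integrals occur.\<close>
  define v where "v = cnj (sgn (z * J))"
  have nv: "norm v \<le> 1" by (simp add: v_def norm_sgn)
  have vz: "v * (z * J) = complex_of_real (norm (z * J))"
  proof (cases "z * J = 0")
    case False
    have "cnj (z * J) * (z * J) = complex_of_real (norm (z * J)) * complex_of_real (norm (z * J))"
      using complex_norm_square[of "z * J"] by (simp add: mult.commute power2_eq_square)
    then show ?thesis using False by (simp add: v_def sgn_eq divide_simps)
  qed (auto simp: v_def)
  have Cc1: "(\<lambda>t. \<beta> t * Re (w * \<theta> (t + a))) \<in> Cc" for w a
    by (intro Cc_mult_continuous(1)[OF b] continuous_intros continuous_on_UNIV_compose[OF th(1)])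
  have Cc0: "(\<lambda>t. \<beta> t * Re (w * \<theta> t)) \<in> Cc" for w using Cc1[of w 0] by simp
  have "norm z * c \<le> norm z * norm J"
    using c complex_Re_le_cmod[of J] by (intro mult_left_mono) (auto simp: J_def)
  also have "\<dots> = Re (v * z * J)" using vz by (simp add: norm_mult mult.assoc)
  also have "\<dots> = I (\<lambda>t. \<beta> t * Re (v * z * \<theta> t))"
    unfolding J_def by (rule I_Re_linear[OF b th(1), symmetric])
  also have "\<dots> \<le> I (\<lambda>t. \<delta> * \<bar>\<beta> t\<bar> + (\<beta> t * Re (v * \<theta> (t + x)) - \<beta> t * Re (v * \<theta> t)))"
  proof (rule I_mono[OF Cc0])
    show "(\<lambda>t. \<delta> * \<bar>\<beta> t\<bar> + (\<beta> t * Re (v * \<theta> (t + x)) - \<beta> t * Re (v * \<theta> t))) \<in> Cc"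
      by (intro Cc_add Cc_diff Cc_cmult Cc_abs b Cc0 Cc1)
    fix t
    have "\<beta> t * Re (v * z * \<theta> t) = \<beta> t * Re (v * (\<theta> t * \<theta> x - \<theta> (t + x))) + (\<beta> t * Re (v * \<theta> (t + x)) - \<beta> t *
        Re (v * \<theta> t))"
      by (simp add: z_def algebra_simps)
    moreover have "norm (v * (\<theta> t * \<theta> x - \<theta> (t + x))) \<le> 1 * \<delta>"
      unfolding norm_mult using d[of t] nv by (intro mult_mono) (auto simp: norm_minus_commute)
    hence "\<bar>Re (v * (\<theta> t * \<theta> x - \<theta> (t + x)))\<bar> \<le> \<delta>" using abs_Re_le_cmod order_trans by fastforce
    hence "\<bar>\<beta> t\<bar> * \<bar>Re (v * (\<theta> t * \<theta> x - \<theta> (t + x)))\<bar> \<le> \<bar>\<beta> t\<bar> * \<delta>" by (rule mult_left_mono) simp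
    hence "\<beta> t * Re (v * (\<theta> t * \<theta> x - \<theta> (t + x))) \<le> \<delta> * \<bar>\<beta> t\<bar>"
      by (metis abs_ge_self abs_mult mult.commute order_trans)
    ultimately show "\<beta> t * Re (v * z * \<theta> t) \<le> \<delta> * \<bar>\<beta> t\<bar> + (\<beta> t * Re (v * \<theta> (t + x)) - \<beta> t * Re (v * \<theta> t))" by
        simp
  qed
  also have "\<dots> = \<delta> * I (\<lambda>t. \<bar>\<beta> t\<bar>) + (I (\<lambda>t. \<beta> t * Re (v * \<theta> (t + x))) - I (\<lambda>t. \<beta> t * Re (v * \<theta> t)))"
    unfolding I_add[OF Cc_cmult[OF Cc_abs[OF b]] Cc_diff[OF Cc1 Cc0]] I_cmult[OF Cc_abs[OF b]] I_diff[OF Cc1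
        Cc0] ..
  also have "I (\<lambda>t. \<beta> t * Re (v * \<theta> (t + x))) = I (\<lambda>t. \<beta> (t + - x) * Re (v * \<theta> t))"
    using I_shift[OF Cc1[of v x], of "- x"] by simp
  also have "I (\<lambda>t. \<beta> (t + - x) * Re (v * \<theta> t)) - I (\<lambda>t. \<beta> t * Re (v * \<theta> t)) \<le> I (\<lambda>t. \<bar>\<beta> (t + - x) - \<beta> t\<bar>)"
  proof -
    have C2: "(\<lambda>t. \<beta> (t + - x) * Re (v * \<theta> t)) \<in> Cc"
      by (intro Cc_mult_continuous(1)[OF Cc_shift[OF b]] continuous_intros th)
    have "I (\<lambda>t. \<beta> (t + - x) * Re (v * \<theta> t)) - I (\<lambda>t. \<beta> t * Re (v * \<theta> t)) = I (\<lambda>t. \<beta> (t + - x) * Re (v * \<theta> t)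
        - \<beta> t * Re (v * \<theta> t))"
      by (rule I_diff[OF C2 Cc0, symmetric])
    also have "\<dots> \<le> I (\<lambda>t. \<bar>\<beta> (t + - x) - \<beta> t\<bar>)"
    proof (rule I_mono[OF Cc_diff[OF C2 Cc0] Cc_abs[OF Cc_diff[OF Cc_shift[OF b] b]]])
      fix t
      have "norm (v * \<theta> t) \<le> 1 * 1" unfolding norm_mult by (intro mult_mono nv th) auto
      hence r: "\<bar>Re (v * \<theta> t)\<bar> \<le> 1" using abs_Re_le_cmod[of "v * \<theta> t"] by linarith
      have "\<beta> (t + - x) * Re (v * \<theta> t) - \<beta> t * Re (v * \<theta> t) = (\<beta> (t + - x) - \<beta> t) * Re (v * \<theta> t)"
        by (simp add: left_diff_distrib)
      also have "\<dots> \<le> \<bar>\<beta> (t + - x) - \<beta> t\<bar> * \<bar>Re (v * \<theta> t)\<bar>" using abs_ge_self by (metis abs_mult)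
      also have "\<dots> \<le> \<bar>\<beta> (t + - x) - \<beta> t\<bar> * 1" by (rule mult_left_mono[OF r]) simp
      finally show "\<beta> (t + - x) * Re (v * \<theta> t) - \<beta> t * Re (v * \<theta> t) \<le> \<bar>\<beta> (t + - x) - \<beta> t\<bar>" by simp
    qed
    finally show ?thesis .
  qed
  finally show ?thesis by (simp add: z_def)
qed

text \<open>If \<open>G Q > 0\<close> keeps the mean of \<open>Q\<close> against \<open>\<beta>\<close> away from zero, then the extracted character differs from
\<open>1\<close> at \<open>x\<close> by at most a multiple of the \<open>L\<^sup>1\<close> distance of \<open>\<beta>\<close> and its translate, and this tends to zero
with \<open>x\<close>.\<close>
theorem continuous_character_extraction:
  assumes G: "cone_functional G B" "\<exists>P\<in>pos_def_cts. 0 < G P"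
    and b: "\<beta> \<in> Cc" and c: "0 < c"
    and lower: "\<And>Q. Q \<in> pos_def_cts \<Longrightarrow> Q 0 = 1 \<Longrightarrow> 0 < G Q \<Longrightarrow> c \<le> I (\<lambda>t. \<beta> t * Re (Q t))"
  shows "\<exists>y :: 'a dual. \<forall>E \<epsilon>. finite E \<longrightarrow> 0 < \<epsilon> \<longrightarrow>
       (\<exists>Q\<in>pos_def_cts. Q 0 = 1 \<and> 0 < G Q \<and> (\<forall>x\<in>E. norm (Q x - ev y x) < \<epsilon>))"
proof -
  obtain \<kappa> where n: "\<And>x. norm (\<kappa> x) = 1" and m: "\<And>x y. \<kappa> (x + y) = \<kappa> x * \<kappa> y" and
    app: "\<And>E \<epsilon>. finite E \<Longrightarrow> 0 < \<epsilon> \<Longrightarrow>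
       \<exists>Q\<in>pos_def_cts. Q 0 = 1 \<and> 0 < G Q \<and> (\<forall>x\<in>E. norm (Q x - \<kappa> x) < \<epsilon>)"
    by (rule character_extraction[OF G]) blast
  have bound: "norm (\<kappa> x - 1) * c \<le> I (\<lambda>t. \<bar>\<beta> (t + - x) - \<beta> t\<bar>)" for x
  proof (rule tendsto_sqrt_bound)
    fix \<eta> :: real assume e: "0 < \<eta>"
    obtain Q where Q: "Q \<in> pos_def_cts" "Q 0 = 1" "0 < G Q" "norm (Q x - \<kappa> x) < \<eta>"
      using app[of "{x}", OF _ e] by auto
    have pd: "pos_def Q" "continuous_on UNIV Q" using Q(1) by (auto simp: pos_def_cts_def)
    have le1: "norm (Q t) \<le> 1" for t using pos_def_norm_le[OF pd(1), of t] Q(2) by simp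
    have "norm (Q x - 1) * c \<le> I (\<lambda>t. \<bar>\<beta> (t + - x) - \<beta> t\<bar>) + sqrt (2 * \<eta>) * I (\<lambda>t. \<bar>\<beta> t\<bar>)"
      by (rule near_character_bound[OF pd(2) le1 b lower[OF Q(1-3)] norm_one_almost_multiplicative[OF pd(1)
          Q(2,4) n]])
    moreover have "norm (\<kappa> x - 1) \<le> norm (Q x - 1) + \<eta>"
      using Q(4) norm_triangle_ineq[of "Q x - 1" "\<kappa> x - Q x"] by (simp add: norm_minus_commute)
    hence "norm (\<kappa> x - 1) * c \<le> (norm (Q x - 1) + \<eta>) * c" by (rule mult_right_mono) (use c in simp)
    ultimately show "norm (\<kappa> x - 1) * c \<le> I (\<lambda>t. \<bar>\<beta> (t + - x) - \<beta> t\<bar>) + sqrt (2 * \<eta>) * I (\<lambda>t. \<bar>\<beta> t\<bar>) + \<eta> * c"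
      by (simp add: algebra_simps)
  qed
  have cont: "continuous_on UNIV \<kappa>"
  proof (rule continuous_homomorphism_circle[OF n m])
    fix \<epsilon> :: real assume e: "0 < \<epsilon>"
    have ec: "0 < \<epsilon> * c" using e c by simp
    obtain V where V: "open V" "0 \<in> V" "\<And>v. v \<in> V \<Longrightarrow> I (\<lambda>x. \<bar>\<beta> (x + v) - \<beta> x\<bar>) \<le> \<epsilon> * c"
      by (rule I_translation_continuous[OF b ec]) blast
    obtain W where W: "open W" "0 \<in> W" "W \<subseteq> V" "\<And>x. x \<in> W \<Longrightarrow> - x \<in> W"
      by (rule symmetric_neighbourhood[OF V(1,2)]) blast
    have "norm (\<kappa> v - 1) \<le> \<epsilon>" if "v \<in> W" for v
    proof -
      have "- v \<in> V" using W that by blast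
      hence "norm (\<kappa> v - 1) * c \<le> \<epsilon> * c" using bound[of v] V(3)[of "- v"] by linarith
      then show ?thesis using c by simp
    qed
    then show "\<exists>V. open V \<and> 0 \<in> V \<and> (\<forall>v\<in>V. norm (\<kappa> v - 1) \<le> \<epsilon>)" using W by blast
  qed
  have "ev (Dual \<kappa>) = \<kappa>" by (rule Dual_inverse) (use n m cont in auto)
  then show ?thesis by (intro exI[of _ "Dual \<kappa>"]) (use app in simp)
qed

text \<open>The quadratic form of the autocorrelation is the integral of the squared modulus of the sum of
\<open>c i * b (r + p i)\<close> over \<open>i\<close>.\<close>
lemma autocorrelation_pos_def:
  assumes b: "b \<in> Cc"
  shows "(\<lambda>t. complex_of_real (I (\<lambda>r. b (r + t) * b r))) \<in> pos_def_cts"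
proof -
  have cb: "continuous_on UNIV (\<lambda>r. b (r + t))" for t using Cc_continuous[OF Cc_shift[OF b]] .
  have C: "(\<lambda>r. b (r + s) * b (r + t)) \<in> Cc" for s t by (rule Cc_mult_continuous(1)[OF Cc_shift[OF b] cb])
  have C0: "(\<lambda>r. b (r + s) * b r) \<in> Cc" for s using C[of s 0] by simp
  have "pos_def (\<lambda>t. complex_of_real (I (\<lambda>r. b (r + t) * b r)))"
    unfolding pos_def_def
  proof (intro allI impI)
    fix A :: "nat set" and p :: "nat \<Rightarrow> 'a" and c :: "nat \<Rightarrow> complex" assume A: "finite A"
    have sh: "I (\<lambda>r. b (r + (p i - p j)) * b r) = I (\<lambda>r. b (r + p i) * b (r + p j))" for i j
      using I_shift[OF C0[of "p i - p j"], of "p j"] by (simp add: algebra_simps)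
    define S where "S = (\<Sum>i\<in>A. \<Sum>j\<in>A. c i * cnj (c j) * complex_of_real (I (\<lambda>r. b (r + p i) * b (r + p j))))"
    have ReM: "Re (z * complex_of_real u) = Re z * u" and ImM: "Im (z * complex_of_real u) = Im z * u" for z u
      by simp_all
    define g where "g r = (\<Sum>i\<in>A. c i * complex_of_real (b (r + p i)))" for r
    have gg: "(\<Sum>i\<in>A. \<Sum>j\<in>A. (c i * cnj (c j)) * complex_of_real (b (r + p i) * b (r + p j))) = complex_of_real
        ((norm (g r))\<^sup>2)" for r
      unfolding complex_norm_square g_def cnj_sum sum_product by (simp add: algebra_simps)
    have "Re S = (\<Sum>i\<in>A. \<Sum>j\<in>A. Re (c i * cnj (c j)) * I (\<lambda>r. b (r + p i) * b (r + p j)))"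
      by (simp add: S_def Re_sum)
    also have "\<dots> = I (\<lambda>r. \<Sum>i\<in>A. \<Sum>j\<in>A. Re (c i * cnj (c j)) * (b (r + p i) * b (r + p j)))"
      by (subst I_sum, intro Cc_sum Cc_cmult C, intro sum.cong refl, subst I_sum, intro Cc_cmult C)
         (simp only: I_cmult[OF C])
    also have "(\<lambda>r. \<Sum>i\<in>A. \<Sum>j\<in>A. Re (c i * cnj (c j)) * (b (r + p i) * b (r + p j))) = (\<lambda>r. (norm (g r))\<^sup>2)"
    proof
      fix r show "(\<Sum>i\<in>A. \<Sum>j\<in>A. Re (c i * cnj (c j)) * (b (r + p i) * b (r + p j))) = (norm (g r))\<^sup>2"
        using arg_cong[OF gg[of r], of Re] by (simp only: Re_sum Re_complex_of_real ReM)
    qed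
    finally have Re: "Re S = I (\<lambda>r. (norm (g r))\<^sup>2)" .
    have "(\<lambda>r. \<Sum>i\<in>A. \<Sum>j\<in>A. Re (c i * cnj (c j)) * (b (r + p i) * b (r + p j))) \<in> Cc"
      by (intro Cc_sum Cc_cmult C)
    hence "(\<lambda>r. (norm (g r))\<^sup>2) \<in> Cc"
      using arg_cong[OF gg, of Re] by (simp only: Re_sum Re_complex_of_real ReM)
    hence Re0: "0 \<le> Re S" unfolding Re by (rule I_nonneg) simp
    have "Im S = (\<Sum>i\<in>A. \<Sum>j\<in>A. Im (c i * cnj (c j)) * I (\<lambda>r. b (r + p i) * b (r + p j)))"
      by (simp add: S_def Im_sum)
    also have "\<dots> = I (\<lambda>r. \<Sum>i\<in>A. \<Sum>j\<in>A. Im (c i * cnj (c j)) * (b (r + p i) * b (r + p j)))"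
      by (subst I_sum, intro Cc_sum Cc_cmult C, intro sum.cong refl, subst I_sum, intro Cc_cmult C)
         (simp only: I_cmult[OF C])
    also have "(\<lambda>r. \<Sum>i\<in>A. \<Sum>j\<in>A. Im (c i * cnj (c j)) * (b (r + p i) * b (r + p j))) = (\<lambda>r. 0)"
    proof
      fix r show "(\<Sum>i\<in>A. \<Sum>j\<in>A. Im (c i * cnj (c j)) * (b (r + p i) * b (r + p j))) = 0"
        using arg_cong[OF gg[of r], of Im] by (simp only: Im_sum Im_complex_of_real ImM)
    qed
    finally have "Im S = 0" by (simp add: I_zero)
    then have "S = complex_of_real (Re S)" by (simp add: complex_eq_iff)
    then show "\<exists>r\<ge>0. (\<Sum>i\<in>A. \<Sum>j\<in>A. c i * cnj (c j) * complex_of_real (I (\<lambda>r. b (r + (p i - p j)) * b r))) =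
        complex_of_real r"
      unfolding sh S_def[symmetric] using Re0 by blast
  qed
  moreover have "continuous_on UNIV (\<lambda>t. I (\<lambda>r. b (r + t) * b r))"
    unfolding continuous_on_def
  proof (intro ballI)
    fix a
    obtain M where M: "0 \<le> M" "\<And>x. \<bar>b x\<bar> \<le> M" using b by (rule Cc_bounded) blast
    show "((\<lambda>t. I (\<lambda>r. b (r + t) * b r)) \<longlongrightarrow> I (\<lambda>r. b (r + a) * b r)) (at a within UNIV)"
    proof (rule tendstoI)
      fix e :: real assume e: "0 < e"
      have e': "0 < e / (2 * (M + 1))" by (intro divide_pos_pos e mult_pos_pos) (use M in auto)
      obtain V where V: "open V" "0 \<in> V" "\<And>v. v \<in> V \<Longrightarrow> I (\<lambda>x. \<bar>b (x + v) - b x\<bar>) \<le> e / (2 * (M + 1))"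
        by (rule I_translation_continuous[OF b e']) blast
      have "eventually (\<lambda>x. x \<in> {x. x + (- a) \<in> V}) (nhds a)"
        by (rule eventually_nhds_in_open[OF open_translate[OF V(1)]]) (use V in simp)
      hence "eventually (\<lambda>t. dist (I (\<lambda>r. b (r + t) * b r)) (I (\<lambda>r. b (r + a) * b r)) < e) (nhds a)"
      proof eventually_elim
        case (elim t)
        have D: "(\<lambda>r. \<bar>b (r + (t + - a)) - b r\<bar>) \<in> Cc" by (intro Cc_abs Cc_diff Cc_shift b)
        have "\<bar>b (r + t) * b r - b (r + a) * b r\<bar> \<le> M * \<bar>b (r + a + (t + - a)) - b (r + a)\<bar>" for r
        proof -
          have "\<bar>b (r + t) * b r - b (r + a) * b r\<bar> = \<bar>b (r + t) - b (r + a)\<bar> * \<bar>b r\<bar>"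
            by (simp add: left_diff_distrib[symmetric] abs_mult)
          also have "\<dots> \<le> \<bar>b (r + t) - b (r + a)\<bar> * M" by (rule mult_left_mono[OF M(2)]) simp
          finally show ?thesis by (simp add: mult.commute add.assoc)
        qed
        hence "\<bar>I (\<lambda>r. b (r + t) * b r - b (r + a) * b r)\<bar> \<le> I (\<lambda>r. M * \<bar>b (r + a + (t + - a)) - b (r + a)\<bar>)"
          by (intro I_abs_le Cc_diff C0 Cc_cmult Cc_shift[OF D])
        also have "\<dots> = M * I (\<lambda>r. \<bar>b (r + (t + - a)) - b r\<bar>)"
          unfolding I_cmult[OF Cc_shift[OF D]] I_shift[OF D] ..
        also have "\<dots> \<le> M * (e / (2 * (M + 1)))" using V(3) elim M by (intro mult_left_mono) auto
        also have "\<dots> < e" 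
        proof -
          have "0 < M * e + e * 2" by (rule add_nonneg_pos) (use e M(1) in simp_all)
          then show ?thesis using M(1) by (simp add: field_simps)
        qed
        finally show ?case unfolding dist_real_def I_diff[OF C0 C0] .
      qed
      then show "\<forall>\<^sub>F t in at a within UNIV. dist (I (\<lambda>r. b (r + t) * b r)) (I (\<lambda>r. b (r + a) * b r)) < e"
        by (rule filter_leD[rotated]) (simp add: at_within_def)
    qed
  qed
  ultimately show ?thesis by (simp add: pos_def_cts_def continuous_on_of_real)
qed

lemma difference_neighbourhood:
  fixes W :: "'a set"
  assumes "open W" "0 \<in> W"
  obtains V where "open V" "0 \<in> V" "\<And>u v. u \<in> V \<Longrightarrow> v \<in> V \<Longrightarrow> u - v \<in> W"
proof -
  have "open ((\<lambda>p::'a \<times> 'a. fst p - snd p) -` W)" by (intro open_vimage assms continuous_intros)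
  from open_prod_elim[OF this, of "(0, 0)"] assms(2) obtain A B where
    "open A" "open B" "(0, 0) \<in> A \<times> B" "A \<times> B \<subseteq> (\<lambda>p::'a \<times> 'a. fst p - snd p) -` W"
    by auto
  then show ?thesis by (intro that[of "A \<inter> B"]) auto
qed

lemma I_bump_Re_bounds:
  assumes b: "\<beta> \<in> Cc" "\<And>x. 0 \<le> \<beta> x" "I \<beta> = 1" and th: "continuous_on UNIV \<theta>"
  shows "(\<And>x. \<beta> x \<noteq> 0 \<Longrightarrow> Re (\<theta> x) \<le> M) \<Longrightarrow> I (\<lambda>x. \<beta> x * Re (\<theta> x)) \<le> M"
    and "(\<And>x. \<beta> x \<noteq> 0 \<Longrightarrow> M \<le> Re (\<theta> x)) \<Longrightarrow> M \<le> I (\<lambda>x. \<beta> x * Re (\<theta> x))"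
proof -
  have C: "(\<lambda>x. \<beta> x * Re (\<theta> x)) \<in> Cc" by (intro Cc_mult_continuous(1)[OF b(1)] continuous_intros th)
  have M: "I (\<lambda>x. M * \<beta> x) = M" using I_cmult[OF b(1)] b(3) by simp
  show "I (\<lambda>x. \<beta> x * Re (\<theta> x)) \<le> M" if le: "\<And>x. \<beta> x \<noteq> 0 \<Longrightarrow> Re (\<theta> x) \<le> M"
  proof -
    have "\<beta> x * Re (\<theta> x) \<le> M * \<beta> x" for x
      using mult_left_mono[OF le b(2)[of x]] by (cases "\<beta> x = 0") (auto simp: mult.commute)
    from I_mono[OF C Cc_cmult[OF b(1)] this] show ?thesis using M by simp
  qed
  show "M \<le> I (\<lambda>x. \<beta> x * Re (\<theta> x))" if le: "\<And>x. \<beta> x \<noteq> 0 \<Longrightarrow> M \<le> Re (\<theta> x)"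
  proof -
    have "M * \<beta> x \<le> \<beta> x * Re (\<theta> x)" for x
      using mult_left_mono[OF le b(2)[of x]] by (cases "\<beta> x = 0") (auto simp: mult.commute)
    from I_mono[OF Cc_cmult[OF b(1)] C this] show ?thesis using M by simp
  qed
qed

lemma I_Re_add:
  assumes "\<beta> \<in> Cc" "continuous_on UNIV \<theta>" "continuous_on UNIV \<phi>"
  shows "I (\<lambda>x. \<beta> x * Re (\<theta> x + \<phi> x)) = I (\<lambda>x. \<beta> x * Re (\<theta> x)) + I (\<lambda>x. \<beta> x * Re (\<phi> x))"
    and "I (\<lambda>x. \<beta> x * Re (complex_of_real r * \<theta> x)) = r * I (\<lambda>x. \<beta> x * Re (\<theta> x))"
proof -
  have C: "(\<lambda>x. \<beta> x * Re (\<theta> x)) \<in> Cc" "(\<lambda>x. \<beta> x * Re (\<phi> x)) \<in> Cc"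
    by (rule Cc_mult_continuous(1)[OF assms(1)], intro continuous_intros assms)+
  show "I (\<lambda>x. \<beta> x * Re (\<theta> x + \<phi> x)) = I (\<lambda>x. \<beta> x * Re (\<theta> x)) + I (\<lambda>x. \<beta> x * Re (\<phi> x))"
    using I_add[OF C] by (simp add: distrib_left)
  show "I (\<lambda>x. \<beta> x * Re (complex_of_real r * \<theta> x)) = r * I (\<lambda>x. \<beta> x * Re (\<theta> x))"
    using I_cmult[OF C(1), of r] by (simp add: mult.left_commute)
qed

text \<open>The autocorrelation \<open>P\<close> of a bump with small support vanishes at \<open>x0\<close>. The functional \<open>G\<close> rewards
functions with a small value at \<open>x0\<close> and with a mean over a neighbourhood of \<open>0\<close> that is close to \<open>Q 0\<close>.
It is positive at \<open>P\<close>, since there the first term is \<open>1/2\<close> and the second at least \<open>0.8\<close>, in units of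
\<open>P 0\<close>, and \<open>1.1\<close> is subtracted; conversely, \<open>G Q > 0\<close> forces the mean to be at least \<open>0.1\<close>, hence
continuity of the character, and \<open>Re (Q x0) < 0.9\<close>, hence a value different from \<open>1\<close> at \<open>x0\<close>.\<close>
theorem characters_separate_points:
  assumes x0: "x0 \<noteq> 0"
  shows "\<exists>y :: 'a dual. ev y x0 \<noteq> 1"
proof -
  obtain V where V: "open V" "0 \<in> V" "\<And>u v. u \<in> V \<Longrightarrow> v \<in> V \<Longrightarrow> u - v \<in> - {x0}"
    by (rule difference_neighbourhood[of "- {x0}"]) (use x0 in \<open>auto simp: open_Compl\<close>)
  obtain b :: "'a \<Rightarrow> real" where b: "b \<in> Cc" "\<And>x. 0 \<le> b x" "b 0 = 1" "\<And>x. x \<notin> V \<Longrightarrow> b x = 0"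
    by (rule bump_function[OF locally_compact V(1,2)]) blast
  define p where "p t = I (\<lambda>r. b (r + t) * b r)" for t
  define P where "P t = complex_of_real (p t)" for t
  have P: "P \<in> pos_def_cts" unfolding P_def p_def by (rule autocorrelation_pos_def[OF b(1)])
  have Pc: "continuous_on UNIV P" using P by (simp add: pos_def_cts_def)
  have "(\<lambda>r. b (r + x0) * b r) = (\<lambda>r. 0)"
  proof
    fix r show "b (r + x0) * b r = 0" using V(3)[of "r + x0" r] b(4)[of "r + x0"] b(4)[of r] by auto
  qed
  hence Px0: "P x0 = 0" by (simp add: P_def p_def I_zero)
  have p0: "0 < p 0" unfolding p_def
    by (rule I_pos[of "\<lambda>r. b (r + 0) * b r" 0, OF Cc_mult_continuous(1)[OF Cc_shift[OF b(1)] Cc_continuous[OF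
        b(1)]]]) (use b in auto)
  have "open ((\<lambda>t. Re (P t)) -` {0.8 * p 0 <..})" by (intro open_vimage open_greaterThan continuous_intros Pc)
  moreover have "0 \<in> (\<lambda>t. Re (P t)) -` {0.8 * p 0 <..}" using p0 by (simp add: P_def)
  ultimately obtain \<beta> where \<beta>: "\<beta> \<in> Cc" "\<And>x. 0 \<le> \<beta> x" "I \<beta> = 1"
    "\<And>x. x \<notin> (\<lambda>t. Re (P t)) -` {0.8 * p 0 <..} \<Longrightarrow> \<beta> x = 0"
    by (rule normalized_bump) blast
  define G where "G Q = (Re (Q 0) - Re (Q x0)) / 2 + I (\<lambda>t. \<beta> t * Re (Q t)) - 1.1 * Re (Q 0)" for Q :: "'a \<Rightarrow>
      complex"
  have bnd: "\<bar>Re (Q x)\<bar> \<le> Re (Q 0)" if "Q \<in> pos_def_cts" for Q x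
    using pos_def_norm_le[of Q x] abs_Re_le_cmod[of "Q x"] that by (simp add: pos_def_cts_def)
  have bI: "I (\<lambda>t. \<beta> t * Re (Q t)) \<le> Re (Q 0)" if "Q \<in> pos_def_cts" for Q
    by (rule I_bump_Re_bounds(1)[OF \<beta>(1-3)]) (use that bnd[OF that] abs_le_D1 in \<open>auto simp: pos_def_cts_def\<close>)
  have cone: "cone_functional G 1"
    unfolding cone_functional_def
  proof (intro conjI ballI allI impI)
    fix P Q :: "'a \<Rightarrow> complex" and r :: real assume P: "P \<in> pos_def_cts"
    have cP: "continuous_on UNIV P" using P by (simp add: pos_def_cts_def)
    { assume "Q \<in> pos_def_cts"
      hence cQ: "continuous_on UNIV Q" by (simp add: pos_def_cts_def)
      show "G (\<lambda>t. P t + Q t) = G P + G Q"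
        unfolding G_def I_Re_add(1)[OF \<beta>(1) cP cQ] by (simp add: field_simps) }
    { show "G (\<lambda>t. complex_of_real r * P t) = r * G P"
        unfolding G_def I_Re_add(2)[OF \<beta>(1) cP cP] by (simp add: field_simps) }
    show "G P \<le> 1 * Re (P 0)" using bnd[OF P, of x0] bnd[OF P, of 0] bI[OF P] by (simp add: G_def abs_le_iff
        field_simps)
  qed
  have "0.8 * p 0 \<le> I (\<lambda>t. \<beta> t * Re (P t))"
    by (rule I_bump_Re_bounds(2)[OF \<beta>(1-3) Pc]) (use \<beta>(4) in \<open>force simp: vimage_def\<close>)
  hence "0 < G P" using p0 by (simp add: G_def Px0) (simp add: P_def)
  hence ex: "\<exists>P\<in>pos_def_cts. 0 < G P" using P by blast
  have low: "0.1 \<le> I (\<lambda>t. \<beta> t * Re (Q t))" if "Q \<in> pos_def_cts" "Q 0 = 1" "0 < G Q" for Q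
  proof -
    have "- 1 \<le> Re (Q x0)" using bnd[OF that(1), of x0] that(2) by (simp add: abs_le_iff)
    moreover have "0 < (1 - Re (Q x0)) / 2 + I (\<lambda>t. \<beta> t * Re (Q t)) - 1.1" using that(2,3) by (simp add:
        G_def)
    ultimately show ?thesis by argo
  qed
  have "\<exists>y :: 'a dual. \<forall>E \<epsilon>. finite E \<longrightarrow> 0 < \<epsilon> \<longrightarrow>
       (\<exists>Q\<in>pos_def_cts. Q 0 = 1 \<and> 0 < G Q \<and> (\<forall>x\<in>E. norm (Q x - ev y x) < \<epsilon>))"
    by (rule continuous_character_extraction[OF cone ex \<beta>(1), where c = "0.1"]) (use low in auto)
  then obtain y :: "'a dual" where y: "\<forall>E \<epsilon>. finite E \<longrightarrow> 0 < \<epsilon> \<longrightarrow>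
       (\<exists>Q\<in>pos_def_cts. Q 0 = 1 \<and> 0 < G Q \<and> (\<forall>x\<in>E. norm (Q x - ev y x) < \<epsilon>))" by blast
  from y[rule_format, of "{x0}" "0.1"] obtain Q where Q: "Q \<in> pos_def_cts" "Q 0 = 1" "0 < G Q" "norm (Q x0 -
      ev y x0) < 0.1"
    by auto
  have "0 < (1 - Re (Q x0)) / 2 + I (\<lambda>t. \<beta> t * Re (Q t)) - 1.1" using Q(2,3) by (simp add: G_def)
  moreover have "I (\<lambda>t. \<beta> t * Re (Q t)) \<le> 1" using bI[OF Q(1)] Q(2) by simp
  ultimately have "Re (Q x0) < 0.9" by argo
  moreover have "\<bar>Re (Q x0 - ev y x0)\<bar> < 0.1" using abs_Re_le_cmod[of "Q x0 - ev y x0"] Q(4) by linarith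
  ultimately have "ev y x0 \<noteq> 1" by auto
  then show ?thesis by blast
qed

end

section \<open>Adjoints of injective endomorphisms\<close>

context invariant_integral
begin

text \<open>Riemann sums for the measure with density \<open>h\<close>: a partition of unity subordinate to translates of a
small set splits \<open>h\<close> into pieces of masses \<open>m j\<close>, and \<open>s j\<close> is a point in the support of a piece.\<close>
lemma fine_decomposition:
  assumes h: "h \<in> Cc" "\<And>x. 0 \<le> h x" and N: "open N" "0 \<in> N"
  obtains J :: "'a set" and m :: "'a \<Rightarrow> real" and s :: "'a \<Rightarrow> 'a" where "finite J" "\<And>j. j \<in> J \<Longrightarrow> 0 \<le> m j" "\<And>j. j
      \<in> J \<Longrightarrow> h (s j) \<noteq> 0"
    "(\<Sum>j\<in>J. m j) = I h"
    "\<And>f \<delta>. continuous_on UNIV f \<Longrightarrow> (\<And>x y. h x \<noteq> 0 \<Longrightarrow> h y \<noteq> 0 \<Longrightarrow> x - y \<in> N \<Longrightarrow> \<bar>f x - f y\<bar> \<le> \<delta>)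
        \<Longrightarrow> \<bar>(\<Sum>j\<in>J. m j * f (s j)) - I (\<lambda>x. h x * f x)\<bar> \<le> \<delta> * I h"
proof -
  obtain K where K: "compact K" "\<And>x. x \<notin> K \<Longrightarrow> h x = 0" using h(1) by (rule CcE) blast
  obtain V where V: "open V" "0 \<in> V" "\<And>u v. u \<in> V \<Longrightarrow> v \<in> V \<Longrightarrow> u - v \<in> N"
    by (rule difference_neighbourhood[OF N]) blast
  obtain b :: "'a \<Rightarrow> real" where b: "b \<in> Cc" "\<And>x. 0 \<le> b x" "b 0 = 1" "\<And>x. x \<notin> V \<Longrightarrow> b x = 0"
    by (rule bump_function[OF locally_compact V(1,2)]) blast
  have cb: "continuous_on UNIV (\<lambda>x. b (x + e))" for e by (rule Cc_continuous[OF Cc_shift[OF b(1)]])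
  have "open (b -` {1/2<..})" by (rule open_vimage[OF open_greaterThan Cc_continuous[OF b(1)]])
  moreover have "0 \<in> b -` {1/2<..}" using b(3) by simp
  ultimately obtain F where F: "finite F" "\<And>x. x \<in> K \<Longrightarrow> \<exists>e\<in>F. x + e \<in> b -` {1/2<..}"
    by (rule compact_cover_translates[OF K(1)]) blast
  define S where "S x = max (1/2) (\<Sum>e\<in>F. b (x + e))" for x
  have S0: "0 < S x" for x by (simp add: S_def less_max_iff_disj)
  have cS: "continuous_on UNIV S" unfolding S_def by (intro continuous_intros cb)
  have SK: "S x = (\<Sum>e\<in>F. b (x + e))" if "x \<in> K" for x
  proof -
    obtain e where e: "e \<in> F" "1/2 < b (x + e)" using F(2)[OF \<open>x \<in> K\<close>] by auto
    have "b (x + e) \<le> (\<Sum>e\<in>F. b (x + e))" by (rule member_le_sum) (use e F b in auto)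
    then show ?thesis using e by (simp add: S_def)
  qed
  define H where "H e x = h x * (b (x + e) / S x)" for e x
  have HC: "H e \<in> Cc" for e unfolding H_def
    by (rule Cc_mult_continuous(1)[OF h(1)]) (intro continuous_intros cb cS ballI, use S0 in \<open>simp add:
        less_imp_neq[symmetric]\<close>)
  have H0: "0 \<le> H e x" for e x unfolding H_def using h(2) b(2) S0[of x] by (simp add: less_imp_le)
  have Hsum: "(\<Sum>e\<in>F. H e x) = h x" for x
  proof (cases "x \<in> K")
    case True
    have "(\<Sum>e\<in>F. H e x) = h x * ((\<Sum>e\<in>F. b (x + e)) / S x)"
      by (simp add: H_def sum_distrib_left sum_divide_distrib)
    then show ?thesis using SK[OF True] S0[of x] by simp
  qed (simp add: H_def K(2))
  define J where "J = {e\<in>F. \<exists>x. H e x \<noteq> 0}"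
  have J: "finite J" "J \<subseteq> F" using F(1) by (auto simp: J_def)
  define s where "s e = (SOME x. H e x \<noteq> 0)" for e
  have s: "H e (s e) \<noteq> 0" if "e \<in> J" for e
    using that someI_ex[of "\<lambda>x. H e x \<noteq> 0"] by (simp add: J_def s_def)
  have near: "x - s e \<in> N" "h x \<noteq> 0" "h (s e) \<noteq> 0" if "e \<in> J" "H e x \<noteq> 0" for e x
  proof -
    have "x + e \<in> V" "s e + e \<in> V" using that(2) s[OF that(1)] b(4) by (auto simp: H_def)
    from V(3)[OF this] show "x - s e \<in> N" by simp
    show "h x \<noteq> 0" "h (s e) \<noteq> 0" using that(2) s[OF that(1)] by (auto simp: H_def)
  qed
  have JF: "(\<Sum>e\<in>J. g e * H e x) = (\<Sum>e\<in>F. g e * H e x)" for g x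
    by (rule sum.mono_neutral_left) (auto simp: J_def F(1))
  show ?thesis
  proof (rule that[of J "\<lambda>e. I (H e)" s])
    show "finite J" by (rule J)
    show "0 \<le> I (H e)" for e by (rule I_nonneg[OF HC H0])
    show "h (s j) \<noteq> 0" if "j \<in> J" for j using s[OF that] by (auto simp: H_def)
    have "(\<Sum>j\<in>J. I (H j)) = I (\<lambda>x. \<Sum>j\<in>J. H j x)" by (rule I_sum[OF HC, symmetric])
    also have "(\<lambda>x. \<Sum>j\<in>J. H j x) = h" using JF[of "\<lambda>_. 1"] Hsum by auto
    finally show sumI: "(\<Sum>j\<in>J. I (H j)) = I h" .
    fix f :: "'a \<Rightarrow> real" and \<delta> assume f: "continuous_on UNIV f" and d: "\<And>x y. h x \<noteq> 0 \<Longrightarrow> h y \<noteq> 0 \<Longrightarrow> x - y \<in> N \<Longrightarrow>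
        \<bar>f x - f y\<bar> \<le> \<delta>"
    have HfC: "(\<lambda>x. H j x * f x) \<in> Cc" for j by (rule Cc_mult_continuous(1)[OF HC f])
    have "I (\<lambda>x. h x * f x) = I (\<lambda>x. \<Sum>j\<in>J. H j x * f x)"
      using JF[of "\<lambda>_. 1"] Hsum by (simp add: sum_distrib_right[symmetric])
    also have "\<dots> = (\<Sum>j\<in>J. I (\<lambda>x. H j x * f x))" by (rule I_sum[OF HfC])
    finally have "(\<Sum>j\<in>J. I (H j) * f (s j)) - I (\<lambda>x. h x * f x) = (\<Sum>j\<in>J. f (s j) * I (H j) - I (\<lambda>x. H j x * f
        x))"
      by (simp add: sum_subtractf mult.commute)
    also have "\<dots> = (\<Sum>j\<in>J. I (\<lambda>x. f (s j) * H j x - H j x * f x))"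
      by (simp add: I_diff[OF Cc_cmult[OF HC] HfC] I_cmult[OF HC])
    finally have "\<bar>(\<Sum>j\<in>J. I (H j) * f (s j)) - I (\<lambda>x. h x * f x)\<bar> \<le> (\<Sum>j\<in>J. \<bar>I (\<lambda>x. f (s j) * H j x - H j x * f
        x)\<bar>)"
      by (simp only: sum_abs)
    also have "\<dots> \<le> (\<Sum>j\<in>J. \<delta> * I (H j))"
    proof (rule sum_mono)
      fix j assume j: "j \<in> J"
      have "\<bar>f (s j) * H j x - H j x * f x\<bar> \<le> \<delta> * H j x" for x
      proof (cases "H j x = 0")
        case False
        have "f (s j) * H j x - H j x * f x = - ((f x - f (s j)) * H j x)" by (simp add: algebra_simps)
        hence "\<bar>f (s j) * H j x - H j x * f x\<bar> = \<bar>f x - f (s j)\<bar> * H j x"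
          using H0[of j x] by (simp only: abs_minus_cancel abs_mult abs_of_nonneg)
        also have "\<dots> \<le> \<delta> * H j x"
          by (rule mult_right_mono[OF d H0]) (use near[OF j False] in auto)
        finally show ?thesis .
      qed simp
      from I_abs_le[OF Cc_diff[OF Cc_cmult[OF HC] HfC] Cc_cmult[OF HC] this]
      show "\<bar>I (\<lambda>x. f (s j) * H j x - H j x * f x)\<bar> \<le> \<delta> * I (H j)" by (simp add: I_cmult[OF HC])
    qed
    also have "\<dots> = \<delta> * I h" by (simp add: sum_distrib_left[symmetric] sumI)
    finally show "\<bar>(\<Sum>j\<in>J. I (H j) * f (s j)) - I (\<lambda>x. h x * f x)\<bar> \<le> \<delta> * I h" .
  qed
qed

text \<open>The square root of a Reiter function, by \<open>(p - q)\<^sup>2 \<le> |p\<^sup>2 - q\<^sup>2|\<close> for \<open>p, q \<ge> 0\<close>.\<close>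
lemma L2_Reiter_function:
  assumes D: "compact D" and e: "0 < \<eta>"
  obtains h where "h \<in> Cc" "\<And>x. 0 \<le> h x" "\<And>x. I (\<lambda>s. h s * h (x + s)) \<le> 1"
    "I (\<lambda>s. h s * h (0 + s)) = 1" "\<And>x. x \<in> D \<Longrightarrow> 1 - \<eta> \<le> I (\<lambda>s. h s * h (x + s))"
proof -
  obtain g where g: "g \<in> Cc" "\<And>x. 0 \<le> g x" "I g = 1" "\<And>x. x \<in> D \<Longrightarrow> I (\<lambda>t. \<bar>g (t + x) - g t\<bar>) \<le> \<eta>"
    by (rule Reiter_function[OF D e]) blast
  define h where "h x = sqrt (g x)" for x
  obtain K where K: "compact K" "\<And>x. x \<notin> K \<Longrightarrow> g x = 0" using g(1) by (rule CcE) blast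
  have hC: "h \<in> Cc"
    by (rule CcI[OF _ K(1)]) (auto simp: h_def K(2) intro!: continuous_on_real_sqrt Cc_continuous[OF g(1)])
  have hh: "h x * h x = g x" for x by (simp add: h_def g(2))
  have h0: "0 \<le> h x" for x by (simp add: h_def g(2))
  have sh: "(\<lambda>s. g (s + x)) \<in> Cc" for x by (rule Cc_shift[OF g(1)])
  have C: "(\<lambda>s. h s * h (x + s)) \<in> Cc" for x
    using Cc_mult_continuous(1)[OF hC Cc_continuous[OF Cc_shift[OF hC, of x]]] by (simp add: add.commute)
  have ineq: "h s * h (x + s) \<le> (1/2) * (g (s + x) + g s)" "\<bar>(1/2) * (g (s + x) + g s) - h s * h (x + s)\<bar> \<le>
      (1/2) * \<bar>g (s + x) - g s\<bar>" for s x
  proof -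
    define p q where "p = h s" and "q = h (x + s)"
    have pq: "g s = p * p" "g (s + x) = q * q" "0 \<le> p" "0 \<le> q" by (simp_all add: p_def q_def hh h0
        add.commute)
    have eq: "(1/2) * (q * q + p * p) - p * q = (1/2) * ((q - p) * (q - p))" by (simp add: algebra_simps)
    have "0 \<le> (q - p) * (q - p)" by simp
    with eq show "h s * h (x + s) \<le> (1/2) * (g (s + x) + g s)" unfolding pq p_def[symmetric] q_def[symmetric]
        by linarith
    have "(q - p) * (q - p) = \<bar>q - p\<bar> * \<bar>q - p\<bar>" by simp
    also have "\<dots> \<le> \<bar>q - p\<bar> * \<bar>q + p\<bar>" using pq(3,4) by (intro mult_left_mono) auto
    also have "\<dots> = \<bar>(q - p) * (q + p)\<bar>" by (rule abs_mult[symmetric])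
    also have "(q - p) * (q + p) = q * q - p * p" by (simp add: algebra_simps)
    finally have "(q - p) * (q - p) \<le> \<bar>q * q - p * p\<bar>" .
    then show "\<bar>(1/2) * (g (s + x) + g s) - h s * h (x + s)\<bar> \<le> (1/2) * \<bar>g (s + x) - g s\<bar>"
      unfolding pq p_def[symmetric] q_def[symmetric] eq by (simp add: abs_mult)
  qed
  have half: "I (\<lambda>s. (1/2) * (g (s + x) + g s)) = 1" for x
    by (simp only: I_cmult[OF Cc_add[OF sh g(1)]] I_add[OF sh g(1)] I_shift[OF g(1)] g(3)) simp
  show ?thesis
  proof (rule that[OF hC h0])
    show "I (\<lambda>s. h s * h (x + s)) \<le> 1" for x
      using I_mono[OF C Cc_cmult[OF Cc_add[OF sh g(1)]] ineq(1), of x] half[of x] by simp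
    show "I (\<lambda>s. h s * h (0 + s)) = 1" using hh g(3) by simp
    fix x assume x: "x \<in> D"
    have "\<bar>I (\<lambda>s. (1/2) * (g (s + x) + g s) - h s * h (x + s))\<bar> \<le> I (\<lambda>s. (1/2) * \<bar>g (s + x) - g s\<bar>)"
      by (rule I_abs_le[OF Cc_diff[OF Cc_cmult[OF Cc_add[OF sh g(1)]] C] Cc_cmult[OF Cc_abs[OF Cc_diff[OF sh
          g(1)]]] ineq(2)])
    also have "\<dots> = (1/2) * I (\<lambda>s. \<bar>g (s + x) - g s\<bar>)" by (rule I_cmult[OF Cc_abs[OF Cc_diff[OF sh g(1)]]])
    also have "\<dots> \<le> (1/2) * \<eta>" using g(4)[OF x] by simp
    finally have "\<bar>1 - I (\<lambda>s. h s * h (x + s))\<bar> \<le> (1/2) * \<eta>"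
      unfolding I_diff[OF Cc_cmult[OF Cc_add[OF sh g(1)]] C] half .
    then show "1 - \<eta> \<le> I (\<lambda>s. h s * h (x + s))" using e by argo
  qed
qed

text \<open>On a compact set a continuous injection is a homeomorphism onto its image.\<close>
lemma small_image_small_point:
  fixes E :: "'a \<Rightarrow> 'a"
  assumes E: "continuous_on UNIV E" "Modules.additive E" "inj E" and C: "compact C" and N: "open N" "0 \<in> N"
  obtains W where "open W" "0 \<in> W" "\<And>u. u \<in> C \<Longrightarrow> E u \<in> W \<Longrightarrow> u \<in> N"
proof -
  have "compact (C - N)" using compact_diff[OF C N(1)] .
  hence "compact (E ` (C - N))" using E(1) by (meson compact_continuous_image continuous_on_subset
      top_greatest)
  hence "closed (E ` (C - N))" by (rule compact_imp_closed)
  moreover have "0 \<notin> E ` (C - N)"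
  proof
    assume "0 \<in> E ` (C - N)"
    then obtain u where u: "u \<in> C - N" "E u = E 0" using additive.zero[OF E(2)] by auto
    then show False using E(3) N(2) by (metis DiffD2 injD)
  qed
  ultimately show ?thesis by (intro that[of "- E ` (C - N)"]) (auto simp: open_Compl)
qed

text \<open>On the image of \<open>E\<close>, the function \<open>E x \<mapsto> ev y x\<close> is a homomorphism but need not be continuous. A
continuous positive definite \<open>P\<close> with \<open>P (E x)\<close> close to \<open>ev y x * P 0\<close> on \<open>D\<close> is obtained by smearing it:
\<open>P t\<close> is the sum over \<open>j\<close>, \<open>k\<close> of \<open>m j * m k * ev y (s j - s k) * p (t - E (s j - s k))\<close>, where \<open>p\<close> is the
autocorrelation of a bump \<open>b\<close> and the \<open>m j\<close>, \<open>s j\<close> discretise an \<open>L\<^sup>2\<close> Reiter function \<open>h\<close> for \<open>D\<close>. The support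
of \<open>b\<close> is so small that at \<open>t = E x\<close> only those terms count for which \<open>x - s j + s k\<close> is small in \<open>X\<close>;
there \<open>ev y (s j - s k)\<close> nearly agrees with \<open>ev y x\<close>. What remains is the sum \<open>R x\<close> without characters.
It approximates a constant times \<open>A x\<close>, the correlation of \<open>h\<close> with its translate by \<open>x\<close>, which is
nearly \<open>1\<close> on \<open>D\<close>.\<close>
lemma pos_def_lifting_character:
  fixes E :: "'a \<Rightarrow> 'a" and y :: "'a dual"
  assumes E: "continuous_on UNIV E" "Modules.additive E" "inj E" and D: "compact D"
  obtains P where "P \<in> pos_def_cts" "0 < Re (P 0)" "\<And>x. x \<in> D \<Longrightarrow> 0.8 * Re (P 0) \<le> Re (cnj (ev y x) * P (E x))"
proof -
  interpret E: additive E by (rule E(2))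
  have yc: "continuous_on UNIV (ev y)" and yn: "\<And>x. norm (ev y x) = 1" and ym: "\<And>u v. ev y (u + v) = ev y u *
      ev y v"
    using ev[of y] by auto
  have y0: "ev y 0 = 1" using ym[of 0 0] yn[of 0] by auto
  define \<eta> :: real where "\<eta> = 1/100"
  have \<eta>: "0 < \<eta>" by (simp add: \<eta>_def)
  obtain h where h: "h \<in> Cc" "\<And>x. 0 \<le> h x" "\<And>x. I (\<lambda>s. h s * h (x + s)) \<le> 1"
    "I (\<lambda>s. h s * h (0 + s)) = 1" "\<And>x. x \<in> D \<Longrightarrow> 1 - \<eta> \<le> I (\<lambda>s. h s * h (x + s))"
    by (rule L2_Reiter_function[OF D \<eta>]) blast
  define A where "A x = I (\<lambda>s. h s * h (x + s))" for x
  obtain L where L: "compact L" "\<And>x. x \<notin> L \<Longrightarrow> h x = 0" using h(1) by (rule CcE) blast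
  have hI: "0 \<le> I h" by (rule I_nonneg[OF h(1,2)])
  define c where "c = I h + 1"
  have c: "0 < c" "I h \<le> c" using hI by (simp_all add: c_def)
  define \<eta>' where "\<eta>' = \<eta> / c"
  have \<eta>': "0 < \<eta>'" using \<eta> c by (simp add: \<eta>'_def)
  obtain V1 where V1: "open V1" "0 \<in> V1" "\<And>x v. v \<in> V1 \<Longrightarrow> \<bar>h (x + v) - h x\<bar> < \<eta>'"
    by (rule Cc_uniformly_continuous[OF h(1) \<eta>']) blast
  define V2 where "V2 = V1 \<inter> (\<lambda>v. norm (ev y v - 1)) -` {..<\<eta>}"
  have "open V2" "0 \<in> V2" unfolding V2_def using V1 \<eta> y0
    by (auto intro!: open_Int open_vimage continuous_intros yc)
  then obtain N1 where N1: "open N1" "0 \<in> N1" "N1 \<subseteq> V2" "\<And>x. x \<in> N1 \<Longrightarrow> - x \<in> N1"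
    by (rule symmetric_neighbourhood) blast
  define D0 where "D0 = insert 0 D"
  have D0: "compact D0" using D by (simp add: D0_def)
  define f where "f = (\<lambda>p :: 'a \<times> 'a \<times> 'a. fst p + fst (snd p) + - snd (snd p))"
  define C where "C = f ` (D0 \<times> L \<times> L)"
  have cC: "compact C" unfolding C_def f_def by (intro compact_continuous_image compact_Times D0 L
      continuous_intros)
  have CI: "x + u - v \<in> C" if "x \<in> D0" "u \<in> L" "v \<in> L" for x u v
    unfolding C_def by (rule image_eqI[where x = "(x, u, v)"]) (use that in \<open>auto simp: f_def\<close>)
  have "compact (C \<union> uminus ` C)" by (intro compact_Un cC compact_continuous_image continuous_intros)
  then obtain \<zeta>0 :: "'a \<Rightarrow> real" where z0: "\<zeta>0 \<in> Cc" "\<And>x. 0 \<le> \<zeta>0 x" "\<And>x. \<zeta>0 x \<le> 1" "\<And>x. x \<in> C \<union> uminus ` C \<Longrightarrow> \<zeta>0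
      x = 1"
    by (rule cutoff_function[OF locally_compact]) blast
  define \<zeta> where "\<zeta> x = \<zeta>0 x * \<zeta>0 (- x)" for x
  have z0m: "continuous_on UNIV (\<lambda>x. \<zeta>0 (- x))"
    by (intro continuous_on_UNIV_compose[OF Cc_continuous[OF z0(1)]] continuous_intros)
  have "\<zeta> = (\<lambda>x. \<zeta>0 x * \<zeta>0 (- x))" by (rule ext) (rule \<zeta>_def)
  hence \<zeta>: "\<zeta> \<in> Cc" "\<And>x. 0 \<le> \<zeta> x" "\<And>x. x \<in> C \<Longrightarrow> \<zeta> x = 1" "\<And>x. \<zeta> (- x) = \<zeta> x"
    using Cc_mult_continuous(1)[OF z0(1) z0m] z0(2,4) by (auto simp: \<zeta>_def mult.commute)
  obtain C' where C': "compact C'" "\<And>x. x \<notin> C' \<Longrightarrow> \<zeta> x = 0" using \<zeta>(1) by (rule CcE) blast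
  obtain W where W: "open W" "0 \<in> W" "\<And>u. u \<in> C' \<Longrightarrow> E u \<in> W \<Longrightarrow> u \<in> N1"
    by (rule small_image_small_point[OF E C'(1) N1(1,2)]) blast
  obtain V where V: "open V" "0 \<in> V" "\<And>u v. u \<in> V \<Longrightarrow> v \<in> V \<Longrightarrow> u - v \<in> W"
    by (rule difference_neighbourhood[OF W(1,2)]) blast
  obtain b :: "'a \<Rightarrow> real" where b: "b \<in> Cc" "\<And>x. 0 \<le> b x" "b 0 = 1" "\<And>x. x \<notin> V \<Longrightarrow> b x = 0"
    by (rule bump_function[OF locally_compact V(1,2)]) blast
  define p where "p t = I (\<lambda>r. b (r + t) * b r)" for t
  have bC: "(\<lambda>r. b (r + t) * b r) \<in> Cc" for t
    by (rule Cc_mult_continuous(1)[OF Cc_shift[OF b(1)] Cc_continuous[OF b(1)]])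
  have p: "(\<lambda>t. complex_of_real (p t)) \<in> pos_def_cts" unfolding p_def by (rule autocorrelation_pos_def[OF
      b(1)])
  have pc: "continuous_on UNIV p"
  proof -
    have "continuous_on UNIV (\<lambda>t. Re (complex_of_real (p t)))"
      using p by (intro continuous_intros) (simp add: pos_def_cts_def)
    then show ?thesis by simp
  qed
  have p_nonneg: "0 \<le> p t" for t unfolding p_def by (rule I_nonneg[OF bC]) (simp add: b)
  have p0: "0 < p 0" unfolding p_def by (rule I_pos[of "\<lambda>r. b (r + 0) * b r" 0, OF bC]) (use b in auto)
  have p_minus: "p (- t) = p t" for t
    using I_shift[OF bC[of "- t"], of t] by (simp add: p_def mult.commute)
  have p_supp: "t \<in> W" if "p t \<noteq> 0" for t
  proof (rule ccontr)
    assume "t \<notin> W"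
    hence "b (r + t) * b r = 0" for r using V(3)[of "r + t" r] b(4)[of "r + t"] b(4)[of r] by auto
    with that show False by (simp add: p_def I_zero)
  qed
  \<comment> \<open>The cutoff \<open>\<zeta>\<close> equals \<open>1\<close> at all arguments \<open>x + s k - s j\<close> that occur. It is needed because \<open>p \<circ> E\<close>
    need not have compact support.\<close>
  define q where "q u = \<zeta> u * p (E u)" for u
  have pEc: "continuous_on UNIV (\<lambda>u. p (E u))" by (rule continuous_on_UNIV_compose[OF pc E(1)])
  have qC: "q \<in> Cc" unfolding q_def by (rule Cc_mult_continuous(1)[OF \<zeta>(1) pEc])
  have q0: "0 \<le> q u" for u by (simp add: q_def \<zeta>(2) p_nonneg)
  have q_minus: "q (- u) = q u" for u by (simp add: q_def \<zeta>(4) E.minus p_minus)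
  have q_supp: "u \<in> N1" if "q u \<noteq> 0" for u
    using that C'(2)[of u] W(3)[of u] p_supp[of "E u"] by (auto simp: q_def)
  have q_C: "q u = p (E u)" if "u \<in> C" for u using \<zeta>(3)[OF that] by (simp add: q_def)
  have "\<exists>l. h l \<noteq> 0"
  proof (rule ccontr)
    assume "\<nexists>l. h l \<noteq> 0"
    hence "(\<lambda>s. h s * h (0 + s)) = (\<lambda>s. 0)" by auto
    with h(4) show False by (simp add: I_zero)
  qed
  then obtain l where "h l \<noteq> 0" by blast
  hence "0 \<in> C" using CI[of 0 l l] L(2)[of l] by (auto simp: D0_def)
  hence "0 < q 0" using q_C[of 0] p0 by (simp add: E.zero)
  hence Iq: "0 < I q" by (intro I_pos[OF qC q0])
  define \<delta> where "\<delta> = \<eta> * I q / (c * c)"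
  have \<delta>: "0 < \<delta>" using \<eta> Iq c by (simp add: \<delta>_def)
  obtain N2 where N2: "open N2" "0 \<in> N2" "\<And>x v. v \<in> N2 \<Longrightarrow> \<bar>q (x + v) - q x\<bar> < \<delta>"
    by (rule Cc_uniformly_continuous[OF qC \<delta>]) blast
  have N12: "open (N1 \<inter> N2)" "0 \<in> N1 \<inter> N2" using N1 N2 by auto
  obtain J :: "'a set" and m :: "'a \<Rightarrow> real" and s :: "'a \<Rightarrow> 'a" where J: "finite J" "\<And>j. j \<in> J \<Longrightarrow> 0 \<le> m j" "\<And>j.
      j \<in> J \<Longrightarrow> h (s j) \<noteq> 0"
    "(\<Sum>j\<in>J. m j) = I h" and
    Riemann: "\<And>f \<delta>. continuous_on UNIV f \<Longrightarrow> (\<And>x y. h x \<noteq> 0 \<Longrightarrow> h y \<noteq> 0 \<Longrightarrow> x - y \<in> N1 \<inter> N2 \<Longrightarrow> \<bar>f x - f y\<bar> \<le> \<delta>)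
        \<Longrightarrow> \<bar>(\<Sum>j\<in>J. m j * f (s j)) - I (\<lambda>x. h x * f x)\<bar> \<le> \<delta> * I h"
    by (rule fine_decomposition[OF h(1,2) N12]) blast
  define R where "R x = (\<Sum>j\<in>J. \<Sum>k\<in>J. m j * m k * q (x + s k - s j))" for x
  have sL: "s j \<in> L" if "j \<in> J" for j using J(3)[OF that] L(2) by blast
  have qr: "I (\<lambda>t. q (u - t)) = I q" for u
  proof -
    have "(\<lambda>t. q (u - t)) = (\<lambda>t. q (t + - u))" using q_minus by (metis add.commute minus_diff_eq
        uminus_add_conv_diff)
    then show ?thesis using I_shift[OF qC, of "- u"] by (simp only:)
  qed
  have qrC: "(\<lambda>t. q (u - t)) \<in> Cc" for u by (rule Cc_reflect[OF qC])
  have inner: "\<bar>(\<Sum>j\<in>J. m j * q (u - s j)) - h u * I q\<bar> \<le> \<delta> * I h + \<eta>' * I q" for u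
  proof -
    have "\<bar>(\<Sum>j\<in>J. m j * q (u - s j)) - I (\<lambda>x. h x * q (u - x))\<bar> \<le> \<delta> * I h"
    proof (rule Riemann[OF Cc_continuous[OF qrC]])
      fix x z assume "x - z \<in> N1 \<inter> N2"
      hence "\<bar>q (u - x + (x - z)) - q (u - x)\<bar> < \<delta>" using N2(3) by blast
      then show "\<bar>q (u - x) - q (u - z)\<bar> \<le> \<delta>" by (simp add: abs_minus_commute)
    qed
    moreover have "\<bar>I (\<lambda>x. h x * q (u - x)) - h u * I q\<bar> \<le> \<eta>' * I q"
    proof -
      have C1: "(\<lambda>x. h x * q (u - x)) \<in> Cc" by (rule Cc_mult_continuous(1)[OF h(1) Cc_continuous[OF qrC]])
      have "\<bar>h x * q (u - x) - h u * q (u - x)\<bar> \<le> \<eta>' * q (u - x)" for x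
      proof (cases "q (u - x) = 0")
        case False
        hence "- (u - x) \<in> V1" using q_supp N1 by (force simp: V2_def)
        from V1(3)[OF this, of u] have "\<bar>h x - h u\<bar> \<le> \<eta>'" by simp
        hence "\<bar>h x - h u\<bar> * q (u - x) \<le> \<eta>' * q (u - x)" by (rule mult_right_mono[OF _ q0])
        then show ?thesis by (simp add: left_diff_distrib[symmetric] abs_mult abs_of_nonneg[OF q0])
      qed simp
      from I_abs_le[OF Cc_diff[OF C1 Cc_cmult[OF qrC]] Cc_cmult[OF qrC] this]
      show ?thesis by (simp only: I_diff[OF C1 Cc_cmult[OF qrC]] I_cmult[OF qrC] qr)
    qed
    ultimately show ?thesis by linarith
  qed
  have Rbound: "\<bar>R x - I q * A x\<bar> \<le> 3 * \<eta> * I q" for x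
  proof -
    have R_eq: "R x = (\<Sum>k\<in>J. m k * (\<Sum>j\<in>J. m j * q (x + s k - s j)))"
      unfolding R_def by (subst sum.swap) (simp add: sum_distrib_left algebra_simps)
    have "\<bar>R x - (\<Sum>k\<in>J. m k * (h (x + s k) * I q))\<bar> = \<bar>\<Sum>k\<in>J. m k * ((\<Sum>j\<in>J. m j * q (x + s k - s j)) - h (x + s
        k) * I q)\<bar>"
      unfolding R_eq by (simp only: sum_subtractf right_diff_distrib)
    also have "\<dots> \<le> (\<Sum>k\<in>J. \<bar>m k * ((\<Sum>j\<in>J. m j * q (x + s k - s j)) - h (x + s k) * I q)\<bar>)" by (rule sum_abs)
    also have "\<dots> \<le> (\<Sum>k\<in>J. m k * (\<delta> * I h + \<eta>' * I q))"
      by (intro sum_mono) (use inner J(2) in \<open>auto simp: abs_mult intro!: mult_left_mono\<close>)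
    also have "\<dots> = I h * (\<delta> * I h + \<eta>' * I q)" by (simp add: sum_distrib_right[symmetric] J(4))
    finally have 1: "\<bar>R x - (\<Sum>k\<in>J. m k * (h (x + s k) * I q))\<bar> \<le> I h * (\<delta> * I h + \<eta>' * I q)" .
    have hc: "continuous_on UNIV (\<lambda>t. h (x + t))"
      using Cc_continuous[OF Cc_shift[OF h(1), of x]] by (simp add: add.commute)
    have "\<bar>(\<Sum>k\<in>J. m k * h (x + s k)) - A x\<bar> \<le> \<eta>' * I h"
      unfolding A_def
    proof (rule Riemann[OF hc])
      fix u z assume "u - z \<in> N1 \<inter> N2"
      hence "u - z \<in> V1" using N1(3) by (auto simp: V2_def)
      from V1(3)[OF this, of "x + z"] show "\<bar>h (x + u) - h (x + z)\<bar> \<le> \<eta>'" by simp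
    qed
    hence "\<bar>(\<Sum>k\<in>J. m k * h (x + s k)) - A x\<bar> * I q \<le> \<eta>' * I h * I q" by (rule mult_right_mono) (use Iq in
        simp)
    moreover have "(\<Sum>k\<in>J. m k * (h (x + s k) * I q)) = (\<Sum>k\<in>J. m k * h (x + s k)) * I q"
      by (simp add: sum_distrib_right mult.assoc)
    hence "(\<Sum>k\<in>J. m k * (h (x + s k) * I q)) - I q * A x = ((\<Sum>k\<in>J. m k * h (x + s k)) - A x) * I q"
      unfolding left_diff_distrib by (simp only: mult.commute[of "I q" "A x"])
    ultimately have 2: "\<bar>(\<Sum>k\<in>J. m k * (h (x + s k) * I q)) - I q * A x\<bar> \<le> \<eta>' * I h * I q"
      using Iq by (simp only: abs_mult abs_of_pos)
    have 3: "\<eta>' * I h \<le> \<eta>" using c \<eta> by (simp add: \<eta>'_def field_simps)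
    hence k3: "\<eta>' * I h * I q \<le> \<eta> * I q" by (rule mult_right_mono) (use Iq in simp)
    have "I h * I h \<le> c * c" using c hI by (intro mult_mono) auto
    hence "\<delta> * (I h * I h) \<le> \<delta> * (c * c)" using \<delta> by (intro mult_left_mono) auto
    also have "\<dots> = \<eta> * I q" using c by (simp add: \<delta>_def)
    finally have 4: "\<delta> * (I h * I h) \<le> \<eta> * I q" .
    have "I h * (\<delta> * I h + \<eta>' * I q) = \<delta> * (I h * I h) + \<eta>' * I h * I q" by (simp add: algebra_simps)
    moreover define X where "X = (\<Sum>k\<in>J. m k * (h (x + s k) * I q))"
    moreover have "\<bar>R x - I q * A x\<bar> \<le> \<bar>R x - X\<bar> + \<bar>X - I q * A x\<bar>" by simp
    ultimately show ?thesis using 1 2 k3 4 by linarith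
  qed
  define P where "P t = (\<Sum>j\<in>J. \<Sum>k\<in>J. (m j * ev y (s j)) * cnj (m k * ev y (s k)) * complex_of_real (p (t + - E
      (s j) - - E (s k))))" for t
  have P: "P \<in> pos_def_cts" unfolding P_def by (rule pos_def_cts_twist[OF p J(1)])
  have PR: "norm (cnj (ev y x) * P (E x) - complex_of_real (R x)) \<le> \<eta> * R x" if x: "x \<in> D0" for x
  proof -
    have Ein: "E x + - E (s j) - - E (s k) = E (x + s k - s j)" for j k by (simp add: E.add E.diff)
    have "norm (cnj (ev y x) * P (E x) - complex_of_real (R x)) =
       norm (\<Sum>j\<in>J. \<Sum>k\<in>J. complex_of_real (m j * m k * q (x + s k - s j)) * (cnj (ev y x) * ev y (s j) * cnj
           (ev y (s k)) - 1))"
    proof -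
      have "cnj (ev y x) * P (E x) = (\<Sum>j\<in>J. \<Sum>k\<in>J. complex_of_real (m j * m k * q (x + s k - s j)) * (cnj (ev y
          x) * ev y (s j) * cnj (ev y (s k))))"
        unfolding P_def Ein sum_distrib_left using q_C[OF CI[OF x sL sL]]
        by (intro sum.cong refl) (simp add: algebra_simps)
      then show ?thesis by (simp add: R_def right_diff_distrib sum_subtractf)
    qed
    also have "\<dots> \<le> (\<Sum>j\<in>J. \<Sum>k\<in>J. norm (complex_of_real (m j * m k * q (x + s k - s j)) * (cnj (ev y x) * ev y
        (s j) * cnj (ev y (s k)) - 1)))"
      by (rule order_trans[OF norm_sum]) (intro sum_mono norm_sum)
    also have "\<dots> \<le> (\<Sum>j\<in>J. \<Sum>k\<in>J. \<eta> * (m j * m k * q (x + s k - s j)))"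
    proof (intro sum_mono)
      fix j k assume jk: "j \<in> J" "k \<in> J"
      show "norm (complex_of_real (m j * m k * q (x + s k - s j)) * (cnj (ev y x) * ev y (s j) * cnj (ev y (s
          k)) - 1))
          \<le> \<eta> * (m j * m k * q (x + s k - s j))"
      proof (cases "q (x + s k - s j) = 0")
        case False
        define u where "u = - (x + s k - s j)"
        have "u \<in> V2" unfolding u_def by (rule subsetD[OF N1(3) N1(4)[OF q_supp[OF False]]])
        hence un: "norm (ev y u - 1) \<le> \<eta>" by (simp add: V2_def)
        have cnj_ev: "cnj (ev y v) * ev y v = 1" for v
          using complex_norm_square[of "ev y v"] yn[of v] by (simp add: mult.commute)
        have "ev y (s j) = ev y x * ev y (s k) * ev y u" by (simp add: ym[symmetric] u_def algebra_simps)
        hence "cnj (ev y x) * ev y (s j) * cnj (ev y (s k)) = (cnj (ev y x) * ev y x) * (cnj (ev y (s k)) * ev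
            y (s k)) * ev y u"
          by (simp add: algebra_simps)
        also have "\<dots> = ev y u" by (simp add: cnj_ev)
        finally have eq: "cnj (ev y x) * ev y (s j) * cnj (ev y (s k)) = ev y u" .
        have pos: "0 \<le> m j * m k * q (x + s k - s j)" using J(2) jk q0 by simp
        show ?thesis unfolding eq norm_mult norm_of_real abs_of_nonneg[OF pos]
          using mult_left_mono[OF un pos] by (simp add: mult.commute)
      qed simp
    qed
    also have "\<dots> = \<eta> * R x" by (simp add: R_def sum_distrib_left)
    finally show ?thesis .
  qed
  have A0: "A 0 = 1" and A1: "A x \<le> 1" for x using h(3)[of x] h(4) by (simp_all add: A_def)
  have Rle: "R x \<le> (1 + 3 * \<eta>) * I q" for x
  proof -
    have "I q * A x \<le> I q" using A1[of x] Iq by simp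
    then show ?thesis using Rbound[of x] by (simp add: abs_le_iff algebra_simps)
  qed
  have key: "\<bar>Re (cnj (ev y x) * P (E x)) - R x\<bar> \<le> \<eta> * ((1 + 3 * \<eta>) * I q)" if "x \<in> D0" for x
  proof -
    have "\<bar>Re (cnj (ev y x) * P (E x) - complex_of_real (R x))\<bar> \<le> \<eta> * R x"
      using PR[OF that] abs_Re_le_cmod order_trans by blast
    also have "\<dots> \<le> \<eta> * ((1 + 3 * \<eta>) * I q)" using Rle \<eta> by (intro mult_left_mono) auto
    finally show ?thesis by simp
  qed
  have k0: "\<bar>Re (P 0) - R 0\<bar> \<le> \<eta> * ((1 + 3 * \<eta>) * I q)"
    using key[of 0] by (simp add: D0_def y0 E.zero)
  have r0: "\<bar>R 0 - I q\<bar> \<le> 3 * \<eta> * I q" using Rbound[of 0] A0 by simp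
  have P0: "0.9 * I q \<le> Re (P 0)" "Re (P 0) \<le> 1.1 * I q"
    using k0 r0 Iq unfolding \<eta>_def by argo+
  show ?thesis
  proof (rule that[OF P])
    show "0 < Re (P 0)" using P0 Iq by argo
    fix x assume x: "x \<in> D"
    have "(1 - \<eta>) * I q \<le> A x * I q" using h(5)[OF x] Iq unfolding A_def by (intro mult_right_mono) auto
    hence lo: "(1 - \<eta>) * I q - 3 * \<eta> * I q \<le> R x" using Rbound[of x] by (simp add: abs_le_iff algebra_simps)
    have "\<bar>Re (cnj (ev y x) * P (E x)) - R x\<bar> \<le> \<eta> * ((1 + 3 * \<eta>) * I q)" using key[of x] x by (simp only:
        D0_def insert_iff simp_thms)
    hence "0.9 * I q \<le> Re (cnj (ev y x) * P (E x))" using lo Iq unfolding \<eta>_def by argo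
    then show "0.8 * Re (P 0) \<le> Re (cnj (ev y x) * P (E x))" using P0 Iq by argo
  qed
qed

text \<open>The functional adds the mean of \<open>cnj (ev y x) * Q (E x)\<close> against a Reiter function \<open>k\<close> for \<open>- K\<close> and the
mean of \<open>Q\<close> over a neighbourhood of \<open>0\<close>. It is positive at the function of the preceding lemma,
because \<open>0.8 + 0.8 > 5/4\<close>, and, for \<open>Q 0 = 1\<close>, where it is positive both means are at least \<open>1/4\<close>. The
second mean makes the extracted character \<open>y'\<close> continuous. The first one, with the near invariance
of \<open>k\<close> under \<open>K\<close>, brings \<open>cnj (ev y x) * ev y' (E x)\<close> close to \<open>1\<close> for \<open>x \<in> K\<close>.\<close>
theorem adjoint_of_injective_has_dense_range:
  fixes E :: "'a \<Rightarrow> 'a" and y :: "'a dual"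
  assumes E: "continuous_on UNIV E" "Modules.additive E" "inj E" and K: "compact K" and e: "0 < \<epsilon>"
  shows "\<exists>y' :: 'a dual. \<forall>x\<in>K. norm (ev y' (E x) - ev y x) \<le> \<epsilon>"
proof -
  interpret E: additive E by (rule E(2))
  have yc: "continuous_on UNIV (ev y)" and yn: "\<And>x. norm (ev y x) = 1" and ym: "\<And>u v. ev y (u + v) = ev y u *
      ev y v"
    using ev[of y] by auto
  have cyc: "continuous_on UNIV (\<lambda>x. cnj (ev y x))" by (intro continuous_intros yc)
  have "compact (uminus ` K)" by (intro compact_continuous_image K continuous_intros)
  moreover have e4: "0 < \<epsilon> / 4" using e by simp
  ultimately obtain k where k: "k \<in> Cc" "\<And>x. 0 \<le> k x" "I k = 1"
    "\<And>x. x \<in> uminus ` K \<Longrightarrow> I (\<lambda>t. \<bar>k (t + x) - k t\<bar>) \<le> \<epsilon> / 4"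
    by (rule Reiter_function) blast
  obtain D where D: "compact D" "\<And>x. x \<notin> D \<Longrightarrow> k x = 0" using k(1) by (rule CcE) blast
  obtain P where P: "P \<in> pos_def_cts" "0 < Re (P 0)" "\<And>x. x \<in> D \<Longrightarrow> 0.8 * Re (P 0) \<le> Re (cnj (ev y x) * P (E
      x))"
    by (rule pos_def_lifting_character[OF E D(1)]) blast
  have Pc: "continuous_on UNIV P" using P(1) by (simp add: pos_def_cts_def)
  have "open ((\<lambda>t. Re (P t)) -` {0.8 * Re (P 0) <..})" by (intro open_vimage open_greaterThan
      continuous_intros Pc)
  moreover have "0 \<in> (\<lambda>t. Re (P t)) -` {0.8 * Re (P 0) <..}" using P(2) by simp
  ultimately obtain \<beta> where \<beta>: "\<beta> \<in> Cc" "\<And>x. 0 \<le> \<beta> x" "I \<beta> = 1"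
    "\<And>x. x \<notin> (\<lambda>t. Re (P t)) -` {0.8 * Re (P 0) <..} \<Longrightarrow> \<beta> x = 0"
    by (rule normalized_bump) blast
  define T where "T Q x = cnj (ev y x) * Q (E x)" for Q :: "'a \<Rightarrow> complex" and x
  have Tc: "continuous_on UNIV (T Q)" if "Q \<in> pos_def_cts" for Q unfolding T_def
    using that by (intro continuous_intros cyc continuous_on_UNIV_compose[OF _ E(1)]) (simp add:
        pos_def_cts_def)
  have Tn: "norm (T Q x) \<le> Re (Q 0)" if "Q \<in> pos_def_cts" for Q x
    using that pos_def_norm_le[of Q] by (simp add: T_def norm_mult yn pos_def_cts_def)
  define G where "G Q = I (\<lambda>x. k x * Re (T Q x)) + I (\<lambda>t. \<beta> t * Re (Q t)) - (5/4) * Re (Q 0)" for Q :: "'a \<Rightarrow>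
      complex"
  have Gk: "I (\<lambda>x. k x * Re (T Q x)) \<le> Re (Q 0)" if "Q \<in> pos_def_cts" for Q
    by (rule I_bump_Re_bounds(1)[OF k(1-3) Tc[OF that]]) (rule order_trans[OF complex_Re_le_cmod Tn[OF that]])
  have Gb: "I (\<lambda>x. \<beta> x * Re (Q x)) \<le> Re (Q 0)" if "Q \<in> pos_def_cts" for Q
    by (rule I_bump_Re_bounds(1)[OF \<beta>(1-3)])
      (use that in \<open>auto simp: pos_def_cts_def intro: order_trans[OF complex_Re_le_cmod pos_def_norm_le]\<close>)
  have cone: "cone_functional G 2"
    unfolding cone_functional_def
  proof (intro conjI ballI allI impI)
    fix P Q :: "'a \<Rightarrow> complex" and r :: real assume P: "P \<in> pos_def_cts"
    have cP: "continuous_on UNIV P" using P by (simp add: pos_def_cts_def)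
    { assume Q: "Q \<in> pos_def_cts"
      hence cQ: "continuous_on UNIV Q" by (simp add: pos_def_cts_def)
      have "T (\<lambda>t. P t + Q t) = (\<lambda>x. T P x + T Q x)" by (simp add: T_def fun_eq_iff algebra_simps)
      then show "G (\<lambda>t. P t + Q t) = G P + G Q"
        unfolding G_def I_Re_add(1)[OF \<beta>(1) cP cQ] using I_Re_add(1)[OF k(1) Tc[OF P] Tc[OF Q]] by (simp add:
            field_simps) }
    { have "T (\<lambda>t. complex_of_real r * P t) = (\<lambda>x. complex_of_real r * T P x)" by (simp add: T_def fun_eq_iff
        algebra_simps)
      then show "G (\<lambda>t. complex_of_real r * P t) = r * G P"
        unfolding G_def I_Re_add(2)[OF \<beta>(1) cP cP] using I_Re_add(2)[OF k(1) Tc[OF P] Tc[OF P], of r] by (simp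
            add: field_simps) }
    have "0 \<le> Re (P 0)" using P pos_def_zero(2)[of P] by (simp add: pos_def_cts_def)
    then show "G P \<le> 2 * Re (P 0)" using Gk[OF P] Gb[OF P] unfolding G_def by argo
  qed
  have "0.8 * Re (P 0) \<le> I (\<lambda>t. \<beta> t * Re (P t))"
    by (rule I_bump_Re_bounds(2)[OF \<beta>(1-3) Pc]) (use \<beta>(4) in \<open>force simp: vimage_def\<close>)
  moreover have "0.8 * Re (P 0) \<le> I (\<lambda>t. k t * Re (T P t))"
    by (rule I_bump_Re_bounds(2)[OF k(1-3) Tc[OF P(1)]]) (use P(3) D(2) in \<open>auto simp: T_def\<close>)
  ultimately have "0 < G P" using P(2) unfolding G_def by argo
  hence ex: "\<exists>P\<in>pos_def_cts. 0 < G P" using P by blast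
  have low: "(1/4) \<le> I (\<lambda>t. \<beta> t * Re (Q t))" "(1/4) \<le> I (\<lambda>t. k t * Re (T Q t))" if "Q \<in> pos_def_cts" "Q 0 = 1"
      "0 < G Q" for Q
  proof -
    have "Re (Q 0) = 1" using that(2) by simp
    then show "(1/4) \<le> I (\<lambda>t. \<beta> t * Re (Q t))" "(1/4) \<le> I (\<lambda>t. k t * Re (T Q t))"
      using that(3) Gk[OF that(1)] Gb[OF that(1)] unfolding G_def by argo+
  qed
  have "\<exists>y :: 'a dual. \<forall>E \<epsilon>. finite E \<longrightarrow> 0 < \<epsilon> \<longrightarrow>
       (\<exists>Q\<in>pos_def_cts. Q 0 = 1 \<and> 0 < G Q \<and> (\<forall>x\<in>E. norm (Q x - ev y x) < \<epsilon>))"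
    by (rule continuous_character_extraction[OF cone ex \<beta>(1), where c = "1/4"]) (use low in auto)
  then obtain y' :: "'a dual" where y': "\<forall>E \<epsilon>. finite E \<longrightarrow> 0 < \<epsilon> \<longrightarrow>
       (\<exists>Q\<in>pos_def_cts. Q 0 = 1 \<and> 0 < G Q \<and> (\<forall>x\<in>E. norm (Q x - ev y' x) < \<epsilon>))" by blast
  have y'n: "norm (ev y' x) = 1" for x using ev[of y'] by auto
  have "norm (ev y' (E x) - ev y x) \<le> \<epsilon>" if x: "x \<in> K" for x
  proof -
    have "norm (ev y' (E x) - ev y x) * (1/4) \<le> \<epsilon> / 4"
    proof (rule tendsto_sqrt_bound)
      fix \<eta> :: real assume \<eta>: "0 < \<eta>"
      from y'[rule_format, of "{E x}" \<eta>] \<eta> obtain Q where Q: "Q \<in> pos_def_cts" "Q 0 = 1" "0 < G Q" "norm (Q (E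
          x) - ev y' (E x)) < \<eta>"
        by auto
      have pd: "pos_def Q" using Q(1) by (simp add: pos_def_cts_def)
      have le1: "norm (T Q t) \<le> 1" for t using Tn[OF Q(1)] Q(2) by simp
      have am: "norm (T Q (t + x) - T Q t * T Q x) \<le> sqrt (2 * \<eta>)" for t
      proof -
        have "T Q (t + x) - T Q t * T Q x = cnj (ev y t) * cnj (ev y x) * (Q (E t + E x) - Q (E t) * Q (E x))"
          by (simp add: T_def ym E.add algebra_simps)
        then show ?thesis using norm_one_almost_multiplicative[OF pd Q(2,4) y'n, of "E t"] by (simp add:
            norm_mult yn)
      qed
      have "norm (T Q x - 1) * (1/4) \<le> I (\<lambda>t. \<bar>k (t + - x) - k t\<bar>) + sqrt (2 * \<eta>) * I (\<lambda>t. \<bar>k t\<bar>)"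
        by (rule near_character_bound[OF Tc[OF Q(1)] le1 k(1) low(2)[OF Q(1-3)] am])
      also have "I (\<lambda>t. \<bar>k (t + - x) - k t\<bar>) \<le> \<epsilon> / 4" using k(4) x by blast
      finally have 1: "norm (T Q x - 1) * (1/4) \<le> \<epsilon> / 4 + sqrt (2 * \<eta>) * I (\<lambda>t. \<bar>k t\<bar>)" by simp
      have "ev y x * cnj (ev y x) = 1" using complex_norm_square[of "ev y x"] yn[of x] by simp
      hence "Q (E x) - ev y x = ev y x * (T Q x - 1)" by (simp add: T_def algebra_simps)
      hence "norm (Q (E x) - ev y x) = norm (T Q x - 1)" by (simp add: norm_mult yn)
      moreover have "norm (ev y' (E x) - ev y x) \<le> norm (Q (E x) - ev y x) + \<eta>"
        using Q(4) norm_triangle_ineq[of "Q (E x) - ev y x" "ev y' (E x) - Q (E x)"] by (simp add: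
            norm_minus_commute)
      ultimately show "norm (ev y' (E x) - ev y x) * (1/4) \<le> \<epsilon> / 4 + sqrt (2 * \<eta>) * I (\<lambda>t. \<bar>k t\<bar>) + \<eta> * (1/4)"
          using 1 by argo
    qed
    then show ?thesis by simp
  qed
  then show ?thesis by blast
qed

end

section \<open>Laws on the line with entire characteristic function\<close>

definition diff_op :: "'a::ab_group_add \<Rightarrow> ('a \<Rightarrow> 'b::ab_group_add) \<Rightarrow> 'a \<Rightarrow> 'b" where
  "diff_op h f x = f (x + h) - f x"

lemma diff_op_Suc: "(diff_op h ^^ Suc n) f x = (diff_op h ^^ n) f (x + h) - (diff_op h ^^ n) f x"
  by (simp add: diff_op_def[of h "(diff_op h ^^ n) f" x])

lemma char_diff_op:
  assumes N: "real_distribution N"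
  shows "(diff_op t ^^ n) (char N) x = (CLINT z|N. iexp (x * z) * (iexp (t * z) - 1) ^ n)"
proof (induction n arbitrary: x)
  case 0 then show ?case by (simp add: char_def)
next
  case (Suc n)
  interpret real_distribution N by (rule N)
  have "norm (iexp (x * z) * (iexp (t * z) - 1) ^ n) \<le> 2 ^ n" for x z
  proof -
    have "norm (iexp (t * z) - 1) \<le> 2" using norm_triangle_ineq4[of "iexp (t * z)" 1] by simp
    then have "norm (iexp (t * z) - 1) ^ n \<le> 2 ^ n" by (rule power_mono) simp
    then show ?thesis by (simp add: norm_mult norm_power)
  qed
  then have i: "complex_integrable N (\<lambda>z. iexp (x * z) * (iexp (t * z) - 1) ^ n)" for x
    by (intro integrable_const_bound[where B = "2 ^ n"]) auto
  have "(diff_op t ^^ Suc n) (char N) x = (diff_op t ^^ n) (char N) (x + t) - (diff_op t ^^ n) (char N) x"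
    by (rule diff_op_Suc)
  also have "\<dots> = (CLINT z|N. iexp ((x + t) * z) * (iexp (t * z) - 1) ^ n - iexp (x * z) * (iexp (t * z) - 1) ^
      n)"
    unfolding Suc by (rule Bochner_Integration.integral_diff[OF i i, symmetric])
  also have "\<dots> = (CLINT z|N. iexp (x * z) * (iexp (t * z) - 1) ^ Suc n)"
    by (intro Bochner_Integration.integral_cong refl) (simp add: algebra_simps exp_add of_real_add)
  finally show ?case .
qed

lemma diff_op_has_derivative:
  fixes F :: "nat \<Rightarrow> complex \<Rightarrow> complex"
  assumes "\<And>j z. (F j has_field_derivative F (Suc j) z) (at z)"
  shows "((diff_op t ^^ m) (F j) has_field_derivative (diff_op t ^^ m) (F (Suc j)) z) (at z)"
proof (induction m arbitrary: z)
  case (Suc m)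
  have "((\<lambda>z. (diff_op t ^^ m) (F j) (z + t)) has_field_derivative (diff_op t ^^ m) (F (Suc j)) (z + t)) (at
      z)"
    using Suc[of "z + t"] by (simp add: DERIV_shift)
  from DERIV_diff[OF this Suc[of z]] show ?case by (simp add: diff_op_def[abs_def])
qed (simp add: assms)

lemma diff_op_derivative_bound:
  fixes F :: "nat \<Rightarrow> complex \<Rightarrow> complex"
  assumes F: "\<And>j z. (F j has_field_derivative F (Suc j) z) (at z)" and S: "convex S"
    and B: "\<And>z. z \<in> S \<Longrightarrow> norm (F (j + m) z) \<le> B" and x: "x \<in> S" "x + of_nat m * t \<in> S"
  shows "norm ((diff_op t ^^ m) (F j) x) \<le> norm t ^ m * B"
  using B x
proof (induction m arbitrary: j x)
  case 0 then show ?case by simp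
next
  case (Suc m)
  have seg: "norm ((diff_op t ^^ m) (F (Suc j)) z) \<le> norm t ^ m * B" if z: "z \<in> closed_segment x (x + t)" for
      z
  proof (rule Suc.IH)
    obtain u where u: "z = (1 - u) *\<^sub>R x + u *\<^sub>R (x + t)" "0 \<le> u" "u \<le> 1" using z by (auto simp:
        closed_segment_def)
    have xt: "x + c *\<^sub>R (of_nat (Suc m) * t) \<in> S" if "0 \<le> c" "c \<le> 1" for c :: real
    proof -
      have "(1 - c) *\<^sub>R x + c *\<^sub>R (x + of_nat (Suc m) * t) \<in> S"
        using convexD[OF S Suc.prems(2,3), of "1 - c" c] that by simp
      then show ?thesis by (simp add: algebra_simps scaleR_conv_of_real)
    qed
    have red: "(w / real (Suc m)) *\<^sub>R (of_nat (Suc m) * t) = w *\<^sub>R t" for w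
      by (simp add: scaleR_conv_of_real del: of_nat_Suc)
    have "z = x + (u / real (Suc m)) *\<^sub>R (of_nat (Suc m) * t)"
      unfolding u(1) red by (simp add: scaleR_conv_of_real algebra_simps)
    then show "z \<in> S" using xt[of "u / real (Suc m)"] u by (simp add: field_simps)
    have "z + of_nat m * t = x + ((u + real m) / real (Suc m)) *\<^sub>R (of_nat (Suc m) * t)"
      unfolding u(1) red by (simp add: scaleR_conv_of_real algebra_simps)
    then show "z + of_nat m * t \<in> S" using xt[of "(u + real m) / real (Suc m)"] u by (simp add: field_simps)
  qed (use Suc.prems in simp)
  have "norm ((diff_op t ^^ m) (F j) (x + t) - (diff_op t ^^ m) (F j) x) \<le> (norm t ^ m * B) * norm (x + t -
      x)"
    by (rule field_differentiable_bound[OF convex_closed_segment[of x "x + t"] _ seg])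
       (auto intro: has_field_derivative_at_within diff_op_has_derivative[of F, OF F])
  then show ?case unfolding diff_op_Suc by (simp add: algebra_simps)
qed

lemma diff_op_of_real:
  assumes "\<And>s. f s = F (complex_of_real s)"
  shows "(diff_op t ^^ n) f s = (diff_op (complex_of_real t) ^^ n) F (complex_of_real s)"
  by (induction n arbitrary: s) (simp_all add: assms diff_op_Suc del: funpow.simps(2))

text \<open>The central difference of order \<open>2 k\<close> of the characteristic function at \<open>0\<close> with step \<open>t\<close> is, up to
sign, the mean of \<open>(2 - 2 cos (t z))\<^sup>k\<close>, which divided by \<open>t\<^sup>2\<^sup>k\<close> tends to the moment as \<open>t \<rightarrow> 0\<close> (Fatou).
The difference is at most \<open>t\<^sup>2\<^sup>k\<close> times a bound for the derivative of \<open>\<Phi>\<close> of order \<open>2 k\<close>, which Cauchy's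
estimate provides.\<close>
lemma even_moment_bound:
  assumes N: "real_distribution N" and \<Phi>: "\<Phi> holomorphic_on UNIV" "\<And>t. char N t = \<Phi> (complex_of_real t)"
    and r: "0 < r" and B: "\<And>z. norm z \<le> r + 1 \<Longrightarrow> norm (\<Phi> z) \<le> B"
  shows "(\<integral>\<^sup>+ z. ennreal (z ^ (2 * k)) \<partial>N) \<le> ennreal (fact (2 * k) * B / r ^ (2 * k))"
proof -
  interpret real_distribution N by (rule N)
  define C where "C = fact (2 * k) * B / r ^ (2 * k)"
  have dB: "norm ((deriv ^^ n) \<Phi> z) \<le> fact n * B / r ^ n" if "z \<in> cball 0 1" for n z
  proof (rule Cauchy_inequality[OF _ _ r])
    show "\<Phi> holomorphic_on ball z r" using \<Phi>(1) holomorphic_on_subset by blast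
    show "continuous_on (cball z r) \<Phi>" using \<Phi>(1) holomorphic_on_imp_continuous_on continuous_on_subset by
        blast
    fix x assume "norm (z - x) = r"
    then have "norm x \<le> r + 1" using that norm_triangle_ineq3[of x z] by (simp add: norm_minus_commute)
    then show "norm (\<Phi> x) \<le> B" by (rule B)
  qed
  have der: "((deriv ^^ j) \<Phi> has_field_derivative (deriv ^^ Suc j) \<Phi> z) (at z)" for j z
    using holomorphic_derivI[OF holomorphic_higher_deriv[OF \<Phi>(1) open_UNIV, of j] open_UNIV UNIV_I] by simp
  have bound: "(LINT z|N. (2 - 2 * cos (t * z)) ^ k) \<le> t ^ (2 * k) * C" if t: "0 < t" "real k * t \<le> 1" for t
  proof -
    have w: "iexp ((- real k * t) * z) * (iexp (t * z) - 1) ^ (2 * k) = (- 1) ^ k * complex_of_real ((2 - 2 *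
        cos (t * z)) ^ k)" for z
    proof -
      have e: "iexp ((- real k * t) * z) = iexp (- (t * z)) ^ k"
        by (simp add: exp_of_nat_mult[symmetric] algebra_simps)
      have "iexp (- (t * z)) * (iexp (t * z) - 1)\<^sup>2 = iexp (t * z) + iexp (- (t * z)) - 2"
        by (simp add: power2_eq_square algebra_simps exp_add[symmetric])
      also have "\<dots> = - complex_of_real (2 - 2 * cos (t * z))" 
        by (simp only: cis_conv_exp[symmetric]) (simp add: complex_eq_iff)
      finally have "(iexp (- (t * z)) * (iexp (t * z) - 1)\<^sup>2) ^ k = (- 1) ^ k * complex_of_real ((2 - 2 * cos
          (t * z)) ^ k)"
        by (simp add: power_mult_distrib[symmetric])
      then show ?thesis unfolding e by (simp add: power_mult_distrib power_mult)
    qed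
    have "norm ((diff_op t ^^ (2 * k)) (char N) (- real k * t)) = \<bar>LINT z|N. (2 - 2 * cos (t * z)) ^ k\<bar>"
    proof -
      have "(CLINT z|N. (- 1) ^ k * complex_of_real ((2 - 2 * cos (t * z)) ^ k)) = (- 1) ^ k * complex_of_real
          (LINT z|N. (2 - 2 * cos (t * z)) ^ k)"
        by (simp only: integral_mult_right_zero integral_complex_of_real)
      then show ?thesis
        unfolding char_diff_op[OF N] w by (simp only: norm_mult norm_power norm_minus_cancel norm_one
            power_one mult_1 norm_of_real)
    qed
    moreover have "norm ((diff_op (complex_of_real t) ^^ (2 * k)) ((deriv ^^ 0) \<Phi>) (complex_of_real (- real k
        * t))) \<le> norm (complex_of_real t) ^ (2 * k) * C"
    proof (rule diff_op_derivative_bound[where S = "cball 0 1" and F = "\<lambda>j. (deriv ^^ j) \<Phi>"])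
      show "norm ((deriv ^^ (0 + 2 * k)) \<Phi> z) \<le> C" if "z \<in> cball 0 1" for z
        using dB[OF that, of "2 * k"] by (simp add: C_def)
      show "complex_of_real (- real k * t) \<in> cball 0 1" using t by (simp add: norm_mult)
      have "complex_of_real (- real k * t) + of_nat (2 * k) * complex_of_real t = complex_of_real (real k *
          t)"
        by (simp add: algebra_simps)
      moreover have "complex_of_real (real k * t) \<in> cball 0 1" using t by (simp add: norm_mult)
      ultimately show "complex_of_real (- real k * t) + of_nat (2 * k) * complex_of_real t \<in> cball 0 1" by
          (simp only:)
    qed (use der in auto)
    ultimately have "\<bar>LINT z|N. (2 - 2 * cos (t * z)) ^ k\<bar> \<le> t ^ (2 * k) * C"
      using diff_op_of_real[of "char N" \<Phi>, OF \<Phi>(2), where t = t and n = "2 * k" and s = "- real k * t"] t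
      by simp
    then show ?thesis by simp
  qed
  define s where "s n = 1 / (real n + real k + 1)" for n
  have s: "0 < s n" "real k * s n \<le> 1" for n by (simp_all add: s_def field_simps)
  have nn: "0 \<le> 2 - 2 * cos u" for u :: real using cos_le_one[of u] by simp
  have int: "integrable N (\<lambda>z. ((2 - 2 * cos (s n * z)) / (s n)\<^sup>2) ^ k)" for n
  proof (rule integrable_const_bound[where B = "(4 / (s n)\<^sup>2) ^ k"])
    have "norm (((2 - 2 * cos (s n * z)) / (s n)\<^sup>2) ^ k) \<le> (4 / (s n)\<^sup>2) ^ k" for z
      unfolding norm_power
    proof (rule power_mono)
      show "norm ((2 - 2 * cos (s n * z)) / (s n)\<^sup>2) \<le> 4 / (s n)\<^sup>2"
      proof -
        have "2 - 2 * cos (s n * z) \<le> 4" using cos_ge_minus_one[of "s n * z"] by argo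
        then have "(2 - 2 * cos (s n * z)) / (s n)\<^sup>2 \<le> 4 / (s n)\<^sup>2" by (rule divide_right_mono) simp
        then show ?thesis using nn[of "s n * z"] by simp
      qed
    qed simp
    then show "AE z in N. norm (((2 - 2 * cos (s n * z)) / (s n)\<^sup>2) ^ k) \<le> (4 / (s n)\<^sup>2) ^ k" by simp
  qed auto
  have le: "(\<integral>\<^sup>+ z. ennreal (((2 - 2 * cos (s n * z)) / (s n)\<^sup>2) ^ k) \<partial>N) \<le> ennreal C" for n
  proof -
    have "(\<integral>\<^sup>+ z. ennreal (((2 - 2 * cos (s n * z)) / (s n)\<^sup>2) ^ k) \<partial>N)
        = ennreal (LINT z|N. ((2 - 2 * cos (s n * z)) / (s n)\<^sup>2) ^ k)"
      by (rule nn_integral_eq_integral[OF int]) (simp add: nn)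
    also have "(LINT z|N. ((2 - 2 * cos (s n * z)) / (s n)\<^sup>2) ^ k) = (LINT z|N. (2 - 2 * cos (s n * z)) ^ k) /
        (s n) ^ (2 * k)"
      by (simp add: power_divide power_mult)
    also have "\<dots> \<le> C" using bound[OF s] s(1)[of n] by (simp add: field_simps)
    finally show ?thesis by (simp add: ennreal_leI)
  qed
  have lim: "(\<lambda>n. ((2 - 2 * cos (s n * z)) / (s n)\<^sup>2) ^ k) \<longlonglongrightarrow> z ^ (2 * k)" for z
  proof -
    have "(\<lambda>n. (2 - 2 * cos (s n * z)) / (s n)\<^sup>2) \<longlonglongrightarrow> z * z" unfolding s_def by real_asymp
    from tendsto_power[OF this, of k] show ?thesis by (simp only: power_mult power2_eq_square)
  qed
  have "(\<integral>\<^sup>+ z. ennreal (z ^ (2 * k)) \<partial>N) = (\<integral>\<^sup>+ z. liminf (\<lambda>n. ennreal (((2 - 2 * cos (s n * z)) / (s n)\<^sup>2) ^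
      k)) \<partial>N)"
    by (intro nn_integral_cong lim_imp_Liminf[symmetric] tendsto_ennrealI lim) simp
  also have "\<dots> \<le> liminf (\<lambda>n. \<integral>\<^sup>+ z. ennreal (((2 - 2 * cos (s n * z)) / (s n)\<^sup>2) ^ k) \<partial>N)"
    by (rule nn_integral_liminf) auto
  also have "\<dots> \<le> liminf (\<lambda>n::nat. ennreal C)" by (rule Liminf_mono) (simp add: le)
  also have "\<dots> = ennreal C" by (simp add: Liminf_const)
  finally show ?thesis by (simp add: C_def)
qed

text \<open>The even moments grow at most like \<open>(2 k)! / r\<^sup>2\<^sup>k\<close> with \<open>r\<close> larger than \<open>|c|\<close>, so the means of the terms
of the series of \<open>cosh (c z)\<close> are dominated by a convergent geometric series.\<close>
lemma entire_char_exponential_moments: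
  assumes N: "real_distribution N" and \<Phi>: "\<Phi> holomorphic_on UNIV" "\<And>t. char N t = \<Phi> (complex_of_real t)"
  shows "(\<integral>\<^sup>+ z. ennreal (exp (c * \<bar>z\<bar>)) \<partial>N) < \<infinity>"
proof -
  interpret real_distribution N by (rule N)
  define r where "r = 2 * (\<bar>c\<bar> + 1)"
  have r: "0 < r" by (simp add: r_def add_nonneg_pos)
  have "compact (\<Phi> ` cball 0 (r + 1))"
    by (intro compact_continuous_image compact_cball) (use \<Phi>(1) holomorphic_on_imp_continuous_on
        continuous_on_subset in blast)
  from compact_imp_bounded[OF this] obtain B where "\<forall>w\<in>\<Phi> ` cball 0 (r + 1). norm w \<le> B"
    unfolding bounded_iff by blast
  then have B: "norm (\<Phi> z) \<le> B" if "norm z \<le> r + 1" for z using that by simp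
  have B0: "0 \<le> B" by (rule order_trans[OF norm_ge_zero B[of 0]]) (use r in simp)
  define T where "T n z = (if even n then (c * z) ^ n / fact n else 0)" for n and z :: real
  have T0: "0 \<le> T n z" for n z
  proof (cases "even n")
    case True
    then have "0 \<le> (c * z) ^ n" by (rule zero_le_even_power)
    then show ?thesis using True by (simp add: T_def)
  qed (simp add: T_def)
  have Tm: "T n \<in> borel_measurable N" for n
  proof (cases "even n")
    case True
    have "(\<lambda>z. (c * z) ^ n / fact n) \<in> borel_measurable N" by (intro borel_measurable_divide
        borel_measurable_power borel_measurable_times) auto
    then show ?thesis using True by (simp add: T_def[abs_def])
  qed (simp add: T_def[abs_def])
  have trm: "(\<integral>\<^sup>+ z. ennreal (T n z) \<partial>N) \<le> ennreal (B * (1/2) ^ n)" for n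
  proof (cases "even n")
    case True
    then obtain k where k: "n = 2 * k" by (auto elim: evenE)
    have "ennreal (T n z) = ennreal (c ^ n / fact n) * ennreal (z ^ (2 * k))" for z
      unfolding k T_def by (subst ennreal_mult'[symmetric]) (auto simp: power_mult_distrib field_simps
          power_mult)
    then have "(\<integral>\<^sup>+ z. ennreal (T n z) \<partial>N) = ennreal (c ^ n / fact n) * (\<integral>\<^sup>+ z. ennreal (z ^ (2 * k)) \<partial>N)"
      by (simp add: nn_integral_cmult)
    also have "\<dots> \<le> ennreal (c ^ n / fact n) * ennreal (fact (2 * k) * B / r ^ (2 * k))"
      by (intro mult_left_mono even_moment_bound[OF N \<Phi> r B]) auto
    also have "\<dots> = ennreal (c ^ n / fact n * (fact (2 * k) * B / r ^ (2 * k)))"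
      by (rule ennreal_mult'[symmetric]) (simp add: True zero_le_even_power)
    also have "c ^ n / fact n * (fact (2 * k) * B / r ^ (2 * k)) = B * (c / r) ^ n"
      by (simp add: k power_divide)
    also have "\<dots> \<le> B * (1/2) ^ n"
    proof (rule mult_left_mono[OF _ B0])
      have "(c / r) ^ n = \<bar>c / r\<bar> ^ n" using power_even_abs[OF True, of "c / r"] by (simp only:)
      also have "\<dots> \<le> (1/2) ^ n" by (rule power_mono) (use r in \<open>auto simp: r_def abs_mult field_simps\<close>)
      finally show "(c / r) ^ n \<le> (1/2) ^ n" .
    qed
    finally show ?thesis by (simp add: ennreal_leI)
  next
    case False then show ?thesis by (simp add: T_def)
  qed
  have sums: "(\<lambda>n. T n z) sums cosh (c * z)" for z
    using cosh_converges[of "c * z"] by (simp only: T_def real_scaleR_def divide_inverse mult.commute)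
  have "(\<integral>\<^sup>+ z. ennreal (cosh (c * z)) \<partial>N) = (\<integral>\<^sup>+ z. (\<Sum>n. ennreal (T n z)) \<partial>N)"
    by (intro nn_integral_cong) (use sums in \<open>simp add: suminf_ennreal_eq[OF T0 sums]\<close>)
  also have "\<dots> = (\<Sum>n. \<integral>\<^sup>+ z. ennreal (T n z) \<partial>N)"
    by (rule nn_integral_suminf) (use Tm in simp)
  also have "\<dots> \<le> (\<Sum>n. ennreal (B * (1/2) ^ n))" by (intro suminf_le trm) auto
  also have "\<dots> = ennreal (B * 2)"
  proof (rule suminf_ennreal_eq)
    show "(\<lambda>n. B * (1/2) ^ n) sums (B * 2)" using sums_mult[OF geometric_sums[of "1/2::real"], of B] by simp
  qed (use B0 in simp)
  finally have cosh: "(\<integral>\<^sup>+ z. ennreal (cosh (c * z)) \<partial>N) < \<infinity>" by (rule order_le_less_trans) simp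
  have "(\<integral>\<^sup>+ z. ennreal (exp (c * \<bar>z\<bar>)) \<partial>N) \<le> (\<integral>\<^sup>+ z. ennreal 2 * ennreal (cosh (c * z)) \<partial>N)"
  proof (rule nn_integral_mono)
    fix z
    have "exp (c * \<bar>z\<bar>) \<le> 2 * cosh (c * z)" by (cases "0 \<le> z") (auto simp: cosh_def)
    then show "ennreal (exp (c * \<bar>z\<bar>)) \<le> ennreal 2 * ennreal (cosh (c * z))"
      by (subst ennreal_mult[symmetric]) (auto simp: ennreal_leI)
  qed
  also have "\<dots> = ennreal 2 * (\<integral>\<^sup>+ z. ennreal (cosh (c * z)) \<partial>N)"
    by (rule nn_integral_cmult) (auto simp: cosh_def)
  also have "\<dots> < \<infinity>" using cosh by (simp add: ennreal_mult_less_top)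
  finally show ?thesis .
qed

lemma char_symmetrization:
  assumes M: "real_distribution M"
  defines "N \<equiv> distr (M \<Otimes>\<^sub>M M) borel (\<lambda>(x, x'). x - x')"
  shows "real_distribution N" and "char N t = complex_of_real ((norm (char M t))\<^sup>2)"
proof -
  interpret M: real_distribution M by (rule M)
  interpret P: pair_prob_space M M ..
  have mb: "(\<lambda>(x, x'). x - x') \<in> borel_measurable (M \<Otimes>\<^sub>M M)" by measurable
  show "real_distribution N" unfolding N_def by (rule P.real_distribution_distr[OF mb])
  have "char N t = (CLINT p|(M \<Otimes>\<^sub>M M). iexp (t * fst p) * cnj (iexp (t * snd p)))"
    unfolding char_def N_def
    by (subst integral_distr[OF mb]) (auto intro!: Bochner_Integration.integral_cong
        simp: split_def exp_cnj exp_add[symmetric] algebra_simps)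
  also have "\<dots> = (CLINT x|M. CLINT x'|M. iexp (t * x) * cnj (iexp (t * x')))"
  proof -
    have eq: "cnj (iexp (t * x)) = iexp (- (t * x))" for x by (simp add: exp_cnj)
    have "integrable (M \<Otimes>\<^sub>M M) (\<lambda>(x, x'). iexp (t * x) * cnj (iexp (t * x')))"
      unfolding eq by (rule P.integrable_const_bound[where B = 1]) (auto simp: split_def norm_mult)
    from P.integral_fst[OF this] show ?thesis by (simp add: split_def)
  qed
  also have "\<dots> = char M t * cnj (char M t)"
    unfolding char_def by simp
  finally show "char N t = complex_of_real ((norm (char M t))\<^sup>2)" unfolding complex_norm_square .
qed

text \<open>By Tonelli, \<open>exp (c |x0 - x|)\<close> is integrable in \<open>x\<close> for some \<open>x0\<close>.\<close>
lemma exponential_moments_of_symmetrization: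
  assumes M: "real_distribution M"
    and fin: "(\<integral>\<^sup>+ z. ennreal (exp (c * \<bar>z\<bar>)) \<partial>(distr (M \<Otimes>\<^sub>M M) borel (\<lambda>(x, x'). x - x'))) < \<infinity>" and c: "0 \<le> c"
  shows "integrable M (\<lambda>x. exp (c * \<bar>x\<bar>))"
proof -
  interpret M: real_distribution M by (rule M)
  interpret P: pair_prob_space M M ..
  have mb: "(\<lambda>(x, x'). x - x') \<in> borel_measurable (M \<Otimes>\<^sub>M M)" by measurable
  have "(\<integral>\<^sup>+ x. \<integral>\<^sup>+ x'. ennreal (exp (c * \<bar>x - x'\<bar>)) \<partial>M \<partial>M) = (\<integral>\<^sup>+ p. ennreal (exp (c * \<bar>fst p - snd p\<bar>)) \<partial>(M \<Otimes>\<^sub>M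
      M))"
    by (subst M.nn_integral_fst[symmetric]) auto
  also have "\<dots> < \<infinity>" using fin by (subst (asm) nn_integral_distr[OF mb]) (auto simp: split_def)
  finally have "(\<integral>\<^sup>+ x. \<integral>\<^sup>+ x'. ennreal (exp (c * \<bar>x - x'\<bar>)) \<partial>M \<partial>M) \<noteq> (\<integral>\<^sup>+ x. \<infinity> \<partial>M)"
    by (simp add: M.emeasure_space_1 del: M.space_eq_univ)
  then obtain x0 where x0: "(\<integral>\<^sup>+ x'. ennreal (exp (c * \<bar>x0 - x'\<bar>)) \<partial>M) \<noteq> \<infinity>"
    by (metis (no_types, lifting) nn_integral_cong)
  have "(\<integral>\<^sup>+ x. ennreal (norm (exp (c * \<bar>x\<bar>))) \<partial>M) \<le> (\<integral>\<^sup>+ x. ennreal (exp (c * \<bar>x0\<bar>)) * ennreal (exp (c * \<bar>x0 -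
      x\<bar>)) \<partial>M)"
  proof (rule nn_integral_mono)
    fix x
    have "c * \<bar>x\<bar> \<le> c * \<bar>x0\<bar> + c * \<bar>x0 - x\<bar>"
      using mult_left_mono[OF abs_triangle_ineq4[of x0 "x0 - x"] c] by (simp add: algebra_simps)
    then show "ennreal (norm (exp (c * \<bar>x\<bar>))) \<le> ennreal (exp (c * \<bar>x0\<bar>)) * ennreal (exp (c * \<bar>x0 - x\<bar>))"
      by (simp add: ennreal_mult[symmetric] exp_add[symmetric] ennreal_leI)
  qed
  also have "\<dots> = ennreal (exp (c * \<bar>x0\<bar>)) * (\<integral>\<^sup>+ x. ennreal (exp (c * \<bar>x0 - x\<bar>)) \<partial>M)"
    by (rule nn_integral_cmult) measurable
  also have "\<dots> < \<infinity>" using x0 by (simp add: ennreal_mult_less_top less_top)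
  finally show ?thesis by (intro integrableI_bounded) auto
qed

lemma entire_laplace_transform:
  assumes M: "real_distribution M" and int: "\<And>c. 0 \<le> c \<Longrightarrow> integrable M (\<lambda>x. exp (c * \<bar>x\<bar>))"
  shows "(\<lambda>z. CLINT x|M. exp (z * complex_of_real x)) holomorphic_on UNIV"
proof -
  interpret M: real_distribution M by (rule M)
  define L where "L z = (CLINT x|M. exp (z * complex_of_real x))" for z
  have dom: "norm (\<Sum>i<n. (z * complex_of_real x) ^ i /\<^sub>R fact i) \<le> exp (norm z * \<bar>x\<bar>)" for n z x
  proof -
    have "norm (\<Sum>i<n. (z * complex_of_real x) ^ i /\<^sub>R fact i) \<le> (\<Sum>i<n. (norm z * \<bar>x\<bar>) ^ i /\<^sub>R fact i)"
      by (rule order_trans[OF norm_sum]) (simp add: norm_power norm_mult)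
    also have "\<dots> \<le> exp (norm z * \<bar>x\<bar>)"
      unfolding exp_def by (rule sum_le_suminf[OF summable_exp_generic]) auto
    finally show ?thesis .
  qed
  have int1: "complex_integrable M (\<lambda>x. (z * complex_of_real x) ^ i /\<^sub>R fact i)" for z i
  proof (rule Bochner_Integration.integrable_bound[OF int[of "norm z"]])
    have "norm ((z * complex_of_real x) ^ i /\<^sub>R fact i) \<le> exp (norm z * \<bar>x\<bar>)" for x
    proof -
      have "(norm z * \<bar>x\<bar>) ^ i /\<^sub>R fact i \<le> (\<Sum>i\<in>{i}. (norm z * \<bar>x\<bar>) ^ i /\<^sub>R fact i)" by simp
      also have "\<dots> \<le> exp (norm z * \<bar>x\<bar>)" unfolding exp_def by (rule sum_le_suminf[OF summable_exp_generic])
          auto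
      finally show ?thesis by (simp add: norm_power norm_mult)
    qed
    then show "AE x in M. norm ((z * complex_of_real x) ^ i /\<^sub>R fact i) \<le> norm (exp (norm z * \<bar>x\<bar>))" by simp
  qed auto
  have sums: "(\<lambda>n. (CLINT x|M. complex_of_real x ^ n /\<^sub>R fact n) * (z - 0) ^ n) sums L z" for z
  proof -
    have "(\<lambda>n. CLINT x|M. (\<Sum>i<n. (z * complex_of_real x) ^ i /\<^sub>R fact i)) \<longlonglongrightarrow> L z"
      unfolding L_def
    proof (rule integral_dominated_convergence[where w = "\<lambda>x. exp (norm z * \<bar>x\<bar>)"])
      show "AE x in M. (\<lambda>n. \<Sum>i<n. (z * complex_of_real x) ^ i /\<^sub>R fact i) \<longlonglongrightarrow> exp (z * complex_of_real x)"
        using exp_converges unfolding sums_def by auto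
      show "AE x in M. norm (\<Sum>i<n. (z * complex_of_real x) ^ i /\<^sub>R fact i) \<le> exp (norm z * \<bar>x\<bar>)" for n
        using dom by simp
    qed (use int in auto)
    moreover have "(CLINT x|M. (\<Sum>i<n. (z * complex_of_real x) ^ i /\<^sub>R fact i)) = (\<Sum>i<n. (CLINT x|M.
        complex_of_real x ^ i /\<^sub>R fact i) * (z - 0) ^ i)" for n
    proof -
      have "(CLINT x|M. (\<Sum>i<n. (z * complex_of_real x) ^ i /\<^sub>R fact i)) = (\<Sum>i<n. CLINT x|M. (z *
          complex_of_real x) ^ i /\<^sub>R fact i)"
        by (rule Bochner_Integration.integral_sum[OF int1])
      also have "\<dots> = (\<Sum>i<n. (CLINT x|M. complex_of_real x ^ i /\<^sub>R fact i) * (z - 0) ^ i)"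
      proof (rule sum.cong[OF refl])
        fix i
        have "(CLINT x|M. (z * complex_of_real x) ^ i /\<^sub>R fact i) = (CLINT x|M. (complex_of_real x ^ i /\<^sub>R fact
            i) * z ^ i)"
          by (intro Bochner_Integration.integral_cong refl) (simp add: power_mult_distrib mult.commute)
        then show "(CLINT x|M. (z * complex_of_real x) ^ i /\<^sub>R fact i) = (CLINT x|M. complex_of_real x ^ i /\<^sub>R
            fact i) * (z - 0) ^ i"
          by simp
      qed
      finally show ?thesis .
    qed
    ultimately show ?thesis by (simp add: sums_def)
  qed
  have "L holomorphic_on ball 0 r" for r by (rule power_series_holomorphic) (rule sums)
  then have "L field_differentiable at z" for z
    using holomorphic_on_imp_differentiable_at[of L "ball 0 (norm z + 1)" z] by simp
  then show ?thesis unfolding L_def[abs_def, symmetric] holomorphic_on_def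
    using field_differentiable_at_within by blast
qed

section \<open>Laws on the line with squared modulus the exponential of a polynomial\<close>

lemma of_real_poly_map_poly:
  "poly (map_poly complex_of_real p) (complex_of_real x) = complex_of_real (poly p x)"
  by (induction p) (simp_all add: map_poly_pCons)

text \<open>A bound on \<open>|Re U|\<close> alone suffices: on the disc of radius \<open>\<rho> = 1 + |z|\<close> around \<open>z\<close> the function
\<open>exp (U / \<rho>\<^sup>2)\<close> is bounded from above and below, so Cauchy's estimate bounds \<open>U'\<close> linearly.\<close>
lemma entire_derivative_affine:
  assumes U: "U holomorphic_on UNIV" and bd: "\<And>z. \<bar>Re (U z)\<bar> \<le> C * (1 + (norm z)\<^sup>2)"
  shows "\<exists>a b. \<forall>z. deriv U z = a + b * z"
proof -
  have C: "0 \<le> C" using order_trans[OF abs_ge_zero bd[of 0]] by simp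
  have dO: "(U has_field_derivative deriv U z) (at z)" for z by (rule holomorphic_derivI[OF U open_UNIV
      UNIV_I])
  have bound: "norm (deriv U z) \<le> exp (10 * C) * (1 + norm z)" for z
  proof -
    define \<rho> where "\<rho> = 1 + norm z"
    have \<rho>: "1 \<le> \<rho>" by (simp add: \<rho>_def)
    define h where "h w = exp (U w / complex_of_real (\<rho>\<^sup>2))" for w
    have re: "\<bar>Re (U w / complex_of_real (\<rho>\<^sup>2))\<bar> \<le> 5 * C" if "norm w \<le> 2 * \<rho>" for w
    proof -
      have "(norm w)\<^sup>2 \<le> (2 * \<rho>)\<^sup>2" using that by (intro power_mono) auto
      moreover have "1 \<le> \<rho>\<^sup>2" using \<rho> by (simp add: one_le_power)
      ultimately have "1 + (norm w)\<^sup>2 \<le> 5 * \<rho>\<^sup>2" by (simp add: power_mult_distrib)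
      then have "C * (1 + (norm w)\<^sup>2) \<le> C * (5 * \<rho>\<^sup>2)" by (rule mult_left_mono[OF _ C])
      then have "\<bar>Re (U w)\<bar> \<le> (5 * C) * \<rho>\<^sup>2" using bd[of w] by (simp add: algebra_simps)
      then have "\<bar>Re (U w)\<bar> / \<rho>\<^sup>2 \<le> 5 * C" using \<rho> by (simp add: divide_le_eq)
      then show ?thesis unfolding Re_divide_of_real abs_divide by simp
    qed
    have hh: "h holomorphic_on UNIV" unfolding h_def by (intro holomorphic_intros U) (use \<rho> in simp)
    have "norm ((deriv ^^ 1) h z) \<le> fact 1 * exp (5 * C) / \<rho> ^ 1"
    proof (rule Cauchy_inequality)
      show "h holomorphic_on ball z \<rho>" using hh holomorphic_on_subset by blast
      show "continuous_on (cball z \<rho>) h" using hh holomorphic_on_imp_continuous_on continuous_on_subset by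
          blast
      fix x assume "norm (z - x) = \<rho>"
      then have "norm x \<le> 2 * \<rho>" using norm_triangle_ineq3[of x z] by (simp add: \<rho>_def norm_minus_commute)
      from abs_le_D1[OF re[OF this]] show "norm (h x) \<le> exp (5 * C)"
        unfolding h_def norm_exp_eq_Re by (simp only: exp_le_cancel_iff)
    qed (use \<rho> in simp)
    moreover have "deriv h z = h z * (deriv U z / complex_of_real (\<rho>\<^sup>2))"
      unfolding h_def by (rule DERIV_imp_deriv) (rule DERIV_chain2[OF DERIV_exp DERIV_cdivide[OF dO]])
    then have "deriv h z = deriv U z / complex_of_real (\<rho>\<^sup>2) * h z" by (simp only: mult.commute)
    ultimately have 1: "norm (deriv U z) / \<rho>\<^sup>2 * norm (h z) \<le> exp (5 * C) / \<rho>"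
      by (simp add: norm_mult norm_divide norm_power)
    have "norm z \<le> 2 * \<rho>" by (simp add: \<rho>_def)
    from abs_le_D2[OF re[OF this]] have "- (5 * C) \<le> Re (U z / complex_of_real (\<rho>\<^sup>2))" by linarith
    then have h: "exp (- (5 * C)) \<le> norm (h z)"
      unfolding h_def norm_exp_eq_Re by (simp only: exp_le_cancel_iff)
    have "norm (deriv U z) / \<rho>\<^sup>2 * exp (- (5 * C)) \<le> norm (deriv U z) / \<rho>\<^sup>2 * norm (h z)"
      by (rule mult_left_mono[OF h]) simp
    with 1 have "norm (deriv U z) / \<rho>\<^sup>2 * exp (- (5 * C)) \<le> exp (5 * C) / \<rho>" by linarith
    then have "norm (deriv U z) \<le> exp (5 * C) * exp (5 * C) * \<rho>"
      using \<rho> by (simp add: exp_minus field_simps power2_eq_square)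
    also have "exp (5 * C) * exp (5 * C) = exp (10 * C)" by (simp add: exp_add[symmetric])
    finally show ?thesis by (simp add: \<rho>_def)
  qed
  have liou: "deriv U z = (\<Sum>k\<le>1. (deriv ^^ k) (deriv U) 0 / fact k * z ^ k)" for z
  proof (rule Liouville_polynomial[where A = 1 and B = "2 * exp (10 * C)"])
    show "deriv U holomorphic_on UNIV" by (rule holomorphic_deriv[OF U open_UNIV])
    fix z :: complex assume "1 \<le> norm z"
    then have "exp (10 * C) * (1 + norm z) \<le> exp (10 * C) * (2 * norm z)" by (intro mult_left_mono) auto
    with bound[of z] have "norm (deriv U z) \<le> exp (10 * C) * (2 * norm z)" by (rule order_trans)
    then show "norm (deriv U z) \<le> 2 * exp (10 * C) * norm z ^ 1" by (simp only: power_one_right mult_ac)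
  qed
  have "deriv U z = deriv U 0 + (deriv (deriv U) 0) * z" for z
    by (subst liou) simp
  then show ?thesis by (intro exI allI)
qed

lemma poly_ray_limit:
  fixes p :: "complex poly"
  shows "((\<lambda>\<rho>. poly p (complex_of_real \<rho> * \<zeta>) / complex_of_real (\<rho> ^ degree p)) \<longlongrightarrow> lead_coeff p * \<zeta> ^ degree p)
      at_top"
proof -
  define d where "d = degree p"
  have "((\<lambda>\<rho>. \<Sum>i\<le>d. coeff p i * \<zeta> ^ i * complex_of_real (\<rho> ^ i / \<rho> ^ d)) \<longlongrightarrow> (\<Sum>i\<le>d. coeff p i * \<zeta> ^ i *
      complex_of_real (if i = d then 1 else 0))) at_top"
  proof (intro tendsto_sum tendsto_mult tendsto_const tendsto_of_real)
    fix i assume i: "i \<in> {..d}"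
    show "((\<lambda>\<rho>::real. \<rho> ^ i / \<rho> ^ d) \<longlongrightarrow> (if i = d then 1 else 0)) at_top"
    proof (cases "i = d")
      case True
      have "\<forall>\<^sub>F \<rho> in at_top. \<rho> ^ i / \<rho> ^ d = (1::real)" using eventually_gt_at_top[of 0] by eventually_elim
          (simp add: True)
      then show ?thesis using True by (simp add: tendsto_eventually)
    next
      case False
      have "((\<lambda>\<rho>::real. 1 / \<rho> ^ (d - i)) \<longlongrightarrow> 0) at_top"
        by (rule real_tendsto_divide_at_top[OF tendsto_const]) (use False i in \<open>auto intro!:
            filterlim_pow_at_top filterlim_ident\<close>)
      moreover have "\<forall>\<^sub>F \<rho> in at_top. 1 / \<rho> ^ (d - i) = \<rho> ^ i / (\<rho> ^ d :: real)"
        using eventually_gt_at_top[of 0] by eventually_elim (use i in \<open>simp add: power_diff\<close>)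
      ultimately show ?thesis using False by (auto intro: Lim_transform_eventually)
    qed
  qed
  also have "(\<Sum>i\<le>d. coeff p i * \<zeta> ^ i * complex_of_real (if i = d then 1 else 0)) = coeff p d * \<zeta> ^ d"
    by (simp add: if_distrib[of "\<lambda>x. _ * complex_of_real x"] cong: if_cong)
  also have "(\<lambda>\<rho>. \<Sum>i\<le>d. coeff p i * \<zeta> ^ i * complex_of_real (\<rho> ^ i / \<rho> ^ d)) = (\<lambda>\<rho>. poly p (complex_of_real \<rho>
      * \<zeta>) / complex_of_real (\<rho> ^ d))"
    by (rule ext) (simp add: poly_altdef d_def sum_divide_distrib power_mult_distrib field_simps)
  finally show ?thesis by (simp add: d_def)
qed

text \<open>The leading coefficient is positive, so on the ray of argument \<open>pi / d\<close>, where \<open>d\<close> is the degree, the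
real part is asymptotically \<open>- r |w|\<^sup>d\<close>. At the corresponding point of the imaginary axis the modulus
is at most \<open>r (sin (pi / d) |w|)\<^sup>d\<close>. For \<open>d \<ge> 3\<close> this contradicts the ridge property.\<close>
lemma ridge_polynomial_degree:
  fixes R :: "real poly"
  defines "Rc \<equiv> map_poly complex_of_real R"
  assumes nonneg: "\<And>t. 0 \<le> poly R t"
    and ridge: "\<And>w. Re (poly Rc (\<i> * complex_of_real (Im w))) \<le> Re (poly Rc w)"
  shows "degree R \<le> 2"
proof (rule ccontr)
  assume "\<not> degree R \<le> 2"
  define d where "d = degree R"
  have d: "3 \<le> d" using \<open>\<not> degree R \<le> 2\<close> by (simp add: d_def)
  define r where "r = lead_coeff R"
  have dc: "degree Rc = d" by (simp add: Rc_def d_def degree_map_poly)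
  have lc: "lead_coeff Rc = complex_of_real r" unfolding dc by (simp add: Rc_def r_def coeff_map_poly d_def)
  have lim: "((\<lambda>\<rho>. Re (poly Rc (complex_of_real \<rho> * \<zeta>) / complex_of_real (\<rho> ^ d))) \<longlongrightarrow> Re (complex_of_real r * \<zeta>
      ^ d)) at_top" for \<zeta>
    using tendsto_Re[OF poly_ray_limit[of Rc \<zeta>]] by (simp only: dc lc[unfolded dc])
  have "0 \<le> r"
  proof (rule tendsto_lowerbound)
    show "((\<lambda>\<rho>. Re (poly Rc (complex_of_real \<rho> * 1) / complex_of_real (\<rho> ^ d))) \<longlongrightarrow> r) at_top" using lim[of 1]
        by simp
    show "\<forall>\<^sub>F \<rho> in at_top. 0 \<le> Re (poly Rc (complex_of_real \<rho> * 1) / complex_of_real (\<rho> ^ d))"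
      using eventually_gt_at_top[of 0]
    proof eventually_elim
      case (elim \<rho>)
      have "poly Rc (complex_of_real \<rho>) = complex_of_real (poly R \<rho>)" by (simp add: Rc_def
          of_real_poly_map_poly)
      then show ?case using nonneg[of \<rho>] elim by (simp add: Re_divide_of_real del: of_real_power)
    qed
  qed simp
  moreover have "r \<noteq> 0" using d by (auto simp: r_def d_def)
  ultimately have r: "0 < r" by simp
  define \<theta> where "\<theta> = pi / real d"
  have \<theta>: "0 < \<theta>" "\<theta> < pi / 2" using d pi_gt_zero by (auto simp: \<theta>_def field_simps)
  have "Re (complex_of_real r * (\<i> * complex_of_real (sin \<theta>)) ^ d) \<le> Re (complex_of_real r * (cis \<theta>) ^ d)"
  proof (rule tendsto_le[OF _ lim lim])
    show "\<forall>\<^sub>F \<rho> in at_top. Re (poly Rc (complex_of_real \<rho> * (\<i> * complex_of_real (sin \<theta>))) / complex_of_real (\<rho>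
        ^ d))
        \<le> Re (poly Rc (complex_of_real \<rho> * cis \<theta>) / complex_of_real (\<rho> ^ d))"
      using eventually_gt_at_top[of 0]
    proof eventually_elim
      case (elim \<rho>)
      have "\<i> * complex_of_real (Im (complex_of_real \<rho> * cis \<theta>)) = complex_of_real \<rho> * (\<i> * complex_of_real
          (sin \<theta>))" by simp
      with ridge[of "complex_of_real \<rho> * cis \<theta>"]
      have "Re (poly Rc (complex_of_real \<rho> * (\<i> * complex_of_real (sin \<theta>)))) \<le> Re (poly Rc (complex_of_real \<rho>
          * cis \<theta>))" by (simp only:)
      then show ?case using elim by (simp only: Re_divide_of_real) (simp add: divide_right_mono)
    qed
  qed simp
  also have "(cis \<theta>) ^ d = cis (real d * \<theta>)" by (rule Complex.DeMoivre)
  also have "real d * \<theta> = pi" using d by (simp add: \<theta>_def)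
  also have "Re (complex_of_real r * cis pi) = - r" by simp
  finally have "Re (complex_of_real r * (\<i> * complex_of_real (sin \<theta>)) ^ d) \<le> - r" .
  moreover have "\<bar>Re (complex_of_real r * (\<i> * complex_of_real (sin \<theta>)) ^ d)\<bar> \<le> r * \<bar>sin \<theta>\<bar> ^ d"
    using abs_Re_le_cmod[of "complex_of_real r * (\<i> * complex_of_real (sin \<theta>)) ^ d"] r by (simp add: norm_mult
        norm_power)
  moreover have "\<bar>sin \<theta>\<bar> ^ d < 1"
  proof -
    have "sin \<theta> < sin (pi / 2)" by (rule sin_monotone_2pi) (use \<theta> pi_gt_zero in auto)
    then have "sin \<theta> < 1" by simp
    moreover have "0 < sin \<theta>" by (rule sin_gt_zero) (use \<theta> in auto)
    ultimately show ?thesis using d by (simp add: power_Suc_less_one power_less_one_iff)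
  qed
  then have "r * \<bar>sin \<theta>\<bar> ^ d < r" using r by simp
  ultimately show False by linarith
qed

text \<open>The symmetrised law has the entire characteristic function \<open>\<Phi> = exp (- R)\<close>. Hence the law has all
exponential moments, and its Laplace transform \<open>L\<close> is entire with \<open>L (\<i> w) L (- \<i> w) = \<Phi> w\<close>. Since
\<open>|L z| \<le> L (Re z)\<close>, the modulus of \<open>\<Phi>\<close> on a horizontal line is largest on the imaginary axis, and so \<open>R\<close>
has degree at most two. Now \<open>L\<close> has no zeros; write \<open>L z = exp (U z + s z\<^sup>2 / 2)\<close> with \<open>U\<close> odd up to
multiples of \<open>2 pi \<i>\<close>. The bounds for \<open>|L|\<close> from above and below show \<open>|Re U z| = O(1 + |z|\<^sup>2)\<close>, so \<open>U'\<close> is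
affine; it is even, hence constant.\<close>
theorem char_modulus_exp_polynomial:
  fixes R :: "real poly"
  assumes M: "real_distribution M" and R: "\<And>t. (norm (char M t))\<^sup>2 = exp (- poly R t)"
  obtains a :: complex and s :: real where "\<And>t. poly R t = s * t\<^sup>2"
    "\<And>t. char M t = exp (a * t - complex_of_real (s * t\<^sup>2 / 2))"
proof -
  interpret M: real_distribution M by (rule M)
  define Rc where "Rc = map_poly complex_of_real R"
  have Rc: "poly Rc (complex_of_real t) = complex_of_real (poly R t)" for t by (simp add: Rc_def
      of_real_poly_map_poly)
  define \<Phi> where "\<Phi> w = exp (- poly Rc w)" for w
  have \<Phi>h: "\<Phi> holomorphic_on UNIV" unfolding \<Phi>_def by (intro holomorphic_intros)
  define N where "N = distr (M \<Otimes>\<^sub>M M) borel (\<lambda>(x, x'). x - x')"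
  have N: "real_distribution N" unfolding N_def by (rule char_symmetrization(1)[OF M])
  have charN: "char N t = \<Phi> (complex_of_real t)" for t
    unfolding N_def char_symmetrization(2)[OF M] R \<Phi>_def Rc by (simp only: of_real_minus[symmetric]
        exp_of_real)
  have int: "integrable M (\<lambda>x. exp (c * \<bar>x\<bar>))" if "0 \<le> c" for c
    by (rule exponential_moments_of_symmetrization[OF M _ that])
       (rule entire_char_exponential_moments[OF N \<Phi>h charN, unfolded N_def])
  define L where "L z = (CLINT x|M. exp (z * complex_of_real x))" for z
  have Lh: "L holomorphic_on UNIV" unfolding L_def[abs_def] by (rule entire_laplace_transform[OF M int])
  define \<Lambda> where "\<Lambda> b = (LINT x|M. exp (b * x))" for b :: real
  have intL: "integrable M (\<lambda>x. exp (b * x))" for b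
  proof (rule Bochner_Integration.integrable_bound[OF int[of "\<bar>b\<bar>"]])
    have "b * x \<le> \<bar>b\<bar> * \<bar>x\<bar>" for x by (metis abs_ge_self abs_mult)
    then show "AE x in M. norm (exp (b * x)) \<le> norm (exp (\<bar>b\<bar> * \<bar>x\<bar>))" by simp
  qed auto
  have L\<Lambda>: "L (complex_of_real b) = complex_of_real (\<Lambda> b)" for b
    unfolding L_def \<Lambda>_def of_real_mult[symmetric] exp_of_real by (rule integral_complex_of_real)
  have L_le: "norm (L z) \<le> \<Lambda> (Re z)" for z
    unfolding L_def \<Lambda>_def by (rule order_trans[OF integral_norm_bound]) (simp add: norm_exp_eq_Re)
  define K where "K = (LINT x|M. \<bar>x\<bar>)"
  have intK: "integrable M (\<lambda>x. \<bar>x\<bar>)" "integrable M (\<lambda>x. x)"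
  proof -
    have "norm x \<le> norm (exp (1 * \<bar>x\<bar>))" for x :: real using exp_ge_add_one_self[of "\<bar>x\<bar>"] by (simp del:
        exp_ge_add_one_self)
    then show "integrable M (\<lambda>x. \<bar>x\<bar>)" "integrable M (\<lambda>x. x)"
      by (intro Bochner_Integration.integrable_bound[OF int[of 1]]; simp)+
  qed
  have K: "0 \<le> K" by (simp add: K_def)
  \<comment> \<open>Jensen's inequality for the exponential, by its tangent.\<close>
  have \<Lambda>_ge: "exp (- K * \<bar>b\<bar>) \<le> \<Lambda> b" for b
  proof -
    have "1 \<le> 1 + (b * (LINT x|M. x) + \<bar>b\<bar> * K)"
    proof -
      have "\<bar>LINT x|M. x\<bar> \<le> K" unfolding K_def using integral_norm_bound[of M "\<lambda>x. x"] by simp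
      then have "\<bar>b\<bar> * \<bar>LINT x|M. x\<bar> \<le> \<bar>b\<bar> * K" by (rule mult_left_mono) simp
      then show ?thesis using abs_ge_minus_self[of "b * (LINT x|M. x)"] by (simp add: abs_mult)
    qed
    also have "\<dots> = (LINT x|M. 1 + (b * x + \<bar>b\<bar> * K))"
      using intK(2) M.prob_space by (simp del: M.space_eq_univ)
    also have "\<dots> \<le> (LINT x|M. exp (K * \<bar>b\<bar>) * exp (b * x))"
    proof (rule integral_mono)
      show "1 + (b * x + \<bar>b\<bar> * K) \<le> exp (K * \<bar>b\<bar>) * exp (b * x)" for x
        using exp_ge_add_one_self[of "b * x + \<bar>b\<bar> * K"] by (simp add: exp_add[symmetric] algebra_simps del:
            exp_ge_add_one_self)
    qed (use intK(2) intL in auto)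
    also have "\<dots> = exp (K * \<bar>b\<bar>) * \<Lambda> b" by (simp add: \<Lambda>_def)
    finally show ?thesis by (simp add: exp_minus field_simps)
  qed
  have \<Lambda>_pos: "0 < \<Lambda> b" for b using \<Lambda>_ge[of b] exp_gt_zero less_le_trans by blast
  have charL: "char M t = L (\<i> * complex_of_real t)" for t
    by (simp add: char_def L_def mult.assoc)
  have prod: "L (\<i> * w) * L (- (\<i> * w)) = \<Phi> w" for w
  proof -
    have "(\<lambda>w. L (\<i> * w) * L (- (\<i> * w)) - \<Phi> w) w = 0"
    proof (rule analytic_continuation[where f = "\<lambda>w. L (\<i> * w) * L (- (\<i> * w)) - \<Phi> w" and S = UNIV and U =
        "range complex_of_real" and \<xi> = 0])
      have h1: "(\<lambda>w. L (\<i> * w)) holomorphic_on UNIV" "(\<lambda>w. L (- (\<i> * w))) holomorphic_on UNIV"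
        by (rule holomorphic_on_compose_gen[OF _ Lh, unfolded o_def]; auto intro!: holomorphic_intros)+
      show "(\<lambda>w. L (\<i> * w) * L (- (\<i> * w)) - \<Phi> w) holomorphic_on UNIV"
        by (intro holomorphic_on_diff holomorphic_on_mult h1 \<Phi>h)
      show "0 islimpt range complex_of_real"
        unfolding islimpt_approachable
      proof (intro allI impI)
        fix e :: real assume "0 < e"
        then show "\<exists>x'\<in>range complex_of_real. x' \<noteq> 0 \<and> dist x' 0 < e"
          by (intro bexI[of _ "complex_of_real (e / 2)"] rangeI) (auto simp: norm_divide)
      qed
      fix z assume "z \<in> range complex_of_real"
      then obtain t where t: "z = complex_of_real t" by blast
      have "L (- (\<i> * z)) = cnj (L (\<i> * z))"
        unfolding L_def t by (subst Bochner_Integration.integral_cnj[symmetric]) (simp add: exp_cnj)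
      then have "L (\<i> * z) * L (- (\<i> * z)) = complex_of_real ((norm (char M t))\<^sup>2)"
        unfolding complex_norm_square by (simp add: charL t)
      also have "\<dots> = \<Phi> z" unfolding R \<Phi>_def t Rc by (simp only: of_real_minus[symmetric] exp_of_real)
      finally show "L (\<i> * z) * L (- (\<i> * z)) - \<Phi> z = 0" by simp
    qed auto
    then show ?thesis by simp
  qed
  have R0: "poly R 0 = 0" using R[of 0] by (simp add: M.char_zero)
  have Rnn: "0 \<le> poly R t" for t
  proof -
    have "(norm (char M t))\<^sup>2 \<le> 1" using M.cmod_char_le_1[of t] by (simp add: power_le_one)
    then show ?thesis unfolding R by simp
  qed
  have Reven: "poly R (- t) = poly R t" for t
  proof -
    have "char M (- t) = cnj (char M t)" unfolding char_def by (subst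
        Bochner_Integration.integral_cnj[symmetric]) (simp add: exp_cnj)
    then have "exp (- poly R (- t)) = exp (- poly R t)" unfolding R[symmetric] by simp
    then show ?thesis by simp
  qed
  have ridge: "Re (poly Rc (\<i> * complex_of_real (Im w))) \<le> Re (poly Rc w)" for w
  proof -
    define b where "b = Im w"
    have "norm (\<Phi> w) = norm (L (\<i> * w)) * norm (L (- (\<i> * w)))" by (simp add: prod[symmetric] norm_mult)
    also have "\<dots> \<le> \<Lambda> (- b) * \<Lambda> b"
      using L_le[of "\<i> * w"] L_le[of "- (\<i> * w)"] \<Lambda>_pos[of "- b"] by (intro mult_mono) (auto simp: b_def)
    also have "\<dots> = norm (\<Phi> (\<i> * complex_of_real b))"
    proof -
      have "\<Phi> (\<i> * complex_of_real b) = L (complex_of_real (- b)) * L (complex_of_real b)"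
        by (simp add: prod[symmetric])
      then show ?thesis unfolding L\<Lambda> using \<Lambda>_pos[of b] \<Lambda>_pos[of "- b"] by (simp add: norm_mult)
    qed
    finally show ?thesis by (simp add: \<Phi>_def norm_exp_eq_Re b_def)
  qed
  have deg: "degree R \<le> 2"
    by (rule ridge_polynomial_degree[OF Rnn]) (rule ridge[unfolded Rc_def])
  have quad: "poly R t = coeff R 0 + coeff R 1 * t + coeff R 2 * t\<^sup>2" for t
  proof -
    have "poly R t = (\<Sum>i\<le>2. coeff R i * t ^ i)"
      unfolding poly_altdef by (rule sum.mono_neutral_left) (use deg in \<open>auto simp: coeff_eq_0\<close>)
    then show ?thesis by (simp add: numeral_2_eq_2)
  qed
  define s where "s = coeff R 2"
  have c0: "coeff R 0 = 0" using quad[of 0] R0 by simp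
  have c1: "coeff R 1 = 0" using quad[of 1] quad[of "-1"] Reven[of 1] by simp
  have Rs: "poly R t = s * t\<^sup>2" for t using quad[of t] c0 c1 by (simp add: s_def)
  have s: "0 \<le> s" using Rnn[of 1] by (simp add: Rs)
  have Rcs: "poly Rc w = complex_of_real s * w\<^sup>2" for w
  proof -
    have "R = [:0, 0, s:]"
    proof (rule poly_eqI)
      fix n show "coeff R n = coeff [:0, 0, s:] n"
        using c0 c1 deg by (auto simp: s_def coeff_pCons numeral_2_eq_2 coeff_eq_0 split: nat.split)
    qed
    then show ?thesis by (simp add: Rc_def map_poly_pCons power2_eq_square algebra_simps)
  qed
  have prodz: "L z * L (- z) = exp (complex_of_real s * z\<^sup>2)" for z
    using prod[of "- \<i> * z"] by (simp add: \<Phi>_def Rcs power_mult_distrib algebra_simps)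
  have Lnz: "L z \<noteq> 0" for z using prodz[of z] by (metis exp_not_eq_zero mult_zero_left)
  obtain g where g: "g holomorphic_on UNIV" "\<And>z. exp (g z) = L z"
    by (rule holomorphic_logarithm_exists[OF convex_UNIV open_UNIV Lh _ UNIV_I]) (use Lnz in auto)
  define U where "U z = g z - complex_of_real s * z\<^sup>2 / 2 - g 0" for z
  have Oh: "U holomorphic_on UNIV" unfolding U_def by (intro holomorphic_intros g) auto
  have L0: "L 0 = 1" using L\<Lambda>[of 0] M.prob_space by (simp add: \<Lambda>_def del: M.space_eq_univ)
  have eO: "L z = exp (U z + complex_of_real s * z\<^sup>2 / 2)" for z
  proof -
    have "exp (g 0) = 1" using g(2)[of 0] L0 by simp
    then show ?thesis by (simp add: U_def g(2)[symmetric] exp_diff)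
  qed
  have OO: "exp (U z + U (- z)) = 1" for z
  proof -
    have "exp (U z + U (- z)) * exp (complex_of_real s * z\<^sup>2) = L z * L (- z)"
      unfolding eO by (simp add: exp_add[symmetric] algebra_simps)
    also note prodz
    finally show ?thesis by simp
  qed
  have dO: "(U has_field_derivative deriv U z) (at z)" for z by (rule holomorphic_derivI[OF Oh open_UNIV
      UNIV_I])
  have dOO: "((\<lambda>z. U z + U (- z)) has_field_derivative deriv U z - deriv U (- z)) (at z)" for z
    by (auto intro!: derivative_eq_intros dO DERIV_chain2[OF dO])
  have deriv_even: "deriv U z = deriv U (- z)" for z
  proof -
    have "((\<lambda>z. exp (U z + U (- z))) has_field_derivative exp (U z + U (- z)) * (deriv U z - deriv U (- z)))
        (at z)"
      using DERIV_chain2[OF DERIV_exp dOO[of z]] by simp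
    moreover have "((\<lambda>z. exp (U z + U (- z))) has_field_derivative 0) (at z)" unfolding OO by simp
    ultimately have "exp (U z + U (- z)) * (deriv U z - deriv U (- z)) = 0" by (rule DERIV_unique)
    then show ?thesis by simp
  qed
  have reO: "\<bar>Re (U z)\<bar> \<le> (2 * s + K) * (1 + (norm z)\<^sup>2)" for z
  proof -
    define x where "x = Re z"
    have x: "\<bar>x\<bar> \<le> norm z" "x\<^sup>2 \<le> (norm z)\<^sup>2"
      using abs_Re_le_cmod[of z] power_mono[OF abs_Re_le_cmod, of z 2] by (simp_all add: x_def)
    have z2: "\<bar>Re (z\<^sup>2)\<bar> \<le> (norm z)\<^sup>2" using abs_Re_le_cmod[of "z\<^sup>2"] by (simp add: norm_power)
    have reL: "norm (L u) = exp (Re (U u) + s * Re (u\<^sup>2) / 2)" for u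
      unfolding eO norm_exp_eq_Re by (simp add: Re_divide_numeral del: Re_power2)
    have up: "norm (L u) \<le> exp (s * (Re u)\<^sup>2 + K * \<bar>Re u\<bar>)" for u
    proof -
      have "\<Lambda> (Re u) * \<Lambda> (- Re u) = exp (s * (Re u)\<^sup>2)"
      proof -
        have "complex_of_real (\<Lambda> (Re u) * \<Lambda> (- Re u)) = complex_of_real (exp (s * (Re u)\<^sup>2))"
          using prodz[of "complex_of_real (Re u)"] L\<Lambda>[of "Re u"] L\<Lambda>[of "- Re u"] by (simp add:
              exp_of_real[symmetric])
        then show ?thesis by (simp only: of_real_eq_iff)
      qed
      then have "\<Lambda> (Re u) = exp (s * (Re u)\<^sup>2) / \<Lambda> (- Re u)" using \<Lambda>_pos[of "- Re u"] by (simp add: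
          field_simps)
      also have "\<dots> \<le> exp (s * (Re u)\<^sup>2) / exp (- K * \<bar>Re u\<bar>)"
        using \<Lambda>_ge[of "- Re u"] \<Lambda>_pos[of "- Re u"] by (intro divide_left_mono mult_pos_pos) auto
      also have "\<dots> = exp (s * (Re u)\<^sup>2 + K * \<bar>Re u\<bar>)" by (simp add: exp_add exp_minus field_simps)
      finally show ?thesis using L_le[of u] by linarith
    qed
    have sK: "s * x\<^sup>2 \<le> s * (norm z)\<^sup>2" "K * \<bar>x\<bar> \<le> K * norm z" "\<bar>s * Re (z\<^sup>2)\<bar> \<le> s * (norm z)\<^sup>2"
      using mult_left_mono[OF x(2) s] mult_left_mono[OF x(1) K] mult_left_mono[OF z2 s] s by (simp_all add:
          abs_mult)
    have "Re (U z) + s * Re (z\<^sup>2) / 2 \<le> s * x\<^sup>2 + K * \<bar>x\<bar>" using up[of z] unfolding reL x_def by simp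
    moreover have "s * Re (z\<^sup>2) - (s * x\<^sup>2 + K * \<bar>x\<bar>) \<le> Re (U z) + s * Re (z\<^sup>2) / 2"
    proof -
      have "exp (s * Re (z\<^sup>2)) = norm (L z) * norm (L (- z))"
        unfolding norm_mult[symmetric] prodz norm_exp_eq_Re by (simp del: Re_power2)
      also have "\<dots> \<le> norm (L z) * exp (s * x\<^sup>2 + K * \<bar>x\<bar>)"
        using up[of "- z"] by (intro mult_left_mono) (simp_all add: x_def)
      also have "\<dots> = exp (Re (U z) + s * Re (z\<^sup>2) / 2 + (s * x\<^sup>2 + K * \<bar>x\<bar>))" unfolding reL by (simp add:
          exp_add)
      finally show ?thesis by simp
    qed
    ultimately have "\<bar>Re (U z)\<bar> \<le> 2 * (s * (norm z)\<^sup>2) + K * norm z"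
      using sK(1,2) abs_le_D1[OF sK(3)] abs_le_D2[OF sK(3)] by (intro abs_leI) linarith+
    moreover have "K * norm z \<le> K * (1 + (norm z)\<^sup>2)"
    proof (rule mult_left_mono[OF _ K])
      have "0 \<le> (norm z - 1)\<^sup>2 + norm z" by simp
      then show "norm z \<le> 1 + (norm z)\<^sup>2" by (simp add: power2_eq_square algebra_simps)
    qed
    moreover have "(2 * s + K) * (1 + (norm z)\<^sup>2) = 2 * s + 2 * (s * (norm z)\<^sup>2) + K * (1 + (norm z)\<^sup>2)" by (simp
        add: algebra_simps)
    ultimately show ?thesis using s by linarith
  qed
  obtain a b where ab: "\<And>z. deriv U z = a + b * z" using entire_derivative_affine[OF Oh reO] by blast
  have "b = 0" using deriv_even[of 1] by (simp add: ab)
  then have "((\<lambda>z. U z - a * z) has_field_derivative 0) (at z)" for z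
    by (auto intro!: derivative_eq_intros dO simp: ab)
  then have "U z - a * z = U 0 - a * 0" for z
    using has_field_derivative_zero_constant[OF convex_UNIV, of "\<lambda>z. U z - a * z"] by (metis UNIV_I)
  moreover have "U 0 = 0" by (simp add: U_def)
  ultimately have Oa: "U z = a * z" for z by simp
  show ?thesis
  proof (rule that[OF Rs])
    fix t show "char M t = exp (a * \<i> * complex_of_real t - complex_of_real (s * t\<^sup>2 / 2))"
      unfolding charL eO Oa by (simp add: power_mult_distrib algebra_simps)
  qed
qed

section \<open>The topology of the character group\<close>

lemma nmul_add: "nmul (m + n) x = nmul m x + nmul n x"
  by (induction n) (simp_all add: algebra_simps)

lemma nmul_nmul: "nmul m (nmul n x) = nmul (m * n) x"
  by (induction m) (simp_all add: nmul_add algebra_simps)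

lemma nmul_plus: "nmul n (x + y) = nmul n x + nmul n y"
  by (induction n) (simp_all add: algebra_simps)

lemma nmul_uminus: "nmul n (- x) = - nmul n x"
  by (induction n) simp_all

lemma nmul_one: "nmul 1 x = x" and nmul_two: "nmul 2 x = x + x"
  by (simp_all add: numeral_2_eq_2)

lemma ev_continuous: "continuous_on UNIV (ev y)"
  and norm_ev [simp]: "norm (ev y x) = 1"
  and ev_add_arg: "ev y (x + x') = ev y x * ev y x'"
  using ev[of y] by auto

lemma ev_nonzero [simp]: "ev y x \<noteq> 0"
  by (metis norm_ev norm_zero zero_neq_one)

lemma ev_zero [simp]: "ev 0 x = 1"
  by transfer simp

lemma ev_add: "ev (y + z) x = ev y x * ev z x"
  by transfer simp

lemma ev_minus: "ev (- y) x = cnj (ev y x)"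
  by transfer simp

lemma ev_cnj_mult [simp]: "cnj (ev y x) * ev y x = 1"
  using complex_norm_square[of "ev y x"] by (simp add: mult.commute)

lemma ev_zero_arg [simp]: "ev y 0 = 1"
proof -
  have "ev y 0 * ev y 0 = ev y 0" using ev_add_arg[of y 0 0] by simp
  moreover have "ev y 0 \<noteq> 0" by (rule ev_nonzero)
  ultimately show ?thesis by simp
qed

lemma ev_minus_arg: "ev y (- x) = cnj (ev y x)"
proof -
  have "ev y (- x) * ev y x = cnj (ev y x) * ev y x" using ev_add_arg[of y "- x" x] by simp
  moreover have "ev y x \<noteq> 0" by (rule ev_nonzero)
  ultimately show ?thesis by (metis mult_right_cancel)
qed

lemma ev_nmul: "ev (nmul n y) x = ev y x ^ n"
  by (induction n) (simp_all add: ev_add)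

lemma ev_nmul_arg: "ev y (nmul n x) = ev y x ^ n"
  by (induction n) (simp_all add: ev_add_arg)

text \<open>The compact-open topology is that of uniform convergence on compact sets. Finitely many compact
pieces, on each of which \<open>ev y\<close> varies by at most \<open>\<epsilon> / 3\<close>, cover \<open>K\<close>, and each piece with a disc around
a value of \<open>ev y\<close> gives a subbasic neighbourhood.\<close>
lemma eventually_dual_uniform:
  fixes y :: "'a::topological_ab_group_add dual"
  assumes K: "compact K" and e: "0 < \<epsilon>"
  shows "eventually (\<lambda>z. \<forall>x\<in>K. norm (ev z x - ev y x) < \<epsilon>) (nhds y)"
proof -
  define A where "A a = (\<lambda>x. norm (ev y x - ev y a)) -` {..<\<epsilon> / 3}" for a
  define C where "C a = K \<inter> (\<lambda>x. norm (ev y x - ev y a)) -` {..\<epsilon> / 3}" for a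
  have cont: "continuous_on UNIV (\<lambda>x. norm (ev y x - ev y a))" for a by (intro continuous_intros
      ev_continuous)
  have "open (A a)" for a unfolding A_def by (rule open_vimage[OF open_lessThan cont])
  moreover have "K \<subseteq> (\<Union>a\<in>K. A a)" using e by (auto simp: A_def)
  ultimately obtain F where F: "F \<subseteq> K" "finite F" "K \<subseteq> (\<Union>a\<in>F. A a)"
    using compactE_image[OF K, of K A] by metis
  have C: "compact (C a)" for a unfolding C_def
    by (intro compact_Int_closed K closed_vimage closed_atMost cont)
  have "\<forall>\<^sub>F z in nhds y. \<forall>a\<in>F. ev z ` C a \<subseteq> ball (ev y a) (\<epsilon> / 2)"
  proof (rule eventually_ball_finite[OF F(2)], rule ballI)
    fix a
    have "open {z :: 'a dual. ev z ` C a \<subseteq> ball (ev y a) (\<epsilon> / 2)}"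
      unfolding open_dual_def by (rule generate_topology.Basis) (use C in blast)
    then show "\<forall>\<^sub>F z in nhds y. ev z ` C a \<subseteq> ball (ev y a) (\<epsilon> / 2)"
      unfolding eventually_nhds
      by (intro exI[of _ "{z. ev z ` C a \<subseteq> ball (ev y a) (\<epsilon> / 2)}"]) (use e in \<open>auto simp: C_def dist_norm
          norm_minus_commute\<close>)
  qed
  then show ?thesis
  proof eventually_elim
    case (elim z)
    show ?case
    proof
      fix x assume x: "x \<in> K"
      then obtain a where a: "a \<in> F" "norm (ev y x - ev y a) < \<epsilon> / 3" using F by (auto simp: A_def)
      then have "x \<in> C a" using x by (simp add: C_def)
      then have "ev z x \<in> ball (ev y a) (\<epsilon> / 2)" using elim a(1) by blast
      then have "norm (ev y a - ev z x) < \<epsilon> / 2" by (simp add: dist_norm)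
      then show "norm (ev z x - ev y x) < \<epsilon>"
        using a(2) norm_triangle_ineq[of "ev z x - ev y a" "ev y a - ev y x"] e by (simp add:
            norm_minus_commute)
    qed
  qed
qed

lemma open_dual_uniform:
  fixes y :: "'a::topological_ab_group_add dual"
  assumes "open S" "y \<in> S"
  shows "\<exists>K \<epsilon>. compact K \<and> 0 < \<epsilon> \<and> (\<forall>z. (\<forall>x\<in>K. norm (ev z x - ev y x) < \<epsilon>) \<longrightarrow> z \<in> S)"
  using assms unfolding open_dual_def
proof (induction S rule: generate_topology.induct)
  case UNIV then show ?case by (intro exI[of _ "{}"] exI[of _ 1]) auto
next
  case (Int A B)
  have "y \<in> A" "y \<in> B" using Int.prems by auto
  from Int.IH(1)[OF this(1)] obtain K e where K: "compact K" "0 < e"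
    "\<forall>z. (\<forall>x\<in>K. norm (ev z x - ev y x) < e) \<longrightarrow> z \<in> A" by blast
  from Int.IH(2)[OF \<open>y \<in> B\<close>] obtain L d where L: "compact L" "0 < d"
    "\<forall>z. (\<forall>x\<in>L. norm (ev z x - ev y x) < d) \<longrightarrow> z \<in> B" by blast
  show ?case
  proof (intro exI[of _ "K \<union> L"] exI[of _ "min e d"] conjI allI impI)
    show "compact (K \<union> L)" using K(1) L(1) by (rule compact_Un)
    show "0 < min e d" using K(2) L(2) by simp
    fix z assume "\<forall>x\<in>K \<union> L. norm (ev z x - ev y x) < min e d"
    then show "z \<in> A \<inter> B" using K(3) L(3) by simp
  qed
next
  case (UN \<A>)
  then obtain A where A: "A \<in> \<A>" "y \<in> A" by blast
  from UN.IH[OF A] show ?case using A(1) by blast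
next
  case (Basis S)
  then obtain K U where S: "S = {z. ev z ` K \<subseteq> U}" "compact K" "open U" by blast
  have "compact (ev y ` K)"
    using S(2) ev_continuous continuous_on_subset by (intro compact_continuous_image) blast+
  moreover have "ev y ` K \<subseteq> U" using Basis.prems S by simp
  ultimately obtain e where e: "0 < e" "(\<Union>x\<in>ev y ` K. ball x e) \<subseteq> U"
    using compact_subset_open_imp_ball_epsilon_subset S(3) by metis
  have "ev z x \<in> U" if "\<forall>x\<in>K. norm (ev z x - ev y x) < e" "x \<in> K" for z x
  proof -
    have "ev z x \<in> ball (ev y x) e" using that by (simp add: dist_norm norm_minus_commute)
    then show ?thesis using e(2) that(2) by blast
  qed
  then show ?case unfolding S(1) using e(1) S(2) by (intro exI[of _ K] exI[of _ e]) auto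
qed

lemma tendsto_dual_iff:
  fixes y :: "'a::topological_ab_group_add dual"
  shows "(f \<longlongrightarrow> y) F \<longleftrightarrow> (\<forall>K \<epsilon>. compact K \<longrightarrow> 0 < \<epsilon> \<longrightarrow> (\<forall>\<^sub>F i in F. \<forall>x\<in>K. norm (ev (f i) x - ev y x) < \<epsilon>))"
proof (intro iffI allI impI)
  fix K :: "'a set" and \<epsilon> :: real assume "(f \<longlongrightarrow> y) F" "compact K" "0 < \<epsilon>"
  then show "\<forall>\<^sub>F i in F. \<forall>x\<in>K. norm (ev (f i) x - ev y x) < \<epsilon>"
    using eventually_dual_uniform[of K \<epsilon> y] by (auto simp: filterlim_iff)
next
  assume *: "\<forall>K \<epsilon>. compact K \<longrightarrow> 0 < \<epsilon> \<longrightarrow> (\<forall>\<^sub>F i in F. \<forall>x\<in>K. norm (ev (f i) x - ev y x) < \<epsilon>)"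
  show "(f \<longlongrightarrow> y) F"
  proof (rule topological_tendstoI)
    fix S assume "open S" "y \<in> S"
    then obtain K \<epsilon> where "compact K" "0 < \<epsilon>" and S: "\<And>z. (\<forall>x\<in>K. norm (ev z x - ev y x) < \<epsilon>) \<Longrightarrow> z \<in> S"
      using open_dual_uniform by metis
    then have "\<forall>\<^sub>F i in F. \<forall>x\<in>K. norm (ev (f i) x - ev y x) < \<epsilon>" using * by blast
    then show "\<forall>\<^sub>F i in F. f i \<in> S" by eventually_elim (rule S)
  qed
qed

instance dual :: (topological_ab_group_add) topological_ab_group_add
proof
  fix a b :: "'a dual"
  show "LIM x nhds a \<times>\<^sub>F nhds b. fst x + snd x :> nhds (a + b)"
    unfolding tendsto_dual_iff
  proof (intro allI impI)
    fix K :: "'a set" and \<epsilon> :: real assume K: "compact K" and e: "0 < \<epsilon>"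
    have "\<forall>\<^sub>F x in nhds a \<times>\<^sub>F nhds b. (\<forall>t\<in>K. norm (ev (fst x) t - ev a t) < \<epsilon> / 2) \<and> (\<forall>t\<in>K. norm (ev (snd x) t -
        ev b t) < \<epsilon> / 2)"
      using eventually_prodI[OF eventually_dual_uniform[OF K, of "\<epsilon> / 2" a] eventually_dual_uniform[OF K, of
          "\<epsilon> / 2" b]] e by simp
    then show "\<forall>\<^sub>F x in nhds a \<times>\<^sub>F nhds b. \<forall>t\<in>K. norm (ev (fst x + snd x) t - ev (a + b) t) < \<epsilon>"
    proof eventually_elim
      case (elim x)
      show ?case
      proof
        fix t assume t: "t \<in> K"
        have "ev (fst x + snd x) t - ev (a + b) t = (ev (fst x) t - ev a t) * ev (snd x) t + ev a t * (ev (snd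
            x) t - ev b t)"
          by (simp add: ev_add algebra_simps)
        then have "norm (ev (fst x + snd x) t - ev (a + b) t) \<le> norm (ev (fst x) t - ev a t) + norm (ev (snd
            x) t - ev b t)"
          using norm_triangle_ineq[of "(ev (fst x) t - ev a t) * ev (snd x) t" "ev a t * (ev (snd x) t - ev b
              t)"]
          by (simp add: norm_mult)
        also have "\<dots> < \<epsilon> / 2 + \<epsilon> / 2" by (intro add_strict_mono) (use elim t in blast)+
        finally show "norm (ev (fst x + snd x) t - ev (a + b) t) < \<epsilon>" by simp
      qed
    qed
  qed
  show "(uminus \<longlongrightarrow> - a) (nhds a)"
    unfolding tendsto_dual_iff
  proof (intro allI impI)
    fix K :: "'a set" and \<epsilon> :: real assume K: "compact K" and e: "0 < \<epsilon>"
    show "\<forall>\<^sub>F z in nhds a. \<forall>x\<in>K. norm (ev (- z) x - ev (- a) x) < \<epsilon>"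
      using eventually_dual_uniform[OF K e, of a]
      by eventually_elim (simp add: ev_minus flip: complex_cnj_diff)
  qed
qed

lemma nmul_continuous: "continuous_on UNIV (\<lambda>y::'a::topological_ab_group_add. nmul n y)"
  by (induction n) (auto intro!: continuous_intros)

lemma compact_exhaustion:
  assumes lc: "locally_compact_space (euclidean :: 'a::{second_countable_topology, t2_space} topology)"
  obtains K :: "nat \<Rightarrow> 'a::{second_countable_topology, t2_space} set" where "\<And>n. compact (K n)" "\<And>m n. m \<le> n \<Longrightarrow>
      K m \<subseteq> K n"
    "\<And>C. compact C \<Longrightarrow> \<exists>n. C \<subseteq> K n"
proof -
  define \<W> where "\<W> = {W :: 'a set. open W \<and> (\<exists>K. compact K \<and> W \<subseteq> K)}"
  have "\<exists>W\<in>\<W>. x \<in> W" for x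
    using bspec[OF lc[unfolded locally_compact_space_def], of x]
    unfolding \<W>_def compactin_euclidean_iff open_openin[symmetric] by auto
  then have cover: "\<Union>\<W> = UNIV" by blast
  obtain \<V> where V: "\<V> \<subseteq> \<W>" "countable \<V>" "\<Union>\<V> = \<Union>\<W>"
    using Lindelof[of \<W>] by (auto simp: \<W>_def)
  have "\<V> \<noteq> {}" using V(3) cover by auto
  then obtain W :: "nat \<Rightarrow> 'a set" where W: "range W = \<V>" using V(2) by (metis uncountable_def)
  have WW: "W n \<in> \<W>" for n
    by (rule subsetD[OF V(1)]) (simp only: W[symmetric] rangeI)
  have "\<exists>K. compact K \<and> W n \<subseteq> K" for n using WW[of n] by (simp add: \<W>_def)
  then have "\<forall>n. \<exists>K. compact K \<and> W n \<subseteq> K" by (rule allI)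
  from choice[OF this] obtain L where "\<forall>n. compact (L n) \<and> W n \<subseteq> L n" by blast
  then have L: "compact (L n)" "W n \<subseteq> L n" for n by blast+
  have oW: "open (W n)" for n using WW[of n] by (simp add: \<W>_def)
  show ?thesis
  proof (rule that[of "\<lambda>n. \<Union>i\<le>n. L i"])
    show "compact (\<Union>i\<le>n. L i)" for n by (intro compact_UN finite_atMost L ballI)
    show "(\<Union>i\<le>m. L i) \<subseteq> (\<Union>i\<le>n. L i)" if "m \<le> n" for m n using that by fastforce
    fix C :: "'a set" assume C: "compact C"
    have "C \<subseteq> (\<Union>n\<in>UNIV. W n)" using V(3) W cover by auto
    then obtain F where F: "finite F" "C \<subseteq> (\<Union>n\<in>F. W n)"
      using compactE_image[OF C, of UNIV W] oW by metis
    have "(\<Union>n\<in>F. W n) \<subseteq> (\<Union>i\<le>Max F. L i)" 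
    proof (rule UN_mono)
      show "F \<subseteq> {..Max F}" using Max_ge[OF F(1)] by (simp add: subset_iff)
    qed (rule L(2))
    with F(2) have "C \<subseteq> (\<Union>i\<le>Max F. L i)" by (rule order_trans)
    then show "\<exists>n. C \<subseteq> (\<Union>i\<le>n. L i)" by (rule exI)
  qed
qed

text \<open>The adjoint of multiplication by \<open>m\<close> on \<open>X\<close> is multiplication by \<open>m\<close> on \<open>Y\<close>.\<close>
lemma nmul_dense:
  fixes y :: "'a::{topological_ab_group_add, t2_space} dual"
  assumes lc: "locally_compact_space (euclidean :: 'a topology)" and inj: "inj (nmul m :: 'a \<Rightarrow> 'a)"
    and P: "eventually P (nhds y)"
  shows "\<exists>w. P (nmul m w)"
proof -
  obtain I :: "('a \<Rightarrow> real) \<Rightarrow> real" where I: "invariant_integral I" using invariant_integral_exists[OF lc] by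
      blast
  interpret invariant_integral I by (rule I)
  obtain S where S: "open S" "y \<in> S" "\<And>z. z \<in> S \<Longrightarrow> P z" using P by (auto simp: eventually_nhds)
  obtain K \<epsilon> where K: "compact K" "0 < \<epsilon>" "\<And>z. (\<forall>x\<in>K. norm (ev z x - ev y x) < \<epsilon>) \<Longrightarrow> z \<in> S"
    using open_dual_uniform[OF S(1,2)] by metis
  have add: "Modules.additive (nmul m :: 'a \<Rightarrow> 'a)" by unfold_locales (rule nmul_plus)
  have "0 < \<epsilon> / 2" using K by simp
  from adjoint_of_injective_has_dense_range[OF nmul_continuous add inj K(1) this, of y]
  obtain w :: "'a dual" where w: "\<forall>x\<in>K. norm (ev w (nmul m x) - ev y x) \<le> \<epsilon> / 2" by blast
  have "norm (ev (nmul m w) x - ev y x) < \<epsilon>" if "x \<in> K" for x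
    using bspec[OF w that] K(2) by (simp add: ev_nmul ev_nmul_arg)
  then show ?thesis using K(3) S(3) by blast
qed

lemma nmul_dense_sequence:
  fixes y :: "'a::{topological_ab_group_add, t2_space, second_countable_topology} dual"
  assumes lc: "locally_compact_space (euclidean :: 'a topology)" and inj: "\<And>k. inj (nmul (m k) :: 'a \<Rightarrow> 'a)"
  shows "\<exists>w. (\<lambda>k. nmul (m k) (w k)) \<longlonglongrightarrow> y"
proof -
  obtain K :: "nat \<Rightarrow> 'a set" where K: "\<And>n. compact (K n)" "\<And>m n. m \<le> n \<Longrightarrow> K m \<subseteq> K n"
    "\<And>C. compact C \<Longrightarrow> \<exists>n. C \<subseteq> K n"
    by (rule compact_exhaustion[OF lc]) blast
  have "\<exists>w. \<forall>x\<in>K k. norm (ev (nmul (m k) w) x - ev y x) < 1 / real (Suc k)" for k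
    by (rule nmul_dense[OF lc inj]) (rule eventually_dual_uniform[OF K(1)], simp)
  then obtain w where w: "\<And>k x. x \<in> K k \<Longrightarrow> norm (ev (nmul (m k) (w k)) x - ev y x) < 1 / real (Suc k)" by metis
  have "(\<lambda>k. nmul (m k) (w k)) \<longlonglongrightarrow> y"
    unfolding tendsto_dual_iff
  proof (intro allI impI)
    fix C :: "'a set" and \<epsilon> :: real assume "compact C" and e: "0 < \<epsilon>"
    then obtain n where n: "C \<subseteq> K n" using K(3) by blast
    obtain j where j: "1 / real (Suc j) < \<epsilon>" using nat_approx_posE[OF e] by auto
    show "\<forall>\<^sub>F k in sequentially. \<forall>x\<in>C. norm (ev (nmul (m k) (w k)) x - ev y x) < \<epsilon>"
      using eventually_ge_at_top[of "max n j"]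
    proof eventually_elim
      case (elim k)
      have "1 / real (Suc k) \<le> 1 / real (Suc j)" using elim by (intro divide_left_mono) auto
      moreover have "C \<subseteq> K k" using n K(2)[of n k] elim by auto
      ultimately show ?case using w j by (meson less_le_trans less_trans subsetD order_le_less_trans)
    qed
  qed
  then show ?thesis by blast
qed

section \<open>Characteristic functions of probability measures\<close>

locale borel_prob_space = prob_space \<mu> for \<mu> :: "'a::{topological_ab_group_add, t2_space,
    second_countable_topology} measure" +
  assumes sets_borel [measurable_cong]: "sets \<mu> = sets borel"
    and locally_compact: "locally_compact_space (euclidean :: 'a topology)"
begin

lemma ev_measurable: "ev y \<in> borel_measurable \<mu>"
  using borel_measurable_continuous_onI[OF ev_continuous[of y]] measurable_cong_sets[OF sets_borel refl] by
      blast

lemma ev_integrable: "complex_integrable \<mu> (ev y)"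
  by (rule integrable_const_bound[where B = 1]) (auto simp: ev_measurable)

lemma char_fn_zero: "char_fn \<mu> 0 = 1"
  by (simp add: char_fn_def prob_space)

lemma norm_char_fn_le: "norm (char_fn \<mu> y) \<le> 1"
  unfolding char_fn_def using integral_norm_bound[of \<mu> "ev y"] by (simp add: prob_space)

lemma char_fn_minus: "char_fn \<mu> (- y) = cnj (char_fn \<mu> y)"
proof -
  have "ev (- y) = (\<lambda>x. cnj (ev y x))" by (rule ext) (rule ev_minus)
  then show ?thesis by (simp add: char_fn_def)
qed

text \<open>The left hand side is a covariance of \<open>ev u\<close> and \<open>ev v\<close>, and the right hand side splits the product of
their centred versions by the inequality of arithmetic and geometric means. The weight \<open>t\<close> lets the
two variances be of different orders of magnitude.\<close>
lemma covariance_bound: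
  assumes t: "0 < t"
  shows "norm (char_fn \<mu> (u + v) - char_fn \<mu> u * char_fn \<mu> v)
     \<le> (t * (1 - (norm (char_fn \<mu> u))\<^sup>2) + (1 - (norm (char_fn \<mu> v))\<^sup>2) / t) / 2"
proof -
  define a b where "a = char_fn \<mu> u" and "b = char_fn \<mu> v"
  have ab: "(\<integral>x. ev u x \<partial>\<mu>) = a" "(\<integral>x. ev v x \<partial>\<mu>) = b" by (simp_all add: a_def b_def char_fn_def)
  have var: "integrable \<mu> (\<lambda>x. (norm (ev y x - char_fn \<mu> y))\<^sup>2) \<and> (\<integral>x. (norm (ev y x - char_fn \<mu> y))\<^sup>2 \<partial>\<mu>) = 1 -
      (norm (char_fn \<mu> y))\<^sup>2" for y
  proof -
    define c where "c = char_fn \<mu> y"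
    have eq: "complex_of_real ((norm (ev y x - c))\<^sup>2) = 1 + c * cnj c - cnj c * ev y x - c * cnj (ev y x)" for
        x
    proof -
      have "(z - c) * cnj (z - c) = cnj z * z + c * cnj c - cnj c * z - c * cnj z" for z
        by (simp add: algebra_simps)
      from this[of "ev y x"] show ?thesis unfolding complex_norm_square ev_cnj_mult .
    qed
    have i: "complex_integrable \<mu> (\<lambda>x. 1 + c * cnj c - cnj c * ev y x - c * cnj (ev y x))"
      using ev_integrable by auto
    then have ir: "integrable \<mu> (\<lambda>x. (norm (ev y x - c))\<^sup>2)" unfolding eq[symmetric] by (simp only:
        complex_of_real_integrable_eq)
    have "complex_of_real (\<integral>x. (norm (ev y x - c))\<^sup>2 \<partial>\<mu>) = (\<integral>x. 1 + c * cnj c - cnj c * ev y x - c * cnj (ev y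
        x) \<partial>\<mu>)"
      unfolding eq[symmetric] by (rule integral_complex_of_real[symmetric])
    also have "\<dots> = 1 + c * cnj c - cnj c * c - c * cnj c"
      using ev_integrable[of y] by (simp add: c_def char_fn_def prob_space)
    also have "\<dots> = complex_of_real (1 - (norm c)\<^sup>2)" by (simp add: complex_norm_square flip: of_real_power)
    finally show ?thesis using ir by (simp only: of_real_eq_iff c_def)
  qed
  have euv: "ev (u + v) = (\<lambda>x. ev u x * ev v x)" by (rule ext) (rule ev_add)
  have iuv: "complex_integrable \<mu> (\<lambda>x. ev u x * ev v x)" using ev_integrable[of "u + v"] by (simp only: euv)
  have "char_fn \<mu> (u + v) - a * b = (\<integral>x. (ev u x - a) * (ev v x - b) \<partial>\<mu>)"
  proof -
    have "(\<integral>x. (ev u x - a) * (ev v x - b) \<partial>\<mu>) = (\<integral>x. ev u x * ev v x - b * ev u x - a * ev v x + a * b \<partial>\<mu>)"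
      by (intro Bochner_Integration.integral_cong refl) (simp add: algebra_simps)
    also have "\<dots> = (\<integral>x. ev u x * ev v x \<partial>\<mu>) - b * a - a * b + a * b"
      using iuv ev_integrable[of u] ev_integrable[of v] by (simp add: ab prob_space)
    finally show ?thesis by (simp add: char_fn_def euv mult.commute)
  qed
  then have "norm (char_fn \<mu> (u + v) - a * b) \<le> (\<integral>x. norm ((ev u x - a) * (ev v x - b)) \<partial>\<mu>)"
    using integral_norm_bound[of \<mu> "\<lambda>x. (ev u x - a) * (ev v x - b)"] by simp
  also have "\<dots> \<le> (\<integral>x. (t * (norm (ev u x - a))\<^sup>2 + (norm (ev v x - b))\<^sup>2 / t) / 2 \<partial>\<mu>)"
  proof (rule integral_mono)
    show "integrable \<mu> (\<lambda>x. norm ((ev u x - a) * (ev v x - b)))"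
    proof (intro integrable_norm)
      have "complex_integrable \<mu> (\<lambda>x. ev u x * ev v x - b * ev u x - a * ev v x + a * b)"
        using iuv ev_integrable[of u] ev_integrable[of v] by auto
      then show "complex_integrable \<mu> (\<lambda>x. (ev u x - a) * (ev v x - b))" by (simp add: algebra_simps)
    qed
    show "integrable \<mu> (\<lambda>x. (t * (norm (ev u x - a))\<^sup>2 + (norm (ev v x - b))\<^sup>2 / t) / 2)"
      using var[of u] var[of v] by (simp add: a_def b_def)
    fix x
    define p q where "p = norm (ev u x - a)" and "q = norm (ev v x - b)"
    have "0 \<le> (t * p - q)\<^sup>2 / t" using t by simp
    also have "(t * p - q)\<^sup>2 / t = t * p\<^sup>2 + q\<^sup>2 / t - 2 * (p * q)" using t by (simp add: power2_eq_square
        field_simps)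
    finally show "norm ((ev u x - a) * (ev v x - b)) \<le> (t * (norm (ev u x - a))\<^sup>2 + (norm (ev v x - b))\<^sup>2 / t) /
        2"
      by (simp add: norm_mult p_def[symmetric] q_def[symmetric])
  qed
  also have "\<dots> = (t * (1 - (norm a)\<^sup>2) + (1 - (norm b)\<^sup>2) / t) / 2"
    using var[of u] var[of v] by (simp add: a_def b_def)
  finally show ?thesis by (simp add: a_def b_def)
qed

lemma tight:
  assumes e: "0 < \<epsilon>"
  obtains K where "compact K" "1 - \<epsilon> < measure \<mu> K"
proof -
  obtain K :: "nat \<Rightarrow> 'a set" where K: "\<And>n. compact (K n)" "\<And>m n. m \<le> n \<Longrightarrow> K m \<subseteq> K n"
    "\<And>C. compact C \<Longrightarrow> \<exists>n. C \<subseteq> K n"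
    by (rule compact_exhaustion[OF locally_compact]) blast
  have Ks: "K n \<in> sets \<mu>" for n unfolding sets_borel using compact_imp_closed[OF K(1)] by simp
  have "(\<Union>n. K n) = UNIV" using K(3)[of "{_}"] by auto
  moreover have "space \<mu> = UNIV" using sets_eq_imp_space_eq[OF sets_borel] by simp
  ultimately have "measure \<mu> (\<Union>n. K n) = 1" using prob_space by simp
  moreover have "(\<lambda>n. measure \<mu> (K n)) \<longlonglongrightarrow> measure \<mu> (\<Union>n. K n)"
    by (rule finite_Lim_measure_incseq) (use Ks K(2) in \<open>auto simp: incseq_def\<close>)
  ultimately have "\<forall>\<^sub>F n in sequentially. 1 - \<epsilon> < measure \<mu> (K n)"
    using order_tendstoD(1)[of "\<lambda>n. measure \<mu> (K n)" 1 sequentially "1 - \<epsilon>"] e by simp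
  then obtain n where "1 - \<epsilon> < measure \<mu> (K n)" unfolding eventually_sequentially by blast
  then show ?thesis using K(1) by (intro that[of "K n"])
qed

lemma char_fn_continuous: "continuous_on UNIV (char_fn \<mu>)"
  unfolding continuous_on_def
proof (intro ballI tendstoI)
  fix y and e :: real assume e: "0 < e"
  then have e8: "0 < e / 8" by simp
  obtain K where K: "compact K" "1 - e / 8 < measure \<mu> K" by (rule tight[OF e8]) blast
  have Ks: "K \<in> sets \<mu>" unfolding sets_borel using compact_imp_closed[OF K(1)] by simp
  have sp: "space \<mu> = UNIV" using sets_eq_imp_space_eq[OF sets_borel] by simp
  have "eventually (\<lambda>z. \<forall>x\<in>K. norm (ev z x - ev y x) < e / 2) (nhds y)"
    using eventually_dual_uniform[OF K(1), of "e / 2"] e by simp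
  then have "eventually (\<lambda>z. dist (char_fn \<mu> z) (char_fn \<mu> y) < e) (nhds y)"
  proof eventually_elim
    case (elim z)
    have "dist (char_fn \<mu> z) (char_fn \<mu> y) = norm (\<integral>x. ev z x - ev y x \<partial>\<mu>)"
      unfolding dist_norm char_fn_def by (subst Bochner_Integration.integral_diff[OF ev_integrable
          ev_integrable]) simp
    also have "\<dots> \<le> (\<integral>x. norm (ev z x - ev y x) \<partial>\<mu>)" by (rule integral_norm_bound)
    also have "\<dots> \<le> (\<integral>x. e / 2 + 2 * indicator (UNIV - K) x \<partial>\<mu>)"
    proof (rule integral_mono)
      show "integrable \<mu> (\<lambda>x. norm (ev z x - ev y x))" using ev_integrable by auto
      show "integrable \<mu> (\<lambda>x. e / 2 + 2 * indicator (UNIV - K) x :: real)"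
        using Ks sets.compl_sets[OF Ks] by (auto simp: sp emeasure_eq_measure)
      fix x
      have "norm (ev z x - ev y x) \<le> 2" using norm_triangle_ineq4[of "ev z x" "ev y x"] by simp
      then show "norm (ev z x - ev y x) \<le> e / 2 + 2 * indicator (UNIV - K) x"
        using elim e by (cases "x \<in> K") (auto simp: less_imp_le)
    qed
    also have "\<dots> = e / 2 + 2 * measure \<mu> (UNIV - K)"
      using Ks sets.compl_sets[OF Ks] prob_space by (simp add: sp emeasure_eq_measure)
    also have "measure \<mu> (UNIV - K) = 1 - measure \<mu> K" using prob_compl[OF Ks] by (simp add: sp)
    also have "e / 2 + 2 * (1 - measure \<mu> K) < e" using K(2) e by argo
    finally show ?case .
  qed
  then show "\<forall>\<^sub>F x in at y within UNIV. dist (char_fn \<mu> x) (char_fn \<mu> y) < e"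
    by (rule filter_leD[rotated]) (simp add: at_within_def)
qed

end

section \<open>Polynomials on Abelian groups\<close>

lemma diff_op_commute: "diff_op h (diff_op k f) = diff_op k (diff_op h f)"
  by (rule ext) (simp add: diff_op_def algebra_simps)

lemma diff_op_funpow_commute: "(diff_op h ^^ n) (diff_op k f) = diff_op k ((diff_op h ^^ n) f)"
  by (induction n) (simp_all add: diff_op_commute)

lemma diff_op_funpow_add: "(diff_op h ^^ n) (\<lambda>x. f x + g x) x = (diff_op h ^^ n) f x + (diff_op h ^^ n) g x"
  by (induction n arbitrary: x) (simp_all add: diff_op_Suc del: funpow.simps(2))

lemma diff_op_funpow_comp:
  assumes "\<And>a b. L (a + b) = L a + L b"
  shows "(diff_op p ^^ n) (\<lambda>z. \<phi> (L z)) z = (diff_op (L p) ^^ n) \<phi> (L z)"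
  by (induction n arbitrary: z) (simp_all add: diff_op_Suc assms del: funpow.simps(2))

lemma diff_op_funpow_additive:
  assumes "\<And>a b. T (a - b) = T a - T b"
  shows "(diff_op h ^^ n) (\<lambda>x. T (f x)) x = T ((diff_op h ^^ n) f x)"
  by (induction n arbitrary: x) (simp_all add: diff_op_Suc assms del: funpow.simps(2))

lemma difference_eq_diff_op: "difference = diff_op"
  by (intro ext) (simp add: difference_def diff_op_def)

lemma diff_op_continuous:
  fixes f :: "'a::topological_ab_group_add \<Rightarrow> real"
  assumes "continuous_on UNIV f"
  shows "continuous_on UNIV (\<lambda>p. (diff_op (fst p) ^^ n) f (snd p))"
proof (induction n)
  case 0
  show ?case by (simp, rule continuous_on_UNIV_compose[OF assms]) (intro continuous_intros)
next
  case (Suc n)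
  have "continuous_on UNIV (\<lambda>p. (diff_op (fst (fst p, snd p + fst p)) ^^ n) f (snd (fst p, snd p + fst p)))"
    by (rule continuous_on_UNIV_compose[OF Suc]) (intro continuous_intros)
  from continuous_on_diff[OF this Suc] show ?case by (simp add: diff_op_Suc del: funpow.simps(2))
qed

text \<open>Applying \<open>diff_op (p j)\<close> to the equation removes the summand \<open>\<phi> j\<close>, since \<open>L j\<close> does not see \<open>p j\<close>,
replaces the other \<open>\<phi> i\<close> by differences of themselves and \<open>\<phi>0\<close> by \<open>diff_op w \<phi>0\<close>. When no summand is
left, the surjectivity of \<open>L0\<close> turns the equation into one for \<open>\<phi>0\<close>.\<close>
lemma elimination:
  fixes \<phi>0 :: "'y::ab_group_add \<Rightarrow> real" and \<phi> :: "'i \<Rightarrow> 'y \<Rightarrow> real" and L :: "'i \<Rightarrow> 'z::ab_group_add \<Rightarrow> 'y"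
  assumes I: "finite I"
    and poly: "\<And>h z. (diff_op h ^^ m) (\<lambda>z. \<phi>0 (L0 z) + (\<Sum>i\<in>I. \<phi> i (L i z))) z = 0"
    and L: "\<And>i a b. L i (a + b) = L i a + L i b" "\<And>a b. L0 (a + b) = L0 a + L0 b"
    and p: "\<And>i. i \<in> I \<Longrightarrow> L i (p i) = 0" "\<And>i. i \<in> I \<Longrightarrow> L0 (p i) = w"
    and s: "\<And>x. L0 (s x) = x"
  shows "(diff_op w ^^ (m + card I)) \<phi>0 x = 0"
  using I poly p
proof (induction I arbitrary: \<phi>0 \<phi> rule: finite_induct)
  case empty
  have "(diff_op (L0 (s w)) ^^ m) \<phi>0 (L0 (s x)) = 0"
    using empty(1)[of "s w" "s x"] by (simp add: diff_op_funpow_comp[of L0, OF L(2)])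
  then show ?case by (simp add: s)
next
  case (insert j I)
  define F where "F z = \<phi>0 (L0 z) + (\<Sum>i\<in>insert j I. \<phi> i (L i z))" for z
  have "diff_op (p j) F = (\<lambda>z. diff_op w \<phi>0 (L0 z) + (\<Sum>i\<in>I. diff_op (L i (p j)) (\<phi> i) (L i z)))"
  proof
    fix z
    have "F z = \<phi>0 (L0 z) + \<phi> j (L j z) + (\<Sum>i\<in>I. \<phi> i (L i z))" for z
      using insert.hyps by (simp add: F_def)
    then show "diff_op (p j) F z = diff_op w \<phi>0 (L0 z) + (\<Sum>i\<in>I. diff_op (L i (p j)) (\<phi> i) (L i z))"
      using insert.prems(2,3)[of j] by (simp add: diff_op_def L sum_subtractf)
  qed
  moreover have "(diff_op h ^^ m) (diff_op (p j) F) z = 0" for h z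
  proof -
    have "(diff_op h ^^ m) F = (\<lambda>z. 0)" using insert.prems(1) by (auto simp: F_def[abs_def])
    then show ?thesis by (simp add: diff_op_funpow_commute diff_op_def[of "p j"])
  qed
  ultimately have "(diff_op h ^^ m) (\<lambda>z. diff_op w \<phi>0 (L0 z) + (\<Sum>i\<in>I. diff_op (L i (p j)) (\<phi> i) (L i z))) z =
      0" for h z
    by simp
  from insert.IH[OF this] insert.prems(2,3) have "(diff_op w ^^ (m + card I)) (diff_op w \<phi>0) x = 0" by blast
  then show ?case using insert.hyps by (simp add: funpow_swap1)
qed

lemma newton_expansion:
  fixes f :: "'a::ab_group_add \<Rightarrow> real"
  shows "f (x + nmul n h) = (\<Sum>i\<le>n. real (n choose i) * (diff_op h ^^ i) f x)"
proof (induction n arbitrary: x)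
  case (Suc n)
  have "f (x + nmul (Suc n) h) = f ((x + h) + nmul n h)" by (simp add: algebra_simps)
  also have "\<dots> = (\<Sum>i\<le>n. real (n choose i) * (diff_op h ^^ i) f (x + h))" by (rule Suc)
  also have "\<dots> = (\<Sum>i\<le>n. real (n choose i) * (diff_op h ^^ i) f x) + (\<Sum>i\<le>n. real (n choose i) * (diff_op h ^^
      Suc i) f x)"
    by (simp add: diff_op_Suc sum.distrib[symmetric] algebra_simps del: funpow.simps(2))
  also have "(\<Sum>i\<le>n. real (n choose i) * (diff_op h ^^ i) f x) = f x + (\<Sum>i\<le>n. real (n choose Suc i) * (diff_op
      h ^^ Suc i) f x)"
  proof -
    have "(\<Sum>i\<le>n. real (n choose i) * (diff_op h ^^ i) f x) = (\<Sum>i\<le>Suc n. real (n choose i) * (diff_op h ^^ i) f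
        x)" by simp
    also have "\<dots> = f x + (\<Sum>i\<le>n. real (n choose Suc i) * (diff_op h ^^ Suc i) f x)"
      by (subst sum.atMost_Suc_shift) simp
    finally show ?thesis .
  qed
  also have "f x + (\<Sum>i\<le>n. real (n choose Suc i) * (diff_op h ^^ Suc i) f x) + (\<Sum>i\<le>n. real (n choose i) *
      (diff_op h ^^ Suc i) f x)
     = f x + (\<Sum>i\<le>n. real (Suc n choose Suc i) * (diff_op h ^^ Suc i) f x)"
    by (simp add: sum.distrib distrib_right add_ac del: funpow.simps)
  also have "\<dots> = (\<Sum>i\<le>Suc n. real (Suc n choose i) * (diff_op h ^^ i) f x)"
    unfolding sum.atMost_Suc_shift[of _ n] by simp
  finally show ?case .
qed simp

text \<open>The binomial coefficient as a polynomial in its upper argument, for Newton's interpolation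
formula.\<close>
definition binomial_poly :: "nat \<Rightarrow> real poly" where
  "binomial_poly i = smult (1 / fact i) (\<Prod>j<i. [:- real j, 1:])"

lemma poly_binomial_poly: "poly (binomial_poly i) (real n) = real (n choose i)"
  unfolding binomial_gbinomial gbinomial_prod_rev
  by (simp add: binomial_poly_def poly_prod atLeast0LessThan)

lemma poly_eq_on_nat:
  fixes p q :: "real poly"
  assumes "\<And>n::nat. poly p (real n) = poly q (real n)"
  shows "p = q"
proof (rule ccontr)
  assume "p \<noteq> q"
  then have "finite {x. poly (p - q) x = 0}" by (intro poly_roots_finite) simp
  moreover have "range real \<subseteq> {x. poly (p - q) x = 0}" using assms by auto
  moreover have "infinite (range real)" by (rule range_inj_infinite) (simp add: inj_on_def)
  ultimately show False using finite_subset by blast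
qed

lemma even_poly_factor:
  fixes e :: "real poly"
  assumes even: "\<And>t. poly e (- t) = poly e t" and zero: "poly e 0 = 0"
  obtains s where "\<And>t. poly e t = t\<^sup>2 * poly s t"
proof -
  obtain r where r: "e = [:0, 1:] * r" using zero poly_eq_0_iff_dvd[of e 0] by (auto elim: dvdE)
  have "poly r (- t) = - poly r t" if "t \<noteq> 0" for t
  proof -
    have "t * poly r (- t) = t * (- poly r t)" using even[of t] by (simp add: r)
    then show ?thesis using that unfolding mult_left_cancel[OF that] by simp
  qed
  then have "poly r (- real (Suc n)) = - poly r (real (Suc n))" for n using of_nat_neq_0 by blast
  then have "poly (pcompose r [:-1, -1:]) (real n) = poly (- pcompose r [:1, 1:]) (real n)" for n
    by (simp add: poly_pcompose algebra_simps)
  then have eq: "pcompose r [:-1, -1:] = - pcompose r [:1, 1:]" by (rule poly_eq_on_nat)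
  have "poly r 0 = - poly r 0"
    using arg_cong[OF eq, of "\<lambda>p. poly p (-1)"] by (simp add: poly_pcompose)
  then obtain s where s: "r = [:0, 1:] * s" using poly_eq_0_iff_dvd[of r 0] by (auto elim: dvdE)
  show ?thesis by (rule that[of s]) (simp add: r s power2_eq_square)
qed

locale continuous_polynomial =
  fixes \<psi> :: "'a::topological_ab_group_add \<Rightarrow> real" and M :: nat
  assumes psi_continuous: "continuous_on UNIV \<psi>" and psi_poly: "\<And>w x. (diff_op w ^^ M) \<psi> x = 0"
begin

text \<open>The real polynomial that interpolates \<open>n \<mapsto> \<psi> (x + n h)\<close>. Its coefficients depend continuously on \<open>h\<close>,
which makes sense of \<open>\<psi> (t h)\<close> for real \<open>t\<close>.\<close>
definition newton :: "'a \<Rightarrow> 'a \<Rightarrow> real poly" where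
  "newton x h = (\<Sum>i<M. smult ((diff_op h ^^ i) \<psi> x) (binomial_poly i))"

lemma psi_poly_ge: "M \<le> i \<Longrightarrow> (diff_op w ^^ i) \<psi> x = 0"
  by (induction i arbitrary: x rule: dec_induct) (simp_all add: psi_poly diff_op_Suc del: funpow.simps(2))

lemma poly_newton: "poly (newton x h) (real n) = \<psi> (x + nmul n h)"
proof -
  have "\<psi> (x + nmul n h) = (\<Sum>i\<le>n. real (n choose i) * (diff_op h ^^ i) \<psi> x)" by (rule newton_expansion)
  also have "\<dots> = (\<Sum>i\<in>{..n} \<union> {..<M}. real (n choose i) * (diff_op h ^^ i) \<psi> x)"
    by (rule sum.mono_neutral_left) auto
  also have "\<dots> = (\<Sum>i<M. real (n choose i) * (diff_op h ^^ i) \<psi> x)"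
    by (rule sum.mono_neutral_right) (auto simp: psi_poly_ge)
  also have "\<dots> = poly (newton x h) (real n)"
    by (simp add: newton_def poly_sum poly_binomial_poly mult.commute)
  finally show ?thesis ..
qed

lemma diff_op_tendsto:
  assumes "(z \<longlongrightarrow> y) F"
  shows "((\<lambda>k. (diff_op (z k) ^^ i) \<psi> 0) \<longlongrightarrow> (diff_op y ^^ i) \<psi> 0) F"
proof -
  have "continuous_on UNIV (\<lambda>w. (diff_op (fst (w, 0::'a)) ^^ i) \<psi> (snd (w, 0::'a)))"
    by (rule continuous_on_UNIV_compose[where g = "\<lambda>w. (w, 0)" and f = "\<lambda>p. (diff_op (fst p) ^^ i) \<psi> (snd
        p)"])
      (rule diff_op_continuous[OF psi_continuous], intro continuous_intros)
  from continuous_on_tendsto_compose[OF this assms(1)] show ?thesis by simp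
qed

lemma poly_newton_tendsto:
  assumes "(z \<longlongrightarrow> y) F" "(t \<longlongrightarrow> t0) F"
  shows "((\<lambda>k. poly (newton 0 (z k)) (t k)) \<longlongrightarrow> poly (newton 0 y) t0) F"
proof -
  have "((\<lambda>k. poly (binomial_poly i) (t k)) \<longlongrightarrow> poly (binomial_poly i) t0) F" for i
    by (rule isCont_tendsto_compose[OF poly_isCont assms(2)])
  then show ?thesis unfolding newton_def poly_sum poly_smult
    by (intro tendsto_sum tendsto_mult diff_op_tendsto[OF assms(1)])
qed

lemma newton_scale: "poly (newton 0 (nmul m h)) t = poly (newton 0 h) (real m * t)"
proof -
  have "newton 0 (nmul m h) = pcompose (newton 0 h) [:0, real m:]"
  proof (rule poly_eq_on_nat)
    fix n
    have "nmul n (nmul m h) = nmul (n * m) h" by (rule nmul_nmul)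
    then show "poly (newton 0 (nmul m h)) (real n) = poly (pcompose (newton 0 h) [:0, real m:]) (real n)"
      using poly_newton[of 0 h "n * m"] by (simp add: poly_newton poly_pcompose)
  qed
  then show ?thesis by (simp add: poly_pcompose mult.commute)
qed

lemma newton_even:
  assumes even: "\<And>y. \<psi> (- y) = \<psi> y"
  shows "poly (newton 0 h) (- t) = poly (newton 0 h) t"
proof -
  have neg: "poly (newton 0 h) (- real N) = poly (newton 0 h) (real N)" for N
  proof -
    define q where "q = newton (- nmul N h) h"
    have "newton 0 h = pcompose q [:real N, 1:]"
    proof (rule poly_eq_on_nat)
      fix n
      have "- nmul N h + nmul (n + N) h = 0 + nmul n h" by (simp add: nmul_add)
      then show "poly (newton 0 h) (real n) = poly (pcompose q [:real N, 1:]) (real n)"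
        using poly_newton[of "- nmul N h" h "n + N"] by (simp add: poly_newton poly_pcompose q_def
            add.commute)
    qed
    then have "poly (newton 0 h) (- real N) = poly q (real 0)" by (simp add: poly_pcompose)
    also have "\<dots> = \<psi> (- nmul N h)" unfolding q_def poly_newton by simp
    also have "\<dots> = poly (newton 0 h) (real N)" by (simp add: even poly_newton)
    finally show ?thesis .
  qed
  have "pcompose (newton 0 h) [:0, -1:] = newton 0 h"
    by (rule poly_eq_on_nat) (simp add: poly_pcompose neg)
  then have "poly (pcompose (newton 0 h) [:0, -1:]) t = poly (newton 0 h) t" by simp
  then show ?thesis by (simp add: poly_pcompose)
qed

end

lemma second_moment_subsequence:
  fixes \<rho> :: "nat \<Rightarrow> real measure"
  assumes \<rho>: "\<And>k. real_distribution (\<rho> k)" and int: "\<And>k. integrable (\<rho> k) (\<lambda>x. x\<^sup>2)"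
    and B: "\<And>k. (\<integral>x. x\<^sup>2 \<partial>\<rho> k) \<le> B"
  obtains r \<rho>' where "strict_mono (r :: nat \<Rightarrow> nat)" "real_distribution \<rho>'" "\<And>t. (\<lambda>k. char (\<rho> (r k)) t) \<longlonglongrightarrow> char
      \<rho>' t"
proof -
  have "\<exists>a b::real. a < b \<and> (\<forall>k. 1 - \<epsilon> < measure (\<rho> k) {a<..b})" if e: "0 < \<epsilon>" for \<epsilon>
  proof -
    define C where "C = 1 + \<bar>B\<bar> / \<epsilon>"
    have C0: "0 < C" using e by (simp add: C_def add_pos_nonneg)
    have "\<epsilon> * C = \<epsilon> + \<bar>B\<bar>" using e by (simp add: C_def field_simps)
    then have "B < \<epsilon> * C" using e by linarith
    then have C: "0 < C" "B / C < \<epsilon>" using C0 by (simp_all add: pos_divide_less_eq)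
    define b where "b = sqrt C"
    have b: "0 < b" "b\<^sup>2 = C" using C by (simp_all add: b_def)
    have "1 - \<epsilon> < measure (\<rho> k) {-b<..b}" for k
    proof -
      interpret real_distribution "\<rho> k" by (rule \<rho>)
      have "measure (\<rho> k) {x\<in>space (\<rho> k). C \<le> x\<^sup>2} \<le> (\<integral>x. x\<^sup>2 \<partial>\<rho> k) / C"
        by (rule integral_Markov_inequality_measure[of _ _ UNIV]) (use int C in auto)
      also have "\<dots> \<le> B / C" using B C by (simp add: divide_right_mono)
      finally have *: "measure (\<rho> k) {x. C \<le> x\<^sup>2} < \<epsilon>" using C(2) by simp
      have "measure (\<rho> k) (- {-b<..b}) \<le> measure (\<rho> k) {x. C \<le> x\<^sup>2}"
      proof (rule finite_measure_mono)
        show "- {-b<..b} \<subseteq> {x. C \<le> x\<^sup>2}"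
        proof
          fix x assume "x \<in> - {-b<..b}"
          then have "b \<le> \<bar>x\<bar>" by auto
          then have "b\<^sup>2 \<le> \<bar>x\<bar>\<^sup>2" using b by (intro power_mono) auto
          then show "x \<in> {x. C \<le> x\<^sup>2}" using b by simp
        qed
      qed simp
      moreover have "measure (\<rho> k) (- {-b<..b}) = 1 - measure (\<rho> k) {-b<..b}"
        using prob_compl[of "{-b<..b}"] by (simp add: Compl_eq_Diff_UNIV)
      ultimately show ?thesis using * by simp
    qed
    then show ?thesis using b by (intro exI[of _ "-b"] exI[of _ b]) auto
  qed
  then have "tight \<rho>" using \<rho> by (simp add: tight_def)
  then obtain r \<rho>' where r: "strict_mono r" "real_distribution \<rho>'" "weak_conv_m (\<rho> \<circ> (\<lambda>k. k) \<circ> r) \<rho>'"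
    using tight_imp_convergent_subsubsequence[of \<rho> "\<lambda>k. k"] by (auto simp: strict_mono_def)
  show ?thesis
  proof (rule that[OF r(1,2)])
    show "(\<lambda>k. char (\<rho> (r k)) t) \<longlonglongrightarrow> char \<rho>' t" for t
      using levy_continuity1[OF _ r(2,3)] \<rho> by simp
  qed
qed

text \<open>Taking \<open>Im w\<close> for the argument of \<open>w\<close> costs an error quadratic in \<open>w - 1\<close> and avoids choosing a branch.\<close>
lemma unimodular_near_exponential:
  fixes w :: complex
  assumes "norm w = 1"
  shows "norm (w ^ n - exp (\<i> * complex_of_real (real n * Im w))) \<le> real n * (norm (w - 1))\<^sup>2"
proof -
  define v where "v = Im w"
  have sq: "(Re w)\<^sup>2 + v\<^sup>2 = 1" using assms by (simp add: cmod_def v_def)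
  have n1: "(norm (w - 1))\<^sup>2 = 2 * (1 - Re w)" unfolding cmod_power2 using sq by (simp add: v_def
      power2_eq_square algebra_simps)
  have re: "Re w \<le> 1" using complex_Re_le_cmod[of w] assms by simp
  have "norm (exp (\<i> * complex_of_real v) - (1 + \<i> * complex_of_real v)) \<le> v\<^sup>2 / 2"
    using iexp_approx1[of v 1] by (simp add: power2_eq_square)
  moreover have "norm ((1 + \<i> * complex_of_real v) - w) = 1 - Re w"
  proof -
    have "(1 + \<i> * complex_of_real v) - w = complex_of_real (1 - Re w)" by (rule complex_eqI) (simp_all add:
        v_def)
    then show ?thesis using re by (simp only: norm_of_real)
  qed
  moreover have "v\<^sup>2 \<le> 2 * (1 - Re w)"
  proof -
    have "v\<^sup>2 = (1 - Re w) * (1 + Re w)" using sq by (simp add: power2_eq_square algebra_simps)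
    also have "\<dots> \<le> (1 - Re w) * 2" using re by (intro mult_left_mono) auto
    finally show ?thesis by simp
  qed
  ultimately have "norm (exp (\<i> * complex_of_real v) - w) \<le> (norm (w - 1))\<^sup>2"
    using norm_triangle_ineq[of "exp (\<i> * complex_of_real v) - (1 + \<i> * complex_of_real v)" "(1 + \<i> *
        complex_of_real v) - w"] n1
    by simp
  then have 1: "norm (w - exp (\<i> * complex_of_real v)) \<le> (norm (w - 1))\<^sup>2" by (simp add: norm_minus_commute)
  have "norm (w ^ n - exp (\<i> * complex_of_real v) ^ n) \<le> real n * norm (w - exp (\<i> * complex_of_real v))"
    by (rule norm_power_diff) (simp_all add: assms)
  also have "\<dots> \<le> real n * (norm (w - 1))\<^sup>2" using 1 by (intro mult_left_mono) auto
  finally show ?thesis by (simp add: v_def exp_of_nat_mult[symmetric] algebra_simps)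
qed

context continuous_polynomial
begin

text \<open>Along a line through the origin an even polynomial without constant term is divisible by \<open>t\<^sup>2\<close>. The
cofactors \<open>s i\<close> do not depend on \<open>h\<close>, so the estimate below is uniform in convergent directions.\<close>
lemma newton_quadratic_factor:
  assumes even: "\<And>y. \<psi> (- y) = \<psi> y" and zero: "\<psi> 0 = 0"
  obtains s :: "nat \<Rightarrow> real poly" where "\<And>h t. poly (newton 0 h) t = t\<^sup>2 * (\<Sum>i<M. (diff_op h ^^ i) \<psi> 0 * poly (s
      i) t)"
proof -
  define e where "e i = smult (1/2) (binomial_poly i + pcompose (binomial_poly i) [:0, -1:])" for i
  have e: "poly (e i) t = (poly (binomial_poly i) t + poly (binomial_poly i) (- t)) / 2" for i t
    by (simp add: e_def poly_pcompose)
  have "\<exists>s. \<forall>t. poly (e i) t = t\<^sup>2 * poly s t" if "i \<noteq> 0" for i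
  proof -
    have 0: "poly (e i) 0 = 0" using poly_binomial_poly[of i 0] that by (simp add: e)
    have 1: "poly (e i) (- t) = poly (e i) t" for t by (simp add: e)
    obtain s where "\<And>t. poly (e i) t = t\<^sup>2 * poly s t" by (rule even_poly_factor[OF 1 0]) blast
    then show ?thesis by blast
  qed
  then obtain s where s: "\<And>i t. i \<noteq> 0 \<Longrightarrow> poly (e i) t = t\<^sup>2 * poly (s i) t" by metis
  have "poly (newton 0 h) t = t\<^sup>2 * (\<Sum>i<M. (diff_op h ^^ i) \<psi> 0 * poly (s i) t)" for h t
  proof -
    have "poly (newton 0 h) t = (poly (newton 0 h) t + poly (newton 0 h) (- t)) / 2" using newton_even[OF
        even] by simp
    also have "\<dots> = (\<Sum>i<M. (diff_op h ^^ i) \<psi> 0 * poly (e i) t)"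
      unfolding newton_def e by (simp add: poly_sum sum.distrib[symmetric] sum_divide_distrib algebra_simps
          add_divide_distrib)
    also have "\<dots> = (\<Sum>i<M. t\<^sup>2 * ((diff_op h ^^ i) \<psi> 0 * poly (s i) t))"
    proof (rule sum.cong[OF refl])
      fix i show "(diff_op h ^^ i) \<psi> 0 * poly (e i) t = t\<^sup>2 * ((diff_op h ^^ i) \<psi> 0 * poly (s i) t)"
        by (cases "i = 0") (simp_all add: zero s)
    qed
    finally show ?thesis by (simp add: sum_distrib_left)
  qed
  then show ?thesis by (rule that)
qed

lemma newton_quadratic_decay:
  assumes even: "\<And>y. \<psi> (- y) = \<psi> y" and zero: "\<psi> 0 = 0"
    and z: "z \<longlonglongrightarrow> y" and t: "t \<longlonglongrightarrow> t0"
  obtains B where "\<And>k::nat. poly (newton 0 (z k)) (t k) \<le> (t k)\<^sup>2 * B"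
proof -
  obtain s :: "nat \<Rightarrow> real poly" where s: "\<And>h t. poly (newton 0 h) t = t\<^sup>2 * (\<Sum>i<M. (diff_op h ^^ i) \<psi> 0 * poly
      (s i) t)"
    by (rule newton_quadratic_factor[OF even zero]) blast
  have "((\<lambda>k. poly (s i) (t k)) \<longlonglongrightarrow> poly (s i) t0)" for i
    by (rule isCont_tendsto_compose[OF poly_isCont t])
  then have "(\<lambda>k. \<Sum>i<M. (diff_op (z k) ^^ i) \<psi> 0 * poly (s i) (t k)) \<longlonglongrightarrow> (\<Sum>i<M. (diff_op y ^^ i) \<psi> 0 * poly (s
      i) t0)"
    by (intro tendsto_sum tendsto_mult diff_op_tendsto[OF z])
  then have "Bseq (\<lambda>k. \<Sum>i<M. (diff_op (z k) ^^ i) \<psi> 0 * poly (s i) (t k))" by (intro convergent_imp_Bseq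
      convergentI)
  then obtain B where B: "\<And>k. norm (\<Sum>i<M. (diff_op (z k) ^^ i) \<psi> 0 * poly (s i) (t k)) \<le> B" using BseqD by
      blast
  have "poly (newton 0 (z k)) (t k) \<le> (t k)\<^sup>2 * B" for k
    unfolding s using B[of k] by (intro mult_left_mono) auto
  then show ?thesis by (rule that)
qed

end

section \<open>Passage to a law on the line\<close>

text \<open>The setting of the Marcinkiewicz theorem on the group. The absence of elements of order two makes
\<open>2\<^sup>k Y\<close> dense in \<open>Y\<close> for every \<open>k\<close>, which substitutes for divisibility.\<close>
locale polynomial_char_fn = borel_prob_space \<mu>
  for \<mu> :: "'a::{topological_ab_group_add, t2_space, second_countable_topology} measure" +
  fixes M :: nat
  assumes nonvanishing: "char_fn \<mu> y \<noteq> 0"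
    and polynomial: "(diff_op w ^^ M) (\<lambda>y. - ln ((norm (char_fn \<mu> y))\<^sup>2)) x = 0"
    and no_involution: "a + a = (0::'a) \<Longrightarrow> a = 0"
begin

definition \<psi> :: "'a dual \<Rightarrow> real" where "\<psi> y = - ln ((norm (char_fn \<mu> y))\<^sup>2)"

lemma norm_char_fn: "norm (char_fn \<mu> y) = exp (- \<psi> y / 2)"
  using nonvanishing[of y] by (simp add: \<psi>_def ln_realpow)

lemma psi_nonneg: "0 \<le> \<psi> y"
proof -
  have "exp (- \<psi> y / 2) \<le> exp 0" using norm_char_fn_le[of y] by (simp add: norm_char_fn)
  then show ?thesis by (simp only: exp_le_cancel_iff)
qed

lemma psi_zero: "\<psi> 0 = 0" by (simp add: \<psi>_def char_fn_zero)

lemma psi_even: "\<psi> (- y) = \<psi> y" by (simp add: \<psi>_def char_fn_minus)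

sublocale continuous_polynomial \<psi> M
proof
  show "continuous_on UNIV \<psi>"
    unfolding \<psi>_def[abs_def] using nonvanishing
    by (intro continuous_intros char_fn_continuous) auto
  show "(diff_op w ^^ M) \<psi> x = 0" for w x unfolding \<psi>_def[abs_def] by (rule polynomial)
qed

lemma inj_two_power: "inj (nmul (2 ^ k) :: 'a \<Rightarrow> 'a)"
proof (induction k)
  case 0 then show ?case by (simp add: inj_def)
next
  case (Suc k)
  have "x = 0" if "nmul (2 ^ Suc k) x = 0" for x :: 'a
  proof -
    have "nmul (2 ^ k) x + nmul (2 ^ k) x = 0" using that nmul_nmul[of 2 "2 ^ k" x] by (simp add: nmul_two)
    then have "nmul (2 ^ k) x = 0" by (rule no_involution)
    moreover have "nmul (2 ^ k) (0::'a) = 0" using nmul_plus[of "2 ^ k" 0 "0::'a"] by (simp only: add_0_right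
        add_cancel_right_right)
    ultimately show ?thesis using injD[OF Suc, of x 0] by simp
  qed
  note zero = this
  show ?case
  proof (rule injI)
    fix x y :: 'a assume eq: "nmul (2 ^ Suc k) x = nmul (2 ^ Suc k) y"
    have "nmul (2 ^ Suc k) (x - y) = 0"
      using nmul_plus[of "2 ^ Suc k" x "- y"] eq by (simp only: nmul_uminus diff_conv_add_uminus[symmetric])
          simp
    then have "x - y = 0" by (rule zero)
    then show "x = y" by simp
  qed
qed

lemma approximate_halving:
  obtains h where "(\<lambda>k. nmul (2 ^ k) (h k)) \<longlonglongrightarrow> (y::'a dual)"
  using nmul_dense_sequence[OF locally_compact, of "\<lambda>k. 2 ^ k" y] inj_two_power by blast

lemma psi_nmul_newton: "\<psi> (nmul n h) = poly (newton 0 h) (real n)"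
  using poly_newton[of 0 h n] by simp

text \<open>With \<open>c k\<close> the conjugate phase of the characteristic function at \<open>h k\<close>, the variable
\<open>w = c k * ev (h k)\<close> has positive mean, and the mean of \<open>|w - 1|\<^sup>2\<close> is at most \<open>\<psi> (h k) = O(4\<^sup>-\<^sup>k)\<close>. So the
variables \<open>Z k = 2\<^sup>k Im w\<close> are bounded in mean square. At \<open>t = m / 2\<^sup>l\<close> the characteristic function of
\<open>Z k\<close> is the mean of \<open>exp (\<i> n Im w)\<close> for the integer \<open>n = m 2\<^sup>k\<^sup>-\<^sup>l\<close>; replacing it by the mean of \<open>w\<^sup>n\<close> costs
\<open>O(n 4\<^sup>-\<^sup>k) = O(2\<^sup>-\<^sup>k)\<close>, and this mean is, up to \<open>c k ^ n\<close>, a value of the given characteristic function.\<close>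
lemma rescaled_limit_law:
  fixes h :: "nat \<Rightarrow> 'a dual" and y :: "'a dual"
  assumes h: "(\<lambda>k. nmul (2 ^ k) (h k)) \<longlonglongrightarrow> y"
  obtains r \<rho> c where "strict_mono (r :: nat \<Rightarrow> nat)" "real_distribution \<rho>" "\<And>k. norm (c k) = (1::real)"
    "\<And>m l. (\<lambda>k. c (r k) ^ (m * 2 ^ (r k - l)) * char_fn \<mu> (nmul (m * 2 ^ (r k - l)) (h (r k)))) \<longlonglongrightarrow> char \<rho> (real
        m / 2 ^ l)"
proof -
  have "(\<lambda>k. (1/2::real) ^ k) \<longlonglongrightarrow> 0" by (rule LIMSEQ_realpow_zero) auto
  from newton_quadratic_decay[OF psi_even psi_zero h this]
  obtain B where B: "\<And>k. poly (newton 0 (nmul (2 ^ k) (h k))) ((1/2) ^ k) \<le> ((1/2) ^ k)\<^sup>2 * B" by blast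
  have psih: "\<psi> (h k) \<le> B / 4 ^ k" for k
  proof -
    have "\<psi> (h k) = poly (newton 0 (h k)) 1" using psi_nmul_newton[of 1 "h k"] by (simp only: nmul_one
        of_nat_1)
    also have "\<dots> = poly (newton 0 (nmul (2 ^ k) (h k))) ((1/2) ^ k)" by (simp add: newton_scale
        power_one_over)
    also have "\<dots> \<le> ((1/2) ^ k)\<^sup>2 * B" by (rule B)
    also have "\<dots> = B / 4 ^ k" by (simp add: power_one_over power_mult[symmetric] power2_eq_square
        power_mult_distrib[symmetric])
    finally show ?thesis .
  qed
  define c where "c k = cnj (sgn (char_fn \<mu> (h k)))" for k
  have c: "norm (c k) = 1" for k using nonvanishing[of "h k"] by (simp add: c_def norm_sgn)
  define w where "w k x = c k * ev (h k) x" for k x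
  have w1: "norm (w k x) = 1" for k x by (simp add: w_def norm_mult c)
  have wm: "w k \<in> borel_measurable \<mu>" for k unfolding w_def by (intro borel_measurable_times
      borel_measurable_const ev_measurable)
  have wi: "complex_integrable \<mu> (w k)" for k by (rule integrable_const_bound[where B = 1]) (auto simp: wm w1)
  have sqb: "(norm (w k x - 1))\<^sup>2 = 2 - 2 * Re (w k x)" for k x
  proof -
    have "(Re (w k x))\<^sup>2 + (Im (w k x))\<^sup>2 = 1" using w1[of k x] cmod_power2[of "w k x"] by simp
    then show ?thesis unfolding cmod_power2 by (simp add: power2_eq_square algebra_simps)
  qed
  have wsq: "integrable \<mu> (\<lambda>x. (norm (w k x - 1))\<^sup>2)" "(\<integral>x. (norm (w k x - 1))\<^sup>2 \<partial>\<mu>) \<le> B / 4 ^ k" for k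
  proof -
    have "integrable \<mu> (\<lambda>x. Re (w k x))" using wi by simp
    then show "integrable \<mu> (\<lambda>x. (norm (w k x - 1))\<^sup>2)" by (simp add: sqb)
    have "(\<integral>x. w k x \<partial>\<mu>) = c k * char_fn \<mu> (h k)" by (simp add: w_def char_fn_def)
    also have "\<dots> = complex_of_real (norm (char_fn \<mu> (h k)))"
    proof -
      have "cnj (sgn z) * z = complex_of_real (norm z)" for z :: complex
        by (cases "z = 0") (simp_all add: sgn_eq complex_norm_square[symmetric] mult.commute[of "cnj z"]
            power2_eq_square)
      then show ?thesis by (simp add: c_def)
    qed
    finally have Ew: "Re (\<integral>x. w k x \<partial>\<mu>) = exp (- \<psi> (h k) / 2)" by (simp add: norm_char_fn)
    have "(\<integral>x. (norm (w k x - 1))\<^sup>2 \<partial>\<mu>) = 2 - 2 * Re (\<integral>x. w k x \<partial>\<mu>)"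
      using wi by (simp add: sqb prob_space)
    also have "\<dots> \<le> \<psi> (h k)" unfolding Ew using exp_ge_add_one_self[of "- \<psi> (h k) / 2"] by simp
    also have "\<dots> \<le> B / 4 ^ k" by (rule psih)
    finally show "(\<integral>x. (norm (w k x - 1))\<^sup>2 \<partial>\<mu>) \<le> B / 4 ^ k" .
  qed
  define Z where "Z k x = 2 ^ k * Im (w k x)" for k x
  have Zm: "Z k \<in> borel_measurable \<mu>" for k unfolding Z_def using wm[of k] by measurable
  define \<rho> where "\<rho> k = distr \<mu> borel (Z k)" for k
  have rho: "real_distribution (\<rho> k)" for k unfolding \<rho>_def using Zm by (intro real_distribution_distr) simp
  have Zb: "(Z k x)\<^sup>2 \<le> 4 ^ k * (norm (w k x - 1))\<^sup>2" for k x
  proof -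
    have "\<bar>Im (w k x)\<bar> \<le> norm (w k x - 1)" using abs_Im_le_cmod[of "w k x - 1"] by simp
    then have "(Im (w k x))\<^sup>2 \<le> (norm (w k x - 1))\<^sup>2" by (simp add: abs_le_square_iff[symmetric])
    moreover have "(Z k x)\<^sup>2 = 4 ^ k * (Im (w k x))\<^sup>2"
      by (simp add: Z_def power_mult_distrib power2_eq_square power_mult_distrib[symmetric])
    ultimately show ?thesis by simp
  qed
  have Zi: "integrable \<mu> (\<lambda>x. (Z k x)\<^sup>2)" for k
    by (rule Bochner_Integration.integrable_bound[OF integrable_mult_right[OF wsq(1)[of k], of "4 ^ k"]])
      (use Zm[of k] Zb in auto)
  have "(\<integral>x. (Z k x)\<^sup>2 \<partial>\<mu>) \<le> B" for k
  proof -
    have "(\<integral>x. (Z k x)\<^sup>2 \<partial>\<mu>) \<le> (\<integral>x. 4 ^ k * (norm (w k x - 1))\<^sup>2 \<partial>\<mu>)"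
      by (intro integral_mono Zi Zb integrable_mult_right wsq)
    also have "\<dots> = 4 ^ k * (\<integral>x. (norm (w k x - 1))\<^sup>2 \<partial>\<mu>)" by simp
    also have "\<dots> \<le> 4 ^ k * (B / 4 ^ k)" using wsq(2) by (intro mult_left_mono) auto
    finally show ?thesis by simp
  qed
  then have "integrable (\<rho> k) (\<lambda>x. x\<^sup>2)" "(\<integral>x. x\<^sup>2 \<partial>\<rho> k) \<le> B" for k
    using Zm Zi by (simp_all add: \<rho>_def integrable_distr_eq integral_distr)
  then obtain r \<rho>' where r: "strict_mono r" "real_distribution \<rho>'" "\<And>t. (\<lambda>k. char (\<rho> (r k)) t) \<longlonglongrightarrow> char \<rho>' t"
    by (rule second_moment_subsequence[of \<rho> B, OF rho]) blast
  have close: "norm (c k ^ n * char_fn \<mu> (nmul n (h k)) - char (\<rho> k) (real n / 2 ^ k)) \<le> real n * (B / 4 ^ k)"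
      for k n
  proof -
    have 1: "c k ^ n * char_fn \<mu> (nmul n (h k)) = (\<integral>x. w k x ^ n \<partial>\<mu>)"
      by (simp add: char_fn_def w_def power_mult_distrib ev_nmul[abs_def])
    have 2: "char (\<rho> k) (real n / 2 ^ k) = (\<integral>x. exp (\<i> * complex_of_real (real n * Im (w k x))) \<partial>\<mu>)"
      unfolding char_def \<rho>_def using Zm by (subst integral_distr) (auto simp: Z_def)
    have i1: "complex_integrable \<mu> (\<lambda>x. w k x ^ n)"
      by (rule integrable_const_bound[where B = 1]) (use wm in \<open>auto simp: w1 norm_power\<close>)
    have i2: "complex_integrable \<mu> (\<lambda>x. exp (\<i> * complex_of_real (real n * Im (w k x))))"
    proof (rule integrable_const_bound[where B = 1])
      show "(\<lambda>x. exp (\<i> * complex_of_real (real n * Im (w k x)))) \<in> borel_measurable \<mu>"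
        using wm[of k] by measurable
    qed (simp add: norm_exp_i_times del: of_real_mult)
    have "norm (c k ^ n * char_fn \<mu> (nmul n (h k)) - char (\<rho> k) (real n / 2 ^ k))
       = norm (\<integral>x. w k x ^ n - exp (\<i> * complex_of_real (real n * Im (w k x))) \<partial>\<mu>)"
      unfolding 1 2 Bochner_Integration.integral_diff[OF i1 i2] ..
    also have "\<dots> \<le> (\<integral>x. real n * (norm (w k x - 1))\<^sup>2 \<partial>\<mu>)"
    proof (rule order_trans[OF integral_norm_bound integral_mono])
      show "integrable \<mu> (\<lambda>x. norm (w k x ^ n - exp (\<i> * complex_of_real (real n * Im (w k x)))))"
        by (rule integrable_norm[OF Bochner_Integration.integrable_diff[OF i1 i2]])
      show "integrable \<mu> (\<lambda>x. real n * (norm (w k x - 1))\<^sup>2)" by (intro integrable_mult_right wsq)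
    qed (rule unimodular_near_exponential[OF w1])
    also have "\<dots> = real n * (\<integral>x. (norm (w k x - 1))\<^sup>2 \<partial>\<mu>)" by simp
    also have "\<dots> \<le> real n * (B / 4 ^ k)" using wsq(2)[of k] by (intro mult_left_mono) auto
    finally show ?thesis .
  qed
  have lim: "(\<lambda>k. c (r k) ^ (m * 2 ^ (r k - l)) * char_fn \<mu> (nmul (m * 2 ^ (r k - l)) (h (r k)))) \<longlonglongrightarrow> char \<rho>'
      (real m / 2 ^ l)" for m l
  proof (rule Lim_transform[OF r(3)[of "real m / 2 ^ l"]])
    have ev: "\<forall>\<^sub>F k in sequentially. norm (c (r k) ^ (m * 2 ^ (r k - l)) * char_fn \<mu> (nmul (m * 2 ^ (r k - l))
        (h (r k))) - char (\<rho> (r k)) (real m / 2 ^ l)) \<le> real m * \<bar>B\<bar> * (1/2) ^ k"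
      using eventually_ge_at_top[of l]
    proof eventually_elim
      case (elim k)
      have k: "l \<le> r k" "k \<le> r k" using elim seq_suble[OF r(1), of k] by auto
      have "real (m * 2 ^ (r k - l)) / 2 ^ r k = real m / 2 ^ l"
      proof -
        have "(2::real) ^ r k = 2 ^ (r k - l) * 2 ^ l" using k(1) by (simp add: power_add[symmetric])
        then show ?thesis by simp
      qed
      moreover have "real (m * 2 ^ (r k - l)) * (B / 4 ^ r k) \<le> real m * \<bar>B\<bar> * (1/2) ^ k"
      proof -
        have "real (m * 2 ^ (r k - l)) * (B / 4 ^ r k) \<le> real (m * 2 ^ (r k - l)) * (\<bar>B\<bar> / 4 ^ r k)"
          by (intro mult_left_mono divide_right_mono) auto
        also have "\<dots> \<le> real m * 2 ^ r k * (\<bar>B\<bar> / 4 ^ r k)"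
          by (intro mult_right_mono) (auto intro!: mult_left_mono power_increasing)
        also have "\<dots> = real m * \<bar>B\<bar> * (1/2) ^ r k"
        proof -
          have "(4::real) ^ r k = 2 ^ r k * 2 ^ r k" by (simp add: power_mult_distrib[symmetric])
          then show ?thesis by (simp add: power_one_over divide_simps)
        qed
        also have "\<dots> \<le> real m * \<bar>B\<bar> * (1/2) ^ k" using k(2) by (intro mult_left_mono power_decreasing) auto
        finally show ?thesis .
      qed
      ultimately show ?case using close[of "r k" "m * 2 ^ (r k - l)"] by (simp only:)
    qed
    have "(\<lambda>k. real m * \<bar>B\<bar> * (1/2) ^ k) \<longlonglongrightarrow> real m * \<bar>B\<bar> * 0"
      by (intro tendsto_mult_left LIMSEQ_realpow_zero) auto
    then show "((\<lambda>k. c (r k) ^ (m * 2 ^ (r k - l)) * char_fn \<mu> (nmul (m * 2 ^ (r k - l)) (h (r k))) - char (\<rho>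
        (r k)) (real m / 2 ^ l)) \<longlongrightarrow> 0) sequentially"
      by (intro Lim_null_comparison[OF ev]) simp
  qed
  show ?thesis by (rule that[OF r(1,2) c lim])
qed

end

section \<open>The modulus of the characteristic function\<close>

lemma poly_quadratic_growth:
  fixes g :: "real poly"
  assumes "(\<lambda>k. poly g (2 ^ k) / 4 ^ k) \<longlonglongrightarrow> C"
  shows "\<exists>a b. \<forall>t. poly g t = a + b * t + C * t\<^sup>2"
proof -
  obtain a b q where g: "g = pCons a (pCons b q)" by (metis pCons_cases)
  have pg: "poly g t = a + b * t + t\<^sup>2 * poly q t" for t by (simp add: g power2_eq_square algebra_simps)
  have "(\<lambda>k. poly g (2 ^ k) / 4 ^ k - a * (1/4) ^ k - b * (1/2) ^ k) \<longlonglongrightarrow> C - a * 0 - b * 0"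
    by (intro tendsto_intros assms LIMSEQ_realpow_zero) auto
  moreover have "poly g (2 ^ k) / 4 ^ k - a * (1/4) ^ k - b * (1/2) ^ k = poly q (2 ^ k)" for k
  proof -
    have "(4::real) ^ k = 2 ^ k * 2 ^ k" by (simp add: power_mult_distrib[symmetric])
    then show ?thesis by (simp add: pg power_one_over divide_simps power2_eq_square)
  qed
  ultimately have lim: "(\<lambda>k. poly q (2 ^ k)) \<longlonglongrightarrow> C" by simp
  have "degree q = 0"
  proof (rule ccontr)
    assume "degree q \<noteq> 0"
    then have "filterlim (poly q) at_infinity at_infinity" by (intro filterlim_poly_at_infinity) simp
    moreover have "filterlim (\<lambda>k. (2::real) ^ k) at_infinity sequentially"
      by (rule filterlim_at_top_imp_at_infinity) real_asymp
    ultimately have "filterlim (\<lambda>k. poly q (2 ^ k)) at_infinity sequentially" by (rule filterlim_compose)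
    then show False using not_tendsto_and_filterlim_at_infinity[OF _ lim] by simp
  qed
  then obtain c where q: "q = [:c:]" by (rule degree_eq_zeroE) blast
  then have "C = c" using lim by (simp add: LIMSEQ_const_iff)
  then show ?thesis using pg q by (intro exI[of _ a] exI[of _ b]) (simp add: mult.commute)
qed

lemma dyadic_approximation:
  fixes t :: real
  assumes "0 \<le> t"
  shows "(\<lambda>l. real (nat \<lfloor>2 ^ l * t\<rfloor>) / 2 ^ l) \<longlonglongrightarrow> t"
proof (rule tendsto_sandwich)
  have b: "2 ^ l * t - 1 \<le> real (nat \<lfloor>2 ^ l * t\<rfloor>)" "real (nat \<lfloor>2 ^ l * t\<rfloor>) \<le> 2 ^ l * t" for l
  proof -
    have "real (nat \<lfloor>2 ^ l * t\<rfloor>) = of_int \<lfloor>2 ^ l * t\<rfloor>" using assms by simp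
    then show "2 ^ l * t - 1 \<le> real (nat \<lfloor>2 ^ l * t\<rfloor>)" "real (nat \<lfloor>2 ^ l * t\<rfloor>) \<le> 2 ^ l * t" by linarith+
  qed
  show "\<forall>\<^sub>F l in sequentially. t - (1/2) ^ l \<le> real (nat \<lfloor>2 ^ l * t\<rfloor>) / 2 ^ l"
  proof (intro always_eventually allI)
    fix l
    have "(2 ^ l * t - 1) / 2 ^ l \<le> real (nat \<lfloor>2 ^ l * t\<rfloor>) / 2 ^ l" by (rule divide_right_mono[OF b(1)]) simp
    then show "t - (1/2) ^ l \<le> real (nat \<lfloor>2 ^ l * t\<rfloor>) / 2 ^ l" by (simp add: diff_divide_distrib
        power_one_over)
  qed
  show "\<forall>\<^sub>F l in sequentially. real (nat \<lfloor>2 ^ l * t\<rfloor>) / 2 ^ l \<le> t"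
    using divide_right_mono[OF b(2), of "2 ^ _"] by (intro always_eventually allI) (simp add: pos_divide_le_eq
        mult.commute[of t] b)
  have "(\<lambda>l. t - (1/2::real) ^ l) \<longlonglongrightarrow> t - 0" by (intro tendsto_intros LIMSEQ_realpow_zero) auto
  then show "(\<lambda>l. t - (1/2::real) ^ l) \<longlonglongrightarrow> t" by simp
qed simp

lemma (in continuous_polynomial) newton_minus_one: "poly (newton u v) (-1) = \<psi> (u - v)"
proof -
  have "newton u v = pcompose (newton (u - v) v) [:1, 1:]"
  proof (rule poly_eq_on_nat)
    fix n
    have "u - v + nmul (n + 1) v = u + nmul n v" by (simp add: algebra_simps)
    then show "poly (newton u v) (real n) = poly (pcompose (newton (u - v) v) [:1, 1:]) (real n)"
      using poly_newton[of "u - v" v "n + 1"] poly_newton[of u v n] by (simp add: poly_pcompose add.commute)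
  qed
  then have "poly (newton u v) (-1) = poly (newton (u - v) v) (real 0)" by (simp add: poly_pcompose)
  also have "\<dots> = \<psi> (u - v)" unfolding poly_newton by simp
  finally show ?thesis .
qed

context polynomial_char_fn
begin

lemma limit_law_modulus:
  assumes h: "(\<lambda>k. nmul (2 ^ k) (h k)) \<longlonglongrightarrow> y" and r: "strict_mono (r :: nat \<Rightarrow> nat)" and \<rho>: "real_distribution \<rho>"
    and c: "\<And>k. norm (c k) = (1::real)"
    and lim: "\<And>m l. (\<lambda>k. c (r k) ^ (m * 2 ^ (r k - l)) * char_fn \<mu> (nmul (m * 2 ^ (r k - l)) (h (r k)))) \<longlonglongrightarrow>
        char \<rho> (real m / 2 ^ l)"
  shows "(norm (char \<rho> t))\<^sup>2 = exp (- poly (newton 0 y) t)"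
proof -
  interpret \<rho>: real_distribution \<rho> by (rule \<rho>)
  have dyadic: "(norm (char \<rho> (real m / 2 ^ l)))\<^sup>2 = exp (- poly (newton 0 y) (real m / 2 ^ l))" for m l
  proof (rule LIMSEQ_unique)
    show "(\<lambda>k. (norm (c (r k) ^ (m * 2 ^ (r k - l)) * char_fn \<mu> (nmul (m * 2 ^ (r k - l)) (h (r k)))))\<^sup>2) \<longlonglongrightarrow>
        (norm (char \<rho> (real m / 2 ^ l)))\<^sup>2"
      by (intro tendsto_intros lim)
    have "(\<lambda>k. nmul (2 ^ r k) (h (r k))) \<longlonglongrightarrow> y" using LIMSEQ_subseq_LIMSEQ[OF h r] by (simp add: o_def)
    then have "(\<lambda>k. exp (- poly (newton 0 (nmul (2 ^ r k) (h (r k)))) (real m / 2 ^ l))) \<longlonglongrightarrow> exp (- poly (newton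
        0 y) (real m / 2 ^ l))"
      by (intro tendsto_intros poly_newton_tendsto)
    moreover have "\<forall>\<^sub>F k in sequentially. exp (- poly (newton 0 (nmul (2 ^ r k) (h (r k)))) (real m / 2 ^ l))
       = (norm (c (r k) ^ (m * 2 ^ (r k - l)) * char_fn \<mu> (nmul (m * 2 ^ (r k - l)) (h (r k)))))\<^sup>2"
      using eventually_ge_at_top[of l]
    proof eventually_elim
      case (elim k)
      have k: "l \<le> r k" using elim seq_suble[OF r, of k] by auto
      have "(2::real) ^ r k = 2 ^ (r k - l) * 2 ^ l" using k by (simp add: power_add[symmetric])
      then have "real (2 ^ r k) * (real m / 2 ^ l) = real (m * 2 ^ (r k - l))" by simp
      then have "poly (newton 0 (nmul (2 ^ r k) (h (r k)))) (real m / 2 ^ l) = \<psi> (nmul (m * 2 ^ (r k - l)) (h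
          (r k)))"
        unfolding newton_scale psi_nmul_newton by (simp only:)
      then show ?case by (simp add: norm_mult norm_power c norm_char_fn power2_eq_square exp_add[symmetric])
    qed
    ultimately show "(\<lambda>k. (norm (c (r k) ^ (m * 2 ^ (r k - l)) * char_fn \<mu> (nmul (m * 2 ^ (r k - l)) (h (r
        k)))))\<^sup>2) \<longlonglongrightarrow> exp (- poly (newton 0 y) (real m / 2 ^ l))"
      by (rule Lim_transform_eventually)
  qed
  have pos: "(norm (char \<rho> t))\<^sup>2 = exp (- poly (newton 0 y) t)" if t: "0 \<le> t" for t
  proof (rule LIMSEQ_unique)
    define d where "d l = real (nat \<lfloor>2 ^ l * t\<rfloor>) / 2 ^ l" for l
    have d: "d \<longlonglongrightarrow> t" unfolding d_def by (rule dyadic_approximation[OF t])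
    show "(\<lambda>l. (norm (char \<rho> (d l)))\<^sup>2) \<longlonglongrightarrow> (norm (char \<rho> t))\<^sup>2"
      by (intro tendsto_intros isCont_tendsto_compose[OF \<rho>.isCont_char d])
    have "(\<lambda>l. exp (- poly (newton 0 y) (d l))) \<longlonglongrightarrow> exp (- poly (newton 0 y) t)"
      by (intro tendsto_intros d)
    then show "(\<lambda>l. (norm (char \<rho> (d l)))\<^sup>2) \<longlonglongrightarrow> exp (- poly (newton 0 y) t)"
      unfolding d_def dyadic .
  qed
  show ?thesis
  proof (cases "0 \<le> t")
    case False
    have "char \<rho> t = cnj (char \<rho> (- t))"
    proof -
      have "char \<rho> (- (- t)) = cnj (char \<rho> (- t))" unfolding char_def
        by (subst Bochner_Integration.integral_cnj[symmetric]) (simp add: exp_cnj)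
      then show ?thesis by simp
    qed
    then show ?thesis using pos[of "- t"] False newton_even[OF psi_even, of y t] by simp
  qed (rule pos)
qed

text \<open>For the limit law \<open>\<rho>\<close> at \<open>y\<close> the modulus of the characteristic function is known at the dyadic
numbers, hence everywhere, and the theorem on the line applies. The unknown constants \<open>c k\<close> cancel
in \<open>char \<rho> 2 / (char \<rho> 1)\<^sup>2\<close>.\<close>
lemma psi_nmul: "\<psi> (nmul n y) = (real n)\<^sup>2 * \<psi> y" (is ?A)
  and char_fn_double: "char_fn \<mu> (y + y) = (char_fn \<mu> y)\<^sup>2 * exp (- complex_of_real (\<psi> y))" (is ?B)
proof -
  obtain h where h: "(\<lambda>k. nmul (2 ^ k) (h k)) \<longlonglongrightarrow> y" by (rule approximate_halving) blast
  obtain r \<rho> c where r: "strict_mono (r :: nat \<Rightarrow> nat)" and \<rho>: "real_distribution \<rho>" and c: "\<And>k. norm (c k) =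
      (1::real)"
    and lim: "\<And>m l. (\<lambda>k. c (r k) ^ (m * 2 ^ (r k - l)) * char_fn \<mu> (nmul (m * 2 ^ (r k - l)) (h (r k)))) \<longlonglongrightarrow>
        char \<rho> (real m / 2 ^ l)"
    by (rule rescaled_limit_law[OF h]) blast
  obtain a s where s: "\<And>t. poly (newton 0 y) t = s * t\<^sup>2" and a: "\<And>t. char \<rho> t = exp (a * t - complex_of_real
      (s * t\<^sup>2 / 2))"
    by (rule char_modulus_exp_polynomial[OF \<rho>, of "newton 0 y"]) (rule limit_law_modulus[OF h r \<rho> c lim],
        blast)
  have sp: "s = \<psi> y" using s[of 1] psi_nmul_newton[of 1 y] by (simp del: nmul.simps add: nmul_one del:
      One_nat_def)
  show ?A using psi_nmul_newton[of n y] by (simp add: s sp)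
  define z where "z k = nmul (2 ^ r k) (h (r k))" for k
  have z: "z \<longlonglongrightarrow> y" using LIMSEQ_subseq_LIMSEQ[OF h r] by (simp add: o_def z_def[abs_def])
  define d where "d k = c (r k) ^ 2 ^ r k" for k
  have d: "norm (d k) = 1" for k by (simp add: d_def norm_power c)
  have l1: "(\<lambda>k. d k * char_fn \<mu> (z k)) \<longlonglongrightarrow> char \<rho> 1" using lim[of 1 0] by (simp add: d_def z_def)
  have l2: "(\<lambda>k. d k ^ 2 * char_fn \<mu> (z k + z k)) \<longlonglongrightarrow> char \<rho> 2"
  proof -
    have "nmul (2 * 2 ^ r k) (h (r k)) = z k + z k" for k by (simp only: nmul_nmul[symmetric] z_def nmul_two)
    moreover have "c (r k) ^ (2 * 2 ^ r k) = d k ^ 2" for k by (simp add: d_def power_mult[symmetric]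
        mult.commute)
    ultimately show ?thesis using lim[of 2 0] by simp
  qed
  have fz: "(\<lambda>k. char_fn \<mu> (z k)) \<longlonglongrightarrow> char_fn \<mu> y" by (rule continuous_on_tendsto_compose[OF char_fn_continuous
      z]) auto
  have fzz: "(\<lambda>k. char_fn \<mu> (z k + z k)) \<longlonglongrightarrow> char_fn \<mu> (y + y)"
    by (rule continuous_on_tendsto_compose[OF char_fn_continuous]) (auto intro!: tendsto_intros z)
  have ch1: "char \<rho> 1 \<noteq> 0" by (simp add: a)
  have "(\<lambda>k. (d k ^ 2 * char_fn \<mu> (z k + z k)) / (d k * char_fn \<mu> (z k))\<^sup>2) \<longlonglongrightarrow> char \<rho> 2 / (char \<rho> 1)\<^sup>2"
    using ch1 by (intro tendsto_intros l1 l2) auto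
  moreover have "(d k ^ 2 * char_fn \<mu> (z k + z k)) / (d k * char_fn \<mu> (z k))\<^sup>2 = char_fn \<mu> (z k + z k) /
      (char_fn \<mu> (z k))\<^sup>2" for k
    using d[of k] by (auto simp: power_mult_distrib)
  moreover have "(\<lambda>k. char_fn \<mu> (z k + z k) / (char_fn \<mu> (z k))\<^sup>2) \<longlonglongrightarrow> char_fn \<mu> (y + y) / (char_fn \<mu> y)\<^sup>2"
    using nonvanishing by (intro tendsto_intros fz fzz) auto
  ultimately have "char_fn \<mu> (y + y) / (char_fn \<mu> y)\<^sup>2 = char \<rho> 2 / (char \<rho> 1)\<^sup>2" using LIMSEQ_unique by simp
  also have "\<dots> = exp (- complex_of_real s)"
    by (simp add: a power2_eq_square exp_add[symmetric] exp_diff[symmetric] algebra_simps)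
  finally show ?B using nonvanishing[of y] by (simp add: sp field_simps)
qed

lemma psi_double: "\<psi> (y + y) = 4 * \<psi> y" using psi_nmul[of 2 y] by (simp add: nmul_two)

lemma one_minus_char_fn_le: "1 - (norm (char_fn \<mu> y))\<^sup>2 \<le> \<psi> y"
proof -
  have "(norm (char_fn \<mu> y))\<^sup>2 = exp (- \<psi> y)" by (simp add: norm_char_fn power2_eq_square exp_add[symmetric])
  then show ?thesis using exp_ge_add_one_self[of "- \<psi> y"] by simp
qed

text \<open>If \<open>u\<close> were \<open>2\<^sup>k w\<close>, the quotient would be \<open>\<psi> (w + v)\<close> exactly. By density there are such \<open>w\<close> with errors
below \<open>1\<close> in the values of \<open>\<psi>\<close> concerned, which is negligible after division by \<open>4\<^sup>k\<close>. Since
\<open>\<psi> w = O(4\<^sup>-\<^sup>k)\<close>, the covariance bound with weight \<open>2\<^sup>k\<close> gives \<open>\<psi> (w + v) \<rightarrow> \<psi> v\<close>.\<close>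
lemma psi_quadratic_limit: "(\<lambda>k. \<psi> (u + nmul (2 ^ k) v) / 4 ^ k) \<longlonglongrightarrow> \<psi> v"
proof -
  have "\<exists>w. \<bar>\<psi> (nmul (2 ^ k) w + nmul (2 ^ k) v) - \<psi> (u + nmul (2 ^ k) v)\<bar> < 1 \<and> \<bar>\<psi> (nmul (2 ^ k) w) - \<psi> u\<bar> <
      1" for k
  proof (rule nmul_dense[OF locally_compact inj_two_power, of _ u])
    have "((\<lambda>z. \<psi> (z + nmul (2 ^ k) v)) \<longlongrightarrow> \<psi> (u + nmul (2 ^ k) v)) (nhds u)"
      by (rule continuous_on_tendsto_compose[OF psi_continuous]) (auto intro!: tendsto_intros filterlim_ident)
    moreover have "((\<lambda>z. \<psi> z) \<longlongrightarrow> \<psi> u) (nhds u)"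
      by (rule continuous_on_tendsto_compose[OF psi_continuous]) (auto intro!: filterlim_ident)
    ultimately show "\<forall>\<^sub>F z in nhds u. \<bar>\<psi> (z + nmul (2 ^ k) v) - \<psi> (u + nmul (2 ^ k) v)\<bar> < 1 \<and> \<bar>\<psi> z - \<psi> u\<bar> < 1"
      by (intro eventually_conj) (auto dest!: tendstoD[of _ _ _ 1] simp: dist_real_def)
  qed
  then obtain w where w: "\<And>k. \<bar>\<psi> (nmul (2 ^ k) (w k) + nmul (2 ^ k) v) - \<psi> (u + nmul (2 ^ k) v)\<bar> < 1"
    "\<And>k. \<bar>\<psi> (nmul (2 ^ k) (w k)) - \<psi> u\<bar> < 1" by metis
  have four: "(real (2 ^ k))\<^sup>2 = 4 ^ k" for k by (simp add: power2_eq_square power_mult_distrib[symmetric])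
  have wv: "\<psi> (nmul (2 ^ k) (w k) + nmul (2 ^ k) v) = 4 ^ k * \<psi> (w k + v)" for k
    using psi_nmul[of "2 ^ k" "w k + v"] unfolding four nmul_plus .
  have ww: "\<psi> (w k) \<le> (\<psi> u + 1) / 4 ^ k" for k
  proof -
    have "4 ^ k * \<psi> (w k) \<le> \<psi> u + 1" using w(2)[of k] psi_nmul[of "2 ^ k" "w k"] unfolding four by linarith
    then show ?thesis by (simp add: field_simps)
  qed
  have l1: "(\<lambda>k. (1/4::real) ^ k) \<longlonglongrightarrow> 0" "(\<lambda>k. (1/2::real) ^ k) \<longlonglongrightarrow> 0" by (rule LIMSEQ_realpow_zero, simp, simp)+
  have w0: "(\<lambda>k. \<psi> (w k)) \<longlonglongrightarrow> 0"
  proof (rule tendsto_sandwich[OF _ _ tendsto_const])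
    show "\<forall>\<^sub>F k in sequentially. 0 \<le> \<psi> (w k)" by (simp add: psi_nonneg)
    show "\<forall>\<^sub>F k in sequentially. \<psi> (w k) \<le> (\<psi> u + 1) * (1/4) ^ k" using ww by (simp add: power_one_over)
    show "(\<lambda>k. (\<psi> u + 1) * (1/4) ^ k) \<longlonglongrightarrow> 0" using tendsto_mult_left[OF l1(1), of "\<psi> u + 1"] by simp
  qed
  have cov: "norm (char_fn \<mu> (w k + v) - char_fn \<mu> (w k) * char_fn \<mu> v) \<le> (\<psi> u + 2) * (1/2) ^ k" for k
  proof -
    have "norm (char_fn \<mu> (w k + v) - char_fn \<mu> (w k) * char_fn \<mu> v)
      \<le> (2 ^ k * (1 - (norm (char_fn \<mu> (w k)))\<^sup>2) + (1 - (norm (char_fn \<mu> v))\<^sup>2) / 2 ^ k) / 2"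
      by (rule covariance_bound) simp
    also have "\<dots> \<le> (2 ^ k * ((\<psi> u + 1) / 4 ^ k) + 1 / 2 ^ k) / 2"
      using one_minus_char_fn_le[of "w k"] ww[of k]
      by (intro divide_right_mono add_mono mult_left_mono) auto
    also have "\<dots> = ((\<psi> u + 2) * (1/2) ^ k) / 2"
    proof -
      have "(4::real) ^ k = 2 ^ k * 2 ^ k" by (simp add: power_mult_distrib[symmetric])
      then show ?thesis by (simp add: power_one_over field_simps)
    qed
    also have "\<dots> \<le> (\<psi> u + 2) * (1/2) ^ k" using psi_nonneg[of u] by simp
    finally show ?thesis .
  qed
  have A: "(\<lambda>k. norm (char_fn \<mu> (w k + v)) - norm (char_fn \<mu> (w k) * char_fn \<mu> v)) \<longlonglongrightarrow> 0"
  proof (rule Lim_null_comparison)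
    show "\<forall>\<^sub>F k in sequentially. norm (norm (char_fn \<mu> (w k + v)) - norm (char_fn \<mu> (w k) * char_fn \<mu> v)) \<le> (\<psi>
        u + 2) * (1/2) ^ k"
      using order_trans[OF norm_triangle_ineq3 cov] by simp
    show "(\<lambda>k. (\<psi> u + 2) * (1/2) ^ k) \<longlonglongrightarrow> 0" using tendsto_mult_left[OF l1(2), of "\<psi> u + 2"] by simp
  qed
  have "(\<lambda>k. norm (char_fn \<mu> (w k) * char_fn \<mu> v)) \<longlonglongrightarrow> exp (- 0 / 2) * exp (- \<psi> v / 2)"
    unfolding norm_mult norm_char_fn by (intro tendsto_intros w0) simp
  from tendsto_add[OF A this] have "(\<lambda>k. norm (char_fn \<mu> (w k + v))) \<longlonglongrightarrow> exp (- \<psi> v / 2)" by simp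
  then have "(\<lambda>k. - 2 * ln (norm (char_fn \<mu> (w k + v)))) \<longlonglongrightarrow> - 2 * ln (exp (- \<psi> v / 2))"
    by (intro tendsto_intros) simp_all
  then have lim: "(\<lambda>k. \<psi> (w k + v)) \<longlonglongrightarrow> \<psi> v" by (simp add: norm_char_fn)
  have "(\<lambda>k. \<psi> (u + nmul (2 ^ k) v) / 4 ^ k - \<psi> (w k + v)) \<longlonglongrightarrow> 0"
  proof (rule Lim_null_comparison[OF _ l1(1)], rule always_eventually, rule allI)
    fix k
    have "\<bar>\<psi> (u + nmul (2 ^ k) v) - 4 ^ k * \<psi> (w k + v)\<bar> \<le> 1" using w(1)[of k] unfolding wv by linarith
    then have "\<bar>\<psi> (u + nmul (2 ^ k) v) - 4 ^ k * \<psi> (w k + v)\<bar> / 4 ^ k \<le> 1 / 4 ^ k" by (rule divide_right_mono)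
        simp
    also have "\<bar>\<psi> (u + nmul (2 ^ k) v) - 4 ^ k * \<psi> (w k + v)\<bar> / 4 ^ k = \<bar>(\<psi> (u + nmul (2 ^ k) v) - 4 ^ k * \<psi>
        (w k + v)) / 4 ^ k\<bar>" by simp
    finally show "norm (\<psi> (u + nmul (2 ^ k) v) / 4 ^ k - \<psi> (w k + v)) \<le> (1/4) ^ k"
      by (simp add: diff_divide_distrib power_one_over)
  qed
  from tendsto_add[OF this lim] show ?thesis by simp
qed

text \<open>The polynomial \<open>n \<mapsto> \<psi> (u + n v)\<close> has quadratic growth with leading coefficient \<open>\<psi> v\<close>; compare its
values at \<open>- 1\<close>, \<open>0\<close> and \<open>1\<close>.\<close>
theorem psi_parallelogram: "\<psi> (u + v) + \<psi> (u - v) = 2 * (\<psi> u + \<psi> v)"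
proof -
  have "(\<lambda>k. poly (newton u v) (2 ^ k) / 4 ^ k) \<longlonglongrightarrow> \<psi> v"
    using psi_quadratic_limit[of u v] poly_newton[of u v "2 ^ _"] by simp
  from poly_quadratic_growth[OF this] obtain a b where g: "\<And>t. poly (newton u v) t = a + b * t + \<psi> v * t\<^sup>2" by
      blast
  have "\<psi> u = a" using poly_newton[of u v 0] by (simp add: g)
  moreover have "\<psi> (u + v) = a + b + \<psi> v" using poly_newton[of u v 1] g[of 1] by (simp del: nmul.simps add:
      nmul_one del: One_nat_def)
  moreover have "\<psi> (u - v) = a - b + \<psi> v" using newton_minus_one[of u v] by (simp add: g)
  ultimately show ?thesis by simp
qed

end

section \<open>The phase of the characteristic function\<close>

context polynomial_char_fn
begin

definition phase :: "'a dual \<Rightarrow> complex" where "phase y = sgn (char_fn \<mu> y)"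

lemma norm_phase [simp]: "norm (phase y) = 1"
  using nonvanishing[of y] by (simp add: phase_def norm_sgn)

lemma char_fn_eq: "char_fn \<mu> y = phase y * complex_of_real (exp (- \<psi> y / 2))"
proof -
  have "char_fn \<mu> y = sgn (char_fn \<mu> y) * complex_of_real (norm (char_fn \<mu> y))"
    using nonvanishing[of y] by (simp add: sgn_eq)
  then show ?thesis by (simp only: phase_def[symmetric] norm_char_fn)
qed

lemma phase_continuous: "continuous_on UNIV phase"
  unfolding phase_def[abs_def] using nonvanishing by (intro continuous_on_sgn char_fn_continuous) auto

lemma phase_minus: "phase (- y) = cnj (phase y)"
  by (simp add: phase_def char_fn_minus sgn_eq)

lemma phase_double: "phase (y + y) = (phase y)\<^sup>2"
proof -
  define e where "e = complex_of_real (exp (- \<psi> (y + y) / 2))"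
  have "phase (y + y) * e = char_fn \<mu> (y + y)" by (simp only: e_def char_fn_eq[symmetric])
  also have "\<dots> = (char_fn \<mu> y)\<^sup>2 * exp (- complex_of_real (\<psi> y))" by (rule char_fn_double)
  also have "\<dots> = (phase y)\<^sup>2 * e"
    unfolding char_fn_eq[of y] e_def psi_double
    by (simp add: power_mult_distrib power2_eq_square exp_of_real exp_add[symmetric] mult.assoc flip:
        of_real_minus of_real_mult)
  finally show ?thesis by (simp add: e_def)
qed

lemma phase_two_power: "phase (nmul (2 ^ k) y) = phase y ^ 2 ^ k"
proof (induction k arbitrary: y)
  case (Suc k)
  have "nmul (2 ^ Suc k) y = nmul (2 ^ k) y + nmul (2 ^ k) y" using nmul_nmul[of 2 "2 ^ k" y] by (simp add:
      nmul_two)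
  then show ?case by (simp only: phase_double Suc power_mult[symmetric] power_Suc2)
qed simp

lemma phase_almost_multiplicative: "norm (phase (u + v) - phase u * phase v) \<le> 2 * (\<psi> u + \<psi> v)"
proof -
  have near: "norm (phase y - char_fn \<mu> y) \<le> \<psi> y / 2" for y
  proof -
    have "phase y - char_fn \<mu> y = phase y * complex_of_real (1 - exp (- \<psi> y / 2))"
      by (simp add: char_fn_eq algebra_simps)
    then have "norm (phase y - char_fn \<mu> y) = \<bar>1 - exp (- \<psi> y / 2)\<bar>" by (simp only: norm_mult norm_phase
        norm_of_real) simp
    also have "\<dots> \<le> \<psi> y / 2" using exp_ge_add_one_self[of "- \<psi> y / 2"] psi_nonneg[of y] by simp
    finally show ?thesis .
  qed
  have 1: "norm (char_fn \<mu> (u + v) - char_fn \<mu> u * char_fn \<mu> v) \<le> (\<psi> u + \<psi> v) / 2"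
    using covariance_bound[of 1 u v] one_minus_char_fn_le[of u] one_minus_char_fn_le[of v] by simp
  have 2: "norm (char_fn \<mu> u * char_fn \<mu> v - phase u * phase v) \<le> \<psi> u / 2 + \<psi> v / 2"
  proof -
    have "char_fn \<mu> u * char_fn \<mu> v - phase u * phase v
      = (char_fn \<mu> u - phase u) * char_fn \<mu> v + phase u * (char_fn \<mu> v - phase v)" by (simp add:
          algebra_simps)
    also have "norm \<dots> \<le> norm (char_fn \<mu> u - phase u) * norm (char_fn \<mu> v) + norm (char_fn \<mu> v - phase v)"
      using norm_triangle_ineq[of "(char_fn \<mu> u - phase u) * char_fn \<mu> v" "phase u * (char_fn \<mu> v - phase v)"]
          by (simp add: norm_mult)
    also have "\<dots> \<le> norm (char_fn \<mu> u - phase u) * 1 + norm (char_fn \<mu> v - phase v)"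
      by (intro add_mono mult_left_mono norm_char_fn_le) auto
    also have "\<dots> \<le> \<psi> u / 2 + \<psi> v / 2" using near[of u] near[of v] by (simp add: norm_minus_commute)
    finally show ?thesis .
  qed
  have "phase (u + v) - phase u * phase v = (phase (u + v) - char_fn \<mu> (u + v)) + ((char_fn \<mu> (u + v) -
      char_fn \<mu> u * char_fn \<mu> v)
    + (char_fn \<mu> u * char_fn \<mu> v - phase u * phase v))" by simp
  also have "norm \<dots> \<le> \<psi> (u + v) / 2 + ((\<psi> u + \<psi> v) / 2 + (\<psi> u / 2 + \<psi> v / 2))"
    by (intro norm_triangle_mono near 1 2)
  also have "\<dots> \<le> 2 * (\<psi> u + \<psi> v)" using psi_parallelogram[of u v] psi_nonneg[of "u - v"] by argo
  finally show ?thesis .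
qed

text \<open>The defect of multiplicativity at \<open>2\<^sup>k a\<close>, \<open>2\<^sup>k b\<close> is at most \<open>2\<^sup>k\<close> times that at \<open>a\<close>, \<open>b\<close>, and the latter is
at most \<open>2 (\<psi> a + \<psi> b)\<close>, which is \<open>4\<^sup>-\<^sup>k\<close> times a bounded quantity.\<close>
lemma phase_add: "phase (u + v) = phase u * phase v"
proof -
  obtain a where a: "(\<lambda>k. nmul (2 ^ k) (a k)) \<longlonglongrightarrow> u" by (rule approximate_halving) blast
  obtain b where b: "(\<lambda>k. nmul (2 ^ k) (b k)) \<longlonglongrightarrow> v" by (rule approximate_halving) blast
  have lim: "(\<lambda>k. phase (z k)) \<longlonglongrightarrow> phase y" "(\<lambda>k. \<psi> (z k)) \<longlonglongrightarrow> \<psi> y" if "z \<longlonglongrightarrow> y" for z y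
    by (rule continuous_on_tendsto_compose[OF phase_continuous that], simp, simp)
      (rule continuous_on_tendsto_compose[OF psi_continuous that], simp, simp)
  define d where "d k = phase (nmul (2 ^ k) (a k) + nmul (2 ^ k) (b k)) - phase (nmul (2 ^ k) (a k)) * phase
      (nmul (2 ^ k) (b k))" for k
  define e where "e k = 2 * (\<psi> (nmul (2 ^ k) (a k)) + \<psi> (nmul (2 ^ k) (b k))) * (1/2) ^ k" for k
  have bound: "norm (d k) \<le> e k" for k
  proof -
    have "phase (nmul (2 ^ k) (a k) + nmul (2 ^ k) (b k)) - phase (nmul (2 ^ k) (a k)) * phase (nmul (2 ^ k)
        (b k))
       = phase (a k + b k) ^ 2 ^ k - (phase (a k) * phase (b k)) ^ 2 ^ k"
      by (simp only: nmul_plus[symmetric] phase_two_power power_mult_distrib)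
    also have "norm \<dots> \<le> real (2 ^ k) * norm (phase (a k + b k) - phase (a k) * phase (b k))"
      by (rule norm_power_diff) (simp_all add: norm_mult)
    also have "\<dots> \<le> real (2 ^ k) * (2 * (\<psi> (a k) + \<psi> (b k)))"
      by (intro mult_left_mono phase_almost_multiplicative) simp
    also have "\<dots> = 2 * (\<psi> (nmul (2 ^ k) (a k)) + \<psi> (nmul (2 ^ k) (b k))) * (1/2) ^ k"
      unfolding psi_nmul by (simp add: power2_eq_square power_one_over field_simps)
    finally show ?thesis unfolding d_def e_def .
  qed
  have "e \<longlonglongrightarrow> 2 * (\<psi> u + \<psi> v) * 0"
    unfolding e_def by (intro tendsto_intros lim a b LIMSEQ_realpow_zero) auto
  then have "e \<longlonglongrightarrow> 0" by simp
  then have "d \<longlonglongrightarrow> 0" by (rule Lim_null_comparison[OF always_eventually[OF allI[OF bound]]])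
  moreover have "d \<longlonglongrightarrow> phase (u + v) - phase u * phase v"
    unfolding d_def by (intro tendsto_diff tendsto_mult lim tendsto_add a b)
  ultimately have "phase (u + v) - phase u * phase v = 0" using LIMSEQ_unique by blast
  then show ?thesis by simp
qed

end

section \<open>Trigonometric polynomials on an infinite torus\<close>

text \<open>A word lists coordinates with a flag for conjugation.\<close>
fun monomial :: "(nat \<times> bool) list \<Rightarrow> (nat \<Rightarrow> complex) \<Rightarrow> complex" where
  "monomial [] z = 1"
| "monomial ((n, b) # ws) z = (if b then cnj (z n) else z n) * monomial ws z"

inductive trig_poly :: "((nat \<Rightarrow> complex) \<Rightarrow> complex) \<Rightarrow> bool" where
  monomial: "trig_poly (\<lambda>z. c * monomial ws z)"
| add: "trig_poly f \<Longrightarrow> trig_poly g \<Longrightarrow> trig_poly (\<lambda>z. f z + g z)"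

lemma monomial_append: "monomial (ws @ vs) z = monomial ws z * monomial vs z"
  by (induction ws) auto

lemma cnj_monomial: "cnj (monomial ws z) = monomial (map (\<lambda>(n, b). (n, \<not> b)) ws) z"
  by (induction ws) auto

lemma continuous_monomial: "continuous_on A (monomial ws)"
proof (induction ws)
  case Nil
  have "monomial [] = (\<lambda>z. 1)" by (rule ext) simp
  then show ?case by simp
next
  case (Cons w ws)
  obtain n b where w: "w = (n, b)" by (cases w)
  have "continuous_on A (\<lambda>z::nat \<Rightarrow> complex. z n)" by (rule continuous_on_subset[OF
      continuous_on_product_coordinates]) simp
  moreover have "monomial (w # ws) = (\<lambda>z. (if b then cnj (z n) else z n) * monomial ws z)" by (rule ext) (simp
      add: w)
  ultimately show ?case using Cons by (cases b) (auto intro!: continuous_intros)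
qed

lemma trig_poly_continuous: "trig_poly f \<Longrightarrow> continuous_on A f"
  by (induction rule: trig_poly.induct) (auto intro!: continuous_intros continuous_monomial)

lemma trig_poly_cnj: "trig_poly f \<Longrightarrow> trig_poly (\<lambda>z. cnj (f z))"
  by (induction rule: trig_poly.induct) (auto simp: cnj_monomial intro: trig_poly.intros)

lemma trig_poly_mult_monomial: "trig_poly f \<Longrightarrow> trig_poly (\<lambda>z. c * monomial ws z * f z)"
proof (induction rule: trig_poly.induct)
  case (monomial d vs)
  have "(\<lambda>z. c * monomial ws z * (d * monomial vs z)) = (\<lambda>z. (c * d) * monomial (ws @ vs) z)"
    by (rule ext) (simp add: monomial_append)
  then show ?case by (simp only: trig_poly.monomial)
next
  case (add f g)
  have "(\<lambda>z. c * monomial ws z * (f z + g z)) = (\<lambda>z. c * monomial ws z * f z + c * monomial ws z * g z)"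
    by (rule ext) (simp add: distrib_left)
  then show ?case using trig_poly.add[OF add.IH] by (simp only:)
qed

lemma trig_poly_mult: "trig_poly f \<Longrightarrow> trig_poly g \<Longrightarrow> trig_poly (\<lambda>z. f z * g z)"
proof (induction rule: trig_poly.induct)
  case (monomial c ws)
  then show ?case by (rule trig_poly_mult_monomial)
next
  case (add f f')
  have "(\<lambda>z. (f z + f' z) * g z) = (\<lambda>z. f z * g z + f' z * g z)" by (rule ext) (simp add: distrib_right)
  then show ?case using trig_poly.add[OF add.IH(1) add.IH(2)] add.prems by (simp only:)
qed

definition torus :: "(nat \<Rightarrow> complex) set" where "torus = {z. \<forall>n. norm (z n) = 1}"

lemma compact_torus: "compact torus"
proof -
  have "compactin (product_topology (\<lambda>i::nat. euclidean :: complex topology) UNIV) (PiE UNIV (\<lambda>i. sphere 0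
      1))"
    by (simp add: compactin_PiE)
  moreover have "PiE UNIV (\<lambda>i. sphere 0 1) = torus" by (auto simp: torus_def PiE_def Pi_def)
  ultimately show ?thesis by (simp add: euclidean_product_topology)
qed

text \<open>The theorem of Stone and Weierstrass for the real parts of trigonometric polynomials.\<close>
lemma trig_poly_separation:
  assumes "closed A" "A \<subseteq> torus" "closed B" "B \<subseteq> torus" "A \<inter> B = {}" "0 < e" "e < 1"
  obtains f where "trig_poly f" "\<And>z. z \<in> torus \<Longrightarrow> 0 \<le> Re (f z) \<and> Re (f z) \<le> 1"
    "\<And>z. z \<in> A \<Longrightarrow> Re (f z) < e" "\<And>z. z \<in> B \<Longrightarrow> 1 - e < Re (f z)"
proof -
  define R where "R = {g. \<exists>f. trig_poly f \<and> g = (\<lambda>z. Re (f z))}"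
  interpret function_ring_on R torus
  proof
    show "compact torus" by (rule compact_torus)
  next
    fix g assume "g \<in> R"
    then show "continuous_on torus g" by (auto simp: R_def intro!: continuous_intros trig_poly_continuous)
  next
    fix g h assume "g \<in> R" "h \<in> R"
    then obtain f f' where f: "trig_poly f" "g = (\<lambda>z. Re (f z))" "trig_poly f'" "h = (\<lambda>z. Re (f' z))" by (auto
        simp: R_def)
    have "trig_poly (\<lambda>z. f z + f' z)" by (rule trig_poly.add[OF f(1,3)])
    moreover have "(\<lambda>z. g z + h z) = (\<lambda>z. Re (f z + f' z))" by (rule ext) (simp add: f)
    ultimately show "(\<lambda>z. g z + h z) \<in> R" unfolding R_def by blast
    have "trig_poly (\<lambda>z. (1/2) * monomial [] z * (f z * f' z + f z * cnj (f' z)))"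
      by (intro trig_poly_mult_monomial trig_poly.add trig_poly_mult trig_poly_cnj f)
    moreover have "(\<lambda>z. g z * h z) = (\<lambda>z. Re ((1/2) * monomial [] z * (f z * f' z + f z * cnj (f' z))))"
      by (rule ext) (simp add: f)
    ultimately show "(\<lambda>z. g z * h z) \<in> R" unfolding R_def by blast
  next
    fix c :: real
    have "trig_poly (\<lambda>z. complex_of_real c * monomial [] z)" by (rule trig_poly.monomial)
    moreover have "(\<lambda>z. c) = (\<lambda>z. Re (complex_of_real c * monomial [] z))" by simp
    ultimately show "(\<lambda>z. c) \<in> R" unfolding R_def by blast
  next
    fix x y assume "x \<in> torus" "y \<in> torus" "x \<noteq> y"
    then obtain n where n: "x n \<noteq> y n" by auto
    have t: "trig_poly (\<lambda>z. c * monomial [(n, False)] z)" for c by (rule trig_poly.monomial)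
    have re: "(\<lambda>z. Re (z n)) \<in> R" unfolding R_def using t[of 1] by auto
    have im: "(\<lambda>z. Im (z n)) \<in> R" unfolding R_def using t[of "- \<i>"] by auto
    show "\<exists>f\<in>R. f x \<noteq> f y"
    proof (cases "Re (x n) = Re (y n)")
      case True
      then have "Im (x n) \<noteq> Im (y n)" using n by (simp add: complex_eq_iff)
      then show ?thesis by (rule bexI[OF _ im])
    next
      case False
      then show ?thesis by (rule bexI[OF _ re])
    qed
  qed
  have "\<exists>g\<in>R. g ` torus \<subseteq> {0..1} \<and> (\<forall>x\<in>A. g x < e) \<and> (\<forall>x\<in>B. 1 - e < g x)" by (rule two[OF assms])
  then obtain g where gR: "g \<in> R" and gg: "g ` torus \<subseteq> {0..1} \<and> (\<forall>x\<in>A. g x < e) \<and> (\<forall>x\<in>B. 1 - e < g x)"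
    by (rule bexE)
  note g = gR gg[THEN conjunct1] gg[THEN conjunct2, THEN conjunct1] gg[THEN conjunct2, THEN conjunct2]
  have "\<exists>f. trig_poly f \<and> g = (\<lambda>z. Re (f z))" using gR unfolding R_def by (rule CollectD)
  then obtain f where ff: "trig_poly f \<and> g = (\<lambda>z. Re (f z))" by (rule exE)
  then have f: "trig_poly f" "\<And>z. g z = Re (f z)" by simp_all
  show ?thesis
  proof (rule that[OF f(1)])
    show "0 \<le> Re (f z) \<and> Re (f z) \<le> 1" if "z \<in> torus" for z
      using subsetD[OF g(2) imageI[OF that]] by (simp add: f(2))
    show "Re (f z) < e" if "z \<in> A" for z using bspec[OF g(3) that] unfolding f(2) .
    show "1 - e < Re (f z)" if "z \<in> B" for z using bspec[OF g(4) that] unfolding f(2) .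
  qed
qed

section \<open>The phase is evaluation at a point\<close>

fun signed_sum :: "(nat \<times> bool) list \<Rightarrow> (nat \<Rightarrow> 'g::ab_group_add) \<Rightarrow> 'g" where
  "signed_sum [] s = 0"
| "signed_sum ((n, b) # ws) s = (if b then - s n else s n) + signed_sum ws s"

lemma monomial_of_homomorphism:
  assumes "G 0 = 1" "\<And>a b. G (a + b) = G a * G b" "\<And>a. G (- a) = cnj (G a)"
  shows "monomial ws (\<lambda>n. G (s n)) = G (signed_sum ws s)"
  by (induction ws) (auto simp: assms)

lemma monomial_mult: "monomial ws (\<lambda>n. a n * b n) = monomial ws a * monomial ws b"
  by (induction ws) auto

lemma signed_sum_double: "signed_sum ws s + signed_sum ws s = signed_sum ws (\<lambda>n. s n + s n)"
  by (induction ws) (auto simp: algebra_simps)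

lemma signed_sum_tendsto:
  fixes y :: "nat \<Rightarrow> 'g::topological_ab_group_add"
  assumes "\<And>n. ((\<lambda>k. s k n) \<longlongrightarrow> y n) F"
  shows "((\<lambda>k. signed_sum ws (s k)) \<longlongrightarrow> signed_sum ws y) F"
  by (induction ws) (auto intro!: tendsto_intros assms)

text \<open>The three characters \<open>x \<mapsto> (2 x\<^sub>0, z)\<close>, \<open>x \<mapsto> (- x\<^sub>0 + x\<^sub>1 + x\<^sub>2 + x\<^sub>3, z)\<close> and \<open>x \<mapsto> (x\<^sub>0 + x\<^sub>1 + x\<^sub>2 + x\<^sub>3, z)\<close> of
the fourth power of \<open>X\<close>, by their components. The third is the product of the first two, and all
have mean of modulus \<open>exp (- \<psi> (2 z) / 2)\<close>, because \<open>2\<^sup>2 = (- 1)\<^sup>2 + 1 + 1 + 1 = 4\<close>.\<close>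
definition leg :: "nat \<Rightarrow> nat \<Rightarrow> 'g::ab_group_add \<Rightarrow> 'g" where
  "leg j i z = (if i = 0 then if j = 0 then z + z else if j = 1 then - z else z else if j = 0 then 0 else z)"

lemma leg_hom: "leg j i 0 = 0" "leg j i (a + b) = leg j i a + leg j i b" "leg j i (- a) = - leg j i a"
  by (simp_all add: leg_def algebra_simps)

definition four_legs :: "nat \<Rightarrow> 'a::topological_ab_group_add dual \<Rightarrow> (nat \<Rightarrow> 'a) \<Rightarrow> complex" where
  "four_legs j z x = (\<Prod>i<4. ev (leg j i z) (x i))"

lemma four_legs_hom: "four_legs j 0 x = 1" "four_legs j (a + b) x = four_legs j a x * four_legs j b x"
  "four_legs j (- a) x = cnj (four_legs j a x)"
  by (simp_all add: four_legs_def leg_hom ev_add ev_minus prod.distrib)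

lemma norm_four_legs [simp]: "norm (four_legs j z x) = 1"
  by (simp add: four_legs_def prod_norm[symmetric])

lemma four_legs_relation: "four_legs 0 z x * four_legs 1 z x = four_legs 2 z x"
proof -
  have "ev (leg 0 i z) (x i) * ev (leg 1 i z) (x i) = ev (leg 2 i z) (x i)" for i
    unfolding ev_add[symmetric] by (simp add: leg_def)
  then show ?thesis by (simp add: four_legs_def prod.distrib[symmetric])
qed

lemma unimodular_product_close:
  fixes a b c a' b' c' :: complex
  assumes "norm a = 1" "norm b = 1" "norm c = 1" "norm a' = 1" "norm b' = 1" "norm c' = 1"
    and "norm (a - a') < d" "norm (b - b') < d" "norm (c - c') < d"
  shows "norm (a * b * c - a' * b' * c') < 3 * d"
proof -
  have "a * b * c - a' * b' * c' = (a - a') * b * c + (a' * (b - b') * c + a' * b' * (c - c'))" by (simp add: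
      algebra_simps)
  also have "norm \<dots> \<le> norm (a - a') + (norm (b - b') + norm (c - c'))"
    by (intro norm_triangle_mono) (simp_all add: norm_mult assms)
  also have "\<dots> < 3 * d" using assms by simp
  finally show ?thesis .
qed

context polynomial_char_fn
begin

text \<open>The mean of the third character is \<open>phase (2 z)\<close> times the common mean of the other two; the twist
compensates this factor.\<close>
definition twist :: "nat \<Rightarrow> 'a dual \<Rightarrow> complex" where "twist j y = (if j = 2 then cnj (phase y) else 1)"

lemma phase_zero: "phase 0 = 1" by (simp add: phase_def char_fn_zero)

lemma twist_hom: "twist j 0 = 1" "twist j (a + b) = twist j a * twist j b" "twist j (- a) = cnj (twist j a)"
  by (simp_all add: twist_def phase_zero phase_add phase_minus)

lemma prod_leg_char_fn:
  assumes "j < 3"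
  shows "(\<Prod>i<4. char_fn \<mu> (leg j i z)) = cnj (twist j (z + z)) * char_fn \<mu> (z + z)"
proof -
  define p e where "p = phase z" and "e = complex_of_real (exp (- \<psi> z / 2))"
  have f: "char_fn \<mu> z = p * e" "char_fn \<mu> (- z) = cnj p * e" "phase (z + z) = p\<^sup>2"
    by (simp_all add: p_def e_def char_fn_eq phase_minus psi_even phase_double)
  have "complex_of_real (exp (- \<psi> (z + z) / 2)) = e ^ 4"
    by (simp add: e_def psi_double exp_of_nat_mult[symmetric] flip: of_real_power)
  then have f2: "char_fn \<mu> (z + z) = p\<^sup>2 * e ^ 4" using char_fn_eq[of "z + z"] by (simp add: f(3))
  have pp: "cnj p * p = 1" using complex_norm_square[of p] norm_phase[of z] by (simp add: p_def mult.commute)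
  consider "j = 0" | "j = 1" | "j = 2" using assms by linarith
  then show ?thesis
  proof cases
    case 1
    then show ?thesis by (simp add: eval_nat_numeral leg_def twist_def char_fn_zero)
  next
    case 2
    have "(\<Prod>i<4. char_fn \<mu> (leg j i z)) = cnj p * e * (p * e) ^ 3"
      using 2 by (simp add: eval_nat_numeral leg_def f)
    also have "\<dots> = (cnj p * p) * p\<^sup>2 * e ^ 4" by (simp add: eval_nat_numeral algebra_simps)
    finally show ?thesis using 2 pp f2 by (simp add: twist_def)
  next
    case 3
    have "(\<Prod>i<4. char_fn \<mu> (leg j i z)) = (p * e) ^ 4"
      using 3 by (simp add: eval_nat_numeral leg_def f)
    then show ?thesis using 3 by (simp add: twist_def f f2 eval_nat_numeral algebra_simps)
  qed
qed

text \<open>When \<open>2 z k n\<close> tends to \<open>y n\<close> for each \<open>n\<close>, the joint law of the twisted characters with parameters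
\<open>z k n\<close> tends to the joint law of the \<open>ev (y n)\<close> under \<open>\<mu>\<close>: this is checked on monomials, where it is a
statement about one parameter, by multiplicativity.\<close>
lemma four_legs_limit:
  fixes y :: "nat \<Rightarrow> 'a dual" and z :: "nat \<Rightarrow> nat \<Rightarrow> 'a dual"
  assumes z: "\<And>n. (\<lambda>k. z k n + z k n) \<longlonglongrightarrow> y n" and j: "j < 3" and f: "trig_poly f"
  defines "P \<equiv> Pi\<^sub>M {..<4::nat} (\<lambda>_. \<mu>)" and "V \<equiv> \<lambda>k x n. twist j (y n) * four_legs j (z k n) x"
  shows "(\<forall>k. complex_integrable P (\<lambda>x. f (V k x))) \<and> complex_integrable \<mu> (\<lambda>x. f (\<lambda>n. ev (y n) x))
     \<and> (\<lambda>k. \<integral>x. f (V k x) \<partial>P) \<longlonglongrightarrow> (\<integral>x. f (\<lambda>n. ev (y n) x) \<partial>\<mu>)"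
  using f
proof (induction rule: trig_poly.induct)
  interpret P: product_prob_space "\<lambda>_. \<mu>" "{..<4::nat}" by unfold_locales
  case (monomial c ws)
  define Y where "Y = signed_sum ws y"
  define Z where "Z k = signed_sum ws (z k)" for k
  have ZY: "(\<lambda>k. Z k + Z k) \<longlonglongrightarrow> Y" unfolding Z_def Y_def signed_sum_double by (rule signed_sum_tendsto[OF z])
  have mV: "monomial ws (V k x) = twist j Y * four_legs j (Z k) x" for k x
    unfolding V_def monomial_mult Y_def Z_def
    by (simp add: monomial_of_homomorphism[where G = "twist j", OF twist_hom] monomial_of_homomorphism[where G
        = "\<lambda>z. four_legs j z x", OF four_legs_hom])
  have mF: "monomial ws (\<lambda>n. ev (y n) x) = ev Y x" for x
    unfolding Y_def by (rule monomial_of_homomorphism[where G = "\<lambda>z. ev z x"]) (simp_all add: ev_add ev_minus)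
  have m: "four_legs j a \<in> borel_measurable P" for a
    unfolding four_legs_def[abs_def] P_def
  proof (rule borel_measurable_prod)
    fix i :: nat assume "i \<in> {..<4}"
    then show "(\<lambda>x. ev (leg j i a) (x i)) \<in> borel_measurable (Pi\<^sub>M {..<4} (\<lambda>_. \<mu>))"
      by (rule measurable_compose[OF measurable_component_singleton[where M = "\<lambda>_. \<mu>"], where g = "ev (leg j i
          a)", OF _ ev_measurable])
  qed
  have i: "complex_integrable P (four_legs j a)" for a
  proof -
    interpret P4: prob_space P unfolding P_def by (rule P.prob_space_axioms)
    show ?thesis by (rule P4.integrable_const_bound[where B = 1]) (auto simp: m)
  qed
  have I: "(\<integral>x. four_legs j a x \<partial>P) = cnj (twist j (a + a)) * char_fn \<mu> (a + a)" for a
  proof -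
    have "(\<integral>x. four_legs j a x \<partial>P) = (\<Prod>i<4. \<integral>x. ev (leg j i a) x \<partial>\<mu>)"
      unfolding four_legs_def P_def by (rule P.product_integral_prod) (auto simp: ev_integrable)
    then show ?thesis using prod_leg_char_fn[OF j, of a] by (simp add: char_fn_def)
  qed
  have "continuous_on UNIV (twist j)" unfolding twist_def[abs_def] by (cases "j = 2") (auto intro!:
      continuous_intros phase_continuous)
  then have tw: "(\<lambda>k. twist j (Z k + Z k)) \<longlonglongrightarrow> twist j Y" by (rule continuous_on_tendsto_compose[OF _ ZY]) auto
  have ch: "(\<lambda>k. char_fn \<mu> (Z k + Z k)) \<longlonglongrightarrow> char_fn \<mu> Y" by (rule continuous_on_tendsto_compose[OF
      char_fn_continuous ZY]) auto
  have "(\<lambda>k. c * (twist j Y * (cnj (twist j (Z k + Z k)) * char_fn \<mu> (Z k + Z k)))) \<longlonglongrightarrow> c * (twist j Y * (cnj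
      (twist j Y) * char_fn \<mu> Y))"
    by (intro tendsto_intros tw ch)
  moreover have "twist j Y * (cnj (twist j Y) * w) = w" for w
  proof -
    have "norm (twist j Y) = 1" by (simp add: twist_def)
    then have "twist j Y * cnj (twist j Y) = 1" using complex_norm_square[of "twist j Y"] by simp
    then show ?thesis by (simp add: mult.assoc[symmetric])
  qed
  ultimately have "(\<lambda>k. \<integral>x. c * monomial ws (V k x) \<partial>P) \<longlonglongrightarrow> (\<integral>x. c * monomial ws (\<lambda>n. ev (y n) x) \<partial>\<mu>)"
    by (simp add: mV mF I char_fn_def)
  then show ?case using i by (simp add: mV mF ev_integrable)
next
  case (add f g)
  then have i: "\<And>k. complex_integrable P (\<lambda>x. f (V k x))" "\<And>k. complex_integrable P (\<lambda>x. g (V k x))"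
    "complex_integrable \<mu> (\<lambda>x. f (\<lambda>n. ev (y n) x))" "complex_integrable \<mu> (\<lambda>x. g (\<lambda>n. ev (y n) x))"
    and l: "(\<lambda>k. \<integral>x. f (V k x) \<partial>P) \<longlonglongrightarrow> (\<integral>x. f (\<lambda>n. ev (y n) x) \<partial>\<mu>)"
      "(\<lambda>k. \<integral>x. g (V k x) \<partial>P) \<longlonglongrightarrow> (\<integral>x. g (\<lambda>n. ev (y n) x) \<partial>\<mu>)" by simp_all
  from tendsto_add[OF l] show ?case
    unfolding Bochner_Integration.integral_add[OF i(1,2), symmetric] Bochner_Integration.integral_add[OF
        i(3,4), symmetric]
    using i by simp
qed

text \<open>Let \<open>Re f\<close> have values in \<open>[0, 1]\<close> on the torus, below \<open>1/8\<close> on the image \<open>A\<close> of \<open>K\<close> and above \<open>7/8\<close> off a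
neighbourhood of \<open>A\<close>. Its mean under the law of \<open>(ev (y n))\<^sub>n\<close> is below \<open>1/8 + 1/8\<close>. So for large \<open>k\<close> the
three means for \<open>V 0\<close>, \<open>V 1\<close>, \<open>V 2\<close> add up to less than \<open>3/4\<close>, and at some outcome the sum of the three
non-negative values is below \<open>7/8\<close>: all three points lie in the neighbourhood.\<close>
lemma phase_approximation:
  assumes K: "compact K" "7 / 8 < measure \<mu> K" and J: "finite J" and e: "0 < \<epsilon>"
  shows "\<exists>x1\<in>K. \<exists>x2\<in>K. \<exists>x3\<in>K. \<forall>y\<in>J. norm (phase y - ev y (x1 + x2 - x3)) < \<epsilon>"
proof -
  interpret P: product_prob_space "\<lambda>_. \<mu>" "{..<4::nat}" by unfold_locales
  define P where "P = Pi\<^sub>M {..<4::nat} (\<lambda>_. \<mu>)"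
  interpret P4: prob_space P unfolding P_def by (rule P.prob_space_axioms)
  obtain N and y :: "nat \<Rightarrow> 'a dual" where y: "J = y ` {i. i < N}"
    using finite_imp_nat_seg_image_inj_on[OF J] by blast
  have "\<exists>w. (\<lambda>k. nmul 2 (w k)) \<longlonglongrightarrow> y n" for n
    by (rule nmul_dense_sequence[OF locally_compact]) (use inj_two_power[of 1] in simp)
  then have "\<exists>w. (\<lambda>k. w k + w k) \<longlonglongrightarrow> y n" for n by (simp only: nmul_two)
  then obtain w where w: "\<And>n. (\<lambda>k. w n k + w n k) \<longlonglongrightarrow> y n" by metis
  define z where "z k n = w n k" for k n
  have z: "(\<lambda>k. z k n + z k n) \<longlonglongrightarrow> y n" for n using w by (simp add: z_def)
  define F where "F x n = ev (y n) x" for x n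
  define V where "V j k x n = twist j (y n) * four_legs j (z k n) x" for j k x n
  define A where "A = F ` K"
  define B where "B = torus \<inter> - (\<Union>x\<in>K. \<Inter>n<N. {v. norm (v n - ev (y n) x) < \<epsilon> / 3})"
  have "continuous_on UNIV F" unfolding F_def[abs_def]
    by (intro continuous_on_coordinatewise_then_product ev_continuous)
  then have A: "closed A" "A \<subseteq> torus"
    unfolding A_def using K(1) by (auto intro: compact_imp_closed compact_continuous_image
        continuous_on_subset simp: torus_def F_def)
  have "open {v::nat \<Rightarrow> complex. norm (v n - c) < \<epsilon> / 3}" for n c
    by (intro open_Collect_less continuous_intros continuous_on_product_coordinates)
  then have "open (\<Union>x\<in>K. \<Inter>n<N. {v. norm (v n - ev (y n) x) < \<epsilon> / 3})" by (intro open_UN ballI open_INT) auto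
  then have "closed (- (\<Union>x\<in>K. \<Inter>n<N. {v. norm (v n - ev (y n) x) < \<epsilon> / 3}))" by (rule closed_Compl)
  then have B: "closed B" "B \<subseteq> torus"
    unfolding B_def using closed_Int[OF compact_imp_closed[OF compact_torus]] by blast+
  have AB: "A \<inter> B = {}" using e by (auto simp: A_def B_def F_def)
  obtain f where f: "trig_poly f" "\<And>z. z \<in> torus \<Longrightarrow> 0 \<le> Re (f z) \<and> Re (f z) \<le> 1"
    "\<And>z. z \<in> A \<Longrightarrow> Re (f z) < 1 / 8" "\<And>z. z \<in> B \<Longrightarrow> 1 - 1 / 8 < Re (f z)"
    by (rule trig_poly_separation[OF A B AB, of "1 / 8"]) auto
  have Vt: "V j k x \<in> torus" for j k x by (simp add: torus_def V_def norm_mult twist_def)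
  have lim: "(\<forall>k. complex_integrable P (\<lambda>x. f (V j k x))) \<and> complex_integrable \<mu> (\<lambda>x. f (F x))
     \<and> (\<lambda>k. \<integral>x. f (V j k x) \<partial>P) \<longlonglongrightarrow> (\<integral>x. f (F x) \<partial>\<mu>)" if "j < 3" for j
    using four_legs_limit[OF z that f(1)] unfolding P_def V_def F_def by simp
  have "Re (\<integral>x. f (F x) \<partial>\<mu>) < 1 / 4"
  proof -
    have Ks: "K \<in> sets \<mu>" unfolding sets_borel using compact_imp_closed[OF K(1)] by simp
    have i: "complex_integrable \<mu> (\<lambda>x. f (F x))" using lim[of 0] by simp
    have "Re (\<integral>x. f (F x) \<partial>\<mu>) = (\<integral>x. Re (f (F x)) \<partial>\<mu>)" using i by simp
    also have "\<dots> \<le> (\<integral>x. 1 / 8 + indicator (space \<mu> - K) x \<partial>\<mu>)"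
    proof (rule integral_mono)
      show "integrable \<mu> (\<lambda>x. Re (f (F x)))" using i by simp
      show "integrable \<mu> (\<lambda>x. 1 / 8 + indicator (space \<mu> - K) x :: real)" using Ks by (simp add:
          less_top[symmetric])
      fix x assume x: "x \<in> space \<mu>"
      show "Re (f (F x)) \<le> 1 / 8 + indicator (space \<mu> - K) x"
      proof (cases "x \<in> K")
        case True
        then have "Re (f (F x)) < 1 / 8" by (intro f(3)) (simp add: A_def)
        then show ?thesis using True by simp
      next
        case False
        have "F x \<in> torus" by (simp add: torus_def F_def)
        then show ?thesis using f(2)[of "F x"] False x by simp
      qed
    qed
    also have "\<dots> = 1 / 8 + measure \<mu> (space \<mu> - K)" using Ks by (simp add: prob_space less_top[symmetric])
    also have "\<dots> < 1 / 4" using prob_compl[OF Ks] K(2) by simp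
    finally show ?thesis .
  qed
  then have ev: "\<forall>\<^sub>F k in sequentially. Re (\<integral>x. f (V j k x) \<partial>P) < 1 / 4" if "j < 3" for j
    using order_tendstoD(2)[OF tendsto_Re] lim[OF that] by blast
  have "\<forall>\<^sub>F k in sequentially. Re (\<integral>x. f (V 0 k x) \<partial>P) < 1 / 4 \<and> Re (\<integral>x. f (V 1 k x) \<partial>P) < 1 / 4 \<and> Re (\<integral>x. f (V
      2 k x) \<partial>P) < 1 / 4"
    by (intro eventually_conj ev) auto
  then obtain k where k: "Re (\<integral>x. f (V 0 k x) \<partial>P) < 1 / 4" "Re (\<integral>x. f (V 1 k x) \<partial>P) < 1 / 4" "Re (\<integral>x. f (V 2 k
      x) \<partial>P) < 1 / 4"
    by (auto simp: eventually_sequentially)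
  define S where "S x = Re (f (V 0 k x)) + Re (f (V 1 k x)) + Re (f (V 2 k x))" for x
  have iV: "complex_integrable P (\<lambda>x. f (V j k x))" if "j < 3" for j using lim[OF that] by simp
  have Sint: "integrable P S" "(\<integral>x. S x \<partial>P) < 3 / 4"
    using k iV[of 0] iV[of 1] iV[of 2] unfolding S_def by simp_all
  have "\<exists>x\<in>space P. S x < 7 / 8"
  proof (rule ccontr)
    assume "\<not> ?thesis"
    then have "7 / 8 \<le> (\<integral>x. S x \<partial>P)" by (intro P4.integral_ge_const Sint(1)) (auto simp: not_less)
    then show False using Sint(2) by simp
  qed
  then obtain x where x: "S x < 7 / 8" by blast
  have "\<exists>a\<in>K. \<forall>n<N. norm (V j k x n - ev (y n) a) < \<epsilon> / 3" if j: "j < 3" for j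
  proof -
    have "Re (f (V j k x)) \<le> S x"
      using f(2)[OF Vt[of 0 k x]] f(2)[OF Vt[of 1 k x]] f(2)[OF Vt[of 2 k x]] j
      by (auto simp: S_def less_Suc_eq numeral_3_eq_3 numeral_2_eq_2)
    then have "V j k x \<notin> B" using f(4)[of "V j k x"] x by auto
    then show ?thesis using Vt[of j k x] by (auto simp: B_def)
  qed
  from this[of 0] this[of 1] this[of 2] obtain x1 x2 x3 where K3: "x1 \<in> K" "x2 \<in> K" "x3 \<in> K"
    and c: "\<And>n. n < N \<Longrightarrow> norm (V 0 k x n - ev (y n) x1) < \<epsilon> / 3" "\<And>n. n < N \<Longrightarrow> norm (V 1 k x n - ev (y n) x2) <
        \<epsilon> / 3"
      "\<And>n. n < N \<Longrightarrow> norm (V 2 k x n - ev (y n) x3) < \<epsilon> / 3"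
    by auto
  have "norm (phase v - ev v (x1 + x2 - x3)) < \<epsilon>" if "v \<in> J" for v
  proof -
    obtain n where n: "n < N" "v = y n" using \<open>v \<in> J\<close> y by auto
    have one: "norm (V j k x n) = 1" for j by (simp add: V_def norm_mult twist_def)
    have "phase v = V 0 k x n * V 1 k x n * cnj (V 2 k x n)"
    proof -
      have "V 0 k x n * V 1 k x n * cnj (V 2 k x n) = phase v * ((four_legs 0 (z k n) x * four_legs 1 (z k n)
          x) * cnj (four_legs 2 (z k n) x))"
        by (simp add: V_def twist_def n)
      also have "\<dots> = phase v" unfolding four_legs_relation using complex_norm_square[of "four_legs 2 (z k n)
          x"] by simp
      finally show ?thesis ..
    qed
    moreover have "ev v (x1 + x2 - x3) = ev v x1 * ev v x2 * cnj (ev v x3)"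
      using ev_add_arg[of v "x1 + x2" "- x3"] by (simp add: ev_add_arg ev_minus_arg)
    moreover have "norm (cnj (V 2 k x n) - cnj (ev v x3)) < \<epsilon> / 3"
      using c(3)[OF n(1)] n(2) by (metis complex_cnj_diff complex_mod_cnj)
    ultimately show ?thesis
      using unimodular_product_close[of "V 0 k x n" "V 1 k x n" "cnj (V 2 k x n)" "ev v x1" "ev v x2" "cnj (ev
          v x3)" "\<epsilon> / 3"]
        c(1,2)[OF n(1)] one n(2) by simp
  qed
  then show ?thesis using K3 by blast
qed

lemma phase_is_evaluation: "\<exists>x. \<forall>y. phase y = ev y x"
proof -
  obtain K where K: "compact K" "1 - 1 / 8 < measure \<mu> K" by (rule tight[of "1 / 8"]) auto
  then have K78: "7 / 8 < measure \<mu> K" by simp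
  define C where "C = (\<lambda>(y, m::nat). {p :: 'a \<times> 'a \<times> 'a. norm (phase y - ev y (fst p + fst (snd p) - snd (snd
      p))) \<le> 1 / real (Suc m)})"
  have "(K \<times> K \<times> K) \<inter> (\<Inter>i\<in>UNIV. C i) \<noteq> {}"
  proof (rule compact_imp_fip_image)
    show "compact (K \<times> K \<times> K)" by (intro compact_Times K)
    have "continuous_on UNIV (\<lambda>p::'a \<times> 'a \<times> 'a. ev y (fst p + fst (snd p) - snd (snd p)))" for y
      by (rule continuous_on_UNIV_compose[OF ev_continuous]) (intro continuous_intros)
    then have "closed {p :: 'a \<times> 'a \<times> 'a. norm (phase y - ev y (fst p + fst (snd p) - snd (snd p))) \<le> 1 / real
        (Suc m)}" for y m
      by (intro closed_Collect_le continuous_intros)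
    then show "closed (C i)" for i by (cases i) (simp add: C_def)
    fix I' :: "('a dual \<times> nat) set" assume I': "finite I'"
    define m where "m = Max (insert 0 (snd ` I'))"
    have "0 < 1 / real (Suc m)" by simp
    then obtain x1 x2 x3 where x: "x1 \<in> K" "x2 \<in> K" "x3 \<in> K"
      and c: "\<And>y. y \<in> fst ` I' \<Longrightarrow> norm (phase y - ev y (x1 + x2 - x3)) < 1 / real (Suc m)"
      using phase_approximation[OF K(1) K78 finite_imageI[OF I', of fst]] by blast
    have "(x1, x2, x3) \<in> C i" if i: "i \<in> I'" for i
    proof -
      obtain y l where yl: "i = (y, l)" by (cases i)
      have "l \<in> insert 0 (snd ` I')" using i yl by force
      then have "l \<le> m" unfolding m_def using I' by (intro Max_ge) auto
      then have "1 / real (Suc m) \<le> 1 / real (Suc l)" by (simp add: frac_le)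
      moreover have "y \<in> fst ` I'" using i yl by force
      ultimately show ?thesis using c[of y] by (simp add: C_def yl)
    qed
    then have "(x1, x2, x3) \<in> (K \<times> K \<times> K) \<inter> (\<Inter>i\<in>I'. C i)" using x by blast
    then show "(K \<times> K \<times> K) \<inter> (\<Inter>i\<in>I'. C i) \<noteq> {}" by blast
  qed
  then obtain p where p: "\<And>i. p \<in> C i" by blast
  have "phase y = ev y (fst p + fst (snd p) - snd (snd p))" for y
  proof -
    define d where "d = norm (phase y - ev y (fst p + fst (snd p) - snd (snd p)))"
    have "d \<le> 1 / real (Suc m)" for m using p[of "(y, m)"] by (simp add: C_def d_def)
    then have "d \<le> 0" using LIMSEQ_le_const[OF LIMSEQ_Suc[OF lim_1_over_n]] by blast
    then show ?thesis by (simp add: d_def)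
  qed
  then show ?thesis by blast
qed

theorem law_is_Gaussian: "\<mu> \<in> Gaussian"
proof -
  obtain x where x: "\<And>y. phase y = ev y x" using phase_is_evaluation by blast
  define \<phi> where "\<phi> y = \<psi> y / 2" for y
  have c: "continuous_on UNIV \<phi>" unfolding \<phi>_def[abs_def] by (intro continuous_intros psi_continuous) simp
  have p: "\<phi> (u + v) + \<phi> (u - v) = 2 * (\<phi> u + \<phi> v)" for u v using psi_parallelogram[of u v] by (simp add:
      \<phi>_def)
  have n: "0 \<le> \<phi> y" for y by (simp add: \<phi>_def psi_nonneg)
  have f: "char_fn \<mu> y = ev y x * complex_of_real (exp (- \<phi> y))" for y unfolding char_fn_eq x \<phi>_def by simp
  show ?thesis unfolding Gaussian_def using prob_space_axioms sets_borel c p n f by blast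
qed

end

section \<open>The functional equation\<close>

definition adj :: "('a::topological_ab_group_add \<Rightarrow> 'a) \<Rightarrow> 'a dual \<Rightarrow> 'a dual" where
  "adj T y = Dual (\<lambda>x. ev y (T x))"

lemma topological_automorphismD:
  assumes "topological_automorphism f"
  shows "f (x + y) = f x + f y" "continuous_on UNIV f" "inv f (f x) = x" "f (inv f x) = x"
    "inv f (x + y) = inv f x + inv f y" "continuous_on UNIV (inv f)" "f 0 = 0" "f (- x) = - f x"
proof -
  interpret Modules.additive f using assms by (simp add: topological_automorphism_def)
  have h: "homeomorphism UNIV UNIV f (inv f)" using assms by (simp add: topological_automorphism_def)
  show a: "f (x + y) = f x + f y" for x y by (rule add)
  show "continuous_on UNIV f" "continuous_on UNIV (inv f)" using h by (auto simp: homeomorphism_def)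
  show l: "inv f (f x) = x" and r: "f (inv f x) = x" for x using h by (auto simp: homeomorphism_def)
  show "inv f (x + y) = inv f x + inv f y"
  proof -
    have "inv f x + inv f y = inv f (f (inv f x + inv f y))" by (simp add: l)
    then show ?thesis by (simp add: a r)
  qed
  show "f 0 = 0" "f (- x) = - f x" by (rule zero, rule minus)
qed

lemma ev_adj:
  assumes "continuous_on UNIV T" "\<And>x y. T (x + y) = T x + T y"
  shows "ev (adj T y) x = ev y (T x)"
proof -
  have "ev (adj T y) = (\<lambda>x. ev y (T x))"
    unfolding adj_def by (rule Dual_inverse) (auto simp: assms(2) ev_add_arg intro:
        continuous_on_UNIV_compose[OF ev_continuous assms(1)])
  then show ?thesis by simp
qed

lemma dual_eqI: "(\<And>x. ev y x = ev z x) \<Longrightarrow> y = z"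
  by (metis ev_inject ext)

lemma adj_add:
  assumes "continuous_on UNIV T" "\<And>x y. T (x + y) = T x + T y"
  shows "adj T (y + z) = adj T y + adj T z"
  by (rule dual_eqI) (simp add: ev_adj[OF assms] ev_add)

lemma char_fn_distr:
  fixes \<xi> :: "'w \<Rightarrow> 'a::{topological_ab_group_add, second_countable_topology, t2_space}"
  assumes "\<xi> \<in> borel_measurable M"
  shows "char_fn (distr M borel \<xi>) y = (LINT \<omega>|M. ev y (\<xi> \<omega>))"
  unfolding char_fn_def
  by (rule integral_distr[OF assms]) (rule borel_measurable_continuous_onI[OF ev_continuous])

lemma ev_sum: "ev y (\<Sum>j\<in>A. x j) = (\<Prod>j\<in>A. ev y (x j))"
  by (induction A rule: infinite_finite_induct) (simp_all add: ev_add_arg)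

lemma diff_op_polynomial_comp:
  fixes q :: "'y::ab_group_add \<Rightarrow> 'b::ab_group_add" and T :: "'b \<Rightarrow> 'c::ab_group_add"
  assumes q: "\<And>y h. (diff_op h ^^ m) q y = 0"
    and L: "\<And>a b. L (a + b) = L a + L b" and T: "\<And>a b. T (a - b) = T a - T b"
  shows "(diff_op h ^^ m) (\<lambda>z. T (q (L z))) z = 0"
proof -
  have "T 0 = 0" using T[of 0 0] by simp
  then show ?thesis
    unfolding diff_op_funpow_additive[where f = "\<lambda>z. q (L z)" and T = T, OF T] diff_op_funpow_comp[where L = L
        and \<phi> = q, OF L] q .
qed

lemma symmetric_characteristic_functions:
  fixes L1 L2 :: "'w \<Rightarrow> 'a::{topological_ab_group_add, second_countable_topology, t2_space}"
  assumes sym: "conditionally_symmetric M L1 L2" and m: "L1 \<in> borel_measurable M" "L2 \<in> borel_measurable M"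
  shows "(LINT \<omega>|M. ev u (L1 \<omega>) * ev v (L2 \<omega>)) = (LINT \<omega>|M. ev u (L1 \<omega>) * ev (- v) (L2 \<omega>))"
proof -
  define h where "h p = ev u (fst p) * ev v (snd p)" for p :: "'a \<times> 'a"
  have hm: "h \<in> borel_measurable borel"
    unfolding h_def
    by (intro borel_measurable_continuous_onI continuous_on_mult continuous_on_UNIV_compose[OF ev_continuous]
        continuous_intros)
  have "continuous_on UNIV (\<lambda>x::'a. - x)" by (intro continuous_intros)
  then have m': "(\<lambda>\<omega>. - L2 \<omega>) \<in> borel_measurable M" using m(2) by (rule borel_measurable_continuous_on)
  have "(LINT \<omega>|M. h (L1 \<omega>, L2 \<omega>)) = (LINT p|distr M borel (\<lambda>\<omega>. (L1 \<omega>, L2 \<omega>)). h p)"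
    by (rule integral_distr[symmetric, OF _ hm]) (intro borel_measurable_Pair m)
  also have "\<dots> = (LINT p|distr M borel (\<lambda>\<omega>. (L1 \<omega>, - L2 \<omega>)). h p)"
    using sym by (simp add: conditionally_symmetric_def)
  also have "\<dots> = (LINT \<omega>|M. h (L1 \<omega>, - L2 \<omega>))"
    by (rule integral_distr[OF _ hm]) (intro borel_measurable_Pair m m')
  finally show ?thesis by (simp add: h_def ev_minus_arg ev_minus)
qed

text \<open>By symmetry the characteristic function of \<open>(L1, L2)\<close> has the same values at \<open>(u, v)\<close> and \<open>(u, - v)\<close>. It
factors by Q-independence at the tuple of the \<open>adj (\<alpha> j) u + adj (\<beta> j) v\<close>.\<close>
lemma Heyde_functional_equation:
  fixes \<xi> :: "'n::finite \<Rightarrow> 'w \<Rightarrow> 'a::{topological_ab_group_add, second_countable_topology, t2_space}"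
  assumes \<xi>: "\<And>j. \<xi> j \<in> borel_measurable M"
    and q: "\<And>y. (LINT \<omega>|M. (\<Prod>j\<in>UNIV. ev (y $ j) (\<xi> j \<omega>))) = (\<Prod>j\<in>UNIV. char_fn (distr M borel (\<xi> j)) (y $ j)) *
        exp (q y)"
    and nz: "\<And>j y. char_fn (distr M borel (\<xi> j)) y \<noteq> 0"
    and sym: "conditionally_symmetric M (\<lambda>\<omega>. \<Sum>j\<in>UNIV. \<alpha> j (\<xi> j \<omega>)) (\<lambda>\<omega>. \<Sum>j\<in>UNIV. \<beta> j (\<xi> j \<omega>))"
    and \<alpha>: "\<And>j. topological_automorphism (\<alpha> j)" and \<beta>: "\<And>j. topological_automorphism (\<beta> j)"
  defines "\<psi> \<equiv> \<lambda>j y. - ln ((norm (char_fn (distr M borel (\<xi> j)) y))\<^sup>2)"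
  shows "(\<Sum>j\<in>UNIV. \<psi> j (adj (\<alpha> j) u + adj (\<beta> j) v) - \<psi> j (adj (\<alpha> j) u + adj (\<beta> j) (- v)))
    = 2 * Re (q (\<chi> j. adj (\<alpha> j) u + adj (\<beta> j) v)) - 2 * Re (q (\<chi> j. adj (\<alpha> j) u + adj (\<beta> j) (- v)))"
proof -
  note a = topological_automorphismD[OF \<alpha>] and b = topological_automorphismD[OF \<beta>]
  have m: "(\<lambda>\<omega>. \<Sum>j\<in>UNIV. \<gamma> j (\<xi> j \<omega>)) \<in> borel_measurable M" if "\<And>j. topological_automorphism (\<gamma> j)" for \<gamma>
    by (intro borel_measurable_sum borel_measurable_continuous_on[OF topological_automorphismD(2)[OF that] \<xi>])
  have e: "ev u (\<Sum>j\<in>UNIV. \<alpha> j (\<xi> j \<omega>)) * ev v (\<Sum>j\<in>UNIV. \<beta> j (\<xi> j \<omega>)) = (\<Prod>j\<in>UNIV. ev ((\<chi> j. adj (\<alpha> j) u + adj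
      (\<beta> j) v) $ j) (\<xi> j \<omega>))" for v \<omega>
    by (simp add: ev_sum ev_add ev_adj[OF a(2,1)] ev_adj[OF b(2,1)] prod.distrib)
  define N where "N v = (\<Prod>j\<in>UNIV. (norm (char_fn (distr M borel (\<xi> j)) (adj (\<alpha> j) u + adj (\<beta> j) v)))\<^sup>2) * exp
      (2 * Re (q (\<chi> j. adj (\<alpha> j) u + adj (\<beta> j) v)))" for v
  have N: "(norm (LINT \<omega>|M. ev u (\<Sum>j\<in>UNIV. \<alpha> j (\<xi> j \<omega>)) * ev v (\<Sum>j\<in>UNIV. \<beta> j (\<xi> j \<omega>))))\<^sup>2 = N v" for v
    unfolding e q N_def by (simp add: norm_mult norm_exp_eq_Re power_mult_distrib prod_norm[symmetric]
        prod_power_distrib exp_double[symmetric])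
  have lnN: "ln (N v) = - (\<Sum>j\<in>UNIV. \<psi> j (adj (\<alpha> j) u + adj (\<beta> j) v)) + 2 * Re (q (\<chi> j. adj (\<alpha> j) u + adj (\<beta> j)
      v))" for v
  proof -
    have "ln (N v) = ln (\<Prod>j\<in>UNIV. (norm (char_fn (distr M borel (\<xi> j)) (adj (\<alpha> j) u + adj (\<beta> j) v)))\<^sup>2) + 2 *
        Re (q (\<chi> j. adj (\<alpha> j) u + adj (\<beta> j) v))"
      unfolding N_def using nz by (subst ln_mult_pos) (auto intro!: prod_pos)
    also have "ln (\<Prod>j\<in>UNIV. (norm (char_fn (distr M borel (\<xi> j)) (adj (\<alpha> j) u + adj (\<beta> j) v)))\<^sup>2) = - (\<Sum>j\<in>UNIV.
        \<psi> j (adj (\<alpha> j) u + adj (\<beta> j) v))"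
      unfolding \<psi>_def sum_negf using nz by (subst ln_prod) auto
    finally show ?thesis .
  qed
  have "N v = N (- v)"
    unfolding N[symmetric] using symmetric_characteristic_functions[OF sym m[OF \<alpha>] m[OF \<beta>], of u v] by simp
  then have "ln (N v) = ln (N (- v))" by simp
  then show ?thesis unfolding lnN sum_subtractf by simp
qed

text \<open>The functional equation is a sum over pairs \<open>(j, s)\<close> of an index and a sign, to which elimination
applies with \<open>(j0, True)\<close> as the distinguished summand. The remaining task is to find, for each
other pair, a point \<open>p\<close> in the kernel of its linear map at which the distinguished map takes the
value \<open>2 w\<close>. For \<open>j = j0\<close> both adjoints take the value \<open>w\<close> at it, so that the distinguished value is
\<open>w + w\<close>. For \<open>j \<noteq> j0\<close> one inverts the adjoint of \<open>\<beta>\<^sub>j\<^sub>0 \<alpha>\<^sub>j\<^sub>0\<^sup>-\<^sup>1 \<plusminus> \<beta>\<^sub>j \<alpha>\<^sub>j\<^sup>-\<^sup>1\<close>, where the sign is opposite to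
that of the pair.\<close>
lemma exp_polynomial_factors:
  fixes \<xi> :: "'n::finite \<Rightarrow> 'w \<Rightarrow> 'a::{topological_ab_group_add, second_countable_topology, t2_space}"
  assumes \<xi>: "\<And>j. \<xi> j \<in> borel_measurable M" and Q: "Q_independent M \<xi>"
    and nz: "\<And>j y. char_fn (distr M borel (\<xi> j)) y \<noteq> 0"
    and sym: "conditionally_symmetric M (\<lambda>\<omega>. \<Sum>j\<in>UNIV. \<alpha> j (\<xi> j \<omega>)) (\<lambda>\<omega>. \<Sum>j\<in>UNIV. \<beta> j (\<xi> j \<omega>))"
    and \<alpha>: "\<And>j. topological_automorphism (\<alpha> j)" and \<beta>: "\<And>j. topological_automorphism (\<beta> j)"
    and plus: "\<And>i j. i \<noteq> j \<Longrightarrow> topological_automorphism (\<lambda>x. \<beta> i (inv (\<alpha> i) x) + \<beta> j (inv (\<alpha> j) x))"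
    and minus: "\<And>i j. i \<noteq> j \<Longrightarrow> topological_automorphism (\<lambda>x. \<beta> i (inv (\<alpha> i) x) - \<beta> j (inv (\<alpha> j) x))"
  obtains N where "\<And>w x. (diff_op (w + w) ^^ N) (\<lambda>y. - ln ((norm (char_fn (distr M borel (\<xi> j0)) y))\<^sup>2)) x = 0"
proof -
  note a = topological_automorphismD[OF \<alpha>] and b = topological_automorphismD[OF \<beta>]
  note ea = ev_adj[OF a(2,1)] and eb = ev_adj[OF b(2,1)] and aa = adj_add[OF a(2,1)] and ab = adj_add[OF
      b(2,1)]
  define ai where "ai j = adj (inv (\<alpha> j))" for j
  define bi where "bi j = adj (inv (\<beta> j))" for j
  have eai: "ev (ai j y) x = ev y (inv (\<alpha> j) x)" and ebi: "ev (bi j y) x = ev y (inv (\<beta> j) x)" for j y x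
    by (simp_all add: ai_def bi_def ev_adj[OF a(6,5)] ev_adj[OF b(6,5)])
  have inva: "adj (\<alpha> j) (ai j y) = y" and invb: "adj (\<beta> j) (bi j y) = y" for j y
    by (rule dual_eqI, simp add: ea eai a, rule dual_eqI, simp add: eb ebi b)
  obtain q m where q: "\<And>y. (LINT \<omega>|M. (\<Prod>j\<in>UNIV. ev (y $ j) (\<xi> j \<omega>))) = (\<Prod>j\<in>UNIV. char_fn (distr M borel (\<xi> j))
      (y $ j)) * exp (q y)"
    and qm: "\<And>y h. (diff_op h ^^ (m + 1)) q y = 0"
    using Q unfolding Q_independent_def group_polynomial_def difference_eq_diff_op by blast
  define \<psi> where "\<psi> j y = - ln ((norm (char_fn (distr M borel (\<xi> j)) y))\<^sup>2)" for j y
  define L where "L i z = (case i of (j, s) \<Rightarrow> adj (\<alpha> j) (fst z) + adj (\<beta> j) (if s then snd z else - snd z))"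
      for i :: "'n \<times> bool" and z :: "'a dual \<times> 'a dual"
  define \<phi> where "\<phi> i y = (case i of (j, s) \<Rightarrow> if s then \<psi> j y else - \<psi> j y)" for i :: "'n \<times> bool" and y
  define I where "I = UNIV - {(j0, True)}"
  have bneg: "adj (\<beta> j) (- y) = - adj (\<beta> j) y" for j y by (rule dual_eqI) (simp add: eb ev_minus)
  have bdiff: "adj (\<beta> j) (y - z) = adj (\<beta> j) y - adj (\<beta> j) z" for j y z using ab[of j y "- z"] by (simp add:
      bneg)
  have Ladd: "L i (z + z') = L i z + L i z'" for i z z' by (cases i) (simp add: L_def aa ab bneg bdiff)
  have eq: "\<phi> (j0, True) (L (j0, True) z) + (\<Sum>i\<in>I. \<phi> i (L i z))
     = 2 * Re (q (\<chi> j. L (j, True) z)) + (- 2 * Re (q (\<chi> j. L (j, False) z)))" for z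
  proof -
    have "\<phi> (j0, True) (L (j0, True) z) + (\<Sum>i\<in>I. \<phi> i (L i z)) = (\<Sum>i\<in>UNIV. \<phi> i (L i z))"
      unfolding I_def by (rule sum.remove[symmetric]) auto
    also have "\<dots> = (\<Sum>j\<in>UNIV. \<Sum>s\<in>UNIV. \<phi> (j, s) (L (j, s) z))"
      unfolding sum.cartesian_product UNIV_Times_UNIV by (simp add: case_prod_beta)
    also have "\<dots> = (\<Sum>j\<in>UNIV. \<psi> j (adj (\<alpha> j) (fst z) + adj (\<beta> j) (snd z)) - \<psi> j (adj (\<alpha> j) (fst z) + adj (\<beta> j)
        (- snd z)))"
      by (simp add: UNIV_bool \<phi>_def L_def)
    also have "\<dots> = 2 * Re (q (\<chi> j. L (j, True) z)) + (- 2 * Re (q (\<chi> j. L (j, False) z)))"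
      unfolding \<psi>_def Heyde_functional_equation[where q = q, OF \<xi> q nz sym \<alpha> \<beta>] by (simp add: L_def)
    finally show ?thesis .
  qed
  have vec: "(\<chi> j. L (j, s) (a + b)) = (\<chi> j. L (j, s) a) + (\<chi> j. L (j, s) b)" for s a b by (simp add:
      vec_eq_iff Ladd)
  have poly: "(diff_op h ^^ (m + 1)) (\<lambda>z. \<phi> (j0, True) (L (j0, True) z) + (\<Sum>i\<in>I. \<phi> i (L i z))) z = 0" for h z
    unfolding eq diff_op_funpow_add
    using diff_op_polynomial_comp[where q = q and m = "m + 1" and T = "\<lambda>c. 2 * Re c" and L = "\<lambda>z. \<chi> j. L (j,
        True) z", OF qm vec]
      diff_op_polynomial_comp[where q = q and m = "m + 1" and T = "\<lambda>c. - 2 * Re c" and L = "\<lambda>z. \<chi> j. L (j,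
          False) z", OF qm vec]
    by (simp add: algebra_simps del: funpow.simps)
  have kernel: "\<exists>p. L i p = 0 \<and> L (j0, True) p = w + w" if "i \<in> I" for i w
  proof -
    obtain j s where i: "i = (j, s)" by (cases i)
    show ?thesis
    proof (cases "j = j0")
      case True
      then have "\<not> s" using that i by (simp add: I_def)
      then show ?thesis using True i by (intro exI[of _ "(ai j w, bi j w)"]) (simp add: L_def inva invb bneg)
    next
      case False
      define \<gamma> where "\<gamma> x = (if s then \<beta> j0 (inv (\<alpha> j0) x) - \<beta> j (inv (\<alpha> j) x) else \<beta> j0 (inv (\<alpha> j0) x) + \<beta> j
          (inv (\<alpha> j) x))" for x
      have "topological_automorphism \<gamma>" unfolding \<gamma>_def[abs_def] using plus[of j0 j] minus[of j0 j] False by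
          (cases s) auto
      note g = topological_automorphismD[OF this]
      define v where "v = adj (inv \<gamma>) (ai j0 (w + w))"
      define u where "u = ai j (adj (\<beta> j) (if s then - v else v))"
      have ev_v: "ev v (\<gamma> x) = ev (w + w) (inv (\<alpha> j0) x)" for x by (simp add: v_def ev_adj[OF g(6,5)] g eai)
      have "L i (u, v) = 0"
        by (rule dual_eqI) (auto simp: i L_def u_def inva ev_add eb ev_minus ev_minus_arg
            complex_norm_square[symmetric] mult.commute[of _ "cnj _"])
      moreover have "L (j0, True) (u, v) = w + w"
      proof (rule dual_eqI)
        fix x
        have "ev (w + w) x = ev v (\<gamma> (\<alpha> j0 x))" by (simp add: ev_v a)
        also have "\<dots> = ev (L (j0, True) (u, v)) x"
          by (auto simp: \<gamma>_def L_def u_def ev_add ea eb eai ev_minus ev_minus_arg a ev_add_arg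
              diff_conv_add_uminus simp del: add_uminus_conv_diff)
        finally show "ev (L (j0, True) (u, v)) x = ev (w + w) x" ..
      qed
      ultimately show ?thesis by blast
    qed
  qed
  have "(diff_op (w + w) ^^ (m + 1 + card I)) (\<phi> (j0, True)) x = 0" for w x
  proof -
    have "\<forall>i\<in>I. \<exists>p. L i p = 0 \<and> L (j0, True) p = w + w" using kernel by blast
    then obtain p where p: "\<And>i. i \<in> I \<Longrightarrow> L i (p i) = 0" "\<And>i. i \<in> I \<Longrightarrow> L (j0, True) (p i) = w + w" by metis
    have "finite I" by simp
    have s: "L (j0, True) (ai j0 y, 0) = y" for y
    proof -
      have "adj (\<beta> j0) 0 = 0" by (rule dual_eqI) (simp add: eb)
      then show ?thesis by (simp add: L_def inva)
    qed
    show ?thesis by (rule elimination[where L = L and \<phi> = \<phi> and s = "\<lambda>y. (ai j0 y, 0)" and p = p, OF \<open>finite I\<close>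
        poly Ladd Ladd p s])
  qed
  then show ?thesis by (intro that[of "m + 1 + card I"]) (simp add: \<phi>_def[abs_def] \<psi>_def[abs_def])
qed

text \<open>The differences of order \<open>N\<close> of the logarithm vanish for steps in \<open>2Y\<close>, hence for all steps by
continuity in the step and density.\<close>
theorem Heyde_Gaussian:
  fixes \<xi> :: "'n::finite \<Rightarrow> 'w \<Rightarrow> 'a::{topological_ab_group_add, second_countable_topology, t2_space}"
  assumes lc: "locally_compact_space (euclidean :: 'a topology)" and M: "prob_space M"
    and \<xi>: "\<And>j. \<xi> j \<in> borel_measurable M" and Q: "Q_independent M \<xi>"
    and nz: "\<And>j y. char_fn (distr M borel (\<xi> j)) y \<noteq> 0"
    and sym: "conditionally_symmetric M (\<lambda>\<omega>. \<Sum>j\<in>UNIV. \<alpha> j (\<xi> j \<omega>)) (\<lambda>\<omega>. \<Sum>j\<in>UNIV. \<beta> j (\<xi> j \<omega>))"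
    and \<alpha>: "\<And>j. topological_automorphism (\<alpha> j)" and \<beta>: "\<And>j. topological_automorphism (\<beta> j)"
    and plus: "\<And>i j. i \<noteq> j \<Longrightarrow> topological_automorphism (\<lambda>x. \<beta> i (inv (\<alpha> i) x) + \<beta> j (inv (\<alpha> j) x))"
    and minus: "\<And>i j. i \<noteq> j \<Longrightarrow> topological_automorphism (\<lambda>x. \<beta> i (inv (\<alpha> i) x) - \<beta> j (inv (\<alpha> j) x))"
    and no2: "\<not> (\<exists>x::'a. x \<noteq> 0 \<and> x + x = 0)"
  shows "distr M borel (\<xi> j) \<in> Gaussian"
proof -
  define \<nu> where "\<nu> = distr M borel (\<xi> j)"
  have nu: "borel_prob_space \<nu>"
    unfolding \<nu>_def by (intro borel_prob_space.intro borel_prob_space_axioms.intro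
        prob_space.prob_space_distr[OF M] \<xi> lc) simp
  interpret borel_prob_space \<nu> by (rule nu)
  define f where "f y = - ln ((norm (char_fn \<nu> y))\<^sup>2)" for y
  have fc: "continuous_on UNIV f"
    unfolding f_def using nz[of j] by (intro continuous_intros char_fn_continuous) (auto simp: \<nu>_def)
  obtain N where N: "\<And>w x. (diff_op (w + w) ^^ N) f x = 0"
    using exp_polynomial_factors[OF \<xi> Q nz sym \<alpha> \<beta> plus minus, of j] unfolding f_def[abs_def] \<nu>_def by blast
  have inj: "inj (nmul 2 :: 'a \<Rightarrow> 'a)"
  proof (rule injI)
    fix x y :: 'a assume "nmul 2 x = nmul 2 y"
    then have "(x - y) + (x - y) = 0" by (simp add: nmul_two algebra_simps)
    then have "x - y = 0" using no2 by blast
    then show "x = y" by simp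
  qed
  have poly: "(diff_op w ^^ N) f x = 0" for w x
  proof (rule ccontr)
    assume nz: "(diff_op w ^^ N) f x \<noteq> 0"
    have "continuous_on UNIV (\<lambda>w. (diff_op (fst (w, x)) ^^ N) f (snd (w, x)))"
      by (rule continuous_on_UNIV_compose[where g = "\<lambda>w. (w, x)" and f = "\<lambda>p. (diff_op (fst p) ^^ N) f (snd
          p)"])
        (rule diff_op_continuous[OF fc], intro continuous_intros)
    from continuous_on_tendsto_compose[OF this, of "\<lambda>w. w" w "nhds w"]
    have "((\<lambda>w. (diff_op w ^^ N) f x) \<longlongrightarrow> (diff_op w ^^ N) f x) (nhds w)" by (simp add: filterlim_ident)
    then have "\<forall>\<^sub>F w in nhds w. (diff_op w ^^ N) f x \<noteq> 0" using nz by (rule tendsto_imp_eventually_ne)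
    from nmul_dense[OF lc inj this] obtain v where "(diff_op (nmul 2 v) ^^ N) f x \<noteq> 0" by blast
    then show False using N[of v x] by (simp add: nmul_two)
  qed
  interpret polynomial_char_fn \<nu> N
  proof
    show "char_fn \<nu> y \<noteq> 0" for y using nz[of j] by (simp add: \<nu>_def)
    show "(diff_op w ^^ N) (\<lambda>y. - ln ((norm (char_fn \<nu> y))\<^sup>2)) x = 0" for w x using poly unfolding
        f_def[abs_def] .
    show "a = 0" if "a + a = 0" for a :: 'a using no2 that by blast
  qed
  show ?thesis using law_is_Gaussian by (simp add: \<nu>_def)
qed

section \<open>Groups with an element of order two\<close>

text \<open>The characteristic function is \<open>1\<close> on \<open>2Y\<close>, so \<open>\<phi> (2 y) = 4 \<phi> y\<close> gives \<open>\<phi> = 0\<close>.\<close>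
lemma Gaussian_char_fn_at_involution:
  assumes G: "\<gamma> \<in> Gaussian" and x0: "\<And>y. ev y x0 * ev y x0 = 1"
    and f: "\<And>y. char_fn \<gamma> y = (3 + ev y x0) / 4"
  shows "ev y x0 = 1"
proof -
  obtain x \<phi> where \<phi>: "\<And>u v. \<phi> (u + v) + \<phi> (u - v) = 2 * (\<phi> u + \<phi> v)"
    and c: "\<And>y. char_fn \<gamma> y = ev y x * complex_of_real (exp (- \<phi> y))"
    using G unfolding Gaussian_def by blast
  have norm: "norm ((3 + ev y x0) / 4) = exp (- \<phi> y)" for y
    unfolding f[symmetric] c by (simp add: norm_mult)
  have "\<phi> 0 = 0" using \<phi>[of 0 0] by simp
  then have "\<phi> (y + y) = 4 * \<phi> y" using \<phi>[of y y] by simp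
  moreover have "exp (- \<phi> (y + y)) = 1" unfolding norm[symmetric] by (simp add: ev_add x0)
  ultimately have n: "norm ((3 + ev y x0) / 4) = 1" unfolding norm by simp
  have "ev y x0 = 1 \<or> ev y x0 = - 1" using x0[of y] by (simp add: square_eq_1_iff)
  then show ?thesis using n by (auto simp: norm_divide)
qed

text \<open>One of the variables has masses \<open>3/4\<close> and \<open>1/4\<close> at \<open>0\<close> and \<open>x0\<close>, the others vanish, and so they are
independent. The characteristic function takes the values \<open>1\<close> and \<open>1/2\<close>; equal masses would produce a
zero.\<close>
theorem Heyde_property_no_involution:
  fixes \<alpha> \<beta> :: "'n::finite \<Rightarrow> 'a::{topological_ab_group_add, second_countable_topology, t2_space} \<Rightarrow> 'a"
  assumes lc: "locally_compact_space (euclidean :: 'a topology)"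
    and \<alpha>: "\<And>j. topological_automorphism (\<alpha> j)" and \<beta>: "\<And>j. topological_automorphism (\<beta> j)"
    and H: "Heyde_property TYPE('a ^ 'n) \<alpha> \<beta>" and x0: "x0 + x0 = (0::'a)"
  shows "x0 = 0"
proof (rule ccontr)
  assume "x0 \<noteq> 0"
  define j0 :: 'n where "j0 = undefined"
  define v :: "'a ^ 'n" where "v = (\<chi> j. if j = j0 then x0 else 0)"
  define p where "p = map_pmf (\<lambda>b. if b then v else 0) (bernoulli_pmf (1 / 4))"
  define M where "M = measure_pmf p"
  define \<xi> where "\<xi> j \<omega> = \<omega> $ j" for j :: 'n and \<omega> :: "'a ^ 'n"
  have sq: "ev y x0 * ev y x0 = 1" for y unfolding ev_add_arg[symmetric] x0 by simp
  have pm1: "ev y x0 = 1 \<or> ev y x0 = - 1" for y using sq[of y] by (simp add: square_eq_1_iff)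
  have int: "(LINT \<omega>|M. h \<omega>) = (3 * h 0 + h v) / 4" for h :: "'a ^ 'n \<Rightarrow> complex"
  proof -
    have "(LINT \<omega>|M. h \<omega>) = (LINT b|measure_pmf (bernoulli_pmf (1 / 4)). h (if b then v else 0))"
      unfolding M_def p_def by simp
    also have "\<dots> = (\<Sum>b\<in>UNIV. pmf (bernoulli_pmf (1 / 4)) b *\<^sub>R h (if b then v else 0))"
      by (rule integral_measure_pmf) auto
    also have "\<dots> = (3 * h 0 + h v) / 4" by (simp add: UNIV_bool scaleR_conv_of_real)
    finally show ?thesis .
  qed
  have m: "\<xi> j \<in> borel_measurable M" for j by (simp add: M_def)
  have ch: "char_fn (distr M borel (\<xi> j)) y = (if j = j0 then (3 + ev y x0) / 4 else 1)" for j y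
    unfolding char_fn_distr[OF m] int by (simp add: \<xi>_def v_def)
  have "group_polynomial (\<lambda>y::'a dual ^ 'n. 0)" unfolding group_polynomial_def by (intro exI[of _ 0]) (simp
      add: difference_def)
  moreover have "(LINT \<omega>|M. (\<Prod>j\<in>UNIV. ev (y $ j) (\<xi> j \<omega>))) = (\<Prod>j\<in>UNIV. char_fn (distr M borel (\<xi> j)) (y $ j))
      * exp 0" for y
  proof -
    have "(\<Prod>j\<in>UNIV. ev (y $ j) (if j = j0 then x0 else 0)) = (\<Prod>j\<in>UNIV. if j = j0 then ev (y $ j0) x0 else 1)"
      by (intro prod.cong) auto
    then show ?thesis unfolding int ch by (simp add: \<xi>_def v_def prod.delta)
  qed
  ultimately have Q: "Q_independent M \<xi>"
    unfolding Q_independent_def by (intro exI[of _ "\<lambda>y. 0"]) simp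
  have nz: "char_fn (distr M borel (\<xi> j)) y \<noteq> 0" for j y
    using pm1[of y] by (auto simp: ch)
  have fixed: "- (\<Sum>j\<in>UNIV. \<beta> j (\<xi> j \<omega>)) = (\<Sum>j\<in>UNIV. \<beta> j (\<xi> j \<omega>))" if "\<omega> \<in> set_pmf p" for \<omega>
  proof -
    have "\<omega> = v \<or> \<omega> = 0" using that by (auto simp: p_def split: if_splits)
    then have "- \<xi> j \<omega> = \<xi> j \<omega>" for j using x0 by (auto simp: \<xi>_def v_def minus_unique)
    then have "- \<beta> j (\<xi> j \<omega>) = \<beta> j (\<xi> j \<omega>)" for j using topological_automorphismD(8)[OF \<beta>, of j "\<xi> j \<omega>"] by
        simp
    then show ?thesis by (simp add: sum_negf[symmetric])
  qed
  have sym: "conditionally_symmetric M (\<lambda>\<omega>. \<Sum>j\<in>UNIV. \<alpha> j (\<xi> j \<omega>)) (\<lambda>\<omega>. \<Sum>j\<in>UNIV. \<beta> j (\<xi> j \<omega>))"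
    unfolding conditionally_symmetric_def
  proof (rule distr_cong_AE[OF refl refl])
    show "AE \<omega> in M. (\<Sum>j\<in>UNIV. \<alpha> j (\<xi> j \<omega>), \<Sum>j\<in>UNIV. \<beta> j (\<xi> j \<omega>)) = (\<Sum>j\<in>UNIV. \<alpha> j (\<xi> j \<omega>), - (\<Sum>j\<in>UNIV. \<beta> j (\<xi>
        j \<omega>)))"
      unfolding M_def AE_measure_pmf_iff using fixed by simp
  qed (simp_all add: M_def)
  have "prob_space M" by (simp add: M_def prob_space_measure_pmf)
  then have "distr M borel (\<xi> j0) \<in> Gaussian"
    using H[unfolded Heyde_property_def] m Q nz sym by blast
  then have all: "ev y x0 = 1" for y by (rule Gaussian_char_fn_at_involution[OF _ sq]) (simp add: ch)
  obtain I :: "('a \<Rightarrow> real) \<Rightarrow> real" where I: "invariant_integral I" using invariant_integral_exists[OF lc] by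
      blast
  interpret invariant_integral I by (rule I)
  show False using characters_separate_points[OF \<open>x0 \<noteq> 0\<close>] all by blast
qed

theorem theorem2:
  fixes \<alpha> \<beta> ::
    "'n::finite \<Rightarrow> 'a::{topological_ab_group_add, second_countable_topology, t2_space} \<Rightarrow> 'a"
  assumes "locally_compact_space (euclidean :: 'a topology)"
    and "CARD('n) \<ge> 2"
    and "\<And>j. topological_automorphism (\<alpha> j)"
    and "\<And>j. topological_automorphism (\<beta> j)"
    and "\<And>i j. i \<noteq> j \<Longrightarrow>
           topological_automorphism (\<lambda>x. \<beta> i (inv (\<alpha> i) x) + \<beta> j (inv (\<alpha> j) x))"
    and "\<And>i j. i \<noteq> j \<Longrightarrow>
           topological_automorphism (\<lambda>x. \<beta> i (inv (\<alpha> i) x) - \<beta> j (inv (\<alpha> j) x))"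
  shows "(Heyde_property TYPE('a ^ 'n) \<alpha> \<beta> \<longleftrightarrow> \<not> (\<exists>x::'a. x \<noteq> 0 \<and> x + x = 0)) \<and>
         (\<not> (\<exists>x::'a. x \<noteq> 0 \<and> x + x = 0) \<longrightarrow> Heyde_property TYPE('w) \<alpha> \<beta>)"
proof (intro conjI iffI impI)
  show "\<not> (\<exists>x::'a. x \<noteq> 0 \<and> x + x = 0)" if "Heyde_property TYPE('a ^ 'n) \<alpha> \<beta>"
    using Heyde_property_no_involution[OF assms(1,3,4) that] by blast
  show "Heyde_property TYPE('a ^ 'n) \<alpha> \<beta>" if no2: "\<not> (\<exists>x::'a. x \<noteq> 0 \<and> x + x = 0)"
    unfolding Heyde_property_def by (intro allI impI Heyde_Gaussian[OF assms(1) _ _ _ _ _ assms(3-6) no2])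
        blast+
  show "Heyde_property TYPE('w) \<alpha> \<beta>" if no2: "\<not> (\<exists>x::'a. x \<noteq> 0 \<and> x + x = 0)"
    unfolding Heyde_property_def by (intro allI impI Heyde_Gaussian[OF assms(1) _ _ _ _ _ assms(3-6) no2])
        blast+
qed

end
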